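(* Let $\eta>0$ and let $n\ge 1$ be an integer. Consider the piecewise polynomial system $$(\dot x,\dot y)=\big(y-2x^2-\eta+\varepsilon f^k(x,y),\ -2xy+\varepsilon g^k(x,y)\big)\quad\text{on } Q_k,\qquad k=1,2,3,4,\quad 0<|\varepsilon|\ll 1,$$ where $Q_1=\{x>0,y>\eta\}$, $Q_2=\{x>0,y<\eta\}$, $Q_3=\{x<0,y<\eta\}$, $Q_4=\{x<0,y>\eta\}$, and $f^k,g^k$ ($k=1,2,3,4$) are real polynomials in $(x,y)$ of degree at most $n$ for which the first order Melnikov function $M$ is not identically zero on $(-\frac1{2\eta},0)$. If $f^1=f^2$, $g^1=g^2$, $f^3=f^4$ and $g^3=g^4$, then the number of limit cycles of this system bifurcating from the period annulus $\{L_h: h\in(-\frac1{2\eta},0)\}$ around the center $(0,\eta)$ of the unperturbed system is not more than $9n-4$ (counting multiplicity).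
   Context: For $\varepsilon=0$ the system is $\dot x=y-2x^2-\eta$, $\dot y=-2xy$. It has the first integral $H(x,y)=y^{-2}\big(x^2-y+\frac{\eta}{2}\big)$ with integrating factor $y^{-3}$, and the unique center $(0,\eta)$ (called a global center), surrounded by the period annulus of clockwise periodic orbits $L_h=\{H(x,y)=h\}$ (in the region $y>0$), $h\in\Sigma=(-\frac1{2\eta},0)$. The orbit $L_h$ tends to the center as $h\to-\frac1{2\eta}$ and to the invariant curve $x^2-y+\frac\eta2=0$ as $h\to0$. Write $L^k_h=L_h\cap Q_k$, oriented clockwise. The first order Melnikov function of the perturbed system is $$M(h)=\sum_{k=1}^4\int_{L_h^k}y^{-3}\big[g^k(x,y)\,dx-f^k(x,y)\,dy\big],\qquad h\in\Sigma.$$ "The number of limit cycles bifurcating from the period annulus is not more than $N$ (counting multiplicity)" is used in the usual first-order Melnikov sense: for every compact $K\subset\Sigma$ there is $\varepsilon_0>0$ such that for all $0<|\varepsilon|<\varepsilon_0$ the perturbed system has at most $N$ limit cycles, counted with multiplicity (as zeros of the displacement map), that are close to the periodic orbits $L_h$, $h\in K$, i.e. that meet the section $\{x=0,\ y>\eta\}$ at a point where $H$ takes a value in $K$. Under the hypothesis of the theorem the only switching line is $x=0$. *)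

theory Defs
  imports "HOL-Analysis.Analysis" "HOL-Library.Extended_Nat"
begin

text \<open>The four open quadrants around the center; other indices are never used.\<close>

definition quadrant :: "real \<Rightarrow> nat \<Rightarrow> (real \<times> real) set" where
  "quadrant \<eta> k =
     (if k = 1 then {(x, y). x > 0 \<and> y > \<eta>}
      else if k = 2 then {(x, y). x > 0 \<and> y < \<eta>}
      else if k = 3 then {(x, y). x < 0 \<and> y < \<eta>}
      else if k = 4 then {(x, y). x < 0 \<and> y > \<eta>}
      else {})"

definition poly_degree_le :: "nat \<Rightarrow> (real \<times> real \<Rightarrow> real) \<Rightarrow> bool" where
  "poly_degree_le n p \<longleftrightarrow>
     (\<exists>a :: nat \<Rightarrow> nat \<Rightarrow> real. \<forall>x y. p (x, y) = (\<Sum>i\<le>n. \<Sum>j\<le>n - i. a i j * x ^ i * y ^ j))"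

definition unperturbed :: "real \<Rightarrow> real \<times> real \<Rightarrow> real \<times> real" where
  "unperturbed \<eta> = (\<lambda>(x, y). (y - 2 * x\<^sup>2 - \<eta>, - 2 * x * y))"

definition perturbed ::
  "real \<Rightarrow> (nat \<Rightarrow> real \<times> real \<Rightarrow> real) \<Rightarrow> (nat \<Rightarrow> real \<times> real \<Rightarrow> real) \<Rightarrow> real
    \<Rightarrow> nat \<Rightarrow> real \<times> real \<Rightarrow> real \<times> real" where
  "perturbed \<eta> f g \<epsilon> k p = unperturbed \<eta> p + \<epsilon> *\<^sub>R (f k p, g k p)"

definition first_integral :: "real \<Rightarrow> real \<times> real \<Rightarrow> real" where
  "first_integral \<eta> = (\<lambda>(x, y). (x\<^sup>2 - y + \<eta> / 2) / y\<^sup>2)"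

definition annulus_range :: "real \<Rightarrow> real set" where
  "annulus_range \<eta> = {- 1 / (2 * \<eta>) <..< 0}"

definition level_orbit :: "real \<Rightarrow> real \<Rightarrow> (real \<times> real) set" where
  "level_orbit \<eta> h = {(x, y). y > 0 \<and> first_integral \<eta> (x, y) = h}"

text \<open>
  For \<open>h\<close> in the annulus range the orbit is the ellipse
  \<open>x^2 - h (y + 1/(2h))^2 = -1/(4h) - \<eta>/2\<close>. It is parametrized clockwise, starting at the top
  point; the lemmas below confirm that one turn traces the level set once, in the direction of
  the unperturbed flow.
\<close>

definition orbit_param :: "real \<Rightarrow> real \<Rightarrow> real \<Rightarrow> real \<times> real" where
  "orbit_param \<eta> h t =
     (let r = sqrt (- 1 / (4 * h) - \<eta> / 2)
      in (r * sin t, - 1 / (2 * h) + r / sqrt (- h) * cos t))"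

definition line_integral ::
  "(real \<times> real \<Rightarrow> real) \<Rightarrow> (real \<times> real \<Rightarrow> real) \<Rightarrow> (real \<Rightarrow> real \<times> real) \<Rightarrow> real set \<Rightarrow> real" where
  "line_integral P Q \<gamma> S =
     integral S (\<lambda>t. P (\<gamma> t) * fst (vector_derivative \<gamma> (at t))
                   + Q (\<gamma> t) * snd (vector_derivative \<gamma> (at t)))"

definition melnikov ::
  "real \<Rightarrow> (nat \<Rightarrow> real \<times> real \<Rightarrow> real) \<Rightarrow> (nat \<Rightarrow> real \<times> real \<Rightarrow> real) \<Rightarrow> real \<Rightarrow> real" where
  "melnikov \<eta> f g h =
     (\<Sum>k = 1..4.
        line_integral (\<lambda>p. g k p / snd p ^ 3) (\<lambda>p. - f k p / snd p ^ 3) (orbit_param \<eta> h)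
          {t \<in> {0..2 * pi}. orbit_param \<eta> h t \<in> quadrant \<eta> k})"

text \<open>
  Filippov convention on the switching lines. At a point interior to a quadrant, or on a
  switching line across which the two fields agree, this is the singleton of the field's value.
\<close>

definition filippov_field ::
  "real \<Rightarrow> (nat \<Rightarrow> real \<times> real \<Rightarrow> real) \<Rightarrow> (nat \<Rightarrow> real \<times> real \<Rightarrow> real) \<Rightarrow> real
    \<Rightarrow> real \<times> real \<Rightarrow> (real \<times> real) set" where
  "filippov_field \<eta> f g \<epsilon> p =
     convex hull {perturbed \<eta> f g \<epsilon> k p | k. k \<in> {1..4} \<and> p \<in> closure (quadrant \<eta> k)}"

text \<open>
  Integral form of the differential inclusion on the interval \<open>I\<close>. As the fields used here are
  locally bounded, it is equivalent to local absolute continuity of \<open>\<gamma>\<close> together with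
  \<open>\<gamma>' t \<in> F (\<gamma> t)\<close> for almost all \<open>t\<close>.
\<close>

definition inclusion_solution ::
  "(real \<times> real \<Rightarrow> (real \<times> real) set) \<Rightarrow> (real \<Rightarrow> real \<times> real) \<Rightarrow> real set \<Rightarrow> bool" where
  "inclusion_solution F \<gamma> I \<longleftrightarrow>
     (\<exists>v. (\<forall>t\<in>I. v t \<in> F (\<gamma> t)) \<and>
          (\<forall>s\<in>I. \<forall>t\<in>I. s \<le> t \<longrightarrow> (v has_integral (\<gamma> t - \<gamma> s)) {s..t}))"

definition periodic_orbit ::
  "(real \<times> real \<Rightarrow> (real \<times> real) set) \<Rightarrow> (real \<times> real) set \<Rightarrow> bool" where
  "periodic_orbit F C \<longleftrightarrow>
     (\<exists>\<gamma> T. T > 0 \<and> inclusion_solution F \<gamma> UNIV \<and> (\<forall>t. \<gamma> (t + T) = \<gamma> t)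
            \<and> (\<exists>t. \<gamma> t \<noteq> \<gamma> 0) \<and> C = range \<gamma>)"

definition limit_cycle ::
  "(real \<times> real \<Rightarrow> (real \<times> real) set) \<Rightarrow> (real \<times> real) set \<Rightarrow> bool" where
  "limit_cycle F C \<longleftrightarrow>
     periodic_orbit F C \<and> (\<exists>U. open U \<and> C \<subseteq> U \<and> (\<forall>C'. periodic_orbit F C' \<and> C' \<subseteq> U \<longrightarrow> C' = C))"

definition cross_section :: "real \<Rightarrow> (real \<times> real) set" where
  "cross_section \<eta> = {(x, y). x = 0 \<and> y > \<eta>}"

definition first_return ::
  "real \<Rightarrow> (real \<times> real \<Rightarrow> (real \<times> real) set) \<Rightarrow> real \<Rightarrow> real \<Rightarrow> bool" where
  "first_return \<eta> F y y' \<longleftrightarrow>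
     (\<exists>\<gamma> T. T > 0 \<and> inclusion_solution F \<gamma> {0..T} \<and> \<gamma> 0 = (0, y) \<and> \<gamma> T = (0, y')
            \<and> (0, y) \<in> cross_section \<eta> \<and> (0, y') \<in> cross_section \<eta>
            \<and> (\<forall>t. 0 < t \<and> t < T \<longrightarrow> \<gamma> t \<notin> cross_section \<eta>))"

text \<open>
  The section is coordinatized by \<open>y\<close>; using the value of the first integral instead is an
  analytic change of coordinate and gives the same multiplicities.
\<close>

definition displacement ::
  "real \<Rightarrow> (real \<times> real \<Rightarrow> (real \<times> real) set) \<Rightarrow> real \<Rightarrow> real" where
  "displacement \<eta> F y = (THE y'. first_return \<eta> F y y') - y"

definition zero_multiplicity :: "(real \<Rightarrow> real) \<Rightarrow> real \<Rightarrow> enat" where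
  "zero_multiplicity d y =
     (if \<exists>m. (deriv ^^ m) d y \<noteq> 0 then enat (LEAST m. (deriv ^^ m) d y \<noteq> 0) else \<infinity>)"

text \<open>
  A cycle close to an orbit of the annulus meets the section in exactly one point, so that the
  supremum is just the multiplicity of the displacement map at that point.
\<close>

definition cycle_multiplicity ::
  "real \<Rightarrow> (real \<times> real \<Rightarrow> (real \<times> real) set) \<Rightarrow> (real \<times> real) set \<Rightarrow> enat" where
  "cycle_multiplicity \<eta> F C =
     (SUP y \<in> {y. (0, y) \<in> C \<inter> cross_section \<eta>}. zero_multiplicity (displacement \<eta> F) y)"

definition limit_cycles_near ::
  "real \<Rightarrow> (real \<times> real \<Rightarrow> (real \<times> real) set) \<Rightarrow> real set \<Rightarrow> (real \<times> real) set set" where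
  "limit_cycles_near \<eta> F K =
     {C. limit_cycle F C \<and> (\<exists>p \<in> C \<inter> cross_section \<eta>. first_integral \<eta> p \<in> K)}"

definition at_most_limit_cycles_bifurcate ::
  "real \<Rightarrow> (nat \<Rightarrow> real \<times> real \<Rightarrow> real) \<Rightarrow> (nat \<Rightarrow> real \<times> real \<Rightarrow> real) \<Rightarrow> nat \<Rightarrow> bool" where
  "at_most_limit_cycles_bifurcate \<eta> f g N \<longleftrightarrow>
     (\<forall>K. compact K \<and> K \<subseteq> annulus_range \<eta> \<longrightarrow>
        (\<exists>\<epsilon>\<^sub>0 > 0. \<forall>\<epsilon>. 0 < \<bar>\<epsilon>\<bar> \<and> \<bar>\<epsilon>\<bar> < \<epsilon>\<^sub>0 \<longrightarrow>
           (let F = filippov_field \<eta> f g \<epsilon>; LC = limit_cycles_near \<eta> F K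
            in finite LC \<and> (\<Sum>C\<in>LC. cycle_multiplicity \<eta> F C) \<le> enat N)))"

lemma orbit_param_radius:
  assumes "\<eta> > 0" "h \<in> annulus_range \<eta>"
  shows "h < 0" "- 1 / (4 * h) - \<eta> / 2 > 0"
  using assms by (auto simp: annulus_range_def field_simps)

lemma ellipse_iff:
  fixes h y x \<eta> :: real
  assumes "h < 0" "y > 0"
  shows "first_integral \<eta> (x, y) = h \<longleftrightarrow>
         x\<^sup>2 + (- h) * (y + 1 / (2 * h))\<^sup>2 = - 1 / (4 * h) - \<eta> / 2"
proof -
  have "(- h) * (y + 1 / (2 * h))\<^sup>2 = - h * y\<^sup>2 - y - 1 / (4 * h)"
    using assms by (simp add: power2_eq_square field_simps)
  moreover have "first_integral \<eta> (x, y) = h \<longleftrightarrow> x\<^sup>2 - y + \<eta> / 2 = h * y\<^sup>2"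
    using assms by (simp add: first_integral_def divide_eq_eq)
  ultimately show ?thesis by (auto simp: algebra_simps)
qed

lemma orbit_param_height_pos:
  assumes "\<eta> > 0" "h \<in> annulus_range \<eta>"
  shows "snd (orbit_param \<eta> h t) > 0"
proof -
  note R = orbit_param_radius[OF assms]
  define r where "r = sqrt (- 1 / (4 * h) - \<eta> / 2)"
  have "r < sqrt (- 1 / (4 * h))"
    unfolding r_def using assms by (intro real_sqrt_less_mono) simp
  also have "sqrt (- 1 / (4 * h)) = 1 / (2 * sqrt (- h))"
    using R(1) real_sqrt_mult[of 4 "- h"] real_sqrt_divide[of 1 "4 * (- h)"] by simp
  finally have "r / sqrt (- h) < 1 / (2 * sqrt (- h)) / sqrt (- h)"
    using R(1) by (intro divide_strict_right_mono) auto
  also have "\<dots> = - 1 / (2 * h)"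
    using R(1) by (simp add: field_simps)
  finally have *: "r / sqrt (- h) < - 1 / (2 * h)" .
  have "r / sqrt (- h) \<ge> 0" using R by (simp add: r_def)
  hence "r / sqrt (- h) * cos t \<ge> r / sqrt (- h) * (- 1)"
    by (intro mult_left_mono) auto
  with * show ?thesis by (simp add: orbit_param_def r_def Let_def)
qed

lemma orbit_param_image:
  assumes "\<eta> > 0" "h \<in> annulus_range \<eta>"
  shows "orbit_param \<eta> h ` {0..2 * pi} = level_orbit \<eta> h"
proof
  note R = orbit_param_radius[OF assms]
  define r where "r = sqrt (- 1 / (4 * h) - \<eta> / 2)"
  have r: "r > 0" "r\<^sup>2 = - 1 / (4 * h) - \<eta> / 2" using R(2) by (simp_all add: r_def)
  have s: "sqrt (- h) > 0" "(sqrt (- h))\<^sup>2 = - h" using R(1) by simp_all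
  show "orbit_param \<eta> h ` {0..2 * pi} \<subseteq> level_orbit \<eta> h"
  proof clarify
    fix x y t assume xy: "(x, y) = orbit_param \<eta> h t"
    have y: "y > 0" using orbit_param_height_pos[OF assms, of t] xy by (metis snd_conv)
    have "x = r * sin t" "y + 1 / (2 * h) = r / sqrt (- h) * cos t"
      using xy by (simp_all add: orbit_param_def r_def Let_def)
    hence "x\<^sup>2 + (- h) * (y + 1 / (2 * h))\<^sup>2
           = r\<^sup>2 * (sin t)\<^sup>2 + (- h) * (r\<^sup>2 / (sqrt (- h))\<^sup>2 * (cos t)\<^sup>2)"
      by (simp only: power_mult_distrib power_divide)
    also have "\<dots> = r\<^sup>2 * ((sin t)\<^sup>2 + (cos t)\<^sup>2)"
      unfolding s(2) using R(1) by (simp add: distrib_left del: sin_cos_squared_add)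
    finally show "(x, y) \<in> level_orbit \<eta> h"
      using ellipse_iff[OF R(1) y, of \<eta> x] r(2) y by (simp add: level_orbit_def)
  qed
  show "level_orbit \<eta> h \<subseteq> orbit_param \<eta> h ` {0..2 * pi}"
  proof clarify
    fix x y assume "(x, y) \<in> level_orbit \<eta> h"
    hence y: "y > 0" and "first_integral \<eta> (x, y) = h" by (auto simp: level_orbit_def)
    hence e: "x\<^sup>2 + (- h) * (y + 1 / (2 * h))\<^sup>2 = r\<^sup>2"
      using ellipse_iff[OF R(1) y, of \<eta> x] r(2) by simp
    define u where "u = sqrt (- h) * (y + 1 / (2 * h)) / r"
    have "(x / r)\<^sup>2 + u\<^sup>2 = (x\<^sup>2 + (sqrt (- h))\<^sup>2 * (y + 1 / (2 * h))\<^sup>2) / r\<^sup>2"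
      by (simp only: u_def power_mult_distrib power_divide add_divide_distrib)
    also have "\<dots> = 1" unfolding s(2) e using r(1) by simp
    finally have "u\<^sup>2 + (x / r)\<^sup>2 = 1" by simp
    then obtain t where t: "0 \<le> t" "t < 2 * pi" "u = cos t" "x / r = sin t"
      using sincos_total_2pi by metis
    have "x = r * sin t" using t(4) r(1) by (simp add: field_simps)
    moreover have "y + 1 / (2 * h) = r / sqrt (- h) * cos t"
      unfolding t(3)[symmetric] u_def using r(1) s(1) by simp
    hence "y = - 1 / (2 * h) + r / sqrt (- h) * cos t" by simp
    ultimately have "(x, y) = orbit_param \<eta> h t"
      by (simp add: orbit_param_def r_def Let_def)
    thus "(x, y) \<in> orbit_param \<eta> h ` {0..2 * pi}" using t by auto
  qed
qed

lemma orbit_param_inj: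
  assumes "\<eta> > 0" "h \<in> annulus_range \<eta>"
  shows "inj_on (orbit_param \<eta> h) {0..<2 * pi}"
proof
  note R = orbit_param_radius[OF assms]
  fix s t :: real
  assume st: "s \<in> {0..<2 * pi}" "t \<in> {0..<2 * pi}" "orbit_param \<eta> h s = orbit_param \<eta> h t"
  have "sin s = sin t" "cos s = cos t"
    using st(3) R by (auto simp: orbit_param_def Let_def)
  then obtain n :: int where n: "s = t + 2 * pi * of_int n"
    using sin_cos_eq_iff by blast
  have "2 * pi * of_int n < 2 * pi * 1" "2 * pi * (- 1) < 2 * pi * of_int n"
    using n st(1,2) unfolding atLeastLessThan_iff by linarith+
  hence "of_int n < (1 :: real)" "- 1 < (of_int n :: real)"
    by (simp_all only: mult_less_cancel_left_pos[of "2 * pi"] pi_gt_zero zero_less_mult_iff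
        zero_less_numeral simp_thms)
  hence "n = 0" by linarith
  thus "s = t" using n by simp
qed

lemma orbit_param_velocity:
  assumes "\<eta> > 0" "h \<in> annulus_range \<eta>"
  shows "(orbit_param \<eta> h has_vector_derivative
           (1 / (2 * sqrt (- h) * snd (orbit_param \<eta> h t))) *\<^sub>R unperturbed \<eta> (orbit_param \<eta> h t))
         (at t)"
proof -
  note R = orbit_param_radius[OF assms]
  define r where "r = sqrt (- 1 / (4 * h) - \<eta> / 2)"
  define s where "s = sqrt (- h)"
  define x where "x = r * sin t"
  define y where "y = - 1 / (2 * h) + r / s * cos t"
  have p: "orbit_param \<eta> h t = (x, y)"
    by (simp add: orbit_param_def r_def s_def x_def y_def Let_def)
  have y0: "y > 0" using orbit_param_height_pos[OF assms, of t] p by simp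
  have s: "s > 0" "h = - s\<^sup>2" using R(1) by (simp_all add: s_def)
  have "(x, y) \<in> level_orbit \<eta> h"
  proof -
    have r2: "r\<^sup>2 = - 1 / (4 * h) - \<eta> / 2" using R(2) by (simp add: r_def)
    have "x\<^sup>2 + (- h) * (y + 1 / (2 * h))\<^sup>2 = r\<^sup>2 * ((sin t)\<^sup>2 + (cos t)\<^sup>2)"
      using s by (simp add: x_def y_def power_mult_distrib power_divide distrib_left
            del: sin_cos_squared_add)
    thus ?thesis using ellipse_iff[OF R(1) y0, of \<eta> x] r2 y0 by (simp add: level_orbit_def)
  qed
  hence lev: "x\<^sup>2 = h * y\<^sup>2 + y - \<eta> / 2"
    using y0 by (simp add: level_orbit_def first_integral_def field_simps)
  have c: "r * cos t = s * (y + 1 / (2 * h))" using s(1) by (simp add: y_def)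
  have 1: "r * cos t = 1 / (2 * s * y) * (y - 2 * x\<^sup>2 - \<eta>)"
    unfolding c lev s(2) using s(1) y0 by (simp add: field_simps power2_eq_square)
  have 2: "- (r / s * sin t) = 1 / (2 * s * y) * (- 2 * x * y)"
    using s(1) y0 by (simp add: x_def)
  have "(orbit_param \<eta> h has_vector_derivative (r * cos t, - (r / s * sin t))) (at t)"
    unfolding orbit_param_def Let_def r_def[symmetric] s_def[symmetric]
    using s(1) by (intro has_vector_derivative_Pair)
       (auto intro!: derivative_eq_intros simp flip: has_real_derivative_iff_has_vector_derivative)
  thus ?thesis unfolding p unfolding 1 2 by (simp add: unperturbed_def s_def)
qed

end

theory Submission
  imports Defs "HOL-Complex_Analysis.Complex_Analysis"
begin

text \<open>
Put \<open>e = \<eta> / 2\<close>. The closed orbit of the unperturbed system through \<open>(0, w\<^sup>2 + e)\<close>, \<open>w > sqrt e\<close>, is an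
ellipse, and it has a parametrization \<open>(xc e w t, yc e w t)\<close> that is rational in \<open>w\<close> and trigonometric in
\<open>t\<close>. In the coordinates \<open>(w, t)\<close> the perturbed field on each side of the line \<open>x = 0\<close> becomes a scalar
equation \<open>dw/dt = eps slope\<close>, which is analytic in \<open>w\<close>, also for complex \<open>w\<close> near a compact interval. A
half-plane is passed in the angle range \<open>{0..\<pi>}\<close> or \<open>{\<pi>..2\<pi>}\<close>, so that the return map is the composition of
two time-\<open>\<pi>\<close> maps of such scalar equations; Picard iteration yields them with analyticity and uniform
first order expansion. Hence \<open>(ret w - w) / eps\<close> tends, uniformly on a complex neighbourhood, to the integral
of the unperturbed slopes, and this limit is the Melnikov function at \<open>hw e w\<close> times a positive analytic
factor (\<open>slope_unperturbed\<close>, \<open>melnikov_halves\<close>).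

Uniform convergence of holomorphic functions carries a bound on the number of zeros, with multiplicity,
from the limit to the functions close to it (\<open>eventually_zeros_le\<close>, by Cauchy estimates and Rolle's
theorem). It remains to bound the zeros of \<open>M\<close> itself. Recursions for the integrals \<open>KK\<close> of
\<open>x ^ i * y ^ k\<close> along half an orbit give an explicit form of \<open>M\<close>: with \<open>N = n - 2\<close>,
\<open>P(h) / (sqrt (-h) h ^ N) + a0 + a1 h + sqrt (1 + 4 e h) B(h) / h ^ N + (\<alpha> + \<beta> h) L(h)\<close>, where \<open>L\<close> is a
logarithm and \<open>P\<close>, \<open>B\<close> are polynomials of degree at most \<open>N + 2\<close> and \<open>N + 1\<close>. Two derivatives remove the
affine part and the logarithm; the remaining two radicals disappear after multiplication by the
conjugate, and Rolle's theorem with multiplicities gives \<open>2 N + 9 = 2 n + 5 \<le> 9 n - 4\<close> zeros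
(\<open>zeros_le_explicit\<close>). For \<open>n = 1\<close> a shorter explicit form gives \<open>5\<close> zeros.

The remaining work is the dynamics: the section is met again exactly once per turn, so that
the displacement of the differential inclusion is the one computed from the scalar equations
(\<open>first_return_iff\<close>), and a periodic orbit through a point of the section that is close to the annulus
orbits is a single turn (\<open>periodic_orbit_through\<close>). The latter uses that return maps of planar flows are
monotone: an orbit that returns higher stays trapped above itself.
\<close>

section \<open>Zeros of real analytic functions, counted with multiplicity\<close>

text \<open>Real analyticity is expressed by a complex extension because zero counts are transferred to limits by
Cauchy estimates.\<close>

definition real_analytic_on :: "(real \<Rightarrow> real) \<Rightarrow> real set \<Rightarrow> bool" where
  "real_analytic_on f I \<longleftrightarrow>
     (\<exists>F. F analytic_on (of_real ` I :: complex set) \<and> (\<forall>x\<in>I. F (of_real x) = of_real (f x)))"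

lemma real_analytic_onI:
  assumes "F analytic_on (of_real ` I :: complex set)" "\<And>x. x \<in> I \<Longrightarrow> F (of_real x) = of_real (f x)"
  shows "real_analytic_on f I"
  using assms by (auto simp: real_analytic_on_def)

lemma real_analytic_on_subset: "real_analytic_on f I \<Longrightarrow> J \<subseteq> I \<Longrightarrow> real_analytic_on f J"
  unfolding real_analytic_on_def by (meson analytic_on_subset image_mono subsetD)

lemma real_analytic_on_cong:
  "real_analytic_on f I \<Longrightarrow> (\<And>x. x \<in> I \<Longrightarrow> f x = g x) \<Longrightarrow> real_analytic_on g I"
  unfolding real_analytic_on_def by (metis (no_types, lifting))

text \<open>A holomorphic function that is real on an interval has real derivative there: its difference quotients
along the interval are real.\<close>

lemma holomorphic_real_deriv:
  fixes F :: "complex \<Rightarrow> complex"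
  assumes I: "open I" "x \<in> I"
    and F: "F field_differentiable at (of_real x)"
    and eq: "\<And>y. y \<in> I \<Longrightarrow> F (of_real y) = of_real (f y)"
  shows "(f has_real_derivative deriv f x) (at x)" "deriv F (of_real x) = of_real (deriv f x)"
proof -
  have D: "(F has_field_derivative deriv F (of_real x)) (at (of_real x))"
    using F by (simp add: DERIV_deriv_iff_field_differentiable)
  have V: "((\<lambda>y. F (of_real y)) has_vector_derivative deriv F (of_real x)) (at x)"
    using has_vector_derivative_real_field[OF D] by simp
  have V2: "((\<lambda>y. of_real (f y) :: complex) has_vector_derivative deriv F (of_real x)) (at x)"
    by (rule has_vector_derivative_transform_within_open[OF V I]) (use eq in auto)
  have re: "(f has_real_derivative Re (deriv F (of_real x))) (at x)"
    using bounded_linear.has_vector_derivative[OF bounded_linear_Re V2]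
    by (simp add: has_real_derivative_iff_has_vector_derivative)
  have "((\<lambda>y::real. 0::real) has_vector_derivative Im (deriv F (of_real x))) (at x)"
    using bounded_linear.has_vector_derivative[OF bounded_linear_Im V2] by simp
  hence im: "Im (deriv F (of_real x)) = 0"
    using has_vector_derivative_const vector_derivative_unique_at by blast
  show "(f has_real_derivative deriv f x) (at x)"
    using re DERIV_imp_deriv by metis
  show "deriv F (of_real x) = of_real (deriv f x)"
    using im DERIV_imp_deriv[OF re] by (simp add: complex_eq_iff)
qed

lemma real_analytic_on_deriv:
  assumes "real_analytic_on f I" "open I"
  shows "real_analytic_on (deriv f) I"
    and "\<And>x. x \<in> I \<Longrightarrow> (f has_real_derivative deriv f x) (at x)"
proof -
  obtain F where F: "F analytic_on (of_real ` I :: complex set)" "\<And>x. x \<in> I \<Longrightarrow> F (of_real x) = of_real (f x)"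
    using assms(1) by (auto simp: real_analytic_on_def)
  have d: "F field_differentiable at (of_real x)" if "x \<in> I" for x
    using F(1) that by (simp add: analytic_on_imp_differentiable_at)
  show "real_analytic_on (deriv f) I"
    by (rule real_analytic_onI[of "deriv F"])
       (use F(1) holomorphic_real_deriv(2)[OF assms(2) _ d F(2)] in \<open>auto intro: analytic_deriv\<close>)
  show "\<And>x. x \<in> I \<Longrightarrow> (f has_real_derivative deriv f x) (at x)"
    using holomorphic_real_deriv(1)[OF assms(2) _ d F(2)] by blast
qed

lemma real_analytic_const: "real_analytic_on (\<lambda>_. c) I"
  by (rule real_analytic_onI[of "\<lambda>_. of_real c"]) (auto intro!: analytic_intros)

lemma real_analytic_ident: "real_analytic_on (\<lambda>x. x) I"
  by (rule real_analytic_onI[of "\<lambda>x. x"]) (auto intro!: analytic_intros)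

lemma real_analytic_add:
  assumes "real_analytic_on f I" "real_analytic_on g I"
  shows "real_analytic_on (\<lambda>x. f x + g x) I"
proof -
  obtain F G where "F analytic_on (of_real ` I :: complex set)" "\<And>x. x \<in> I \<Longrightarrow> F (of_real x) = of_real (f x)"
    "G analytic_on (of_real ` I :: complex set)" "\<And>x. x \<in> I \<Longrightarrow> G (of_real x) = of_real (g x)"
    using assms by (auto simp: real_analytic_on_def)
  thus ?thesis by (intro real_analytic_onI[of "\<lambda>z. F z + G z"]) (auto intro!: analytic_intros)
qed

lemma real_analytic_mult:
  assumes "real_analytic_on f I" "real_analytic_on g I"
  shows "real_analytic_on (\<lambda>x. f x * g x) I"
proof -
  obtain F G where "F analytic_on (of_real ` I :: complex set)" "\<And>x. x \<in> I \<Longrightarrow> F (of_real x) = of_real (f x)"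
    "G analytic_on (of_real ` I :: complex set)" "\<And>x. x \<in> I \<Longrightarrow> G (of_real x) = of_real (g x)"
    using assms by (auto simp: real_analytic_on_def)
  thus ?thesis by (intro real_analytic_onI[of "\<lambda>z. F z * G z"]) (auto intro!: analytic_intros)
qed

lemma real_analytic_inverse:
  assumes "real_analytic_on f I" "\<And>x. x \<in> I \<Longrightarrow> f x \<noteq> 0"
  shows "real_analytic_on (\<lambda>x. inverse (f x)) I"
proof -
  obtain F where "F analytic_on (of_real ` I :: complex set)" "\<And>x. x \<in> I \<Longrightarrow> F (of_real x) = of_real (f x)"
    using assms by (auto simp: real_analytic_on_def)
  thus ?thesis using assms(2)
    by (intro real_analytic_onI[of "\<lambda>z. inverse (F z)"]) (auto intro!: analytic_intros)
qed

lemma real_analytic_divide: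
  assumes "real_analytic_on f I" "real_analytic_on g I" "\<And>x. x \<in> I \<Longrightarrow> g x \<noteq> 0"
  shows "real_analytic_on (\<lambda>x. f x / g x) I"
  using real_analytic_mult[OF assms(1) real_analytic_inverse[OF assms(2,3)]]
  by (simp add: divide_inverse)

lemma real_analytic_diff:
  assumes "real_analytic_on f I" "real_analytic_on g I"
  shows "real_analytic_on (\<lambda>x. f x - g x) I"
  using real_analytic_add[OF assms(1) real_analytic_mult[OF real_analytic_const[of "-1"] assms(2)]]
  by simp

lemma real_analytic_power:
  assumes "real_analytic_on f I"
  shows "real_analytic_on (\<lambda>x. f x ^ n) I"
  by (induction n) (auto intro: real_analytic_mult assms real_analytic_const)

lemma real_analytic_poly: "real_analytic_on (poly p) I"
proof (induction p)
  case 0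
  then show ?case using real_analytic_const[of 0] by (simp add: poly_0[abs_def])
next
  case (pCons a p)
  have "real_analytic_on (\<lambda>x. a + x * poly p x) I"
    by (intro real_analytic_add real_analytic_mult real_analytic_const real_analytic_ident pCons)
  thus ?case by (rule real_analytic_on_cong) simp
qed

lemma real_analytic_ln:
  assumes "real_analytic_on f I" "\<And>x. x \<in> I \<Longrightarrow> f x > 0"
  shows "real_analytic_on (\<lambda>x. ln (f x)) I"
proof -
  obtain F where F: "F analytic_on (of_real ` I :: complex set)" "\<And>x. x \<in> I \<Longrightarrow> F (of_real x) = of_real (f x)"
    using assms by (auto simp: real_analytic_on_def)
  have "(\<lambda>z. Ln (F z)) analytic_on (of_real ` I)"
    by (intro analytic_intros F) (use F(2) assms(2) in \<open>auto simp: complex_nonpos_Reals_iff\<close>, fastforce)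
  thus ?thesis
    by (rule real_analytic_onI) (use F(2) assms(2) Ln_of_real in auto)
qed

lemma real_analytic_sqrt:
  assumes "real_analytic_on f I" "\<And>x. x \<in> I \<Longrightarrow> f x > 0"
  shows "real_analytic_on (\<lambda>x. sqrt (f x)) I"
proof -
  obtain F where F: "F analytic_on (of_real ` I :: complex set)" "\<And>x. x \<in> I \<Longrightarrow> F (of_real x) = of_real (f x)"
    using assms by (auto simp: real_analytic_on_def)
  have "(\<lambda>z. csqrt (F z)) analytic_on (of_real ` I)"
    by (intro analytic_intros F) (use F(2) assms(2) in \<open>auto simp: complex_nonpos_Reals_iff\<close>, fastforce)
  thus ?thesis
    by (rule real_analytic_onI) (use F(2) assms(2) of_real_sqrt in \<open>auto simp: less_imp_le\<close>)
qed

lemma real_analytic_compose: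
  assumes f: "real_analytic_on f J" and g: "real_analytic_on g I" and "\<And>x. x \<in> I \<Longrightarrow> g x \<in> J"
  shows "real_analytic_on (\<lambda>x. f (g x)) I"
proof -
  obtain F G where F: "F analytic_on (of_real ` J :: complex set)" "\<And>x. x \<in> J \<Longrightarrow> F (of_real x) = of_real (f x)"
    and G: "G analytic_on (of_real ` I :: complex set)" "\<And>x. x \<in> I \<Longrightarrow> G (of_real x) = of_real (g x)"
    using f g by (auto simp: real_analytic_on_def)
  have "(F \<circ> G) analytic_on (of_real ` I :: complex set)"
    by (rule analytic_on_compose_gen[OF G(1) F(1)]) (use G(2) assms(3) in auto)
  thus ?thesis by (rule real_analytic_onI) (use F(2) G(2) assms(3) in auto)
qed

lemmas real_analytic_intros = real_analytic_const real_analytic_ident real_analytic_add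
  real_analytic_diff real_analytic_mult real_analytic_divide real_analytic_power real_analytic_poly
  real_analytic_ln real_analytic_sqrt

definition vanishes :: "nat \<Rightarrow> (real \<Rightarrow> real) \<Rightarrow> real \<Rightarrow> bool" where
  "vanishes m f x \<longleftrightarrow> (\<forall>j<m. (deriv ^^ j) f x = 0)"

lemma vanishes_0 [simp]: "vanishes 0 f x"
  by (simp add: vanishes_def)

lemma vanishes_Suc: "vanishes (Suc m) f x \<longleftrightarrow> f x = 0 \<and> vanishes m (deriv f) x"
proof -
  have "(deriv ^^ j) (deriv f) = (deriv ^^ Suc j) f" for j
    by (simp only: funpow_Suc_right o_apply)
  thus ?thesis by (auto simp: vanishes_def less_Suc_eq_0_disj simp del: funpow.simps(2))
qed

lemma vanishes_mono: "vanishes m f x \<Longrightarrow> k \<le> m \<Longrightarrow> vanishes k f x"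
  by (auto simp: vanishes_def)

lemma vanishes_cong:
  assumes "open I" "x \<in> I" "\<And>y. y \<in> I \<Longrightarrow> f y = g y"
  shows "vanishes m f x \<longleftrightarrow> vanishes m g x"
proof -
  have "(deriv ^^ j) f x = (deriv ^^ j) g x" for j
    by (rule higher_deriv_cong_ev) (use assms in \<open>auto simp: eventually_nhds\<close>)
  thus ?thesis by (simp add: vanishes_def)
qed

text \<open>The product rule as an equation between derivative functions, in the form in which it can be iterated.\<close>

lemma deriv_mult_on:
  assumes "real_analytic_on f I" "real_analytic_on g I" "open I" "x \<in> I"
  shows "deriv (\<lambda>x. f x * g x) x = deriv f x * g x + f x * deriv g x"
  using DERIV_mult[OF real_analytic_on_deriv(2)[OF assms(1,3,4)] real_analytic_on_deriv(2)[OF assms(2,3,4)]]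
  by (intro DERIV_imp_deriv) (simp add: algebra_simps)

lemma vanishes_add:
  assumes "real_analytic_on f I" "real_analytic_on g I" "open I" "x \<in> I"
    "vanishes m f x" "vanishes m g x"
  shows "vanishes m (\<lambda>x. f x + g x) x"
  using assms
proof (induction m arbitrary: f g)
  case (Suc m)
  have "vanishes m (\<lambda>x. deriv f x + deriv g x) x"
    by (rule Suc.IH[OF real_analytic_on_deriv(1)[OF Suc.prems(1,3)] real_analytic_on_deriv(1)[OF Suc.prems(2,3)] Suc.prems(3,4)])
       (use Suc.prems in \<open>auto simp: vanishes_Suc\<close>)
  moreover have "deriv (\<lambda>x. f x + g x) y = deriv f y + deriv g y" if "y \<in> I" for y
    using DERIV_add[OF real_analytic_on_deriv(2)[OF Suc.prems(1,3) that]
        real_analytic_on_deriv(2)[OF Suc.prems(2,3) that]] by (rule DERIV_imp_deriv)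
  ultimately show ?case
    using vanishes_cong[OF Suc.prems(3,4), of "deriv (\<lambda>x. f x + g x)" "\<lambda>x. deriv f x + deriv g x"]
      Suc.prems by (auto simp: vanishes_Suc)
qed simp

text \<open>By the product rule each derivative of \<open>f * g\<close> is a combination of derivatives of \<open>f\<close> of at most the same order.\<close>

lemma vanishes_mult:
  assumes "real_analytic_on f I" "real_analytic_on g I" "open I" "x \<in> I" "vanishes m f x"
  shows "vanishes m (\<lambda>x. f x * g x) x"
  using assms
proof (induction m arbitrary: f g)
  case (Suc m)
  note d = real_analytic_on_deriv(1)
  have "vanishes m (\<lambda>x. deriv f x * g x + f x * deriv g x) x"
  proof (rule vanishes_add[of "\<lambda>x. deriv f x * g x" I "\<lambda>x. f x * deriv g x"])
    show "vanishes m (\<lambda>x. deriv f x * g x) x"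
      by (rule Suc.IH[OF d[OF Suc.prems(1,3)] Suc.prems(2-4)]) (use Suc.prems in \<open>auto simp: vanishes_Suc\<close>)
    show "vanishes m (\<lambda>x. f x * deriv g x) x"
      by (rule Suc.IH[OF Suc.prems(1) d[OF Suc.prems(2,3)] Suc.prems(3,4)])
         (use vanishes_mono[OF Suc.prems(5)] in auto)
  qed (use Suc.prems d in \<open>auto intro: real_analytic_mult\<close>)
  moreover have "deriv (\<lambda>x. f x * g x) y = deriv f y * g y + f y * deriv g y" if "y \<in> I" for y
    using deriv_mult_on[OF Suc.prems(1,2,3) that] .
  ultimately show ?case
    using vanishes_cong[OF Suc.prems(3,4), of "deriv (\<lambda>x. f x * g x)"] Suc.prems
    by (auto simp: vanishes_Suc)
qed simp

text \<open>Multiply by the analytic function \<open>1 / g\<close>.\<close>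

lemma vanishes_mult_cancel:
  assumes "real_analytic_on f I" "real_analytic_on g I" "open I" "x \<in> I"
    "vanishes m (\<lambda>x. f x * g x) x" "\<And>x. x \<in> I \<Longrightarrow> g x \<noteq> 0"
  shows "vanishes m f x"
proof -
  have van: "vanishes m (\<lambda>x. (f x * g x) * inverse (g x)) x"
    by (rule vanishes_mult[of "\<lambda>x. f x * g x" I "\<lambda>x. inverse (g x)"])
       (use assms in \<open>auto intro: real_analytic_mult real_analytic_inverse\<close>)
  have "(f y * g y) * inverse (g y) = f y" if "y \<in> I" for y
    using assms(6)[OF that] by simp
  from vanishes_cong[OF assms(3,4), of "\<lambda>x. (f x * g x) * inverse (g x)" f, OF this]
  show ?thesis using van by blast
qed

text \<open>Since \<open>(f \<circ> g)' = (f' \<circ> g) g'\<close> and \<open>g'\<close> has no zero, the induction hypothesis applies to \<open>f'\<close>.\<close>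

lemma vanishes_compose:
  assumes "real_analytic_on f J" "open J" "real_analytic_on g I" "open I" "x \<in> I"
    "\<And>x. x \<in> I \<Longrightarrow> g x \<in> J" "\<And>x. x \<in> I \<Longrightarrow> deriv g x \<noteq> 0"
    "vanishes m (\<lambda>x. f (g x)) x"
  shows "vanishes m f (g x)"
  using assms
proof (induction m arbitrary: f)
  case (Suc m)
  have e: "deriv (\<lambda>x. f (g x)) y = deriv f (g y) * deriv g y" if "y \<in> I" for y
    using DERIV_chain2[OF real_analytic_on_deriv(2)[OF Suc.prems(1,2)] real_analytic_on_deriv(2)[OF Suc.prems(3,4)]]
      that Suc.prems(6) by (intro DERIV_imp_deriv) auto
  have "vanishes m (\<lambda>x. deriv f (g x) * deriv g x) x"
    using vanishes_cong[OF Suc.prems(4,5) e] Suc.prems(8) by (auto simp: vanishes_Suc)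
  hence "vanishes m (\<lambda>x. deriv f (g x)) x"
    using vanishes_mult_cancel[OF real_analytic_compose[OF real_analytic_on_deriv(1)[OF Suc.prems(1,2)]
          Suc.prems(3,6)] real_analytic_on_deriv(1)[OF Suc.prems(3,4)] Suc.prems(4,5) _ Suc.prems(7)] by blast
  hence "vanishes m (deriv f) (g x)"
    using Suc.IH[OF real_analytic_on_deriv(1)[OF Suc.prems(1,2)] Suc.prems(2-5)] Suc.prems(6,7) by blast
  thus ?case using Suc.prems(8) by (auto simp: vanishes_Suc)
qed simp

text \<open>Between consecutive zeros of \<open>f\<close> lies a zero of the derivative that is not itself one of the given zeros.\<close>

lemma Rolle_gaps:
  fixes f f' :: "real \<Rightarrow> real"
  assumes "finite S" "S \<noteq> {}" "S \<subseteq> I" "is_interval I"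
    "\<And>x. x \<in> I \<Longrightarrow> (f has_real_derivative f' x) (at x)" "\<And>x. x \<in> S \<Longrightarrow> f x = 0"
  shows "\<exists>G. finite G \<and> Suc (card G) = card S \<and> G \<inter> S = {} \<and> G \<subseteq> {Min S..Max S} \<and> (\<forall>x\<in>G. f' x = 0)"
  using assms
proof (induction S rule: finite_linorder_max_induct)
  case (insert b A)
  show ?case
  proof (cases "A = {}")
    case True
    thus ?thesis by (intro exI[of _ "{}"]) auto
  next
    case False
    then obtain G where G: "finite G" "Suc (card G) = card A" "G \<inter> A = {}" "G \<subseteq> {Min A..Max A}"
      "\<forall>x\<in>G. f' x = 0" using insert by auto
    define a where "a = Max A"
    have a: "a \<in> A" "a < b" using False insert by (auto simp: a_def)
    have sub: "{a..b} \<subseteq> I"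
    proof
      fix t assume t: "t \<in> {a..b}"
      have "a \<in> I" "b \<in> I" using a(1) insert.prems(2) by auto
      thus "t \<in> I" using t insert.prems(3) unfolding is_interval_1 by (meson atLeastAtMost_iff)
    qed
    obtain \<xi> where \<xi>: "a < \<xi>" "\<xi> < b" "f' \<xi> = 0"
    proof -
      have "\<exists>\<xi>. a < \<xi> \<and> \<xi> < b \<and> (\<lambda>h. h * f' \<xi>) = (\<lambda>v. 0)"
      proof (rule Rolle_deriv[OF a(2)])
        show "f a = f b" using insert.prems(5) a by auto
        show "continuous_on {a..b} f"
          by (rule DERIV_continuous_on[of _ _ f'])
             (use insert.prems(4) sub in \<open>meson has_field_derivative_at_within subsetD\<close>)
        show "\<And>x. a < x \<Longrightarrow> x < b \<Longrightarrow> (f has_derivative (\<lambda>h. h * f' x)) (at x)"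
          using insert.prems(4) sub
          by (simp add: has_field_derivative_def mult.commute[of _ "f' _"] subset_iff)
      qed
      thus ?thesis using that by (metis mult_1)
    qed
    have "\<xi> \<notin> G" using G(4) \<xi> a_def by auto
    moreover have "b \<notin> G" using G(4) a(2) unfolding a_def by (meson atLeastAtMost_iff leD subsetD)
    moreover have "b \<notin> A" "\<xi> \<notin> A"
      using a(2) \<xi> Max_ge[OF insert(1)] unfolding a_def[symmetric] by force+
    have "Max A < b" using a(2) by (simp add: a_def)
    hence "Max (insert b A) = b" using Max_insert[OF insert(1) False, of b] max.absorb3 by metis
    hence mm: "Min (insert b A) \<le> Min A" "Max (insert b A) = b" "Min A \<le> a"
      using insert(1) False a by auto
    moreover have "G \<subseteq> {Min (insert b A)..b}" "\<xi> \<in> {Min (insert b A)..b}"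
      using G(4) mm a \<xi> unfolding a_def[symmetric] by force+
    moreover have "(insert \<xi> G) \<inter> insert b A = {}"
      using \<open>b \<notin> G\<close> \<open>\<xi> \<notin> A\<close> G(3) \<xi>(2) by auto
    moreover have "card (insert \<xi> G) = Suc (card G)" "card (insert b A) = Suc (card A)"
      using G(1) insert(1) \<open>\<xi> \<notin> G\<close> \<open>b \<notin> A\<close> by auto
    ultimately show ?thesis using G(1,2,5) \<xi>(3)
      by (intro exI[of _ "insert \<xi> G"] conjI) (auto simp: mm(2))
  qed
qed simp

text \<open>Rolle's theorem with multiplicities: a zero of order \<open>k\<close> is a zero of order \<open>k - 1\<close> of the derivative, and
each gap between different zeros contributes one further zero, so exactly one is lost in total.\<close>

lemma Rolle_multiplicity:
  assumes "real_analytic_on f I" "open I" "is_interval I" "finite S" "S \<subseteq> I"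
    "\<And>x. x \<in> S \<Longrightarrow> vanishes (\<mu> x) f x" "sum \<mu> S = Suc m"
  shows "\<exists>T \<nu>. finite T \<and> T \<subseteq> I \<and> (\<forall>x\<in>T. vanishes (\<nu> x) (deriv f) x) \<and> sum \<nu> T = m"
proof -
  define S' where "S' = {x\<in>S. \<mu> x > 0}"
  have S': "finite S'" "S' \<subseteq> I" using assms by (auto simp: S'_def)
  have sm: "sum \<mu> S' = Suc m"
    unfolding assms(7)[symmetric] S'_def using assms(4) by (intro sum.mono_neutral_left) auto
  have "f x = 0" if "x \<in> S'" for x
    using assms(6)[of x] that vanishes_def[of "\<mu> x" f x] by (force simp: S'_def)
  moreover have "S' \<noteq> {}" using sm by auto
  ultimately obtain G where G: "finite G" "Suc (card G) = card S'" "G \<inter> S' = {}" "G \<subseteq> {Min S'..Max S'}"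
    "\<forall>x\<in>G. deriv f x = 0"
    using Rolle_gaps[OF S'(1) _ S'(2) assms(3) real_analytic_on_deriv(2)[OF assms(1,2)]] by blast
  have GI: "G \<subseteq> I"
  proof -
    have "Min S' \<in> I" "Max S' \<in> I" using S' \<open>S' \<noteq> {}\<close> Min_in Max_in by blast+
    thus ?thesis using G(4) assms(3) unfolding is_interval_1 by (meson atLeastAtMost_iff subsetD subsetI)
  qed
  define \<nu> where "\<nu> x = (if x \<in> G then 1 else \<mu> x - 1)" for x
  have "vanishes (\<nu> x) (deriv f) x" if "x \<in> S' \<union> G" for x
  proof (cases "x \<in> G")
    case True
    thus ?thesis using G(5) by (simp add: \<nu>_def vanishes_Suc)
  next
    case False
    hence "x \<in> S" "\<mu> x > 0" using that by (auto simp: S'_def)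
    hence "vanishes (Suc (\<mu> x - 1)) f x" using assms(6) by simp
    thus ?thesis using False by (simp add: \<nu>_def vanishes_Suc)
  qed
  moreover have "sum \<nu> (S' \<union> G) = m"
  proof -
    have "sum \<nu> (S' \<union> G) = sum \<nu> S' + card G"
      using G S' by (subst sum.union_disjoint) (auto simp: \<nu>_def)
    moreover have "sum \<nu> S' + card S' = sum \<mu> S'"
    proof -
      have "sum \<nu> S' + card S' = (\<Sum>x\<in>S'. \<nu> x + 1)" by (simp add: sum.distrib del: add_Suc_right One_nat_def)
      also have "\<dots> = sum \<mu> S'" using G(3) by (intro sum.cong) (auto simp: \<nu>_def S'_def)
      finally show ?thesis .
    qed
    ultimately show ?thesis using sm G(2) by linarith
  qed
  ultimately show ?thesis using G(1) S' GI by (intro exI[of _ "S' \<union> G"] exI[of _ \<nu>]) auto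
qed

text \<open>Counting prescribed multiplicities at finitely many points avoids zero sets that might be infinite and
orders that might be undefined.\<close>

definition zeros_le :: "(real \<Rightarrow> real) \<Rightarrow> real set \<Rightarrow> nat \<Rightarrow> bool" where
  "zeros_le f I N \<longleftrightarrow>
     (\<forall>S \<mu>. finite S \<and> S \<subseteq> I \<and> (\<forall>x\<in>S. vanishes (\<mu> x) f x) \<longrightarrow> sum \<mu> S \<le> N)"

lemma zeros_leD:
  "zeros_le f I N \<Longrightarrow> finite S \<Longrightarrow> S \<subseteq> I \<Longrightarrow> (\<And>x. x \<in> S \<Longrightarrow> vanishes (\<mu> x) f x) \<Longrightarrow> sum \<mu> S \<le> N"
  unfolding zeros_le_def by blast

lemma zeros_le_mono: "zeros_le f I N \<Longrightarrow> N \<le> N' \<Longrightarrow> zeros_le f I N'"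
  unfolding zeros_le_def by (meson order_trans)

lemma zeros_le_cong:
  assumes "zeros_le f I N" "open I" "\<And>x. x \<in> I \<Longrightarrow> f x = g x"
  shows "zeros_le g I N"
  using assms(1) vanishes_cong[OF assms(2) _ assms(3)] unfolding zeros_le_def by (meson subsetD)

lemma zeros_le_deriv:
  assumes "real_analytic_on f I" "open I" "is_interval I" "zeros_le (deriv f) I N"
  shows "zeros_le f I (Suc N)"
  unfolding zeros_le_def
proof (intro allI impI)
  fix S \<mu> assume S: "finite S \<and> S \<subseteq> I \<and> (\<forall>x\<in>S. vanishes (\<mu> x) f x)"
  show "sum \<mu> S \<le> Suc N"
  proof (cases "sum \<mu> S")
    case (Suc m)
    then obtain T \<nu> where "finite T" "T \<subseteq> I" "\<forall>x\<in>T. vanishes (\<nu> x) (deriv f) x" "sum \<nu> T = m"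
      using Rolle_multiplicity[OF assms(1-3), of S \<mu> m] S by auto
    thus ?thesis using zeros_leD[OF assms(4), of T \<nu>] Suc by auto
  qed simp
qed

lemma zeros_le_nonzero:
  assumes "\<And>x. x \<in> I \<Longrightarrow> f x \<noteq> 0"
  shows "zeros_le f I N"
  unfolding zeros_le_def
proof (intro allI impI)
  fix S \<mu> assume S: "finite S \<and> S \<subseteq> I \<and> (\<forall>x\<in>S. vanishes (\<mu> x) f x)"
  have "\<mu> x = 0" if "x \<in> S" for x
  proof (rule ccontr)
    assume "\<mu> x \<noteq> 0"
    hence "vanishes (Suc (\<mu> x - 1)) f x" using S that by auto
    thus False using assms that S by (auto simp: vanishes_Suc)
  qed
  thus "sum \<mu> S \<le> N" by simp
qed

lemma zeros_le_mult:
  assumes "real_analytic_on f I" "real_analytic_on g I" "open I" "zeros_le (\<lambda>x. f x * g x) I N"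
  shows "zeros_le f I N"
  unfolding zeros_le_def using vanishes_mult[OF assms(1-3)] assms(4)
  by (meson subsetD zeros_leD)

text \<open>Rolle's theorem, applied \<open>m\<close> times.\<close>

lemma zeros_le_higher_deriv:
  assumes "real_analytic_on f I" "open I" "is_interval I" "\<And>x. x \<in> I \<Longrightarrow> (deriv ^^ m) f x \<noteq> 0"
  shows "zeros_le f I m"
  using assms
proof (induction m arbitrary: f)
  case 0
  thus ?case using zeros_le_nonzero by auto
next
  case (Suc m)
  have "zeros_le (deriv f) I m"
    by (rule Suc.IH) (use Suc.prems real_analytic_on_deriv in \<open>auto simp: funpow_swap1\<close>)
  thus ?case using zeros_le_deriv Suc.prems by blast
qed

lemma zeros_le_poly:
  assumes "p \<noteq> 0" "open I" "is_interval I"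
  shows "zeros_le (poly p) I (degree p)"
  using assms(1)
proof (induction "degree p" arbitrary: p)
  case 0
  then obtain c where "p = [:c:]" "c \<noteq> 0" by (metis degree_eq_zeroE pCons_0_0)
  thus ?case by (intro zeros_le_nonzero) auto
next
  case (Suc d)
  have "pderiv p \<noteq> 0" "degree (pderiv p) = d" using Suc.hyps(2)
    by (metis degree_pderiv diff_Suc_1 nat.distinct(1) pderiv_eq_0_iff)+
  moreover have "deriv (poly p) x = poly (pderiv p) x" for x
    by (rule DERIV_imp_deriv[OF poly_DERIV])
  hence "deriv (poly p) = poly (pderiv p)" by blast
  ultimately show ?case
    using zeros_le_deriv[OF real_analytic_poly assms(2,3), of p d] Suc by metis
qed

text \<open>An analytic change of coordinate carries zeros to zeros of the same order.\<close>

lemma zeros_le_compose: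
  assumes "real_analytic_on f J" "open J" "real_analytic_on g I" "open I"
    "\<And>x. x \<in> I \<Longrightarrow> g x \<in> J" "\<And>x. x \<in> I \<Longrightarrow> deriv g x \<noteq> 0" "inj_on g I" "zeros_le f J N"
  shows "zeros_le (\<lambda>x. f (g x)) I N"
  unfolding zeros_le_def
proof (intro allI impI)
  fix S \<mu> assume S: "finite S \<and> S \<subseteq> I \<and> (\<forall>x\<in>S. vanishes (\<mu> x) (\<lambda>x. f (g x)) x)"
  have inj: "inj_on g S" using assms(7) S inj_on_subset by blast
  define \<nu> where "\<nu> = \<mu> \<circ> the_inv_into S g"
  have "sum \<nu> (g ` S) \<le> N"
  proof (rule zeros_leD[OF assms(8)])
    show "vanishes (\<nu> y) f y" if "y \<in> g ` S" for y
      using that S inj vanishes_compose[OF assms(1-4)] assms(5,6)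
      by (auto simp: \<nu>_def the_inv_into_f_f subset_iff)
  qed (use S assms(5) in auto)
  also have "sum \<nu> (g ` S) = sum \<mu> S"
    using inj by (simp add: sum.reindex \<nu>_def the_inv_into_f_f)
  finally show "sum \<mu> S \<le> N" .
qed

section \<open>Stability of zero counts under uniform limits\<close>

text \<open>Cauchy's estimate on balls of radius \<open>r\<close> around the points of the smaller ball.\<close>

lemma uniform_limit_higher_deriv:
  fixes F :: "real \<Rightarrow> complex \<Rightarrow> complex"
  assumes U: "open U" "cball z (2 * r) \<subseteq> U" "r > 0"
    and hol: "\<forall>\<^sub>F eps in A. F eps holomorphic_on U" "F0 holomorphic_on U"
    and lim: "uniform_limit U F F0 A" and d: "d > 0"
  shows "\<forall>\<^sub>F eps in A. \<forall>w\<in>cball z r. cmod ((deriv ^^ m) (F eps) w - (deriv ^^ m) F0 w) < d"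
proof -
  define c where "c = d * r ^ m / (2 * fact m)"
  have c: "c > 0" using U d by (simp add: c_def)
  show ?thesis
    using hol(1) uniform_limitD[OF lim c]
  proof eventually_elim
    case (elim eps)
    show ?case
    proof
      fix w assume w: "w \<in> cball z r"
      have sub: "cball w r \<subseteq> U"
      proof
        fix y assume "y \<in> cball w r"
        hence "dist z y \<le> 2 * r" using w dist_triangle[of z y w] by auto
        thus "y \<in> U" using U by auto
      qed
      have hd: "(\<lambda>w. F eps w - F0 w) holomorphic_on U" using elim hol by (intro holomorphic_intros)
      have "cmod ((deriv ^^ m) (\<lambda>w. F eps w - F0 w) w) \<le> fact m * c / r ^ m"
      proof (rule Cauchy_inequality)
        show "(\<lambda>w. F eps w - F0 w) holomorphic_on ball w r"
          using hd sub by (meson ball_subset_cball holomorphic_on_subset)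
        show "continuous_on (cball w r) (\<lambda>w. F eps w - F0 w)"
          using hd sub by (meson holomorphic_on_imp_continuous_on continuous_on_subset)
        show "cmod (F eps x - F0 x) \<le> c" if "cmod (w - x) = r" for x
          using elim(2) sub that by (force simp: dist_norm less_imp_le)
      qed (use U in auto)
      also have "fact m * c / r ^ m = d / 2" using U by (simp add: c_def)
      also have "(deriv ^^ m) (\<lambda>w. F eps w - F0 w) w = (deriv ^^ m) (F eps) w - (deriv ^^ m) F0 w"
        by (rule higher_deriv_diff) (use elim hol U sub w in auto)
      finally show "cmod ((deriv ^^ m) (F eps) w - (deriv ^^ m) F0 w) < d" using d by simp
    qed
  qed
qed

lemma higher_deriv_real:
  assumes "open I" "x \<in> I" "F analytic_on (of_real ` I :: complex set)" "\<And>x. x \<in> I \<Longrightarrow> F (of_real x) = of_real (f x)"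
  shows "(deriv ^^ m) F (of_real x) = of_real ((deriv ^^ m) f x)"
  using assms(2)
proof (induction m arbitrary: x)
  case (Suc m)
  have "(deriv ^^ m) F field_differentiable at (of_real x)"
    using analytic_higher_deriv[OF assms(3), of m] Suc.prems analytic_on_imp_differentiable_at by blast
  from holomorphic_real_deriv(2)[OF assms(1) Suc.prems this Suc.IH]
  show ?case by simp
qed (use assms in auto)

text \<open>Near each point of \<open>K\<close> some derivative of the limit function does not vanish; by Cauchy estimates the same
derivative of \<open>f eps\<close> does not vanish on a small interval, so that Rolle's theorem bounds the zeros of
\<open>f eps\<close> there by the order of the zero of the limit. Finitely many such intervals cover \<open>K\<close>, and only those around
zeros of the limit contribute.\<close>

lemma eventually_zeros_le:
  fixes F :: "real \<Rightarrow> complex \<Rightarrow> complex" and f :: "real \<Rightarrow> real \<Rightarrow> real"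
  assumes I: "open I" "compact K" "K \<subseteq> I" and U: "open U" "of_real ` I \<subseteq> U"
    and hol: "\<forall>\<^sub>F eps in A. F eps holomorphic_on U" "F0 holomorphic_on U"
    and lim: "uniform_limit U F F0 A"
    and re: "\<forall>\<^sub>F eps in A. \<forall>x\<in>I. F eps (of_real x) = of_real (f eps x)"
    and re0: "\<And>x. x \<in> I \<Longrightarrow> F0 (of_real x) = of_real (f0 x)"
    and z: "zeros_le f0 I N"
  shows "\<forall>\<^sub>F eps in A. zeros_le (f eps) K N"
proof -
  have an0: "F0 analytic_on (of_real ` I)" using hol(2) U analytic_on_holomorphic by blast
  define mm where "mm x = (LEAST m. (deriv ^^ m) f0 x \<noteq> 0)" for x
  have ex: "\<exists>m. (deriv ^^ m) f0 x \<noteq> 0" if "x \<in> I" for x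
  proof (rule ccontr)
    assume "\<not> ?thesis"
    hence "sum (\<lambda>_. Suc N) {x} \<le> N"
      by (intro zeros_leD[OF z]) (use that in \<open>auto simp: vanishes_def\<close>)
    thus False by simp
  qed
  have mm: "(deriv ^^ mm x) f0 x \<noteq> 0" "vanishes (mm x) f0 x" if "x \<in> I" for x
    using LeastI_ex[OF ex[OF that]] not_less_Least[of _ "\<lambda>m. (deriv ^^ m) f0 x \<noteq> 0"]
    by (auto simp: mm_def vanishes_def)
  have loc: "\<exists>r>0. \<forall>\<^sub>F eps in A. zeros_le (f eps) (ball x r) (mm x)" if x: "x \<in> I" for x
  proof -
    define G where "G = (deriv ^^ mm x) F0"
    define c where "c = cmod (G (of_real x)) / 2"
    have "G (of_real x) = of_real ((deriv ^^ mm x) f0 x)"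
      unfolding G_def using higher_deriv_real[OF I(1) x an0 re0] by simp
    hence c: "c > 0" using mm(1)[OF x] by (simp add: c_def)
    have "G holomorphic_on U" unfolding G_def by (intro holomorphic_intros hol U)
    hence "continuous_on U G" by (rule holomorphic_on_imp_continuous_on)
    hence "isCont G (of_real x)" using U x by (auto simp: continuous_on_eq_continuous_at)
    then obtain d1 where d1: "d1 > 0" "\<And>w. dist w (of_real x) < d1 \<Longrightarrow> dist (G w) (G (of_real x)) < c"
      unfolding continuous_at_eps_delta using c by meson
    obtain d2 where d2: "d2 > 0" "cball (of_real x) d2 \<subseteq> U"
      using U x open_contains_cball by (metis image_subset_iff)
    obtain d3 where d3: "d3 > 0" "ball x d3 \<subseteq> I" using I(1) x open_contains_ball by blast
    define r where "r = min (d1/2) (min (d2/2) d3)"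
    have r: "r > 0" "r < d1" "2 * r \<le> d2" "r \<le> d3" using d1 d2 d3 by (auto simp: r_def)
    have ev: "\<forall>\<^sub>F eps in A. \<forall>w\<in>cball (of_real x) r. cmod ((deriv ^^ mm x) (F eps) w - G w) < c"
      unfolding G_def
      by (rule uniform_limit_higher_deriv[OF U(1) _ r(1) hol lim c]) (use d2 r in auto)
    have "\<forall>\<^sub>F eps in A. zeros_le (f eps) (ball x r) (mm x)"
      using ev hol(1) re
    proof eventually_elim
      case (elim eps)
      have bI: "ball x r \<subseteq> I" using d3 r by auto
      have an: "F eps analytic_on (of_real ` ball x r)" using elim(2) U bI analytic_on_holomorphic
        by (metis (no_types, lifting) image_mono order_trans)
      show ?case
      proof (rule zeros_le_higher_deriv)
        show "real_analytic_on (f eps) (ball x r)"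
          by (rule real_analytic_onI[OF an]) (use elim(3) bI in auto)
        show "(deriv ^^ mm x) (f eps) y \<noteq> 0" if y: "y \<in> ball x r" for y
        proof
          assume "(deriv ^^ mm x) (f eps) y = 0"
          hence "(deriv ^^ mm x) (F eps) (of_real y) = 0"
            using higher_deriv_real[OF open_ball y an, of "f eps" "mm x"] elim(3) bI
            by (simp add: subset_iff)
          moreover have "dist (of_real y :: complex) (of_real x) = dist y x"
            by (simp add: dist_norm flip: of_real_diff)
          moreover from this have "of_real y \<in> cball (of_real x :: complex) r" "dist (of_real y :: complex) (of_real x) < d1"
            using y r by (auto simp: dist_commute)
          hence "cmod ((deriv ^^ mm x) (F eps) (of_real y) - G (of_real y)) < c"
            using elim(1) by blast
          ultimately have "cmod (G (of_real y)) < c" "dist (G (of_real y)) (G (of_real x)) < c"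
            using d1(2)[of "of_real y"] \<open>dist (of_real y :: complex) (of_real x) < d1\<close> by auto
          moreover have "cmod (G (of_real x)) \<le> cmod (G (of_real y)) + dist (G (of_real y)) (G (of_real x))"
            by (metis dist_norm norm_triangle_sub norm_minus_commute add.commute dist_commute)
          ultimately show False by (simp add: c_def)
        qed
      qed (auto simp: is_interval_convex_1)
    qed
    thus ?thesis using r by blast
  qed
  then obtain r where r: "\<And>x. x \<in> I \<Longrightarrow> r x > 0" "\<And>x. x \<in> I \<Longrightarrow> \<forall>\<^sub>F eps in A. zeros_le (f eps) (ball x (r x)) (mm x)"
    by metis
  obtain X where X: "X \<subseteq> K" "finite X" "K \<subseteq> (\<Union>x\<in>X. ball x (r x))"
  proof (rule compactE_image[OF I(2), of K "\<lambda>x. ball x (r x)"])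
    show "K \<subseteq> (\<Union>c\<in>K. ball c (r c))" using r(1) I(3) by force
  qed auto
  have "\<forall>\<^sub>F eps in A. \<forall>x\<in>X. zeros_le (f eps) (ball x (r x)) (mm x)"
    using X r(2) I(3) by (auto simp: eventually_ball_finite_distrib)
  thus ?thesis
  proof eventually_elim
    case (elim eps)
    show ?case unfolding zeros_le_def
    proof (intro allI impI)
      fix S \<mu> assume S: "finite S \<and> S \<subseteq> K \<and> (\<forall>x\<in>S. vanishes (\<mu> x) (f eps) x)"
      have "S = (\<Union>x\<in>X. S \<inter> ball x (r x))" using S X(3) by blast
      hence "sum \<mu> S = sum \<mu> (\<Union>x\<in>X. S \<inter> ball x (r x))" by simp
      also have "\<dots> \<le> (\<Sum>x\<in>X. sum \<mu> (S \<inter> ball x (r x)))"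
        using X(2)
      proof (induction X rule: finite_induct)
        case (insert x X)
        have "sum \<mu> (\<Union>x\<in>insert x X. S \<inter> ball x (r x))
            \<le> sum \<mu> (S \<inter> ball x (r x)) + sum \<mu> (\<Union>x\<in>X. S \<inter> ball x (r x))"
          using S insert(1) by (simp add: sum_Un_nat)
        thus ?case using insert by simp
      qed simp
      also have "\<dots> \<le> (\<Sum>x\<in>X. mm x)"
        using elim S by (intro sum_mono) (auto intro!: zeros_leD)
      also have "\<dots> \<le> N"
        by (rule zeros_leD[OF z]) (use X I mm in auto)
      finally show "sum \<mu> S \<le> N" .
    qed
  qed
qed

section \<open>Scalar equations with a holomorphic right-hand side\<close>

text \<open>The estimate by length times bound, for intervals given by their end points.\<close>

lemma norm_integral_le:
  fixes f :: "real \<Rightarrow> 'a::banach"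
  assumes "f integrable_on {a..b}" "a \<le> b" "0 \<le> B" "\<And>t. t \<in> {a..b} \<Longrightarrow> norm (f t) \<le> B"
  shows "norm (integral {a..b} f) \<le> B * (b - a)"
  using has_integral_bound[of B f "integral {a..b} f" a b] assms by (simp add: integrable_integral)

text \<open>Cauchy's theory controls the derivative by the values of the function nearby, whose joint continuity is given.\<close>

lemma continuous_deriv_param:
  fixes F :: "complex \<Rightarrow> real \<Rightarrow> complex"
  assumes cont: "continuous_on (cball z r \<times> {a..b}) (\<lambda>(w, t). F w t)"
    and hol: "\<And>t. t \<in> {a..b} \<Longrightarrow> (\<lambda>w. F w t) holomorphic_on ball z r" and r: "r > 0"
  shows "continuous_on (ball z r \<times> {a..b}) (\<lambda>(w, t). deriv (\<lambda>w. F w t) w)"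
proof -
  define g where "g \<theta> = circlepath z r \<theta>" for \<theta>
  define G where "G wt \<theta> = F (g \<theta>) (snd wt) / (g \<theta> - fst wt)\<^sup>2 * vector_derivative (circlepath z r) (at \<theta>)"
    for wt :: "complex \<times> real" and \<theta> :: real
  have gs: "dist z (g \<theta>) = r" for \<theta>
    using r by (simp add: g_def circlepath dist_norm norm_mult)
  have gc: "continuous_on A g" for A
    unfolding g_def circlepath by (intro continuous_intros)
  have eq: "deriv (\<lambda>w. F w t) w = 1 / (2 * of_real pi * \<i>) * integral {0..1} (G (w, t))"
    if "w \<in> ball z r" "t \<in> {a..b}" for w t
  proof -
    have "continuous_on (cball z r) (\<lambda>w. F w t)"
      by (rule continuous_on_compose2[OF cont, of _ "\<lambda>w. (w, t)", simplified])
         (use that in \<open>auto intro!: continuous_intros\<close>)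
    from Cauchy_derivative_integral_circlepath(2)[OF this hol[OF that(2)] that(1)]
    have "deriv (\<lambda>w. F w t) w = 1 / (2 * of_real pi * \<i>) * contour_integral (circlepath z r) (\<lambda>u. F u t / (u - w)\<^sup>2)"
      by (rule DERIV_imp_deriv)
    also have "contour_integral (circlepath z r) (\<lambda>u. F u t / (u - w)\<^sup>2) = integral {0..1} (G (w, t))"
      by (simp add: contour_integral_integral G_def[abs_def] g_def)
    finally show ?thesis .
  qed
  have "continuous_on (ball z r \<times> {a..b}) (\<lambda>wt. integral (cbox 0 1) (G wt))"
  proof (rule integral_continuous_on_param)
    have "continuous_on ((ball z r \<times> {a..b}) \<times> {0..1}) (\<lambda>x. F (g (snd x)) (snd (fst x)))"
      by (rule continuous_on_compose2[OF cont, of _ "\<lambda>x. (g (snd x), snd (fst x))", simplified])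
         (use gs in \<open>auto intro!: continuous_intros continuous_on_compose2[OF gc]\<close>)
    moreover have "g \<theta> - w \<noteq> 0" if "w \<in> ball z r" for w \<theta>
      using gs[of \<theta>] that by auto
    ultimately show "continuous_on ((ball z r \<times> {a..b}) \<times> cbox 0 1) (\<lambda>(x, t). G x t)"
      unfolding G_def split_beta vector_derivative_circlepath
      by (auto intro!: continuous_intros continuous_on_compose2[OF gc])
  qed
  hence "continuous_on (ball z r \<times> {a..b}) (\<lambda>wt. 1 / (2 * of_real pi * \<i>) * integral {0..1} (G wt))"
    by (intro continuous_intros) auto
  thus ?thesis by (rule continuous_on_eq) (use eq in auto)
qed

text \<open>Differentiation under the integral sign; the derivative in the parameter is jointly continuous by
\<open>continuous_deriv_param\<close>.\<close>

lemma holomorphic_on_integral_param: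
  fixes F :: "complex \<Rightarrow> real \<Rightarrow> complex"
  assumes S: "open S" and cont: "continuous_on (S \<times> {a..b}) (\<lambda>(w, t). F w t)"
    and hol: "\<And>t. t \<in> {a..b} \<Longrightarrow> (\<lambda>w. F w t) holomorphic_on S"
  shows "(\<lambda>w. integral {a..b} (F w)) holomorphic_on S"
proof -
  have "\<exists>r>0. (\<lambda>w. integral {a..b} (F w)) holomorphic_on ball z r" if z: "z \<in> S" for z
  proof -
    obtain r where r: "r > 0" "cball z r \<subseteq> S" using S z open_contains_cball by blast
    have c: "continuous_on (cball z r \<times> {a..b}) (\<lambda>(w, t). F w t)"
      by (rule continuous_on_subset[OF cont]) (use r in auto)
    have h: "(\<lambda>w. F w t) holomorphic_on ball z r" if "t \<in> {a..b}" for t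
      using hol[OF that] r ball_subset_cball holomorphic_on_subset by (metis order_trans)
    have "(\<lambda>w. integral (cbox a b) (F w)) holomorphic_on ball z r"
    proof (rule leibniz_rule_holomorphic[where fx = "\<lambda>w t. deriv (\<lambda>w. F w t) w"])
      show "((\<lambda>w. F w t) has_field_derivative deriv (\<lambda>w. F w t) w) (at w within ball z r)"
        if "w \<in> ball z r" "t \<in> cbox a b" for w t
        using holomorphic_derivI[OF h open_ball that(1)] that(2) by auto
      show "F w integrable_on cbox a b" if "w \<in> ball z r" for w
        by (rule integrable_continuous, rule continuous_on_compose2[OF c, of _ "\<lambda>t. (w, t)", simplified])
           (use that in \<open>auto intro!: continuous_intros\<close>)
      show "continuous_on (ball z r \<times> cbox a b) (\<lambda>(w, t). deriv (\<lambda>w. F w t) w)"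
        using continuous_deriv_param[OF c h r(1)] by simp
    qed auto
    thus ?thesis using r by auto
  qed
  thus ?thesis
    by (metis (no_types, lifting) S analytic_imp_holomorphic analytic_on_def)
qed

lemma continuous_on_integral_upto:
  fixes G :: "complex \<Rightarrow> real \<Rightarrow> complex"
  assumes cont: "continuous_on (S \<times> {a..b}) (\<lambda>(w, t). G w t)"
    and bd: "\<And>w t. w \<in> S \<Longrightarrow> t \<in> {a..b} \<Longrightarrow> cmod (G w t) \<le> B"
  shows "continuous_on (S \<times> {a..b}) (\<lambda>(w, t). integral {a..t} (G w))"
proof -
  have main: "\<exists>d>0. \<forall>x\<in>S. \<forall>s. a \<le> s \<and> s \<le> b \<longrightarrow> dist (x, s) (w, t) < d \<longrightarrow>
     dist (integral {a..s} (G x)) (integral {a..t} (G w)) < e"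
    if wt: "w \<in> S" "a \<le> t" "t \<le> b" and e: "e > 0" for w t and e :: real
  proof -
  have int: "G w integrable_on {c..d}" if "w \<in> S" "a \<le> c" "d \<le> b" for w c d
    by (rule integrable_continuous_real, rule continuous_on_compose2[OF cont, of _ "\<lambda>t. (w, t)", simplified])
       (use that in \<open>auto intro!: continuous_intros\<close>)
  have B: "B \<ge> 0" using order_trans[OF norm_ge_zero bd[of w t]] wt by auto
  have "continuous_on S (\<lambda>w. integral (cbox a t) (G w))"
    by (rule integral_continuous_on_param) (rule continuous_on_subset[OF cont], use wt in auto)
  then obtain d where d: "d > 0" "\<And>w'. w' \<in> S \<Longrightarrow> dist w' w < d \<Longrightarrow>
      dist (integral {a..t} (G w')) (integral {a..t} (G w)) < e / 2"
    unfolding continuous_on_iff using wt e by (metis cbox_interval half_gt_zero)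
  define d' where "d' = min d (e / (2 * (B + 1)))"
  have d': "d' > 0" using d e B by (simp add: d'_def)
  have lip: "cmod (integral {a..t'} (G w') - integral {a..t} (G w')) \<le> B * \<bar>t' - t\<bar>"
    if "w' \<in> S" "a \<le> t'" "t' \<le> b" for w' t'
  proof -
    have *: "cmod (integral {a..t2} (G w') - integral {a..t1} (G w')) \<le> B * (t2 - t1)"
      if t12: "a \<le> t1" "t1 \<le> t2" "t2 \<le> b" for t1 t2
    proof -
      have "integral {a..t2} (G w') = integral {a..t1} (G w') + integral {t1..t2} (G w')"
        using Henstock_Kurzweil_Integration.integral_combine[OF t12(1,2) int[OF \<open>w' \<in> S\<close>]] t12 by simp
      moreover have "cmod (integral {t1..t2} (G w')) \<le> B * (t2 - t1)"
        by (rule norm_integral_le) (use B int[OF \<open>w' \<in> S\<close>] \<open>w' \<in> S\<close> bd t12 in auto)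
      ultimately show ?thesis using t12 by simp
    qed
    show ?thesis
    proof (cases "t \<le> t'")
      case True
      thus ?thesis using *[of t t'] wt that by simp
    next
      case False
      thus ?thesis using *[of t' t] wt that by (simp add: norm_minus_commute)
    qed
  qed
  show ?thesis
  proof (intro exI[of _ d'] conjI ballI allI impI d')
    fix w' t' assume w': "w' \<in> S" "a \<le> t' \<and> t' \<le> b" "dist (w', t') (w, t) < d'"
    have "dist w' w < d'" "dist t' t < d'"
      using w'(3) dist_fst_le[of "(w', t')" "(w, t)"] dist_snd_le[of "(w', t')" "(w, t)"] by auto
    hence 1: "dist (integral {a..t} (G w')) (integral {a..t} (G w)) < e / 2"
      using d(2) w' by (simp add: d'_def)
    have "\<bar>t' - t\<bar> \<le> e / (2 * (B + 1))" using \<open>dist t' t < d'\<close> by (simp add: d'_def dist_real_def)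
    hence "B * \<bar>t' - t\<bar> \<le> B * (e / (2 * (B + 1)))" using B by (rule mult_left_mono)
    also have "\<dots> < e / 2" using B e by (simp add: field_simps)
    finally have "dist (integral {a..t'} (G w')) (integral {a..t} (G w')) < e / 2"
      using lip[of w' t'] w' by (simp add: dist_norm)
    thus "dist (integral {a..t'} (G w')) (integral {a..t} (G w)) < e"
      using 1 dist_triangle_half_l dist_commute by (metis (no_types, lifting))
  qed
  qed
  show ?thesis unfolding continuous_on_iff
  proof (intro ballI allI impI)
    fix x and e :: real assume x: "x \<in> S \<times> {a..b}" and e: "0 < e"
    obtain w t where wt: "x = (w, t)" "w \<in> S" "a \<le> t" "t \<le> b" using x by auto
    obtain d where "d > 0" "\<forall>x\<in>S. \<forall>s. a \<le> s \<and> s \<le> b \<longrightarrow> dist (x, s) (w, t) < d \<longrightarrow>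
      dist (integral {a..s} (G x)) (integral {a..t} (G w)) < e"
      using main[OF wt(2-4) e] by blast
    thus "\<exists>d>0. \<forall>x'\<in>S \<times> {a..b}. dist x' x < d \<longrightarrow>
      dist (case x' of (w, t) \<Rightarrow> integral {a..t} (G w)) (case x of (w, t) \<Rightarrow> integral {a..t} (G w)) < e"
      using wt(1) by (intro exI[of _ d]) auto
  qed
qed

text \<open>The setting of a Picard iteration for \<open>dw/dt = \<kappa> R w t\<close> with a parameter \<open>\<kappa>\<close> so small that a solution moves by at
most \<open>d\<close> over the whole interval and that the iteration contracts. Initial values range over \<open>V'\<close>, values over \<open>V\<close>.\<close>

locale picard =
  fixes R :: "complex \<Rightarrow> real \<Rightarrow> complex" and V V' :: "complex set" and a b B L d \<kappa> :: real
  assumes opn: "open V" "open V'" and ab: "a \<le> b"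
    and cont: "continuous_on (V \<times> {a..b}) (\<lambda>(w, t). R w t)"
    and hol: "\<And>t. t \<in> {a..b} \<Longrightarrow> (\<lambda>w. R w t) holomorphic_on V"
    and bound: "\<And>w t. w \<in> V \<Longrightarrow> t \<in> {a..b} \<Longrightarrow> cmod (R w t) \<le> B"
    and lip: "\<And>w w' t. w \<in> V \<Longrightarrow> w' \<in> V \<Longrightarrow> t \<in> {a..b} \<Longrightarrow> cmod (R w t - R w' t) \<le> L * cmod (w - w')"
    and margin: "\<And>w. w \<in> V' \<Longrightarrow> cball w d \<subseteq> V" and dpos: "d > 0"
    and small: "\<bar>\<kappa>\<bar> * B * (b - a) \<le> d" "\<bar>\<kappa>\<bar> * L * (b - a) \<le> 1 / 2"
    and nonneg: "B \<ge> 0" "L \<ge> 0"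
begin

primrec iter :: "nat \<Rightarrow> complex \<Rightarrow> real \<Rightarrow> complex" where
  "iter 0 w t = w"
| "iter (Suc k) w t = w + of_real \<kappa> * integral {a..t} (\<lambda>s. R (iter k w s) s)"

lemma integral_R_bound:
  assumes "a \<le> t" "t \<le> b" "\<And>s. s \<in> {a..t} \<Longrightarrow> u s \<in> V" "continuous_on {a..t} u"
  shows "(\<lambda>s. R (u s) s) integrable_on {a..t}"
    and "cmod (of_real \<kappa> * integral {a..t} (\<lambda>s. R (u s) s)) \<le> \<bar>\<kappa>\<bar> * B * (b - a)"
proof -
  show int: "(\<lambda>s. R (u s) s) integrable_on {a..t}"
    by (rule integrable_continuous_real, rule continuous_on_compose2[OF cont, of _ "\<lambda>s. (u s, s)", simplified])
       (use assms in \<open>auto intro!: continuous_intros\<close>)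
  have "cmod (integral {a..t} (\<lambda>s. R (u s) s)) \<le> B * (t - a)"
    by (rule norm_integral_le) (use nonneg(1) int bound assms in auto)
  also have "\<dots> \<le> B * (b - a)" using assms nonneg by (auto intro!: mult_left_mono)
  finally show "cmod (of_real \<kappa> * integral {a..t} (\<lambda>s. R (u s) s)) \<le> \<bar>\<kappa>\<bar> * B * (b - a)"
    by (simp add: norm_mult mult.assoc mult_left_mono)
qed

lemma iter_props:
  "(\<forall>w\<in>V'. \<forall>t\<in>{a..b}. iter k w t \<in> cball w d) \<and>
   continuous_on (V' \<times> {a..b}) (\<lambda>(w, t). iter k w t) \<and>
   (\<forall>t\<in>{a..b}. (\<lambda>w. iter k w t) holomorphic_on V')"
proof (induction k)
  case 0
  show ?case using dpos by (auto simp: split_beta intro!: continuous_intros holomorphic_intros)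
next
  case (Suc k)
  have inV: "iter k w t \<in> V" if "w \<in> V'" "t \<in> {a..b}" for w t
    using Suc margin that by blast
  have c: "continuous_on (V' \<times> {a..b}) (\<lambda>(w, t). R (iter k w t) t)"
    unfolding split_beta
    by (rule continuous_on_compose2[OF cont, of _ "\<lambda>x. (iter k (fst x) (snd x), snd x)", simplified])
       (use Suc inV in \<open>auto intro!: continuous_intros simp: split_beta\<close>)
  have ct: "continuous_on {a..t} (iter k w)" if "w \<in> V'" "t \<in> {a..b}" for w t
    by (rule continuous_on_compose2[of "V' \<times> {a..b}" "\<lambda>(w, t). iter k w t" _ "\<lambda>s. (w, s)", simplified])
       (use Suc that in \<open>auto intro!: continuous_intros\<close>)
  have "continuous_on (V' \<times> {a..b}) (\<lambda>(w, t). integral {a..t} (\<lambda>s. R (iter k w s) s))"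
    by (rule continuous_on_integral_upto[where B = B]) (use c bound inV in auto)
  hence c2: "continuous_on (V' \<times> {a..b}) (\<lambda>(w, t). iter (Suc k) w t)"
    by (auto simp: split_beta intro!: continuous_intros)
  have "iter (Suc k) w t \<in> cball w d" if "w \<in> V'" "t \<in> {a..b}" for w t
    using integral_R_bound(2)[of t "iter k w"] small(1) that ct inV by (auto simp: dist_norm)
  moreover have "(\<lambda>w. iter (Suc k) w t) holomorphic_on V'" if t: "t \<in> {a..b}" for t
  proof -
    have "(\<lambda>w. integral {a..t} (\<lambda>s. R (iter k w s) s)) holomorphic_on V'"
    proof (rule holomorphic_on_integral_param[OF opn(2)])
      show "continuous_on (V' \<times> {a..t}) (\<lambda>(w, s). R (iter k w s) s)"
        by (rule continuous_on_subset[OF c]) (use t in auto)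
      show "(\<lambda>w. R (iter k w s) s) holomorphic_on V'" if "s \<in> {a..t}" for s
      proof -
        have "(\<lambda>w. iter k w s) holomorphic_on V'" "s \<in> {a..b}" using Suc t that by auto
        from holomorphic_on_compose_gen[OF this(1) hol[OF this(2)]] inV this(2)
        show ?thesis by (auto simp: o_def)
      qed
    qed
    thus ?thesis by (auto intro!: holomorphic_intros)
  qed
  ultimately show ?case using c2 by blast
qed

lemma iter_in_V: "w \<in> V' \<Longrightarrow> t \<in> {a..b} \<Longrightarrow> iter k w t \<in> V"
  using iter_props margin by blast

lemma iter_cont: "w \<in> V' \<Longrightarrow> t \<in> {a..b} \<Longrightarrow> continuous_on {a..t} (iter k w)"
  by (rule continuous_on_compose2[of "V' \<times> {a..b}" "\<lambda>(w, t). iter k w t" _ "\<lambda>s. (w, s)", simplified])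
     (use iter_props in \<open>auto intro!: continuous_intros\<close>)

lemma contraction:
  assumes "t \<in> {a..b}" "\<And>s. s \<in> {a..t} \<Longrightarrow> u s \<in> V" "continuous_on {a..t} u"
    "\<And>s. s \<in> {a..t} \<Longrightarrow> v s \<in> V" "continuous_on {a..t} v"
    "\<And>s. s \<in> {a..t} \<Longrightarrow> cmod (u s - v s) \<le> m"
  shows "cmod (of_real \<kappa> * integral {a..t} (\<lambda>s. R (u s) s) - of_real \<kappa> * integral {a..t} (\<lambda>s. R (v s) s)) \<le> m / 2"
proof -
  have m: "m \<ge> 0" using order_trans[OF norm_ge_zero assms(6)[of a]] assms(1) by auto
  have iu: "(\<lambda>s. R (u s) s) integrable_on {a..t}" "(\<lambda>s. R (v s) s) integrable_on {a..t}"
    using integral_R_bound(1) assms by auto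
  have "cmod (integral {a..t} (\<lambda>s. R (u s) s - R (v s) s)) \<le> (L * m) * (t - a)"
  proof (rule norm_integral_le)
    show "(\<lambda>s. R (u s) s - R (v s) s) integrable_on {a..t}"
      using integrable_diff[OF iu] by simp
    fix s assume s: "s \<in> {a..t}"
    have "cmod (R (u s) s - R (v s) s) \<le> L * cmod (u s - v s)"
      using lip assms s by auto
    also have "\<dots> \<le> L * m" using assms(6) s nonneg by (auto intro: mult_left_mono)
    finally show "cmod (R (u s) s - R (v s) s) \<le> L * m" .
  qed (use nonneg m assms(1) in auto)
  also have "\<dots> \<le> (L * m) * (b - a)" using assms(1) nonneg m by (auto intro!: mult_left_mono)
  finally have "\<bar>\<kappa>\<bar> * cmod (integral {a..t} (\<lambda>s. R (u s) s) - integral {a..t} (\<lambda>s. R (v s) s)) \<le> \<bar>\<kappa>\<bar> * (L * m * (b - a))"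
    using Henstock_Kurzweil_Integration.integral_diff[OF iu] by (auto intro: mult_left_mono)
  also have "\<dots> = (\<bar>\<kappa>\<bar> * L * (b - a)) * m" by simp
  also have "\<dots> \<le> 1 / 2 * m" using small(2) m by (rule mult_right_mono)
  finally show ?thesis by (simp add: norm_mult flip: right_diff_distrib)
qed

text \<open>The contraction constant is \<open>1/2\<close>, so that consecutive iterates differ by a geometric sequence, uniformly in the
initial value.\<close>

lemma iter_diff:
  "w \<in> V' \<Longrightarrow> t \<in> {a..b} \<Longrightarrow> cmod (iter (Suc k) w t - iter k w t) \<le> d * (1/2) ^ k"
proof (induction k arbitrary: t)
  case 0
  thus ?case using iter_props[of "Suc 0"] by (auto simp: dist_norm norm_minus_commute)
next
  case (Suc k)
  have "cmod (of_real \<kappa> * integral {a..t} (\<lambda>s. R (iter (Suc k) w s) s) - of_real \<kappa> * integral {a..t} (\<lambda>s. R (iter k w s) s))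
        \<le> (d * (1/2) ^ k) / 2"
    by (rule contraction) (use Suc iter_in_V iter_cont in \<open>auto simp del: iter.simps\<close>)
  thus ?case by simp
qed

definition flow :: "complex \<Rightarrow> real \<Rightarrow> complex" where
  "flow w t = w + (\<Sum>k. iter (Suc k) w t - iter k w t)"

lemma iter_uniform_limit:
  "uniform_limit (V' \<times> {a..b}) (\<lambda>k (w, t). iter k w t) (\<lambda>(w, t). flow w t) sequentially"
proof -
  have "uniform_limit (V' \<times> {a..b}) (\<lambda>n x. \<Sum>k<n. iter (Suc k) (fst x) (snd x) - iter k (fst x) (snd x))
     (\<lambda>x. \<Sum>k. iter (Suc k) (fst x) (snd x) - iter k (fst x) (snd x)) sequentially"
    by (rule Weierstrass_m_test[where M = "\<lambda>k. d * (1/2) ^ k"])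
       (use iter_diff in \<open>auto simp del: iter.simps intro!: summable_mult\<close>)
  moreover have "(\<Sum>k<n. iter (Suc k) w t - iter k w t) = iter n w t - w" for n w t
    by (subst sum_lessThan_telescope) simp
  ultimately show ?thesis
    by (simp add: uniform_limit_iff dist_norm flow_def split_beta algebra_simps del: iter.simps)
qed

text \<open>The limit of the iterates solves the integral equation because they converge uniformly.\<close>

lemma flow_props:
  assumes w: "w \<in> V'"
  shows "continuous_on {a..b} (flow w)"
    and "\<And>t. t \<in> {a..b} \<Longrightarrow> flow w t \<in> cball w d"
    and "\<And>t. t \<in> {a..b} \<Longrightarrow> flow w t = w + of_real \<kappa> * integral {a..t} (\<lambda>s. R (flow w s) s)"
proof -
  have "continuous_on (V' \<times> {a..b}) (\<lambda>(w, t). flow w t)"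
    by (rule uniform_limit_theorem[OF _ iter_uniform_limit]) (use iter_props in auto)
  thus c: "continuous_on {a..b} (flow w)"
    by (rule continuous_on_compose2[of "V' \<times> {a..b}" "\<lambda>(w, t). flow w t" _ "\<lambda>s. (w, s)", simplified])
       (use w in \<open>auto intro!: continuous_intros\<close>)
  have lim: "(\<lambda>k. iter k w t) \<longlonglongrightarrow> flow w t" if "t \<in> {a..b}" for t
    using tendsto_uniform_limitI[OF iter_uniform_limit, of "(w, t)"] that w by simp
  show cb: "flow w t \<in> cball w d" if "t \<in> {a..b}" for t
    by (rule Lim_in_closed_set[OF closed_cball _ _ lim[OF that]]) (use iter_props w that in auto)
  show "flow w t = w + of_real \<kappa> * integral {a..t} (\<lambda>s. R (flow w s) s)" if t: "t \<in> {a..b}" for t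
  proof -
    have "(\<lambda>k. iter (Suc k) w t) \<longlonglongrightarrow> w + of_real \<kappa> * integral {a..t} (\<lambda>s. R (flow w s) s)"
    proof (rule LIMSEQ_I)
      fix e :: real assume e: "e > 0"
      obtain N where N: "\<And>n s. n \<ge> N \<Longrightarrow> s \<in> {a..b} \<Longrightarrow> dist (iter n w s) (flow w s) < e"
        using iter_uniform_limit e w unfolding uniform_limit_iff eventually_sequentially by fastforce
      have "norm (iter (Suc n) w t - (w + of_real \<kappa> * integral {a..t} (\<lambda>s. R (flow w s) s))) < e" if "n \<ge> N" for n
      proof -
        have "cmod (of_real \<kappa> * integral {a..t} (\<lambda>s. R (iter n w s) s) - of_real \<kappa> * integral {a..t} (\<lambda>s. R (flow w s) s)) \<le> e / 2"
        proof (rule contraction[OF t])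
          show "flow w s \<in> V" if "s \<in> {a..t}" for s using cb margin[OF w] that t by auto
          show "continuous_on {a..t} (flow w)" using c t by (auto intro: continuous_on_subset)
          show "cmod (iter n w s - flow w s) \<le> e" if "s \<in> {a..t}" for s
            using N[OF \<open>n \<ge> N\<close>, of s] that t by (auto simp: dist_norm)
        qed (use iter_in_V iter_cont w t in auto)
        thus ?thesis using e by (simp add: algebra_simps)
      qed
      thus "\<exists>N. \<forall>n\<ge>N. norm (iter (Suc n) w t - (w + of_real \<kappa> * integral {a..t} (\<lambda>s. R (flow w s) s))) < e"
        by blast
    qed
    thus ?thesis using LIMSEQ_unique LIMSEQ_Suc[OF lim[OF t]] by blast
  qed
qed

text \<open>A uniform limit of holomorphic iterates.\<close>

lemma flow_holomorphic: "t \<in> {a..b} \<Longrightarrow> (\<lambda>w. flow w t) holomorphic_on V'"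
proof (rule holomorphic_uniform_sequence[OF opn(2)])
  assume t: "t \<in> {a..b}"
  show "(\<lambda>w. iter n w t) holomorphic_on V'" for n using iter_props t by blast
  fix x assume x: "x \<in> V'"
  then obtain r where r: "r > 0" "cball x r \<subseteq> V'" using opn(2) open_contains_cball by blast
  have "uniform_limit (cball x r) (\<lambda>n w. iter n w t) (\<lambda>w. flow w t) sequentially"
    using iter_uniform_limit r t unfolding uniform_limit_iff by (fastforce elim!: eventually_mono)
  thus "\<exists>r>0. cball x r \<subseteq> V' \<and> uniform_limit (cball x r) (\<lambda>n w. iter n w t) (\<lambda>w. flow w t) sequentially"
    using r by blast
qed

text \<open>Real initial values stay real because each iterate does.\<close>

lemma flow_real:
  assumes R: "\<And>w t. w \<in> V \<Longrightarrow> w \<in> \<real> \<Longrightarrow> t \<in> {a..b} \<Longrightarrow> R w t \<in> \<real>"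
    and w: "w \<in> V'" "w \<in> \<real>" and t: "t \<in> {a..b}"
  shows "flow w t \<in> \<real>"
proof -
  have "iter k w t \<in> \<real>" if "t \<in> {a..b}" for k t
    using that
  proof (induction k arbitrary: t)
    case (Suc k)
    have int: "(\<lambda>s. R (iter k w s) s) integrable_on {a..t}"
      using integral_R_bound(1) Suc w iter_in_V iter_cont by auto
    have "Im (integral {a..t} (\<lambda>s. R (iter k w s) s)) = integral {a..t} (\<lambda>s. Im (R (iter k w s) s))"
      using integral_linear[OF int bounded_linear_Im] by (simp add: o_def)
    also have "\<dots> = integral {a..t} (\<lambda>s. 0)"
      by (rule Henstock_Kurzweil_Integration.integral_cong)
         (use R iter_in_V w Suc in \<open>auto simp: complex_is_Real_iff\<close>)
    finally have "integral {a..t} (\<lambda>s. R (iter k w s) s) \<in> \<real>" by (simp add: complex_is_Real_iff)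
    thus ?case using w by auto
  qed (use w in auto)
  moreover have "(\<lambda>k. iter k w t) \<longlonglongrightarrow> flow w t"
    using tendsto_uniform_limitI[OF iter_uniform_limit, of "(w, t)"] t w by simp
  ultimately show ?thesis
    using t by (intro Lim_in_closed_set[OF closed_complex_Reals]) auto
qed

end

section \<open>Coordinates adapted to the unperturbed orbits\<close>

text \<open>The functions \<open>xc\<close> and \<open>yc\<close> parametrize the closed unperturbed orbit through \<open>(0, w\<^sup>2 + e)\<close> clockwise from its top point
\<open>t = 0\<close>; \<open>xw, xt, yw, yt\<close> are the partial derivatives. They are defined over real and complex \<open>w\<close> alike, the latter
being needed for holomorphic dependence on the section coordinate \<open>w\<close>.\<close>

definition xc :: "real \<Rightarrow> 'a::real_normed_field \<Rightarrow> real \<Rightarrow> 'a" where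
  "xc e w t = (w\<^sup>2 - of_real e) / (2 * w) * of_real (sin t)"

definition yc :: "real \<Rightarrow> 'a::real_normed_field \<Rightarrow> real \<Rightarrow> 'a" where
  "yc e w t = (w\<^sup>2 + of_real e) * (w\<^sup>2 + of_real e + (w\<^sup>2 - of_real e) * of_real (cos t)) / (2 * w\<^sup>2)"

definition xw :: "real \<Rightarrow> 'a::real_normed_field \<Rightarrow> real \<Rightarrow> 'a" where
  "xw e w t = (w\<^sup>2 + of_real e) / (2 * w\<^sup>2) * of_real (sin t)"

definition xt :: "real \<Rightarrow> 'a::real_normed_field \<Rightarrow> real \<Rightarrow> 'a" where
  "xt e w t = (w\<^sup>2 - of_real e) / (2 * w) * of_real (cos t)"

definition yw :: "real \<Rightarrow> 'a::real_normed_field \<Rightarrow> real \<Rightarrow> 'a" where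
  "yw e w t = (w ^ 4 - of_real e ^ 2 + (w ^ 4 + of_real e ^ 2) * of_real (cos t)) / w ^ 3"

definition yt :: "real \<Rightarrow> 'a::real_normed_field \<Rightarrow> real \<Rightarrow> 'a" where
  "yt e w t = - ((w\<^sup>2 + of_real e) * (w\<^sup>2 - of_real e) / (2 * w\<^sup>2) * of_real (sin t))"

text \<open>The Jacobian determinant of \<open>(xc, yc)\<close>, see \<open>jacobian_eq\<close>; it does not vanish for \<open>w > sqrt e\<close>.\<close>

definition jac :: "real \<Rightarrow> 'a::real_normed_field \<Rightarrow> real \<Rightarrow> 'a" where
  "jac e w t = - ((yc e w t)\<^sup>2 * (w\<^sup>2 - of_real e) / (w\<^sup>2 + of_real e)\<^sup>2)"

lemma jacobian_eq:
  fixes w :: "'a::real_normed_field"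
  assumes "w \<noteq> 0" "w\<^sup>2 + of_real e \<noteq> 0"
  shows "xw e w t * yt e w t - xt e w t * yw e w t = jac e w t"
proof -
  define S C :: 'a where "S = of_real (sin t)" and "C = of_real (cos t)"
  define c :: 'a where "c = of_real e"
  have "S ^ 2 = 1 - C ^ 2"
    by (simp add: S_def C_def sin_squared_eq flip: of_real_power)
  moreover have "xw e w t * yt e w t - xt e w t * yw e w t
     = - ((w\<^sup>2 - c) / (4 * w ^ 4) * ((w\<^sup>2 + c)\<^sup>2 * S ^ 2 + 2 * C * (w ^ 4 - c ^ 2 + (w ^ 4 + c ^ 2) * C)))"
    unfolding xw_def yt_def xt_def yw_def S_def[symmetric] C_def[symmetric] c_def[symmetric]
    using assms by (simp add: field_simps power2_eq_square power4_eq_xxxx power3_eq_cube)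
  ultimately have "xw e w t * yt e w t - xt e w t * yw e w t
     = - ((w\<^sup>2 - c) / (4 * w ^ 4) * ((w\<^sup>2 + c)\<^sup>2 * (1 - C ^ 2) + 2 * C * (w ^ 4 - c ^ 2 + (w ^ 4 + c ^ 2) * C)))"
    by simp
  also have "(w\<^sup>2 + c)\<^sup>2 * (1 - C ^ 2) + 2 * C * (w ^ 4 - c ^ 2 + (w ^ 4 + c ^ 2) * C)
     = (w\<^sup>2 + c + (w\<^sup>2 - c) * C)\<^sup>2"
    by algebra
  also have "- ((w\<^sup>2 - c) / (4 * w ^ 4) * (w\<^sup>2 + c + (w\<^sup>2 - c) * C)\<^sup>2) = jac e w t"
    unfolding jac_def yc_def S_def[symmetric] C_def[symmetric] c_def[symmetric]
    using assms unfolding c_def[symmetric]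
    by (simp add: power_divide power_mult_distrib)
  finally show ?thesis .
qed

lemma of_real_coords [simp]:
  "xc e (of_real w :: complex) t = of_real (xc e w t)" "yc e (of_real w :: complex) t = of_real (yc e w t)"
  "xw e (of_real w :: complex) t = of_real (xw e w t)" "yw e (of_real w :: complex) t = of_real (yw e w t)"
  "xt e (of_real w :: complex) t = of_real (xt e w t)" "yt e (of_real w :: complex) t = of_real (yt e w t)"
  "jac e (of_real w :: complex) t = of_real (jac e w t)"
  by (simp_all add: xc_def yc_def xw_def yw_def xt_def yt_def jac_def)

definition pev :: "nat \<Rightarrow> (nat \<Rightarrow> nat \<Rightarrow> real) \<Rightarrow> 'a::real_normed_field \<Rightarrow> 'a \<Rightarrow> 'a" where
  "pev n a x y = (\<Sum>i\<le>n. \<Sum>j\<le>n - i. of_real (a i j) * x ^ i * y ^ j)"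

lemma pev_of_real [simp]: "pev n a (of_real x :: complex) (of_real y) = of_real (pev n a x y)"
  by (simp add: pev_def)

text \<open>In the coordinates \<open>(w, t)\<close> the perturbed field reads \<open>w' = eps zeta\<close>, \<open>t' = omega + eps Theta\<close>, by Cramer's rule.
Hence \<open>dw/dt = eps slope\<close>.\<close>

definition zeta :: "real \<Rightarrow> nat \<Rightarrow> (nat \<Rightarrow> nat \<Rightarrow> real) \<Rightarrow> (nat \<Rightarrow> nat \<Rightarrow> real) \<Rightarrow> 'a::real_normed_field \<Rightarrow> real \<Rightarrow> 'a" where
  "zeta e n a b w t = (pev n a (xc e w t) (yc e w t) * yt e w t - pev n b (xc e w t) (yc e w t) * xt e w t) / jac e w t"

definition Theta :: "real \<Rightarrow> nat \<Rightarrow> (nat \<Rightarrow> nat \<Rightarrow> real) \<Rightarrow> (nat \<Rightarrow> nat \<Rightarrow> real) \<Rightarrow> 'a::real_normed_field \<Rightarrow> real \<Rightarrow> 'a" where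
  "Theta e n a b w t = (xw e w t * pev n b (xc e w t) (yc e w t) - yw e w t * pev n a (xc e w t) (yc e w t)) / jac e w t"

definition omega :: "real \<Rightarrow> 'a::real_normed_field \<Rightarrow> real \<Rightarrow> 'a" where
  "omega e w t = 2 * (w / (w\<^sup>2 + of_real e)) * yc e w t"

definition speed :: "real \<Rightarrow> nat \<Rightarrow> (nat \<Rightarrow> nat \<Rightarrow> real) \<Rightarrow> (nat \<Rightarrow> nat \<Rightarrow> real) \<Rightarrow> real \<Rightarrow> 'a::real_normed_field \<Rightarrow> real \<Rightarrow> 'a" where
  "speed e n a b eps w t = omega e w t + of_real eps * Theta e n a b w t"

definition slope :: "real \<Rightarrow> nat \<Rightarrow> (nat \<Rightarrow> nat \<Rightarrow> real) \<Rightarrow> (nat \<Rightarrow> nat \<Rightarrow> real) \<Rightarrow> real \<Rightarrow> 'a::real_normed_field \<Rightarrow> real \<Rightarrow> 'a" where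
  "slope e n a b eps w t = zeta e n a b w t / speed e n a b eps w t"

lemma of_real_slope [simp]:
  "zeta e n a b (of_real w :: complex) t = of_real (zeta e n a b w t)"
  "Theta e n a b (of_real w :: complex) t = of_real (Theta e n a b w t)"
  "omega e (of_real w :: complex) t = of_real (omega e w t)"
  "speed e n a b eps (of_real w :: complex) t = of_real (speed e n a b eps w t)"
  "slope e n a b eps (of_real w :: complex) t = of_real (slope e n a b eps w t)"
  by (simp_all add: zeta_def Theta_def omega_def speed_def slope_def)

text \<open>These are the denominators of the coordinate formulas. On \<open>Re w > sqrt e\<close> the square \<open>w\<^sup>2\<close> avoids the nonpositive
real axis, which excludes their zeros.\<close>

lemma right_half_plane_nonzero:
  fixes w :: complex
  assumes "e > 0" "Re w > sqrt e"
  shows "w \<noteq> 0" "w\<^sup>2 + of_real e \<noteq> 0" "w\<^sup>2 - of_real e \<noteq> 0" "yc e w t \<noteq> 0"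
proof -
  have re: "Re w > 0" using assms real_sqrt_gt_zero[OF assms(1)] by linarith
  have sq: "w\<^sup>2 \<noteq> of_real r" if "r \<le> 0" for r
  proof
    assume "w\<^sup>2 = of_real r"
    hence "Re (w\<^sup>2) = r" "Im (w\<^sup>2) = 0" by simp_all
    hence "Im w = 0" "(Re w)\<^sup>2 = r" using re by (auto simp: power2_eq_square)
    thus False using re that by (metis not_le zero_less_power)
  qed
  show "w \<noteq> 0" using re by auto
  show ne: "w\<^sup>2 + of_real e \<noteq> 0" using sq[of "-e"] assms by (auto simp: add_eq_0_iff2)
  show "w\<^sup>2 - of_real e \<noteq> 0"
  proof
    assume "w\<^sup>2 - of_real e = 0"
    hence "w\<^sup>2 = (of_real (sqrt e))\<^sup>2" using assms by (simp flip: of_real_power)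
    hence "w = of_real (sqrt e) \<or> w = - of_real (sqrt e)" by (simp add: power2_eq_iff)
    thus False using assms re by auto
  qed
  show "yc e w t \<noteq> 0"
  proof
    assume "yc e w t = 0"
    hence *: "w\<^sup>2 + of_real e + (w\<^sup>2 - of_real e) * of_real (cos t) = 0"
      using ne \<open>w \<noteq> 0\<close> by (auto simp: yc_def)
    hence **: "w\<^sup>2 * of_real (1 + cos t) = of_real (- e * (1 - cos t))" by (simp add: algebra_simps)
    show False
    proof (cases "1 + cos t = 0")
      case True
      thus ?thesis using ** assms by (simp add: add_eq_0_iff)
    next
      case False
      hence "w\<^sup>2 = of_real (- e * (1 - cos t) / (1 + cos t))"
        using ** by (simp add: field_simps flip: of_real_add of_real_diff of_real_mult)
      moreover have "0 \<le> 1 + cos t" using cos_ge_minus_one[of t] by linarith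
      hence "- e * (1 - cos t) / (1 + cos t) \<le> 0"
        using assms(1) by (intro divide_nonpos_nonneg) auto
      ultimately show False using sq by blast
    qed
  qed
qed

lemma jac_nonzero: "e > 0 \<Longrightarrow> Re w > sqrt e \<Longrightarrow> jac e w t \<noteq> 0"
  using right_half_plane_nonzero[of e w] by (simp add: jac_def)

lemma yc_pos:
  fixes w :: real assumes "e > 0" "w > 0"
  shows "yc e w t > 0"
proof -
  have "w\<^sup>2 * (1 + cos t) + e * (1 - cos t) > 0"
  proof (cases "cos t = 1")
    case False
    hence "1 - cos t > 0" using cos_le_one[of t] by linarith
    moreover have "w\<^sup>2 * (1 + cos t) \<ge> 0" using cos_ge_minus_one[of t] by (intro mult_nonneg_nonneg) (auto simp del: cos_ge_minus_one)
    ultimately show ?thesis using assms by (simp add: add_nonneg_pos)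
  qed (use assms in auto)
  hence "w\<^sup>2 + e + (w\<^sup>2 - e) * cos t > 0" by (simp add: algebra_simps)
  thus ?thesis unfolding yc_def using assms by (auto intro!: divide_pos_pos mult_pos_pos add_pos_pos)
qed

lemma omega_pos: "e > 0 \<Longrightarrow> w > 0 \<Longrightarrow> omega e (w::real) t > 0"
  using yc_pos[of e w t] by (simp add: omega_def add_pos_pos)

lemma coords_continuous:
  fixes S :: "(complex \<times> real) set"
  assumes "e > 0" and S: "\<And>x. x \<in> S \<Longrightarrow> Re (W x) > sqrt e"
    and c: "continuous_on S W" "continuous_on S T"
  shows "continuous_on S (\<lambda>x. zeta e n a b (W x) (T x))" "continuous_on S (\<lambda>x. Theta e n a b (W x) (T x))"
    "continuous_on S (\<lambda>x. omega e (W x) (T x))"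
proof -
  note nz = right_half_plane_nonzero[OF assms(1) S] jac_nonzero[OF assms(1) S]
  have x: "continuous_on S (\<lambda>x. xc e (W x) (T x))" and y: "continuous_on S (\<lambda>x. yc e (W x) (T x))"
    unfolding xc_def yc_def using nz c by (auto intro!: continuous_intros)
  have p: "continuous_on S (\<lambda>x. pev n a (xc e (W x) (T x)) (yc e (W x) (T x)))" for a
    unfolding pev_def by (intro continuous_intros x y)
  have j: "continuous_on S (\<lambda>x. jac e (W x) (T x))"
    unfolding jac_def using nz c y by (auto intro!: continuous_intros)
  have d: "continuous_on S (\<lambda>x. xw e (W x) (T x))" "continuous_on S (\<lambda>x. yw e (W x) (T x))"
    "continuous_on S (\<lambda>x. xt e (W x) (T x))" "continuous_on S (\<lambda>x. yt e (W x) (T x))"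
    unfolding xw_def yw_def xt_def yt_def using nz c by (auto intro!: continuous_intros)
  show "continuous_on S (\<lambda>x. zeta e n a b (W x) (T x))" "continuous_on S (\<lambda>x. Theta e n a b (W x) (T x))"
    unfolding zeta_def Theta_def by (intro continuous_intros p j d; use nz in blast)+
  show "continuous_on S (\<lambda>x. omega e (W x) (T x))"
    unfolding omega_def using nz c y by (auto intro!: continuous_intros)
qed

lemma coords_holomorphic:
  assumes "e > 0" and S: "\<And>x. x \<in> S \<Longrightarrow> Re x > sqrt e"
  shows "(\<lambda>w. zeta e n a b w t) holomorphic_on S" "(\<lambda>w. Theta e n a b w t) holomorphic_on S"
    "(\<lambda>w. omega e w t) holomorphic_on S"
proof -
  note nz = right_half_plane_nonzero[OF assms(1) S] jac_nonzero[OF assms(1) S]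
  have x: "(\<lambda>x. xc e x t) holomorphic_on S" and y: "(\<lambda>x. yc e x t) holomorphic_on S"
    unfolding xc_def yc_def using nz by (auto intro!: holomorphic_intros)
  have p: "(\<lambda>x. pev n a (xc e x t) (yc e x t)) holomorphic_on S" for a
    unfolding pev_def by (intro holomorphic_intros x y)
  have j: "(\<lambda>x. jac e x t) holomorphic_on S"
    unfolding jac_def using nz y by (auto intro!: holomorphic_intros)
  have d: "(\<lambda>x. xw e x t) holomorphic_on S" "(\<lambda>x. yw e x t) holomorphic_on S"
    "(\<lambda>x. xt e x t) holomorphic_on S" "(\<lambda>x. yt e x t) holomorphic_on S"
    unfolding xw_def yw_def xt_def yt_def using nz by (auto intro!: holomorphic_intros)
  show "(\<lambda>x. zeta e n a b x t) holomorphic_on S" "(\<lambda>x. Theta e n a b x t) holomorphic_on S"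
    unfolding zeta_def Theta_def by (intro holomorphic_intros p j d; use nz in blast)+
  show "(\<lambda>x. omega e x t) holomorphic_on S"
    unfolding omega_def using nz y by (auto intro!: holomorphic_intros)
qed

text \<open>Cauchy's estimate bounds the derivative by \<open>M / d\<close>; convexity of the domain turns this into a Lipschitz bound.\<close>

lemma bounded_holomorphic_lipschitz:
  assumes "open V" "f holomorphic_on V" "\<And>w. w \<in> V \<Longrightarrow> cmod (f w) \<le> B"
    "convex U" "\<And>w. w \<in> U \<Longrightarrow> cball w d \<subseteq> V" "d > 0" "w \<in> U" "w' \<in> U"
  shows "cmod (f w - f w') \<le> B / d * cmod (w - w')"
proof (rule field_differentiable_bound[OF assms(4) _ _ assms(7,8)])
  fix z assume z: "z \<in> U"
  have zV: "z \<in> V" using assms(5)[OF z] assms(6) by auto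
  show "(f has_field_derivative deriv f z) (at z within U)"
    using holomorphic_derivI[OF assms(2,1) zV] by (rule has_field_derivative_at_within)
  have "cmod ((deriv ^^ 1) f z) \<le> fact 1 * B / d ^ 1"
  proof (rule Cauchy_inequality)
    show "f holomorphic_on ball z d"
      using assms(2,5) z by (meson ball_subset_cball holomorphic_on_subset)
    show "continuous_on (cball z d) f"
      using assms(2,5) z by (meson holomorphic_on_imp_continuous_on continuous_on_subset)
    show "cmod (f x) \<le> B" if "cmod (z - x) = d" for x
    proof (rule assms(3))
      have "x \<in> cball z d" using that by (simp add: dist_norm)
      thus "x \<in> V" using assms(5)[OF z] by blast
    qed
  qed (use assms in auto)
  thus "cmod (deriv f z) \<le> B / d" by simp
qed

text \<open>A box in the complex plane that contains the interval \<open>{A..B}\<close> with margin \<open>r\<close>. Several margins are used at once, as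
each estimate costs a part of the margin.\<close>

definition cbx :: "real \<Rightarrow> real \<Rightarrow> real \<Rightarrow> complex set" where
  "cbx A B r = box (Complex (A - r) (- r)) (Complex (B + r) r)"

lemma cbx_iff: "w \<in> cbx A B r \<longleftrightarrow> A - r < Re w \<and> Re w < B + r \<and> \<bar>Im w\<bar> < r"
  by (auto simp: cbx_def in_box_complex_iff)

lemma cbx_open_convex: "open (cbx A B r)" "convex (cbx A B r)"
  by (simp_all add: cbx_def open_box convex_box)

lemma cbx_margin:
  assumes "w \<in> cbx A B r" "r + d \<le> r'"
  shows "cball w d \<subseteq> cbx A B r'"
proof
  fix z assume "z \<in> cball w d"
  hence "\<bar>Re w - Re z\<bar> \<le> d" "\<bar>Im w - Im z\<bar> \<le> d"
    using abs_Re_le_cmod[of "w - z"] abs_Im_le_cmod[of "w - z"] by (auto simp: dist_norm)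
  thus "z \<in> cbx A B r'" using assms by (auto simp: cbx_iff)
qed

lemma cbx_mono: "r \<le> r' \<Longrightarrow> cbx A B r \<subseteq> cbx A B r'"
  by (auto simp: cbx_iff)

text \<open>For \<open>eps = 0\<close> the speed \<open>omega\<close> is continuous without zeros on a compact set, so that it stays away from \<open>0\<close> also for
small \<open>eps\<close>. All bounds are uniform in \<open>eps\<close>, \<open>w\<close>, \<open>t\<close>.\<close>

lemma slope_bounds:
  assumes e: "e > 0" and r: "sqrt e < A - r"
  shows "\<exists>eps1 m M. eps1 > 0 \<and> m > 0 \<and> M > 0 \<and> (\<forall>eps w t. \<bar>eps\<bar> \<le> eps1 \<and> w \<in> cbx A B r \<and> 0 \<le> t \<and> t \<le> 2 * pi \<longrightarrow>
     m \<le> cmod (speed e n a b eps w t) \<and> cmod (speed e n a b eps w t) \<le> M \<and>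
     (w \<in> \<real> \<longrightarrow> m \<le> speed e n a b eps (Re w) t) \<and>
     cmod (slope e n a b eps w t) \<le> M \<and> cmod (slope e n a b eps w t - slope e n a b 0 w t) \<le> M * \<bar>eps\<bar>)"
proof -
  define C where "C = cbox (Complex (A - r) (- r)) (Complex (B + r) r) \<times> {0..2*pi}"
  have comp: "compact C" unfolding C_def by (intro compact_Times compact_cbox compact_Icc)
  have reC: "Re (fst x) > sqrt e" if "x \<in> C" for x
    using that r by (auto simp: C_def in_cbox_complex_iff)
  have cc: "continuous_on C (\<lambda>x. zeta e n a b (fst x) (snd x))" "continuous_on C (\<lambda>x. Theta e n a b (fst x) (snd x))"
    "continuous_on C (\<lambda>x. omega e (fst x) (snd x))"
    by (rule coords_continuous[OF e]; use reC in \<open>auto intro!: continuous_intros\<close>)+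
  have "\<exists>K>0. \<forall>x\<in>C. cmod (F x) \<le> K" if "continuous_on C F" for F
    using compact_imp_bounded[OF compact_continuous_image[OF that comp]] unfolding bounded_pos by auto
  from this[OF cc(1)] this[OF cc(2)] this[OF cc(3)]
  obtain Z T O' where Z: "Z > 0" "\<And>x. x \<in> C \<Longrightarrow> cmod (zeta e n a b (fst x) (snd x)) \<le> Z"
    and T: "T > 0" "\<And>x. x \<in> C \<Longrightarrow> cmod (Theta e n a b (fst x) (snd x)) \<le> T"
    and O': "O' > 0" "\<And>x. x \<in> C \<Longrightarrow> cmod (omega e (fst x) (snd x)) \<le> O'" by blast
  have om: "omega e (fst x) (snd x) \<noteq> 0" if "x \<in> C" for x
    using right_half_plane_nonzero[OF e reC[OF that]] by (simp add: omega_def)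
  obtain m where m: "m > 0" "\<And>x. x \<in> C \<Longrightarrow> cmod (omega e (fst x) (snd x)) \<ge> 2 * m"
  proof (cases "C = {}")
    case True thus ?thesis using that[of 1] by auto
  next
    case False
    obtain x0 where "x0 \<in> C" "\<And>x. x \<in> C \<Longrightarrow> cmod (omega e (fst x0) (snd x0)) \<le> cmod (omega e (fst x) (snd x))"
      using continuous_attains_inf[OF comp False, of "\<lambda>x. cmod (omega e (fst x) (snd x))"]
        continuous_on_norm[OF cc(3)] by blast
    thus ?thesis using that[of "cmod (omega e (fst x0) (snd x0)) / 2"] om by auto
  qed
  define eps1 where "eps1 = m / T"
  define M where "M = O' + m + Z / m + Z * T / (2 * m * m)"
  have pos: "Z / m > 0" "Z * T / (2 * m * m) > 0" using Z T m by auto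
  have M: "O' + m \<le> M" "Z / m \<le> M" "Z * T / (2 * m * m) \<le> M" "M > 0"
    using O' m pos by (auto simp: M_def)
  have main: "m \<le> cmod (speed e n a b eps w t) \<and> cmod (speed e n a b eps w t) \<le> M \<and>
     (w \<in> \<real> \<longrightarrow> m \<le> speed e n a b eps (Re w) t) \<and>
     cmod (slope e n a b eps w t) \<le> M \<and> cmod (slope e n a b eps w t - slope e n a b 0 w t) \<le> M * \<bar>eps\<bar>"
    if eps: "\<bar>eps\<bar> \<le> eps1" and w: "w \<in> cbx A B r" and t: "0 \<le> t" "t \<le> 2 * pi" for eps w t
  proof -
    have xC: "(w, t) \<in> C" using w t by (auto simp: C_def in_cbox_complex_iff cbx_iff)
    note b = Z(2)[OF xC, simplified] T(2)[OF xC, simplified] O'(2)[OF xC, simplified] m(2)[OF xC, simplified]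
    have et: "cmod (of_real eps * Theta e n a b w t) \<le> m"
    proof -
      have "\<bar>eps\<bar> * cmod (Theta e n a b w t) \<le> eps1 * T"
        by (rule mult_mono) (use eps b(2) T(1) in auto)
      thus ?thesis using T(1) by (simp add: eps1_def norm_mult)
    qed
    have 1: "m \<le> cmod (speed e n a b eps w t)"
      using norm_diff_ineq[of "omega e w t" "of_real eps * Theta e n a b w t"] b et by (simp add: speed_def)
    have 2: "cmod (speed e n a b eps w t) \<le> M"
      using norm_triangle_ineq[of "omega e w t" "of_real eps * Theta e n a b w t"] b et M by (simp add: speed_def)
    have 3: "m \<le> speed e n a b eps (Re w) t" if "w \<in> \<real>"
    proof -
      obtain v where v: "w = of_real v" using \<open>w \<in> \<real>\<close> unfolding Reals_def by blast
      have "v > sqrt e" using reC[OF xC] v by simp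
      hence vp: "v > 0" using real_sqrt_gt_zero[OF e] by linarith
      have "cmod (omega e w t) = omega e v t" using omega_pos[OF e vp, of t] v by simp
      moreover have "\<bar>eps * Theta e n a b v t\<bar> \<le> m"
        using et v by (simp add: norm_mult abs_mult)
      ultimately have "2 * m \<le> omega e v t" "- m \<le> eps * Theta e n a b v t"
        using b(4) by linarith+
      thus ?thesis unfolding v by (simp add: speed_def)
    qed
    have s0: "speed e n a b eps w t \<noteq> 0" "omega e w t \<noteq> 0" using 1 m(1) om[OF xC] by auto
    have 4: "cmod (slope e n a b eps w t) \<le> M"
    proof -
      have "cmod (slope e n a b eps w t) \<le> Z / m"
        unfolding slope_def norm_divide by (rule frac_le) (use b(1) 1 m(1) Z(1) in auto)
      thus ?thesis using M by simp
    qed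
    have 5: "cmod (slope e n a b eps w t - slope e n a b 0 w t) \<le> M * \<bar>eps\<bar>"
    proof -
      have "slope e n a b eps w t - slope e n a b 0 w t
         = - (of_real eps * (zeta e n a b w t * Theta e n a b w t / (omega e w t * speed e n a b eps w t)))"
        unfolding slope_def using s0 by (simp add: speed_def field_simps)
      hence "cmod (slope e n a b eps w t - slope e n a b 0 w t)
         = \<bar>eps\<bar> * (cmod (zeta e n a b w t) * cmod (Theta e n a b w t) / (cmod (omega e w t) * cmod (speed e n a b eps w t)))"
        by (simp add: norm_mult norm_divide)
      also have "\<dots> \<le> \<bar>eps\<bar> * (Z * T / (2 * m * m))"
      proof (rule mult_left_mono[OF frac_le])
        show "cmod (zeta e n a b w t) * cmod (Theta e n a b w t) \<le> Z * T"
          by (rule mult_mono) (use b(1,2) Z(1) T(1) in auto)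
        show "2 * m * m \<le> cmod (omega e w t) * cmod (speed e n a b eps w t)"
          by (rule mult_mono) (use b(4) 1 m(1) in auto)
      qed (use Z(1) T(1) m(1) in auto)
      also have "\<dots> \<le> \<bar>eps\<bar> * M" by (rule mult_left_mono[OF M(3)]) simp
      finally show ?thesis by (simp add: mult.commute)
    qed
    show ?thesis using 1 2 3 4 5 by blast
  qed
  have main': "\<forall>eps w t. \<bar>eps\<bar> \<le> eps1 \<and> w \<in> cbx A B r \<and> 0 \<le> t \<and> t \<le> 2 * pi \<longrightarrow>
     m \<le> cmod (speed e n a b eps w t) \<and> cmod (speed e n a b eps w t) \<le> M \<and>
     (w \<in> \<real> \<longrightarrow> m \<le> speed e n a b eps (Re w) t) \<and>
     cmod (slope e n a b eps w t) \<le> M \<and> cmod (slope e n a b eps w t - slope e n a b 0 w t) \<le> M * \<bar>eps\<bar>"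
    by (intro allI impI, elim conjE, rule main)
  have "eps1 > 0" using m(1) T(1) by (simp add: eps1_def)
  thus ?thesis using m(1) M(4) main' by (intro exI[of _ eps1] exI[of _ m] exI[of _ M] conjI)
qed

section \<open>The scalar equation of one half-plane\<close>

text \<open>Uniform bounds for the scalar equation \<open>dw/dt = eps slope\<close> on a complex neighbourhood of \<open>{A..B}\<close>. The smallness
conditions make a solution move by at most \<open>\<delta> / 4\<close> during a half turn, both in the angle variable and in time.\<close>

locale half_field =
  fixes n :: nat and a b :: "nat \<Rightarrow> nat \<Rightarrow> real" and e A B \<delta> eps1 m M :: real
  assumes e: "e > 0" and A: "sqrt e < A - 4 * \<delta>" and AB: "A \<le> B" and \<delta>: "\<delta> > 0"
    and pos: "eps1 > 0" "m > 0" "M > 0"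
    and speed_lower: "\<And>eps w t. \<bar>eps\<bar> \<le> eps1 \<Longrightarrow> w \<in> cbx A B (4 * \<delta>) \<Longrightarrow> 0 \<le> t \<Longrightarrow> t \<le> 2 * pi \<Longrightarrow> m \<le> cmod (speed e n a b eps w t)"
    and speed_upper: "\<And>eps w t. \<bar>eps\<bar> \<le> eps1 \<Longrightarrow> w \<in> cbx A B (4 * \<delta>) \<Longrightarrow> 0 \<le> t \<Longrightarrow> t \<le> 2 * pi \<Longrightarrow> cmod (speed e n a b eps w t) \<le> M"
    and speed_pos: "\<And>eps w t. \<bar>eps\<bar> \<le> eps1 \<Longrightarrow> w \<in> cbx A B (4 * \<delta>) \<Longrightarrow> 0 \<le> t \<Longrightarrow> t \<le> 2 * pi \<Longrightarrow> w \<in> \<real> \<Longrightarrow> m \<le> speed e n a b eps (Re w) t"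
    and slope_bound: "\<And>eps w t. \<bar>eps\<bar> \<le> eps1 \<Longrightarrow> w \<in> cbx A B (4 * \<delta>) \<Longrightarrow> 0 \<le> t \<Longrightarrow> t \<le> 2 * pi \<Longrightarrow> cmod (slope e n a b eps w t) \<le> M"
    and slope_diff: "\<And>eps w t. \<bar>eps\<bar> \<le> eps1 \<Longrightarrow> w \<in> cbx A B (4 * \<delta>) \<Longrightarrow> 0 \<le> t \<Longrightarrow> t \<le> 2 * pi \<Longrightarrow> cmod (slope e n a b eps w t - slope e n a b 0 w t) \<le> M * \<bar>eps\<bar>"
    and smallness: "eps1 * M * pi \<le> \<delta> / 4" "eps1 * (M / \<delta>) * pi \<le> 1 / 2"
      "pi / m * (M * eps1 * M) \<le> \<delta> / 4" "pi / m * (M * eps1 * (M / \<delta>)) \<le> 1 / 2"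

text \<open>Only \<open>eps1\<close> has to be chosen; its reciprocal must exceed finitely many constants, which are added up.\<close>

lemma half_field_exists:
  fixes n :: nat and a b :: "nat \<Rightarrow> nat \<Rightarrow> real"
  assumes e: "e > 0" and A: "sqrt e < A - 4 * \<delta>" and AB: "A \<le> B" and \<delta>: "\<delta> > 0"
  shows "\<exists>eps1 m M. half_field n a b e A B \<delta> eps1 m M"
proof -
  obtain eps0 m M where *: "eps0 > 0" "m > 0" "M > 0"
    "\<forall>eps w t. \<bar>eps\<bar> \<le> eps0 \<and> w \<in> cbx A B (4 * \<delta>) \<and> 0 \<le> t \<and> t \<le> 2 * pi \<longrightarrow>
     m \<le> cmod (speed e n a b eps w t) \<and> cmod (speed e n a b eps w t) \<le> M \<and>
     (w \<in> \<real> \<longrightarrow> m \<le> speed e n a b eps (Re w) t) \<and>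
     cmod (slope e n a b eps w t) \<le> M \<and> cmod (slope e n a b eps w t - slope e n a b 0 w t) \<le> M * \<bar>eps\<bar>"
    using slope_bounds[OF e A, where n = n and a = a and b = b and B = B] by (elim exE conjE) blast
  \<comment> \<open>The sum of the constants that \<open>eps1\<close> has to beat in the four smallness conditions.\<close>
  define K where "K = 4 * (M * pi) / \<delta> + 2 * (M / \<delta>) * pi + 4 * (pi / m * (M * M)) / \<delta> + 2 * (pi / m * (M * (M / \<delta>)))"
  have p: "4 * (M * pi) / \<delta> > 0" "2 * (M / \<delta>) * pi > 0" "4 * (pi / m * (M * M)) / \<delta> > 0" "2 * (pi / m * (M * (M / \<delta>))) > 0"
    using * \<delta> by auto
  hence K: "K > 0" "4 * (M * pi) / \<delta> \<le> K" "2 * (M / \<delta>) * pi \<le> K" "4 * (pi / m * (M * M)) / \<delta> \<le> K" "2 * (pi / m * (M * (M / \<delta>))) \<le> K"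
    unfolding K_def by linarith+
  define eps1 where "eps1 = min eps0 (1 / K)"
  have e1: "eps1 > 0" "eps1 \<le> eps0" "eps1 * K \<le> 1"
    using K *(1) by (auto simp: eps1_def min_def field_simps)
  have le: "eps1 * X \<le> 1" if "X \<le> K" for X
    using mult_left_mono[OF that, of eps1] e1 by linarith
  have s1: "eps1 * M * pi \<le> \<delta> / 4" using le[OF K(2)] \<delta> by (simp add: field_simps)
  have s2: "eps1 * (M / \<delta>) * pi \<le> 1 / 2" using le[OF K(3)] by (simp add: field_simps)
  have s3: "pi / m * (M * eps1 * M) \<le> \<delta> / 4" using le[OF K(4)] \<delta> pos_divide_le_eq[of \<delta> "eps1 * (4 * (pi / m * (M * M)))" 1]
    by (simp add: mult_ac)
  have s4: "pi / m * (M * eps1 * (M / \<delta>)) \<le> 1 / 2" using le[OF K(5)] by (simp add: field_simps)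
  have le0: "\<bar>eps\<bar> \<le> eps0" if "\<bar>eps\<bar> \<le> eps1" for eps using that e1(2) by linarith
  have "half_field n a b e A B \<delta> eps1 m M"
  proof (unfold_locales)
    fix eps :: real and w :: complex and t :: real
    assume h: "\<bar>eps\<bar> \<le> eps1" "w \<in> cbx A B (4 * \<delta>)" "0 \<le> t" "t \<le> 2 * pi"
    note c = *(4)[rule_format, OF conjI[OF le0[OF h(1)] conjI[OF h(2) conjI[OF h(3,4)]]]]
    show "m \<le> cmod (speed e n a b eps w t)" "cmod (speed e n a b eps w t) \<le> M"
      "cmod (slope e n a b eps w t) \<le> M" "cmod (slope e n a b eps w t - slope e n a b 0 w t) \<le> M * \<bar>eps\<bar>"
      using c by blast+
    show "m \<le> speed e n a b eps (Re w) t" if "w \<in> \<real>" using c that by blast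
  qed (fact e A AB \<delta> e1(1) *(2,3) s1 s2 s3 s4)+
  thus ?thesis by blast
qed

context half_field
begin

lemma cbx_Re: "w \<in> cbx A B r \<Longrightarrow> r \<le> 4 * \<delta> \<Longrightarrow> Re w > sqrt e"
  using A by (auto simp: cbx_iff)

lemma of_real_cbx: "(of_real w :: complex) \<in> cbx A B r \<longleftrightarrow> A - r < w \<and> w < B + r \<and> 0 < r"
  by (auto simp: cbx_iff)

lemma slope_continuous:
  assumes "\<bar>eps\<bar> \<le> eps1" "S \<subseteq> cbx A B (4 * \<delta>) \<times> {0..2 * pi}"
  shows "continuous_on S (\<lambda>(w, t). slope e n a b eps w t)"
proof -
  have re: "Re (fst x) > sqrt e" if "x \<in> S" for x using assms(2) that cbx_Re by auto
  have "speed e n a b eps (fst x) (snd x) \<noteq> 0" if "x \<in> S" for x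
    using speed_lower[OF assms(1), of "fst x" "snd x"] assms(2) that pos by force
  thus ?thesis
    unfolding slope_def speed_def split_beta
    by (intro continuous_intros coords_continuous e re) auto
qed

lemma slope_holomorphic:
  assumes "\<bar>eps\<bar> \<le> eps1" "0 \<le> t" "t \<le> 2 * pi"
  shows "(\<lambda>w. slope e n a b eps w t) holomorphic_on cbx A B (4 * \<delta>)"
proof -
  have "speed e n a b eps w t \<noteq> 0" if "w \<in> cbx A B (4 * \<delta>)" for w
    using speed_lower[OF assms(1) that assms(2,3)] pos by auto
  thus ?thesis
    unfolding slope_def speed_def
    by (intro holomorphic_intros coords_holomorphic e cbx_Re) (auto simp: speed_def)
qed

lemma slope_lipschitz:
  assumes "\<bar>eps\<bar> \<le> eps1" "0 \<le> t" "t \<le> 2 * pi" "w \<in> cbx A B (3 * \<delta>)" "w' \<in> cbx A B (3 * \<delta>)"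
  shows "cmod (slope e n a b eps w t - slope e n a b eps w' t) \<le> M / \<delta> * cmod (w - w')"
  by (rule bounded_holomorphic_lipschitz[OF cbx_open_convex(1) slope_holomorphic[OF assms(1-3)] _ cbx_open_convex(2) _ \<delta> assms(4,5)])
     (use slope_bound assms cbx_margin[of _ A B "3 * \<delta>" \<delta> "4 * \<delta>"] in auto)

lemma real_bounds:
  assumes "\<bar>eps\<bar> \<le> eps1" "0 \<le> t" "t \<le> 2 * pi" "A - 3 * \<delta> < w" "w < B + 3 * \<delta>"
  shows "m \<le> speed e n a b eps w t" "speed e n a b eps w t \<le> M" "\<bar>slope e n a b eps w t\<bar> \<le> M"
proof -
  have w: "of_real w \<in> cbx A B (4 * \<delta>)" using assms \<delta> by (auto simp: of_real_cbx)
  show "m \<le> speed e n a b eps w t" using speed_pos[OF assms(1) w assms(2,3)] by simp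
  show "speed e n a b eps w t \<le> M" using speed_upper[OF assms(1) w assms(2,3)] by (simp add: abs_le_iff)
  show "\<bar>slope e n a b eps w t\<bar> \<le> M" using slope_bound[OF assms(1) w assms(2,3)] by simp
qed

lemma real_lipschitz:
  assumes "\<bar>eps\<bar> \<le> eps1" "0 \<le> t" "t \<le> 2 * pi" "A - 3 * \<delta> < w" "w < B + 3 * \<delta>" "A - 3 * \<delta> < w'" "w' < B + 3 * \<delta>"
  shows "\<bar>slope e n a b eps w t - slope e n a b eps w' t\<bar> \<le> M / \<delta> * \<bar>w - w'\<bar>"
  using slope_lipschitz[OF assms(1-3), of "of_real w" "of_real w'"] assms \<delta>
  by (simp add: of_real_cbx flip: of_real_diff)

definition avg :: "real \<Rightarrow> complex \<Rightarrow> complex" where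
  "avg t0 w = integral {t0..t0 + pi} (\<lambda>t. slope e n a b 0 w t)"

lemma slope_integrable:
  assumes "\<bar>eps\<bar> \<le> eps1" "0 \<le> t0" "t1 \<le> 2 * pi" "w \<in> cbx A B (4 * \<delta>)"
  shows "(\<lambda>t. slope e n a b eps w t) integrable_on {t0..t1}"
  by (rule integrable_continuous_real, rule continuous_on_compose2[OF slope_continuous[OF assms(1) order_refl], of _ "\<lambda>t. (w, t)", simplified])
     (use assms in \<open>auto intro!: continuous_intros\<close>)

lemma avg_holomorphic:
  assumes "0 \<le> t0" "t0 \<le> pi"
  shows "avg t0 holomorphic_on cbx A B (4 * \<delta>)"
  unfolding avg_def[abs_def]
  by (rule holomorphic_on_integral_param[OF cbx_open_convex(1)])
     (use assms pos in \<open>auto intro!: slope_continuous slope_holomorphic\<close>)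

text \<open>Integrate the Lipschitz bound of the slope.\<close>

lemma avg_lipschitz:
  assumes t: "0 \<le> t0" "t0 \<le> pi" and w: "w \<in> cbx A B (3 * \<delta>)" "w' \<in> cbx A B (3 * \<delta>)"
  shows "cmod (avg t0 w - avg t0 w') \<le> M / \<delta> * pi * cmod (w - w')"
proof -
  have w4: "w \<in> cbx A B (4 * \<delta>)" "w' \<in> cbx A B (4 * \<delta>)" using w cbx_mono[of "3 * \<delta>" "4 * \<delta>"] \<delta> by auto
  have i: "(\<lambda>t. slope e n a b 0 w t) integrable_on {t0..t0 + pi}" if "w \<in> cbx A B (4 * \<delta>)" for w
    using slope_integrable[of 0 t0 "t0 + pi"] t that pos by auto
  have "norm (integral {t0..t0+pi} (\<lambda>t. slope e n a b 0 w t - slope e n a b 0 w' t)) \<le> (M / \<delta> * cmod (w - w')) * (t0 + pi - t0)"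
    by (rule norm_integral_le)
       (use integrable_diff[OF i[OF w4(1)] i[OF w4(2)]] slope_lipschitz w t pos \<delta> in auto)
  thus ?thesis
    unfolding avg_def by (simp add: Henstock_Kurzweil_Integration.integral_diff[OF i[OF w4(1)] i[OF w4(2)]] mult_ac)
qed

lemma avg_real:
  assumes t: "0 \<le> t0" "t0 \<le> pi" and w: "(of_real w :: complex) \<in> cbx A B (4 * \<delta>)"
  shows "avg t0 (of_real w) = of_real (integral {t0..t0 + pi} (\<lambda>t. slope e n a b 0 w t))"
proof -
  have "(\<lambda>t. slope e n a b 0 (of_real w :: complex) t) integrable_on {t0..t0 + pi}"
    by (rule slope_integrable) (use t w pos in auto)
  from integrable_linear[OF this bounded_linear_Re]
  have "(\<lambda>t. slope e n a b 0 w t) integrable_on {t0..t0 + pi}" by (simp add: o_def)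
  from integral_linear[OF this bounded_linear_of_real[where 'a = complex]]
  show ?thesis by (simp add: avg_def o_def)
qed

end

locale half_flow = half_field +
  fixes eps t0 :: real
  assumes eps: "\<bar>eps\<bar> \<le> eps1" and t0: "0 \<le> t0" "t0 \<le> pi"
begin

sublocale picard "slope e n a b eps" "cbx A B (3 * \<delta>)" "cbx A B (2 * \<delta>)" t0 "t0 + pi" M "M / \<delta>" \<delta> eps
proof
  have sub: "cbx A B (3 * \<delta>) \<subseteq> cbx A B (4 * \<delta>)" using \<delta> by (intro cbx_mono) auto
  show "continuous_on (cbx A B (3 * \<delta>) \<times> {t0..t0 + pi}) (\<lambda>(w, t). slope e n a b eps w t)"
    by (rule slope_continuous[OF eps]) (use sub t0 in auto)
  show "(\<lambda>w. slope e n a b eps w t) holomorphic_on cbx A B (3 * \<delta>)" if "t \<in> {t0..t0 + pi}" for t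
    by (rule holomorphic_on_subset[OF slope_holomorphic sub]) (use eps that t0 in auto)
  show "cmod (slope e n a b eps w t) \<le> M" if "w \<in> cbx A B (3 * \<delta>)" "t \<in> {t0..t0 + pi}" for w t
    using slope_bound[OF eps] sub that t0 by auto
  show "cmod (slope e n a b eps w t - slope e n a b eps w' t) \<le> M / \<delta> * cmod (w - w')"
    if "w \<in> cbx A B (3 * \<delta>)" "w' \<in> cbx A B (3 * \<delta>)" "t \<in> {t0..t0 + pi}" for w w' t
    using slope_lipschitz[OF eps] that t0 by auto
  show "cball w \<delta> \<subseteq> cbx A B (3 * \<delta>)" if "w \<in> cbx A B (2 * \<delta>)" for w
    using cbx_margin[OF that] by auto
  have "\<bar>eps\<bar> * (M * pi) \<le> eps1 * (M * pi)" "\<bar>eps\<bar> * (M / \<delta> * pi) \<le> eps1 * (M / \<delta> * pi)"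
    using eps pos \<delta> by (intro mult_right_mono; auto)+
  thus "\<bar>eps\<bar> * M * (t0 + pi - t0) \<le> \<delta>" "\<bar>eps\<bar> * (M / \<delta>) * (t0 + pi - t0) \<le> 1 / 2"
    using smallness(1,2) \<delta> unfolding mult.assoc add_diff_cancel_left' by linarith+
qed (use \<delta> pos cbx_open_convex in auto)

definition psi :: "real \<Rightarrow> real \<Rightarrow> real" where
  "psi w t = Re (flow (of_real w) t)"

lemma flow_close:
  assumes w: "w \<in> cbx A B (2 * \<delta>)" and t: "t \<in> {t0..t0 + pi}"
  shows "cmod (flow w t - w) \<le> M * pi * \<bar>eps\<bar>"
proof -
  have "cmod (of_real eps * integral {t0..t} (\<lambda>s. slope e n a b eps (flow w s) s)) \<le> \<bar>eps\<bar> * M * (t0 + pi - t0)"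
  proof (rule integral_R_bound(2))
    show "flow w s \<in> cbx A B (3 * \<delta>)" if "s \<in> {t0..t}" for s
      using flow_props(2)[OF w, of s] margin[OF w] that t by auto
    show "continuous_on {t0..t} (flow w)"
      using flow_props(1)[OF w] t by (auto intro: continuous_on_subset)
  qed (use t in auto)
  thus ?thesis using flow_props(3)[OF w t] by (simp add: mult_ac)
qed

text \<open>Replace \<open>slope eps (flow w s)\<close> by \<open>slope 0 w\<close> under the integral: both the change of \<open>w\<close> along the flow and the change of
\<open>eps\<close> cost a factor \<open>\<bar>eps\<bar>\<close>, besides the factor \<open>eps\<close> in front of the integral.\<close>

lemma flow_first_order:
  assumes w: "w \<in> cbx A B (2 * \<delta>)"
  shows "cmod (flow w (t0 + pi) - w - of_real eps * avg t0 w) \<le> (M / \<delta> * (M * pi) + M) * pi * \<bar>eps\<bar>\<^sup>2"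
proof -
  have w3: "w \<in> cbx A B (3 * \<delta>)" and w4: "w \<in> cbx A B (4 * \<delta>)"
    using w cbx_mono[of "2 * \<delta>" "3 * \<delta>" A B] cbx_mono[of "2 * \<delta>" "4 * \<delta>" A B] \<delta> by auto
  have fV: "flow w s \<in> cbx A B (3 * \<delta>)" if "s \<in> {t0..t0+pi}" for s
    using flow_props(2)[OF w that] margin[OF w] by auto
  have i1: "(\<lambda>s. slope e n a b eps (flow w s) s) integrable_on {t0..t0+pi}"
    by (rule integral_R_bound(1)) (use fV flow_props(1)[OF w] in auto)
  have i2: "(\<lambda>s. slope e n a b 0 w s) integrable_on {t0..t0+pi}"
    using slope_integrable[of 0 t0 "t0 + pi"] t0 w4 pos by auto
  have "flow w (t0 + pi) - w - of_real eps * avg t0 w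
      = of_real eps * integral {t0..t0+pi} (\<lambda>s. slope e n a b eps (flow w s) s - slope e n a b 0 w s)"
    unfolding avg_def Henstock_Kurzweil_Integration.integral_diff[OF i1 i2]
    using flow_props(3)[OF w, of "t0 + pi"] by (simp add: right_diff_distrib)
  moreover have "norm (integral {t0..t0+pi} (\<lambda>s. slope e n a b eps (flow w s) s - slope e n a b 0 w s))
     \<le> (M / \<delta> * (M * pi) + M) * \<bar>eps\<bar> * (t0 + pi - t0)"
  proof (rule norm_integral_le)
    show "(\<lambda>s. slope e n a b eps (flow w s) s - slope e n a b 0 w s) integrable_on {t0..t0 + pi}"
      using integrable_diff[OF i1 i2] .
    fix s assume s: "s \<in> {t0..t0 + pi}"
    have "cmod (slope e n a b eps (flow w s) s - slope e n a b eps w s) \<le> M / \<delta> * cmod (flow w s - w)"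
      using lip[OF fV w3] s by auto
    also have "\<dots> \<le> M / \<delta> * (M * pi * \<bar>eps\<bar>)"
      using flow_close[OF w s] pos \<delta> by (intro mult_left_mono) auto
    finally have 1: "cmod (slope e n a b eps (flow w s) s - slope e n a b eps w s) \<le> M / \<delta> * (M * pi * \<bar>eps\<bar>)" .
    have 2: "cmod (slope e n a b eps w s - slope e n a b 0 w s) \<le> M * \<bar>eps\<bar>"
      using slope_diff[OF eps w4] s t0 by auto
    have "cmod (slope e n a b eps (flow w s) s - slope e n a b 0 w s)
       \<le> cmod (slope e n a b eps (flow w s) s - slope e n a b eps w s) + cmod (slope e n a b eps w s - slope e n a b 0 w s)"
      using norm_triangle_ineq[of "slope e n a b eps (flow w s) s - slope e n a b eps w s" "slope e n a b eps w s - slope e n a b 0 w s"]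
      by simp
    thus "cmod (slope e n a b eps (flow w s) s - slope e n a b 0 w s) \<le> (M / \<delta> * (M * pi) + M) * \<bar>eps\<bar>"
      using 1 2 by (simp only: distrib_right)
  qed (use pos \<delta> in auto)
  ultimately have "cmod (flow w (t0 + pi) - w - of_real eps * avg t0 w) \<le> \<bar>eps\<bar> * ((M / \<delta> * (M * pi) + M) * \<bar>eps\<bar> * pi)"
    by (simp only: norm_mult norm_of_real real_norm_def) (rule mult_left_mono, simp_all only: add_diff_cancel_left' abs_ge_zero)
  also have "\<dots> = (M / \<delta> * (M * pi) + M) * pi * \<bar>eps\<bar>\<^sup>2" by (simp add: power2_eq_square)
  finally show ?thesis .
qed

lemma flow_of_real:
  assumes "A - 2 * \<delta> < w" "w < B + 2 * \<delta>" "t \<in> {t0..t0 + pi}"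
  shows "flow (of_real w) t = of_real (psi w t)"
proof -
  have "flow (of_real w) t \<in> \<real>"
  proof (rule flow_real)
    show "slope e n a b eps v t \<in> \<real>" if "v \<in> \<real>" for v :: complex and t
    proof -
      obtain r where "v = of_real r" using \<open>v \<in> \<real>\<close> unfolding Reals_def by blast
      thus ?thesis by simp
    qed
  qed (use assms \<delta> in \<open>auto simp: of_real_cbx\<close>)
  thus ?thesis by (simp add: psi_def of_real_Re)
qed

lemma psi_props:
  assumes w: "A - 2 * \<delta> < w" "w < B + 2 * \<delta>"
  shows "psi w t0 = w" "continuous_on {t0..t0 + pi} (psi w)"
    "\<And>t. t \<in> {t0..t0+pi} \<Longrightarrow> \<bar>psi w t - w\<bar> \<le> M * pi * \<bar>eps\<bar>"
    "\<And>t. t \<in> {t0..t0+pi} \<Longrightarrow> A - 3 * \<delta> < psi w t \<and> psi w t < B + 3 * \<delta>"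
    "\<And>t. t \<in> {t0..t0+pi} \<Longrightarrow> (psi w has_real_derivative eps * slope e n a b eps (psi w t) t) (at t within {t0..t0+pi})"
proof -
  have w2: "of_real w \<in> cbx A B (2 * \<delta>)" using w \<delta> by (auto simp: of_real_cbx)
  note fp = flow_props[OF w2]
  show "psi w t0 = w" using fp(3)[of t0] by (simp add: psi_def)
  show "continuous_on {t0..t0 + pi} (psi w)"
    unfolding psi_def by (intro continuous_intros fp)
  show "\<bar>psi w t - w\<bar> \<le> M * pi * \<bar>eps\<bar>" if "t \<in> {t0..t0+pi}" for t
    using flow_close[OF w2 that] flow_of_real[OF w that] by (simp flip: of_real_diff)
  show 3: "A - 3 * \<delta> < psi w t \<and> psi w t < B + 3 * \<delta>" if "t \<in> {t0..t0+pi}" for t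
  proof -
    have "of_real (psi w t) \<in> cbx A B (3 * \<delta>)"
      using fp(2)[OF that] margin[OF w2] unfolding flow_of_real[OF w that] by blast
    thus ?thesis by (simp add: of_real_cbx)
  qed
  fix t assume t: "t \<in> {t0..t0+pi}"
  have fV: "flow (of_real w) s \<in> cbx A B (3 * \<delta>)" if "s \<in> {t0..t0+pi}" for s
    using fp(2)[OF that] margin[OF w2] by auto
  have "continuous_on {t0..t0+pi} (\<lambda>s. slope e n a b eps (flow (of_real w) s) s)"
    by (rule continuous_on_compose2[OF cont, of _ "\<lambda>s. (flow (of_real w) s, s)", simplified])
       (use fV fp(1) in \<open>auto intro!: continuous_intros\<close>)
  from integral_has_vector_derivative[OF this t]
  have "((\<lambda>u. of_real w + of_real eps * integral {t0..u} (\<lambda>s. slope e n a b eps (flow (of_real w) s) s))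
     has_vector_derivative (of_real eps * slope e n a b eps (flow (of_real w) t) t)) (at t within {t0..t0+pi})"
    by (auto intro!: derivative_eq_intros)
  hence "(flow (of_real w) has_vector_derivative (of_real eps * slope e n a b eps (flow (of_real w) t) t)) (at t within {t0..t0+pi})"
    by (rule has_vector_derivative_transform[OF t fp(3), rotated])
  from bounded_linear.has_vector_derivative[OF bounded_linear_Re this]
  have "(psi w has_vector_derivative Re (of_real eps * slope e n a b eps (flow (of_real w) t) t)) (at t within {t0..t0+pi})"
    by (simp only: psi_def[abs_def])
  moreover have "Re (of_real eps * slope e n a b eps (flow (of_real w) t) t) = eps * slope e n a b eps (psi w t) t"
    unfolding flow_of_real[OF w t] by simp
  ultimately show "(psi w has_real_derivative eps * slope e n a b eps (psi w t) t) (at t within {t0..t0+pi})"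
    unfolding has_real_derivative_iff_has_vector_derivative by (simp only:)
qed

text \<open>The displacement \<open>flow w - w\<close> is bounded by \<open>\<delta> / 4\<close> on a neighbourhood of margin \<open>\<delta>\<close>, so that its Lipschitz
constant is at most \<open>1/4\<close> by Cauchy's estimate, too small to reverse the order of \<open>w\<close> and \<open>w'\<close>.\<close>

lemma psi_mono:
  assumes w: "A - \<delta> < w" "w < w'" "w' < B + \<delta>"
  shows "psi w (t0 + pi) < psi w' (t0 + pi)"
proof -
  define G where "G w = flow w (t0 + pi) - w" for w
  have G: "G holomorphic_on cbx A B (2 * \<delta>)"
    unfolding G_def by (intro holomorphic_intros flow_holomorphic) auto
  have bnd: "cmod (G w) \<le> \<delta> / 4" if "w \<in> cbx A B (2 * \<delta>)" for w
  proof -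
    have "cmod (G w) \<le> M * pi * \<bar>eps\<bar>" unfolding G_def using flow_close[OF that] by auto
    also have "\<dots> \<le> M * pi * eps1" using eps pos by (intro mult_left_mono) auto
    finally show ?thesis using smallness(1) by (simp add: mult_ac)
  qed
  have c: "of_real w \<in> cbx A B \<delta>" "of_real w' \<in> cbx A B \<delta>" using w \<delta> by (auto simp: of_real_cbx)
  have "cmod (G (of_real w') - G (of_real w)) \<le> \<delta> / 4 / \<delta> * cmod (of_real w' - of_real w)"
    by (rule bounded_holomorphic_lipschitz[OF cbx_open_convex(1) G bnd cbx_open_convex(2) _ \<delta> c(2,1)])
       (use cbx_margin[of _ A B \<delta> \<delta> "2 * \<delta>"] in auto)
  also have "\<dots> = (w' - w) / 4" using w \<delta> by (simp flip: of_real_diff)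
  also have "G (of_real w') - G (of_real w) = of_real ((psi w' (t0 + pi) - w') - (psi w (t0 + pi) - w))"
    unfolding G_def using w \<delta> by (simp add: flow_of_real)
  finally have "\<bar>(psi w' (t0 + pi) - w') - (psi w (t0 + pi) - w)\<bar> \<le> (w' - w) / 4"
    by (simp only: norm_of_real)
  hence "- ((psi w' (t0 + pi) - w') - (psi w (t0 + pi) - w)) \<le> (w' - w) / 4" by (rule abs_le_D2)
  thus ?thesis using w(2) by (simp add: field_simps)
qed

end

section \<open>Inverting the coordinates\<close>

text \<open>This is \<open>first_integral (2 * e)\<close>. The coordinate \<open>ww\<close> of a point is found from it by solving
\<open>w / (w\<^sup>2 + e) = sqrt (-HH)\<close> for the larger root; \<open>cc\<close> is then the cosine of the angle.\<close>

definition HH :: "real \<Rightarrow> real \<Rightarrow> real \<Rightarrow> real" where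
  "HH e x y = (x\<^sup>2 - y + e) / y\<^sup>2"

definition annulus :: "real \<Rightarrow> real \<Rightarrow> real \<Rightarrow> bool" where
  "annulus e x y \<longleftrightarrow> y > 0 \<and> x\<^sup>2 < y - e \<and> \<not> (x = 0 \<and> y = 2 * e)"

definition ww :: "real \<Rightarrow> real \<Rightarrow> real \<Rightarrow> real" where
  "ww e x y = sqrt (e * (1 + sqrt (1 + 4 * e * HH e x y)) / (1 - sqrt (1 + 4 * e * HH e x y)))"

definition cc :: "real \<Rightarrow> real \<Rightarrow> real \<Rightarrow> real" where
  "cc e x y = (let w = ww e x y in
     (y - (w\<^sup>2 + e)\<^sup>2 / (2 * w\<^sup>2)) / ((w\<^sup>2 + e) * (w\<^sup>2 - e) / (2 * w\<^sup>2)))"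

lemma square_cancel_aux:
  fixes k z U :: real
  assumes "k \<noteq> 0" "z \<noteq> 0"
  shows "k / z\<^sup>2 * (z * U / (2 * k))\<^sup>2 = U\<^sup>2 / (4 * k)"
  using assms by (simp add: field_simps power2_eq_square)

lemma circle_height_aux:
  fixes k z d u :: real
  shows "z\<^sup>2 / (2 * k) + u * (z * d / (2 * k)) = z * (z + d * u) / (2 * k)"
  by (simp add: add_divide_distrib algebra_simps power2_eq_square)

lemma circle_slope_aux:
  fixes w z d S :: real
  assumes "w \<noteq> 0" "z \<noteq> 0"
  shows "z * d / (2 * w\<^sup>2) * S * (2 * (w / z)) = 2 * (d / (2 * w) * S)"
  using assms by (simp add: field_simps power2_eq_square)

lemma HH_coords:
  fixes w :: real
  assumes "e > 0" "w > 0"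
  shows "(xc e w t)\<^sup>2 = - (w\<^sup>2 / (w\<^sup>2 + e)\<^sup>2) * (yc e w t)\<^sup>2 + yc e w t - e"
    and "HH e (xc e w t) (yc e w t) = - (w\<^sup>2 / (w\<^sup>2 + e)\<^sup>2)"
proof -
  have z: "w\<^sup>2 + e \<noteq> 0" using assms by (simp add: add_pos_pos less_imp_neq[symmetric])
  define C where "C = cos t"
  have "(xc e w t)\<^sup>2 = (w\<^sup>2 - e)\<^sup>2 * (1 - C\<^sup>2) / (4 * w\<^sup>2)"
    by (simp add: xc_def power_mult_distrib power_divide sin_squared_eq C_def)
  also have "\<dots> = - (w\<^sup>2 / (w\<^sup>2 + e)\<^sup>2) * (yc e w t)\<^sup>2 + yc e w t - e"
  proof -
    have "- (w\<^sup>2 / (w\<^sup>2 + e)\<^sup>2) * (yc e w t)\<^sup>2 = - ((w\<^sup>2 + e + (w\<^sup>2 - e) * C)\<^sup>2 / (4 * w\<^sup>2))"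
      using square_cancel_aux[of "w\<^sup>2" "w\<^sup>2 + e" "w\<^sup>2 + e + (w\<^sup>2 - e) * C"] z assms
      by (simp add: yc_def C_def)
    moreover have "yc e w t = 2 * (w\<^sup>2 + e) * (w\<^sup>2 + e + (w\<^sup>2 - e) * C) / (4 * w\<^sup>2)"
      using assms by (simp add: yc_def C_def divide_simps algebra_simps)
    moreover have "e = 4 * e * w\<^sup>2 / (4 * w\<^sup>2)" using assms by simp
    moreover have "(w\<^sup>2 - e)\<^sup>2 * (1 - C\<^sup>2) = - (w\<^sup>2 + e + (w\<^sup>2 - e) * C)\<^sup>2 + 2 * (w\<^sup>2 + e) * (w\<^sup>2 + e + (w\<^sup>2 - e) * C) - 4 * e * w\<^sup>2"
      by algebra
    ultimately show ?thesis by (simp only: add_divide_distrib diff_divide_distrib minus_divide_left)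
  qed
  finally show *: "(xc e w t)\<^sup>2 = - (w\<^sup>2 / (w\<^sup>2 + e)\<^sup>2) * (yc e w t)\<^sup>2 + yc e w t - e" .
  show "HH e (xc e w t) (yc e w t) = - (w\<^sup>2 / (w\<^sup>2 + e)\<^sup>2)"
    unfolding HH_def * using yc_pos[OF assms, of t] by (simp add: field_simps)
qed

lemma annulus_HH:
  assumes "e > 0" "annulus e x y"
  shows "HH e x y < 0" "1 + 4 * e * HH e x y > 0"
proof -
  have y: "y > 0" and "x\<^sup>2 < y - e" using assms by (auto simp: annulus_def)
  thus "HH e x y < 0" by (simp add: HH_def divide_neg_pos)
  have "1 + 4 * e * HH e x y = ((y - 2 * e)\<^sup>2 + 4 * e * x\<^sup>2) / y\<^sup>2"
    using y by (simp add: HH_def field_simps power2_eq_square)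
  moreover have "(y - 2 * e)\<^sup>2 + 4 * e * x\<^sup>2 > 0"
  proof (cases "x = 0")
    case True
    thus ?thesis using assms by (auto simp: annulus_def)
  next
    case False
    thus ?thesis using assms(1) by (simp add: add_nonneg_pos)
  qed
  ultimately show "1 + 4 * e * HH e x y > 0" using y by simp
qed

lemma ww_props:
  assumes e: "e > 0" and ann: "annulus e x y"
  shows "ww e x y > sqrt e" "HH e x y = - ((ww e x y)\<^sup>2 / ((ww e x y)\<^sup>2 + e)\<^sup>2)"
proof -
  define h q where "h = HH e x y" and "q = sqrt (1 + 4 * e * h)"
  have h: "h < 0" "1 + 4 * e * h > 0" using annulus_HH[OF assms] by (auto simp: h_def)
  have q: "q > 0" "q\<^sup>2 = 1 + 4 * e * h" using h by (auto simp: q_def)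
  have q1: "q < 1"
  proof -
    have "q\<^sup>2 < 1\<^sup>2" using q(2) h e by (simp add: mult_pos_neg)
    thus ?thesis by (rule power_less_imp_less_base) simp
  qed
  have w: "ww e x y = sqrt (e * (1 + q) / (1 - q))" by (simp add: ww_def q_def h_def)
  have w2: "(ww e x y)\<^sup>2 = e * (1 + q) / (1 - q)" unfolding w using e q q1 by simp
  have "e < e * (1 + q) / (1 - q)" using e q q1 by (simp add: field_simps)
  thus "ww e x y > sqrt e" unfolding w by (rule real_sqrt_less_mono)
  have z: "(ww e x y)\<^sup>2 + e = 2 * e / (1 - q)" unfolding w2 using q1 by (simp add: field_simps)
  have "(ww e x y)\<^sup>2 / ((ww e x y)\<^sup>2 + e)\<^sup>2 = (1 - q\<^sup>2) / (4 * e)"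
    unfolding z unfolding w2 using q1 e by (simp add: field_simps power2_eq_square)
  thus "HH e x y = - ((ww e x y)\<^sup>2 / ((ww e x y)\<^sup>2 + e)\<^sup>2)"
    using q(2) e by (simp add: h_def field_simps)
qed

lemma ww_coords:
  fixes w :: real
  assumes "e > 0" "w > sqrt e"
  shows "annulus e (xc e w t) (yc e w t)" "ww e (xc e w t) (yc e w t) = w"
proof -
  have w0: "w > 0" using assms real_sqrt_gt_zero[OF assms(1)] by linarith
  have we: "w\<^sup>2 > e" using assms w0 by (metis real_less_rsqrt real_sqrt_less_iff real_sqrt_abs abs_of_pos)
  have y: "yc e w t > 0" using yc_pos[OF assms(1) w0] .
  have "w\<^sup>2 + e > 0" using assms(1) by (simp add: add_nonneg_pos)
  hence "0 < w\<^sup>2 / (w\<^sup>2 + e)\<^sup>2 * (yc e w t)\<^sup>2"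
    using w0 y by (intro mult_pos_pos divide_pos_pos zero_less_power) auto
  hence x: "(xc e w t)\<^sup>2 < yc e w t - e" using HH_coords(1)[OF assms(1) w0, of t] by linarith
  have h: "HH e (xc e w t) (yc e w t) = - (w\<^sup>2 / (w\<^sup>2 + e)\<^sup>2)" using HH_coords(2)[OF assms(1) w0] .
  have zp: "w\<^sup>2 + e > 0" using assms(1) by (simp add: add_nonneg_pos)
  define k where "k = w\<^sup>2"
  have k: "k > e" "k + e > 0" using we zp by (auto simp: k_def)
  have "1 + 4 * e * HH e (xc e w t) (yc e w t) = ((w\<^sup>2 - e) / (w\<^sup>2 + e))\<^sup>2"
  proof -
    have "(k + e)\<^sup>2 \<noteq> 0" using k by simp
    hence "1 + 4 * e * - (k / (k + e)\<^sup>2) = ((k + e)\<^sup>2 - 4 * e * k) / (k + e)\<^sup>2"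
      by (simp only: diff_divide_distrib) simp
    also have "(k + e)\<^sup>2 - 4 * e * k = (k - e)\<^sup>2" by algebra
    finally show ?thesis unfolding h k_def[symmetric] by (simp add: power_divide)
  qed
  hence q: "sqrt (1 + 4 * e * HH e (xc e w t) (yc e w t)) = (w\<^sup>2 - e) / (w\<^sup>2 + e)"
    using we zp by simp
  have "e * (1 + (w\<^sup>2 - e) / (w\<^sup>2 + e)) / (1 - (w\<^sup>2 - e) / (w\<^sup>2 + e)) = w\<^sup>2"
  proof -
    have "1 + (k - e) / (k + e) = 2 * k / (k + e)" "1 - (k - e) / (k + e) = 2 * e / (k + e)"
      using k by (simp_all add: field_simps)
    thus ?thesis unfolding k_def[symmetric] using k assms(1) by simp
  qed
  thus "ww e (xc e w t) (yc e w t) = w" unfolding ww_def q using w0 by simp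
  have "\<not> (xc e w t = 0 \<and> yc e w t = 2 * e)"
  proof
    assume c: "xc e w t = 0 \<and> yc e w t = 2 * e"
    have "1 + 4 * e * HH e (xc e w t) (yc e w t) = 0" unfolding HH_def using c assms(1)
      by (simp add: field_simps power2_eq_square)
    thus False using q we zp by simp
  qed
  thus "annulus e (xc e w t) (yc e w t)" using x y by (simp add: annulus_def)
qed

lemma annulus_circle:
  assumes e: "e > 0" and ann: "annulus e x y"
  defines "w \<equiv> ww e x y"
  shows "x\<^sup>2 = ((w\<^sup>2 - e) / (2 * w))\<^sup>2 * (1 - (cc e x y)\<^sup>2)" "\<bar>cc e x y\<bar> \<le> 1"
    and "y = (w\<^sup>2 + e) * (w\<^sup>2 + e + (w\<^sup>2 - e) * cc e x y) / (2 * w\<^sup>2)"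
    and "x \<noteq> 0 \<Longrightarrow> \<bar>cc e x y\<bar> < 1"
proof -
  have w: "w > sqrt e" and h: "HH e x y = - (w\<^sup>2 / (w\<^sup>2 + e)\<^sup>2)" using ww_props[OF assms(1,2)] by (auto simp: w_def)
  have w0: "w > 0" using w real_sqrt_gt_zero[OF e] by linarith
  have we: "w\<^sup>2 > e" using w w0 e by (metis real_less_rsqrt real_sqrt_less_iff real_sqrt_abs abs_of_pos)
  have zp: "w\<^sup>2 + e > 0" using e by (simp add: add_nonneg_pos)
  have y0: "y > 0" using ann by (simp add: annulus_def)
  define u where "u = cc e x y"
  have u: "u = (y - (w\<^sup>2 + e)\<^sup>2 / (2 * w\<^sup>2)) / ((w\<^sup>2 + e) * (w\<^sup>2 - e) / (2 * w\<^sup>2))"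
    by (simp add: u_def cc_def w_def Let_def)
  have "u * ((w\<^sup>2 + e) * (w\<^sup>2 - e) / (2 * w\<^sup>2)) = y - (w\<^sup>2 + e)\<^sup>2 / (2 * w\<^sup>2)"
    unfolding u using we zp w0 by simp
  hence y: "y = (w\<^sup>2 + e) * (w\<^sup>2 + e + (w\<^sup>2 - e) * u) / (2 * w\<^sup>2)"
    using circle_height_aux[of "w\<^sup>2 + e" "w\<^sup>2" u "w\<^sup>2 - e"] by linarith
  thus "y = (w\<^sup>2 + e) * (w\<^sup>2 + e + (w\<^sup>2 - e) * cc e x y) / (2 * w\<^sup>2)" by (simp add: u_def)
  have "x\<^sup>2 = HH e x y * y\<^sup>2 + y - e" using y0 by (simp add: HH_def)
  also have "\<dots> = - (w\<^sup>2 / (w\<^sup>2 + e)\<^sup>2) * y\<^sup>2 + y - e" by (simp add: h)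
  also have "\<dots> = - ((w\<^sup>2 + e + (w\<^sup>2 - e) * u)\<^sup>2 / (4 * w\<^sup>2)) + y - e"
    using square_cancel_aux[of "w\<^sup>2" "w\<^sup>2 + e" "w\<^sup>2 + e + (w\<^sup>2 - e) * u"] zp w0
    by (simp flip: y)
  also have "\<dots> = ((w\<^sup>2 - e)\<^sup>2 * (1 - u\<^sup>2)) / (4 * w\<^sup>2)"
  proof -
    have "y = 2 * (w\<^sup>2 + e) * (w\<^sup>2 + e + (w\<^sup>2 - e) * u) / (4 * w\<^sup>2)"
      using w0 unfolding y by (simp add: divide_simps algebra_simps)
    moreover have "e = 4 * e * w\<^sup>2 / (4 * w\<^sup>2)" using w0 by simp
    moreover have "(w\<^sup>2 - e)\<^sup>2 * (1 - u\<^sup>2) = - (w\<^sup>2 + e + (w\<^sup>2 - e) * u)\<^sup>2 + 2 * (w\<^sup>2 + e) * (w\<^sup>2 + e + (w\<^sup>2 - e) * u) - 4 * e * w\<^sup>2"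
      by algebra
    ultimately show ?thesis by (simp only: add_divide_distrib diff_divide_distrib minus_divide_left)
  qed
  finally show x: "x\<^sup>2 = ((w\<^sup>2 - e) / (2 * w))\<^sup>2 * (1 - (cc e x y)\<^sup>2)"
    by (simp add: u_def power_divide power_mult_distrib)
  have r: "((w\<^sup>2 - e) / (2 * w))\<^sup>2 > 0" using we w0 by simp
  have "0 \<le> ((w\<^sup>2 - e) / (2 * w))\<^sup>2 * (1 - (cc e x y)\<^sup>2)" using x by (metis zero_le_power2)
  hence "0 \<le> 1 - (cc e x y)\<^sup>2" using r by (simp add: zero_le_mult_iff)
  thus "\<bar>cc e x y\<bar> \<le> 1" by (simp add: abs_square_le_1)
  assume "x \<noteq> 0"
  hence "0 < ((w\<^sup>2 - e) / (2 * w))\<^sup>2 * (1 - (cc e x y)\<^sup>2)" using x by (metis zero_less_power2)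
  hence "0 < 1 - (cc e x y)\<^sup>2" using r by (simp add: zero_less_mult_iff)
  thus "\<bar>cc e x y\<bar> < 1" by (simp add: abs_square_less_1)
qed

text \<open>The angle measured on the half-plane of sign \<open>\<sigma>\<close>, with values in \<open>{0..\<pi>}\<close> on the right and in \<open>{\<pi>..2\<pi>}\<close> on the left.
Inverse cosine gives a formula that is continuous up to the switching line.\<close>

definition ang :: "real \<Rightarrow> real \<Rightarrow> real \<Rightarrow> real \<Rightarrow> real" where
  "ang e \<sigma> x y = pi + \<sigma> * (arccos (cc e x y) - pi)"

lemma ang_props:
  assumes e: "e > 0" and ann: "annulus e x y" and \<sigma>: "\<sigma> = 1 \<or> \<sigma> = -1" and x: "\<sigma> * x \<ge> 0"
  shows "xc e (ww e x y) (ang e \<sigma> x y) = x" "yc e (ww e x y) (ang e \<sigma> x y) = y"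
    and "(if \<sigma> = 1 then 0 else pi) \<le> ang e \<sigma> x y" "ang e \<sigma> x y \<le> (if \<sigma> = 1 then 0 else pi) + pi"
proof -
  note ac = annulus_circle[OF e ann]
  define u where "u = cc e x y"
  define w where "w = ww e x y"
  have u: "-1 \<le> u" "u \<le> 1" using ac(2) by (auto simp: u_def abs_le_iff)
  have c: "cos (ang e \<sigma> x y) = u" and s: "sin (ang e \<sigma> x y) = \<sigma> * sqrt (1 - u\<^sup>2)"
    using \<sigma> u by (auto simp: ang_def u_def[symmetric] cos_arccos sin_arccos cos_diff sin_diff)
  show "yc e (ww e x y) (ang e \<sigma> x y) = y"
    using ac(3) by (simp add: yc_def c u_def)
  have w: "w > sqrt e" using ww_props[OF e ann] by (simp add: w_def)
  have w0: "w > 0" using w real_sqrt_gt_zero[OF e] by linarith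
  have we: "w\<^sup>2 > e" using w w0 e by (metis real_less_rsqrt real_sqrt_less_iff real_sqrt_abs abs_of_pos)
  have u2: "0 \<le> 1 - u\<^sup>2" using u by (simp add: abs_square_le_1 abs_le_iff)
  have "(\<sigma> * x)\<^sup>2 = ((w\<^sup>2 - e) / (2 * w) * sqrt (1 - u\<^sup>2))\<^sup>2"
    using ac(1) \<sigma> u2 by (auto simp: w_def u_def power_mult_distrib power_divide)
  hence "\<sigma> * x = (w\<^sup>2 - e) / (2 * w) * sqrt (1 - u\<^sup>2)"
    by (rule power2_eq_imp_eq) (use x we w0 u2 in auto)
  thus "xc e (ww e x y) (ang e \<sigma> x y) = x"
    using \<sigma> by (auto simp: xc_def s w_def)
  show "(if \<sigma> = 1 then 0 else pi) \<le> ang e \<sigma> x y" "ang e \<sigma> x y \<le> (if \<sigma> = 1 then 0 else pi) + pi"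
    using arccos_lbound[OF u] arccos_ubound[OF u] \<sigma> by (auto simp: ang_def u_def)
qed

lemma ww_cc_continuous:
  assumes e: "e > 0" and ann: "\<And>s. s \<in> S \<Longrightarrow> annulus e (X s) (Y s)"
    and c: "continuous_on S X" "continuous_on S Y"
  shows "continuous_on S (\<lambda>s. ww e (X s) (Y s))" "continuous_on S (\<lambda>s. cc e (X s) (Y s))"
proof -
  have y0: "Y s \<noteq> 0" if "s \<in> S" for s using ann[OF that] by (auto simp: annulus_def)
  have "sqrt (1 + 4 * e * HH e (X s) (Y s)) \<noteq> 1" if "s \<in> S" for s
    using annulus_HH(1)[OF e ann[OF that]] e by simp
  thus cw: "continuous_on S (\<lambda>s. ww e (X s) (Y s))"
    unfolding ww_def HH_def using y0 c by (auto intro!: continuous_intros)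
  have nz: "ww e (X s) (Y s) \<noteq> 0" "(ww e (X s) (Y s))\<^sup>2 + e \<noteq> 0" "(ww e (X s) (Y s))\<^sup>2 - e \<noteq> 0" if "s \<in> S" for s
  proof -
    have w: "ww e (X s) (Y s) > sqrt e" using ww_props(1)[OF e ann[OF that]] .
    hence w0: "ww e (X s) (Y s) > 0" using real_sqrt_gt_zero[OF e] by linarith
    have "(ww e (X s) (Y s))\<^sup>2 > e" using w w0 e by (metis real_less_rsqrt real_sqrt_less_iff real_sqrt_abs abs_of_pos)
    thus "ww e (X s) (Y s) \<noteq> 0" "(ww e (X s) (Y s))\<^sup>2 + e \<noteq> 0" "(ww e (X s) (Y s))\<^sup>2 - e \<noteq> 0"
      using w0 e by auto
  qed
  show "continuous_on S (\<lambda>s. cc e (X s) (Y s))"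
    unfolding cc_def Let_def using nz cw c by (auto intro!: continuous_intros)
qed

lemma ww_cc_differentiable:
  assumes e: "e > 0" and ann: "annulus e (X s) (Y s)"
    and d: "(X has_real_derivative X') (at s)" "(Y has_real_derivative Y') (at s)"
  shows "\<exists>D. ((\<lambda>s. ww e (X s) (Y s)) has_real_derivative D) (at s)"
    "\<exists>D. ((\<lambda>s. cc e (X s) (Y s)) has_real_derivative D) (at s)"
proof -
  have y0: "Y s \<noteq> 0" using ann by (auto simp: annulus_def)
  have "((\<lambda>s. HH e (X s) (Y s)) has_real_derivative
     ((2 * X s * X' - Y') * (Y s)\<^sup>2 - ((X s)\<^sup>2 - Y s + e) * (2 * Y s * Y')) / ((Y s)\<^sup>2 * (Y s)\<^sup>2)) (at s)"
    unfolding HH_def using y0 d by (auto intro!: derivative_eq_intros)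
  then obtain H' where H: "((\<lambda>s. HH e (X s) (Y s)) has_real_derivative H') (at s)" by blast
  note h = annulus_HH[OF e ann]
  have "((\<lambda>s. sqrt (1 + 4 * e * HH e (X s) (Y s))) has_real_derivative
      inverse (sqrt (1 + 4 * e * HH e (X s) (Y s))) / 2 * (4 * e * H')) (at s)"
    using H h by (auto intro!: derivative_eq_intros)
  then obtain Q' where Q: "((\<lambda>s. sqrt (1 + 4 * e * HH e (X s) (Y s))) has_real_derivative Q') (at s)" by blast
  define q where "q s = sqrt (1 + 4 * e * HH e (X s) (Y s))" for s
  have q: "q s > 0" "q s < 1" using h e by (auto simp: q_def mult_pos_neg)
  have Q: "(q has_real_derivative Q') (at s)" using Q by (simp add: q_def[abs_def])
  have pos: "e * (1 + q s) / (1 - q s) > 0" using e q by (intro divide_pos_pos mult_pos_pos) auto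
  have E: "((\<lambda>s. e * (1 + q s) / (1 - q s)) has_real_derivative
      ((e * Q') * (1 - q s) - (e * (1 + q s)) * (- Q')) / ((1 - q s) * (1 - q s))) (at s)"
    using Q q by (auto intro!: derivative_eq_intros)
  have "(ww e (X s) (Y s)) = sqrt (e * (1 + q s) / (1 - q s))" for s by (simp add: ww_def q_def)
  thus "\<exists>D. ((\<lambda>s. ww e (X s) (Y s)) has_real_derivative D) (at s)"
    using DERIV_chain2[OF DERIV_real_sqrt[OF pos] E] by auto
  then obtain W' where W: "((\<lambda>s. ww e (X s) (Y s)) has_real_derivative W') (at s)" by blast
  define w where "w s = ww e (X s) (Y s)" for s
  have wg: "w s > sqrt e" using ww_props(1)[OF e ann] by (simp add: w_def)
  hence w0: "w s > 0" using real_sqrt_gt_zero[OF e] by linarith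
  have "(w s)\<^sup>2 > e" using wg w0 e by (metis real_less_rsqrt real_sqrt_less_iff real_sqrt_abs abs_of_pos)
  hence nz: "w s \<noteq> 0" "(w s)\<^sup>2 + e \<noteq> 0" "(w s)\<^sup>2 - e \<noteq> 0" using w0 e by auto
  have W: "(w has_real_derivative W') (at s)" using W by (simp add: w_def[abs_def])
  have nz2: "((w s)\<^sup>2 + e) * ((w s)\<^sup>2 - e) / (2 * (w s)\<^sup>2) \<noteq> 0" using nz by simp
  have 1: "\<exists>D. ((\<lambda>s. ((w s)\<^sup>2 + e)\<^sup>2 / (2 * (w s)\<^sup>2)) has_real_derivative D) (at s)"
    by (rule exI, rule DERIV_divide) (use nz W in \<open>auto intro!: derivative_eq_intros\<close>)
  have 2: "\<exists>D. ((\<lambda>s. ((w s)\<^sup>2 + e) * ((w s)\<^sup>2 - e) / (2 * (w s)\<^sup>2)) has_real_derivative D) (at s)"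
    by (rule exI, rule DERIV_divide) (use nz W in \<open>auto intro!: derivative_eq_intros\<close>)
  obtain D1 D2 where D: "((\<lambda>s. ((w s)\<^sup>2 + e)\<^sup>2 / (2 * (w s)\<^sup>2)) has_real_derivative D1) (at s)"
    "((\<lambda>s. ((w s)\<^sup>2 + e) * ((w s)\<^sup>2 - e) / (2 * (w s)\<^sup>2)) has_real_derivative D2) (at s)"
    using 1 2 by blast
  have "cc e (X s) (Y s) = (Y s - ((w s)\<^sup>2 + e)\<^sup>2 / (2 * (w s)\<^sup>2)) / (((w s)\<^sup>2 + e) * ((w s)\<^sup>2 - e) / (2 * (w s)\<^sup>2))" for s
    by (simp add: cc_def w_def Let_def)
  thus "\<exists>D. ((\<lambda>s. cc e (X s) (Y s)) has_real_derivative D) (at s)"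
    using DERIV_divide[OF DERIV_diff[OF d(2) D(1)] D(2) nz2] by auto
qed

lemma unperturbed_coords:
  fixes w :: real
  assumes "e > 0" "w > 0"
  shows "yc e w t - 2 * (xc e w t)\<^sup>2 - 2 * e = xt e w t * omega e w t"
    "- 2 * xc e w t * yc e w t = yt e w t * omega e w t"
proof -
  have z: "w\<^sup>2 + e \<noteq> 0" using assms by (simp add: add_pos_pos less_imp_neq[symmetric])
  have "yc e w t - 2 * (xc e w t)\<^sup>2 - 2 * e = yc e w t * (2 * (w\<^sup>2 / (w\<^sup>2 + e)\<^sup>2) * yc e w t - 1)"
    unfolding HH_coords(1)[OF assms] by (simp add: algebra_simps power2_eq_square)
  also have "2 * (w\<^sup>2 / (w\<^sup>2 + e)\<^sup>2) * yc e w t = (w\<^sup>2 + e + (w\<^sup>2 - e) * cos t) / (w\<^sup>2 + e)"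
    using z assms by (simp add: yc_def power2_eq_square[of "w\<^sup>2 + e"])
  also have "(w\<^sup>2 + e + (w\<^sup>2 - e) * cos t) / (w\<^sup>2 + e) - 1 = (w\<^sup>2 - e) * cos t / (w\<^sup>2 + e)"
    using z by (simp add: field_simps)
  also have "yc e w t * ((w\<^sup>2 - e) * cos t / (w\<^sup>2 + e)) = xt e w t * omega e w t"
    using z assms by (simp add: xt_def omega_def)
  finally show "yc e w t - 2 * (xc e w t)\<^sup>2 - 2 * e = xt e w t * omega e w t" .
  have "yt e w t * omega e w t = - ((w\<^sup>2 + e) * (w\<^sup>2 - e) / (2 * w\<^sup>2) * sin t * (2 * (w / (w\<^sup>2 + e)))) * yc e w t"
    by (simp add: yt_def omega_def)
  also have "(w\<^sup>2 + e) * (w\<^sup>2 - e) / (2 * w\<^sup>2) * sin t * (2 * (w / (w\<^sup>2 + e))) = 2 * xc e w t"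
    using circle_slope_aux[of w "w\<^sup>2 + e" "w\<^sup>2 - e" "sin t"] z assms by (simp add: xc_def)
  finally show "- 2 * xc e w t * yc e w t = yt e w t * omega e w t" by simp
qed

lemma jac_real_nonzero: "e > 0 \<Longrightarrow> w > sqrt e \<Longrightarrow> jac e (w :: real) t \<noteq> 0"
  using jac_nonzero[of e "of_real w" t] by (simp add: )

text \<open>Cramer's rule: the perturbation is written in the basis of the partial derivatives of the coordinate map.\<close>

lemma field_coords:
  fixes w eps t A B :: real and n :: nat and a b :: "nat \<Rightarrow> nat \<Rightarrow> real"
  assumes e: "e > 0" and w: "w > sqrt e"
  defines "FX \<equiv> yc e w t - 2 * (xc e w t)\<^sup>2 - 2 * e + eps * pev n a (xc e w t) (yc e w t)"
    and "FY \<equiv> - 2 * xc e w t * yc e w t + eps * pev n b (xc e w t) (yc e w t)"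
  shows "xw e w t * A + xt e w t * B = FX \<and> yw e w t * A + yt e w t * B = FY \<longleftrightarrow>
     A = eps * zeta e n a b w t \<and> B = speed e n a b eps w t"
proof -
  have w0: "w > 0" using w real_sqrt_gt_zero[OF e] by linarith
  have z: "w\<^sup>2 + e \<noteq> 0" using e by (simp add: add_nonneg_pos less_imp_neq[symmetric])
  define J where "J = jac e w t"
  have J0: "J \<noteq> 0" using jac_real_nonzero[OF e w] by (simp add: J_def)
  have J: "xw e w t * yt e w t - xt e w t * yw e w t = J"
    using jacobian_eq[of w e t] z w0 by (simp add: J_def)
  define f g where "f = pev n a (xc e w t) (yc e w t)" and "g = pev n b (xc e w t) (yc e w t)"
  have F: "FX = xt e w t * omega e w t + eps * f" "FY = yt e w t * omega e w t + eps * g"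
    using unperturbed_coords[OF e w0, of t] by (simp_all add: FX_def FY_def f_def g_def)
  define p q r s o' where "p = xw e w t" "q = xt e w t" "r = yw e w t" "s = yt e w t" "o' = omega e w t"
  have zt: "zeta e n a b w t * J = f * s - g * q" "Theta e n a b w t * J = p * g - r * f"
    using J0 by (simp_all add: zeta_def Theta_def J_def f_def g_def p_q_r_s_o'_def)
  have Jp: "p * s - q * r = J" using J by (simp add: p_q_r_s_o'_def)
  have "p * A + q * B = q * o' + eps * f \<and> r * A + s * B = s * o' + eps * g \<longleftrightarrow>
     A * J = eps * (f * s - g * q) \<and> (B - o') * J = eps * (p * g - r * f)"
  proof
    assume "p * A + q * B = q * o' + eps * f \<and> r * A + s * B = s * o' + eps * g"
    thus "A * J = eps * (f * s - g * q) \<and> (B - o') * J = eps * (p * g - r * f)"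
      unfolding Jp[symmetric] by algebra
  next
    assume h: "A * J = eps * (f * s - g * q) \<and> (B - o') * J = eps * (p * g - r * f)"
    hence "(p * A + q * B - q * o' - eps * f) * J = 0" "(r * A + s * B - s * o' - eps * g) * J = 0"
      unfolding Jp[symmetric] by algebra+
    thus "p * A + q * B = q * o' + eps * f \<and> r * A + s * B = s * o' + eps * g" using J0 by auto
  qed
  also have "\<dots> \<longleftrightarrow> A * J = eps * zeta e n a b w t * J \<and> (B - o') * J = eps * Theta e n a b w t * J"
    by (simp add: zt mult.assoc)
  also have "\<dots> \<longleftrightarrow> A = eps * zeta e n a b w t \<and> B = speed e n a b eps w t"
    using J0 by (auto simp: speed_def p_q_r_s_o'_def)
  finally show ?thesis unfolding F by (simp add: p_q_r_s_o'_def)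
qed

lemma coords_derivative:
  fixes W \<theta> :: "real \<Rightarrow> real"
  assumes "W s > 0" and d: "(W has_real_derivative W') (at s within S)" "(\<theta> has_real_derivative T') (at s within S)"
  shows "((\<lambda>s. xc e (W s) (\<theta> s)) has_real_derivative xw e (W s) (\<theta> s) * W' + xt e (W s) (\<theta> s) * T') (at s within S)"
    "((\<lambda>s. yc e (W s) (\<theta> s)) has_real_derivative yw e (W s) (\<theta> s) * W' + yt e (W s) (\<theta> s) * T') (at s within S)"
proof -
  have w: "W s \<noteq> 0" using assms by simp
  show "((\<lambda>s. xc e (W s) (\<theta> s)) has_real_derivative xw e (W s) (\<theta> s) * W' + xt e (W s) (\<theta> s) * T') (at s within S)"
    unfolding xc_def xw_def xt_def using w
    by (auto intro!: derivative_eq_intros d simp: field_simps power2_eq_square)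
  show "((\<lambda>s. yc e (W s) (\<theta> s)) has_real_derivative yw e (W s) (\<theta> s) * W' + yt e (W s) (\<theta> s) * T') (at s within S)"
    unfolding yc_def yw_def yt_def using w
    by (auto intro!: derivative_eq_intros d simp: field_simps power2_eq_square power3_eq_cube power4_eq_xxxx)
qed

section \<open>Passage through a half-plane\<close>

definition fx :: "real \<Rightarrow> nat \<Rightarrow> (nat \<Rightarrow> nat \<Rightarrow> real) \<Rightarrow> real \<Rightarrow> real \<Rightarrow> real \<Rightarrow> real" where
  "fx e n a eps x y = y - 2 * x\<^sup>2 - 2 * e + eps * pev n a x y"

definition fy :: "nat \<Rightarrow> (nat \<Rightarrow> nat \<Rightarrow> real) \<Rightarrow> real \<Rightarrow> real \<Rightarrow> real \<Rightarrow> real" where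
  "fy n b eps x y = - 2 * x * y + eps * pev n b x y"

lemma coords_continuous_real:
  fixes W \<theta> :: "'x::t2_space \<Rightarrow> real"
  assumes "\<And>s. s \<in> S \<Longrightarrow> W s > 0" "continuous_on S W" "continuous_on S \<theta>"
  shows "continuous_on S (\<lambda>s. xc e (W s) (\<theta> s))" "continuous_on S (\<lambda>s. yc e (W s) (\<theta> s))"
proof -
  have w: "W s \<noteq> 0" if "s \<in> S" for s using assms(1)[OF that] by simp
  show "continuous_on S (\<lambda>s. xc e (W s) (\<theta> s))" "continuous_on S (\<lambda>s. yc e (W s) (\<theta> s))"
    unfolding xc_def yc_def using w assms(2,3) by (auto intro!: continuous_intros)
qed

lemma open_annulus: "open {(x, y). annulus e x y}"
proof -
  have "{(x, y). annulus e x y} = {p. 0 < snd p} \<inter> {p. (fst p)\<^sup>2 < snd p - e} \<inter> - {(0, 2 * e)}"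
    by (auto simp: annulus_def)
  also have "open \<dots>"
    by (intro open_Int open_Collect_less continuous_intros open_Compl)
  finally show ?thesis .
qed

lemma open_annulus_band:
  assumes "e > 0"
  shows "open {(x, y). annulus e x y \<and> \<bar>ww e x y - v\<bar> < r}"
proof -
  let ?G = "{(x, y). annulus e x y}"
  have "continuous_on ?G (\<lambda>p. ww e (fst p) (snd p))"
    by (rule ww_cc_continuous(1)[OF assms]) (auto intro!: continuous_intros)
  hence c: "continuous_on ?G (\<lambda>p. \<bar>ww e (fst p) (snd p) - v\<bar>)" by (intro continuous_intros)
  have "open (?G \<inter> (\<lambda>p. \<bar>ww e (fst p) (snd p) - v\<bar>) -` {..<r})"
    by (rule continuous_open_preimage[OF c open_annulus open_lessThan])
  also have "?G \<inter> (\<lambda>p. \<bar>ww e (fst p) (snd p) - v\<bar>) -` {..<r} = {(x, y). annulus e x y \<and> \<bar>ww e x y - v\<bar> < r}"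
    by auto
  finally show ?thesis .
qed

context half_flow
begin

text \<open>A solution that starts in the annulus on the closed half-plane of sign \<open>\<sigma>\<close> and enters it moves on with angular speed at
least \<open>m\<close>. So after time at most \<open>pi / m\<close> the angle has reached the switching line, unless the solution ends before;
meanwhile \<open>ww\<close> varies by at most \<open>\<delta> / 4\<close>. If it starts on the line, \<open>ww\<close> follows the scalar solution \<open>psi\<close> as a
function of the angle, by uniqueness for the scalar equation. The exit time is the supremum of the times up to which the solution
stays in the half-plane and in the annulus band.\<close>

lemma half_turn:
  fixes X Y :: "real \<Rightarrow> real" and tau0 T \<sigma> :: real
  defines "W \<equiv> \<lambda>s. ww e (X s) (Y s)" and "\<theta> \<equiv> \<lambda>s. ang e \<sigma> (X s) (Y s)"
  assumes \<sigma>: "\<sigma> = 1 \<or> \<sigma> = -1" and t0e: "t0 = (if \<sigma> = 1 then 0 else pi)"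
    and T: "tau0 < T" and cont: "continuous_on {tau0..T} X" "continuous_on {tau0..T} Y"
    and derX: "\<And>s. tau0 < s \<Longrightarrow> s < T \<Longrightarrow> \<sigma> * X s > 0 \<Longrightarrow> (X has_real_derivative fx e n a eps (X s) (Y s)) (at s)"
    and derY: "\<And>s. tau0 < s \<Longrightarrow> s < T \<Longrightarrow> \<sigma> * X s > 0 \<Longrightarrow> (Y has_real_derivative fy n b eps (X s) (Y s)) (at s)"
    and start: "annulus e (X tau0) (Y tau0)" "A - \<delta> < W tau0" "W tau0 < B + \<delta>"
    and enter: "\<exists>s>tau0. \<forall>r. tau0 < r \<and> r < s \<longrightarrow> \<sigma> * X r > 0"
  shows "\<exists>tau1. tau0 < tau1 \<and> tau1 \<le> T \<and> tau1 - tau0 \<le> pi / m \<and> (\<forall>s. tau0 < s \<and> s < tau1 \<longrightarrow> \<sigma> * X s > 0) \<and>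
    (\<forall>s\<in>{tau0..tau1}. annulus e (X s) (Y s) \<and> \<sigma> * X s \<ge> 0 \<and> \<bar>W s - W tau0\<bar> \<le> \<delta> / 4) \<and>
    (X tau1 \<noteq> 0 \<and> tau1 = T \<or> X tau1 = 0 \<and> \<theta> tau1 = t0 + pi) \<and> continuous_on {tau0..tau1} \<theta> \<and>
    (\<theta> tau0 = t0 \<longrightarrow> (\<forall>s\<in>{tau0..tau1}. W s = psi (W tau0) (\<theta> s)))"
proof -
  define W0 where "W0 = W tau0"
  have W0e: "sqrt e < W0 - \<delta> / 2" using start A \<delta> by (simp add: W0_def)
  define good where "good s \<longleftrightarrow> tau0 < s \<and> s \<le> T \<and>
     (\<forall>r. tau0 < r \<and> r < s \<longrightarrow> \<sigma> * X r > 0 \<and> annulus e (X r) (Y r) \<and> \<bar>W r - W0\<bar> < \<delta> / 2)" for s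
  have near: "\<exists>d>0. \<forall>r\<in>{tau0..T}. \<bar>r - s\<bar> < d \<longrightarrow> annulus e (X r) (Y r) \<and> \<bar>W r - W0\<bar> < \<delta> / 2"
    if s: "s \<in> {tau0..T}" "annulus e (X s) (Y s)" "\<bar>W s - W0\<bar> < \<delta> / 2" for s
  proof -
    have c: "continuous_on {tau0..T} (\<lambda>s. (X s, Y s))" using cont by (intro continuous_intros)
    let ?G = "{(x, y). annulus e x y \<and> \<bar>ww e x y - W0\<bar> < \<delta> / 2}"
    have "(X s, Y s) \<in> ?G" using s by (simp add: W_def)
    then obtain r where r: "r > 0" "ball (X s, Y s) r \<subseteq> ?G"
      using open_annulus_band[OF e, of W0 "\<delta> / 2"] open_contains_ball by meson
    obtain d where d: "d > 0" "\<And>q. q \<in> {tau0..T} \<Longrightarrow> dist q s < d \<Longrightarrow> dist (X q, Y q) (X s, Y s) < r"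
      using c r(1) s(1) unfolding continuous_on_iff by meson
    have "annulus e (X q) (Y q) \<and> \<bar>W q - W0\<bar> < \<delta> / 2" if "q \<in> {tau0..T}" "\<bar>q - s\<bar> < d" for q
    proof -
      have "(X q, Y q) \<in> ball (X s, Y s) r"
        using d(2)[OF that(1)] that(2) by (simp add: dist_commute dist_real_def abs_minus_commute)
      thus ?thesis using r(2) by (auto simp: W_def)
    qed
    thus ?thesis using d(1) by blast
  qed
  obtain s0 where s0: "s0 > tau0" "\<And>r. tau0 < r \<Longrightarrow> r < s0 \<Longrightarrow> \<sigma> * X r > 0" using enter by blast
  have ex: "\<exists>s. good s"
  proof -
    obtain d where d: "d > 0" "\<And>r. r \<in> {tau0..T} \<Longrightarrow> \<bar>r - tau0\<bar> < d \<Longrightarrow> annulus e (X r) (Y r) \<and> \<bar>W r - W0\<bar> < \<delta> / 2"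
      using near[of tau0] start(1) T \<delta> by (auto simp: W0_def)
    have "good (min s0 (min T (tau0 + d)))"
      unfolding good_def using s0 d T by auto
    thus ?thesis by blast
  qed
  define tau1 where "tau1 = Sup {s. good s}"
  have bdd: "bdd_above {s. good s}" by (rule bdd_aboveI[of _ T]) (auto simp: good_def)
  have t1: "tau0 < tau1" "tau1 \<le> T"
  proof -
    obtain s where "good s" using ex by blast
    thus "tau0 < tau1" using cSup_upper[OF _ bdd, of s] by (auto simp: good_def tau1_def)
    show "tau1 \<le> T" unfolding tau1_def by (rule cSup_least) (use ex in \<open>auto simp: good_def\<close>)
  qed
  have in_open: "\<sigma> * X r > 0 \<and> annulus e (X r) (Y r) \<and> \<bar>W r - W0\<bar> < \<delta> / 2" if r: "tau0 < r" "r < tau1" for r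
  proof -
    obtain s where "good s" "r < s"
      using r(2) less_cSup_iff[OF _ bdd, of r] ex by (auto simp: tau1_def)
    thus ?thesis using r(1) by (auto simp: good_def)
  qed
  define K where "K = (\<lambda>(w, t). (xc e w t :: real, yc e w t :: real)) ` ({W0 - \<delta> / 2..W0 + \<delta> / 2} \<times> {t0..t0 + pi})"
  have sqrte: "sqrt e > 0" using e by simp
  have W0pos: "W0 - \<delta> / 2 > 0" using W0e sqrte by linarith
  have "closed K"
  proof -
    have "continuous_on ({W0 - \<delta> / 2..W0 + \<delta> / 2} \<times> {t0..t0 + pi}) (\<lambda>p. (xc e (fst p) (snd p) :: real, yc e (fst p) (snd p) :: real))"
      by (intro continuous_intros coords_continuous_real) (use W0pos in auto)
    hence "compact K" unfolding K_def split_beta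
      by (rule compact_continuous_image) (intro compact_Times compact_Icc)
    thus ?thesis by (rule compact_imp_closed)
  qed
  have cl: "closure {tau0<..<tau1} = {tau0..tau1}" using t1 by simp
  have sub: "{tau0..tau1} \<subseteq> {tau0..T}" using t1 by auto
  have c1: "continuous_on {tau0..tau1} X" "continuous_on {tau0..tau1} Y"
    using cont sub continuous_on_subset by blast+
  have "(\<lambda>s. (X s, Y s)) ` closure {tau0<..<tau1} \<subseteq> K"
  proof (rule image_closure_subset[OF _ \<open>closed K\<close>])
    show "continuous_on (closure {tau0<..<tau1}) (\<lambda>s. (X s, Y s))" unfolding cl using c1 by (intro continuous_intros)
    show "(\<lambda>s. (X s, Y s)) ` {tau0<..<tau1} \<subseteq> K"
    proof clarify
      fix s assume "s \<in> {tau0<..<tau1}"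
      hence io: "\<sigma> * X s > 0" "annulus e (X s) (Y s)" "\<bar>W s - W0\<bar> < \<delta> / 2" using in_open by auto
      note ap = ang_props[OF e io(2) \<sigma> less_imp_le[OF io(1)]]
      have "(X s, Y s) = (\<lambda>(w, t). (xc e w t, yc e w t)) (W s, \<theta> s)" using ap by (simp add: W_def \<theta>_def)
      moreover have "(W s, \<theta> s) \<in> {W0 - \<delta> / 2..W0 + \<delta> / 2} \<times> {t0..t0 + pi}"
      proof -
        have "W0 - \<delta> / 2 \<le> W s" "W s \<le> W0 + \<delta> / 2" using io(3) by linarith+
        thus ?thesis using ap(3,4) by (auto simp: \<theta>_def t0e)
      qed
      ultimately show "(X s, Y s) \<in> K" unfolding K_def by blast
    qed
  qed
  hence inK: "(X s, Y s) \<in> K" if "s \<in> {tau0..tau1}" for s using that unfolding cl by blast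
  have ann: "annulus e (X s) (Y s)" and Wle: "\<bar>W s - W0\<bar> \<le> \<delta> / 2" if s: "s \<in> {tau0..tau1}" for s
  proof -
    obtain w t where wt: "X s = xc e w t" "Y s = yc e w t" "w \<in> {W0 - \<delta> / 2..W0 + \<delta> / 2}"
      using inK[OF s] by (auto simp: K_def)
    have "w > sqrt e" using wt(3) W0e by auto
    note wc = ww_coords[OF e this, of t]
    show "annulus e (X s) (Y s)" using wc(1) wt by simp
    have "W s = w" using wc(2) wt by (simp add: W_def)
    thus "\<bar>W s - W0\<bar> \<le> \<delta> / 2" using wt(3) by (simp only: atLeastAtMost_iff) linarith
  qed
  have Xge: "\<sigma> * X s \<ge> 0" if s: "s \<in> {tau0..tau1}" for s
  proof -
    have "(\<lambda>s. \<sigma> * X s) ` closure {tau0<..<tau1} \<subseteq> {0..}"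
    proof (rule image_closure_subset)
      show "continuous_on (closure {tau0<..<tau1}) (\<lambda>s. \<sigma> * X s)" unfolding cl using c1 by (intro continuous_intros)
      show "(\<lambda>s. \<sigma> * X s) ` {tau0<..<tau1} \<subseteq> {0..}" using in_open by (auto intro: less_imp_le)
    qed auto
    thus ?thesis using s unfolding cl image_subset_iff atLeast_iff by blast
  qed
  have cW: "continuous_on {tau0..tau1} W" unfolding W_def by (rule ww_cc_continuous(1)[OF e ann c1])
  have c\<theta>: "continuous_on {tau0..tau1} \<theta>" unfolding \<theta>_def ang_def
    using ww_cc_continuous(2)[OF e ann c1] annulus_circle(2)[OF e ann]
    by (intro continuous_intros) (auto simp: abs_le_iff)
  have \<theta>r: "t0 \<le> \<theta> s" "\<theta> s \<le> t0 + pi" if "s \<in> {tau0..tau1}" for s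
    using ang_props(3,4)[OF e ann[OF that] \<sigma> Xge[OF that]] by (auto simp: \<theta>_def t0e)
  have co: "xc e (W s) (\<theta> s) = X s" "yc e (W s) (\<theta> s) = Y s" if "s \<in> {tau0..tau1}" for s
    using ang_props(1,2)[OF e ann[OF that] \<sigma> Xge[OF that]] by (auto simp: \<theta>_def W_def)
  have Wrange: "A - 3 * \<delta> < W s" "W s < B + 3 * \<delta>" "W s > sqrt e" "A - 2 * \<delta> < W0" "W0 < B + 2 * \<delta>" if "s \<in> {tau0..tau1}" for s
    using Wle[OF that] start \<delta> W0e unfolding W0_def[symmetric] by linarith+
  have ders: "(W has_real_derivative eps * zeta e n a b (W s) (\<theta> s)) (at s) \<and>
      (\<theta> has_real_derivative speed e n a b eps (W s) (\<theta> s)) (at s)" if s: "tau0 < s" "s < tau1" for s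
  proof -
    have scl: "s \<in> {tau0..tau1}" using s by auto
    note io = in_open[OF s]
    have dX: "(X has_real_derivative fx e n a eps (X s) (Y s)) (at s)"
      and dY: "(Y has_real_derivative fy n b eps (X s) (Y s)) (at s)" using derX derY s io t1 by auto
    obtain W' C' where W': "(W has_real_derivative W') (at s)"
      and C': "((\<lambda>s. cc e (X s) (Y s)) has_real_derivative C') (at s)"
      using ww_cc_differentiable[OF e ann[OF scl] dX dY] by (auto simp: W_def)
    have "X s \<noteq> 0" using io \<sigma> by auto
    hence lt: "-1 < cc e (X s) (Y s)" "cc e (X s) (Y s) < 1" using annulus_circle(4)[OF e ann[OF scl]] by (auto simp: abs_less_iff)
    have "((\<lambda>s. arccos (cc e (X s) (Y s))) has_real_derivative inverse (- sqrt (1 - (cc e (X s) (Y s))\<^sup>2)) * C') (at s)"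
      by (rule DERIV_chain2[OF DERIV_arccos[OF lt] C'])
    from DERIV_add[OF DERIV_const[of pi] DERIV_cmult[OF DERIV_diff[OF this DERIV_const[of pi]], of \<sigma>]]
    have "\<exists>T'. (\<theta> has_real_derivative T') (at s)" unfolding \<theta>_def ang_def by blast
    then obtain T' where T': "(\<theta> has_real_derivative T') (at s)" by blast
    have w0: "W s > 0" using Wrange(3)[OF scl] sqrte by linarith
    note cd = coords_derivative[OF w0 W' T', of e]
    have op: "open {tau0<..<tau1}" "s \<in> {tau0<..<tau1}" using s by auto
    have "(X has_real_derivative xw e (W s) (\<theta> s) * W' + xt e (W s) (\<theta> s) * T') (at s)"
      by (rule has_field_derivative_transform_within_open[OF cd(1) op]) (use co in auto)
    hence 1: "xw e (W s) (\<theta> s) * W' + xt e (W s) (\<theta> s) * T' = fx e n a eps (X s) (Y s)" using dX DERIV_unique by blast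
    have "(Y has_real_derivative yw e (W s) (\<theta> s) * W' + yt e (W s) (\<theta> s) * T') (at s)"
      by (rule has_field_derivative_transform_within_open[OF cd(2) op]) (use co in auto)
    hence 2: "yw e (W s) (\<theta> s) * W' + yt e (W s) (\<theta> s) * T' = fy n b eps (X s) (Y s)" using dY DERIV_unique by blast
    have "W' = eps * zeta e n a b (W s) (\<theta> s) \<and> T' = speed e n a b eps (W s) (\<theta> s)"
      using field_coords[OF e Wrange(3)[OF scl], of "\<theta> s" W' T' eps n a b] 1 2 co[OF scl]
      by (simp add: fx_def fy_def)
    thus ?thesis using W' T' by blast
  qed
  have tr: "0 \<le> \<theta> s \<and> \<theta> s \<le> 2 * pi" if "s \<in> {tau0..tau1}" for s
    using \<theta>r[OF that] t0 by auto
  have bnd: "m \<le> speed e n a b eps (W s) (\<theta> s)" "speed e n a b eps (W s) (\<theta> s) \<le> M"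
    "\<bar>slope e n a b eps (W s) (\<theta> s)\<bar> \<le> M" if "s \<in> {tau0..tau1}" for s
    using real_bounds[OF eps _ _ Wrange(1,2)[OF that]] tr[OF that] by auto
  have zs: "zeta e n a b (W s) (\<theta> s) = slope e n a b eps (W s) (\<theta> s) * speed e n a b eps (W s) (\<theta> s)" if "s \<in> {tau0..tau1}" for s
    using bnd(1)[OF that] pos by (simp add: slope_def)
  have grow: "m * (s - r) \<le> \<theta> s - \<theta> r" if "tau0 \<le> r" "r < s" "s \<le> tau1" for r s
  proof -
    have "\<exists>l z. r < z \<and> z < s \<and> DERIV \<theta> z :> l \<and> \<theta> s - \<theta> r = (s - r) * l"
      by (rule MVT[OF that(2)]) (use that c\<theta> ders in \<open>auto intro: continuous_on_subset simp: real_differentiable_def, force\<close>)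
    then obtain l z where z: "r < z" "z < s" "DERIV \<theta> z :> l" "\<theta> s - \<theta> r = (s - r) * l" by blast
    have "l = speed e n a b eps (W z) (\<theta> z)" using ders[of z] z that DERIV_unique by fastforce
    hence "m \<le> l" using bnd(1)[of z] z that by auto
    thus ?thesis using z(4) that by (simp add: mult.commute mult_right_mono)
  qed
  have time: "tau1 - tau0 \<le> pi / m"
    using grow[of tau0 tau1] t1 \<theta>r[of tau0] \<theta>r[of tau1] pos by (simp add: field_simps)
  have Wclose: "\<bar>W s - W0\<bar> \<le> \<delta> / 4" if s: "s \<in> {tau0..tau1}" for s
  proof (cases "s = tau0")
    case False
    hence ls: "tau0 < s" using s by auto
    have "\<exists>l z. tau0 < z \<and> z < s \<and> DERIV W z :> l \<and> W s - W tau0 = (s - tau0) * l"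
      by (rule MVT[OF ls]) (use s cW ders in \<open>auto intro: continuous_on_subset simp: real_differentiable_def, force\<close>)
    then obtain l z where z: "tau0 < z" "z < s" "DERIV W z :> l" "W s - W tau0 = (s - tau0) * l" by blast
    have zc: "z \<in> {tau0..tau1}" using z s by auto
    have "l = eps * zeta e n a b (W z) (\<theta> z)" using ders[of z] z s DERIV_unique by fastforce
    hence "\<bar>l\<bar> = \<bar>eps\<bar> * (\<bar>slope e n a b eps (W z) (\<theta> z)\<bar> * \<bar>speed e n a b eps (W z) (\<theta> z)\<bar>)"
      by (simp add: zs[OF zc] abs_mult)
    also have "\<dots> \<le> eps1 * (M * M)"
      using eps bnd[OF zc] pos by (intro mult_mono) auto
    finally have l: "\<bar>l\<bar> \<le> eps1 * (M * M)" .
    have "\<bar>W s - W0\<bar> = (s - tau0) * \<bar>l\<bar>" using z(4) ls by (simp add: W0_def abs_mult)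
    also have "\<dots> \<le> pi / m * (eps1 * (M * M))"
      using time s l pos ls by (intro mult_mono) auto
    also have "\<dots> \<le> \<delta> / 4" using smallness(3) by (simp add: mult_ac)
    finally show ?thesis .
  qed (use \<delta> in \<open>auto simp: W0_def\<close>)
  have stop: "X tau1 \<noteq> 0 \<and> tau1 = T \<or> X tau1 = 0 \<and> \<theta> tau1 = t0 + pi"
  proof (rule ccontr)
    assume c: "\<not> ?thesis"
    have e1: "tau1 \<in> {tau0..tau1}" using t1 by auto
    show False
    proof (cases "X tau1 = 0")
      case True
      have "\<theta> tau1 > \<theta> tau0" using grow[of tau0 tau1] t1 pos by (smt (verit) mult_pos_pos)
      hence g: "\<theta> tau1 > t0" using \<theta>r(1)[of tau0] t1 by auto
      hence l: "\<theta> tau1 < t0 + pi" using c True \<theta>r(2)[OF e1] by auto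
      have "xc e (W tau1) (\<theta> tau1) = 0" using co[OF e1] True by simp
      moreover have "(W tau1)\<^sup>2 - e \<noteq> 0" "W tau1 \<noteq> 0"
      proof -
        have "W tau1 > sqrt e" using Wrange(3)[OF e1] .
        thus "W tau1 \<noteq> 0" "(W tau1)\<^sup>2 - e \<noteq> 0" using sqrte e
          by (auto simp: real_sqrt_unique)
      qed
      ultimately have s0: "sin (\<theta> tau1) = 0" by (auto simp: xc_def)
      show False
      proof (cases "\<sigma> = 1")
        case True
        thus False using s0 g l sin_gt_zero[of "\<theta> tau1"] by (simp add: t0e)
      next
        case False
        thus False using s0 g l sin_lt_zero[of "\<theta> tau1"] by (simp add: t0e)
      qed
    next
      case False
      hence lt: "tau1 < T" using c t1 by auto
      have xp: "\<sigma> * X tau1 > 0" using False Xge[OF e1] \<sigma> by auto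
      have "\<bar>W tau1 - W0\<bar> < \<delta> / 2" using Wclose[OF e1] \<delta> by linarith
      then obtain d where d: "d > 0" "\<And>r. r \<in> {tau0..T} \<Longrightarrow> \<bar>r - tau1\<bar> < d \<Longrightarrow> annulus e (X r) (Y r) \<and> \<bar>W r - W0\<bar> < \<delta> / 2"
        using near[of tau1] ann[OF e1] sub e1 by blast
      have "continuous_on {tau0..T} (\<lambda>s. \<sigma> * X s)" using cont by (intro continuous_intros)
      then obtain d2 where d2: "d2 > 0" "\<And>r. r \<in> {tau0..T} \<Longrightarrow> dist r tau1 < d2 \<Longrightarrow> dist (\<sigma> * X r) (\<sigma> * X tau1) < \<sigma> * X tau1"
        using xp t1 unfolding continuous_on_iff by (metis atLeastAtMost_iff less_imp_le)
      define s where "s = min T (tau1 + min d d2)"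
      have sg: "s > tau1" "s \<le> T" using lt d(1) d2(1) by (auto simp: s_def)
      have "good s"
        unfolding good_def
      proof (intro conjI allI impI)
        fix r assume r: "tau0 < r \<and> r < s"
        have *: "\<sigma> * X r > 0 \<and> annulus e (X r) (Y r) \<and> \<bar>W r - W0\<bar> < \<delta> / 2"
        proof (cases "r < tau1")
          case True
          thus ?thesis using in_open r by blast
        next
          case False
          hence rr: "r \<in> {tau0..T}" "\<bar>r - tau1\<bar> < d" "dist r tau1 < d2" using r t1 by (auto simp: s_def dist_real_def)
          thus ?thesis using d(2) d2(2)[OF rr(1,3)] by (auto simp: dist_real_def)
        qed
        thus "\<sigma> * X r > 0" "annulus e (X r) (Y r)" "\<bar>W r - W0\<bar> < \<delta> / 2" by blast+
      qed (use sg t1 in auto)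
      hence "s \<le> tau1" unfolding tau1_def using bdd by (intro cSup_upper) auto
      thus False using sg by simp
    qed
  qed
  have uniq: "\<forall>s\<in>{tau0..tau1}. W s = psi W0 (\<theta> s)" if th0: "\<theta> tau0 = t0"
  proof -
    define E where "E s = W s - psi W0 (\<theta> s)" for s
    have e0: "tau0 \<in> {tau0..tau1}" using t1 by auto
    note pp = psi_props[OF Wrange(4,5)[OF e0]]
    have cE: "continuous_on {tau0..tau1} E" unfolding E_def
      by (intro continuous_intros cW continuous_on_compose2[OF pp(2) c\<theta>]) (use \<theta>r in auto)
    have "\<exists>s\<in>{tau0..tau1}. \<forall>r\<in>{tau0..tau1}. \<bar>E r\<bar> \<le> \<bar>E s\<bar>"
      using continuous_attains_sup[of "{tau0..tau1}" "\<lambda>s. \<bar>E s\<bar>"] cE t1 by (auto intro!: continuous_intros)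
    then obtain s where s: "s \<in> {tau0..tau1}" "\<And>r. r \<in> {tau0..tau1} \<Longrightarrow> \<bar>E r\<bar> \<le> \<bar>E s\<bar>" by blast
    have E0: "E tau0 = 0" using pp(1) th0 by (simp add: E_def W0_def)
    have "\<bar>E s\<bar> \<le> \<bar>E s\<bar> / 2"
    proof (cases "s = tau0")
      case False
      hence ls: "tau0 < s" using s by auto
      have dE: "(E has_real_derivative eps * zeta e n a b (W z) (\<theta> z) - (eps * slope e n a b eps (psi W0 (\<theta> z)) (\<theta> z)) * speed e n a b eps (W z) (\<theta> z)) (at z)"
        if z: "tau0 < z" "z < tau1" for z
      proof -
        have zc: "z \<in> {tau0..tau1}" using z by auto
        have "\<theta> tau0 < \<theta> z" "\<theta> z < \<theta> tau1"
          using grow[of tau0 z] grow[of z tau1] z pos by (smt (verit) mult_pos_pos)+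
        hence int: "\<theta> z \<in> {t0<..<t0 + pi}" using \<theta>r(1)[OF e0] \<theta>r(2)[of tau1] t1 by auto
        have "(psi W0 has_real_derivative eps * slope e n a b eps (psi W0 (\<theta> z)) (\<theta> z)) (at (\<theta> z) within {t0..t0 + pi})"
          by (rule pp(5)) (use int in auto)
        moreover have "at (\<theta> z) within {t0..t0 + pi} = at (\<theta> z)"
          by (rule at_within_interior) (use int in auto)
        ultimately have dpsi: "(psi W0 has_real_derivative eps * slope e n a b eps (psi W0 (\<theta> z)) (\<theta> z)) (at (\<theta> z))" by simp
        have dd: "(W has_real_derivative eps * zeta e n a b (W z) (\<theta> z)) (at z)"
          "(\<theta> has_real_derivative speed e n a b eps (W z) (\<theta> z)) (at z)" using ders[OF z] by auto
        show ?thesis unfolding E_def by (rule DERIV_diff[OF dd(1) DERIV_chain2[OF dpsi dd(2)]])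
      qed
      have "\<exists>l z. tau0 < z \<and> z < s \<and> DERIV E z :> l \<and> E s - E tau0 = (s - tau0) * l"
        by (rule MVT[OF ls]) (use s cE dE in \<open>auto intro: continuous_on_subset simp: real_differentiable_def, force\<close>)
      then obtain l z where z: "tau0 < z" "z < s" "DERIV E z :> l" "E s - E tau0 = (s - tau0) * l" by blast
      have zc: "z \<in> {tau0..tau1}" "z < tau1" using z s by auto
      have lz: "l = eps * zeta e n a b (W z) (\<theta> z) - (eps * slope e n a b eps (psi W0 (\<theta> z)) (\<theta> z)) * speed e n a b eps (W z) (\<theta> z)"
        using dE[OF z(1) zc(2)] z(3) DERIV_unique by blast
      also have "\<dots> = eps * speed e n a b eps (W z) (\<theta> z) * (slope e n a b eps (W z) (\<theta> z) - slope e n a b eps (psi W0 (\<theta> z)) (\<theta> z))"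
        unfolding zs[OF zc(1)] by (simp add: algebra_simps)
      finally have lz: "\<bar>l\<bar> = \<bar>eps\<bar> * \<bar>speed e n a b eps (W z) (\<theta> z)\<bar> * \<bar>slope e n a b eps (W z) (\<theta> z) - slope e n a b eps (psi W0 (\<theta> z)) (\<theta> z)\<bar>"
        by (simp add: abs_mult)
      also have "\<dots> \<le> eps1 * M * (M / \<delta> * \<bar>E s\<bar>)"
      proof (intro mult_mono)
        have "\<theta> z \<in> {t0..t0+pi}" using \<theta>r[OF zc(1)] by auto
        from pp(4)[OF this] have "\<bar>slope e n a b eps (W z) (\<theta> z) - slope e n a b eps (psi W0 (\<theta> z)) (\<theta> z)\<bar> \<le> M / \<delta> * \<bar>W z - psi W0 (\<theta> z)\<bar>"
          using real_lipschitz[OF eps _ _ Wrange(1,2)[OF zc(1)]] tr[OF zc(1)] by auto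
        also have "\<dots> \<le> M / \<delta> * \<bar>E s\<bar>"
          using s(2)[OF zc(1)] pos \<delta> by (intro mult_left_mono) (auto simp: E_def)
        finally show "\<bar>slope e n a b eps (W z) (\<theta> z) - slope e n a b eps (psi W0 (\<theta> z)) (\<theta> z)\<bar> \<le> M / \<delta> * \<bar>E s\<bar>" .
      qed (use eps bnd[OF zc(1)] pos in auto)
      finally have l: "\<bar>l\<bar> \<le> eps1 * M * (M / \<delta> * \<bar>E s\<bar>)" .
      have "\<bar>E s\<bar> = (s - tau0) * \<bar>l\<bar>" using z(4) ls E0 by (simp add: abs_mult)
      also have "\<dots> \<le> pi / m * (eps1 * M * (M / \<delta> * \<bar>E s\<bar>))"
        using time s l pos ls by (intro mult_mono) auto
      also have "\<dots> = (pi / m * (M * eps1 * (M / \<delta>))) * \<bar>E s\<bar>" by simp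
      also have "\<dots> \<le> 1 / 2 * \<bar>E s\<bar>" using smallness(4) by (rule mult_right_mono) simp
      finally show ?thesis by simp
    qed (use E0 in auto)
    hence "E r = 0" if "r \<in> {tau0..tau1}" for r using s(2)[OF that] by auto
    thus ?thesis by (auto simp: E_def)
  qed
  have op: "\<forall>s. tau0 < s \<and> s < tau1 \<longrightarrow> \<sigma> * X s > 0" using in_open by blast
  have clo: "\<forall>s\<in>{tau0..tau1}. annulus e (X s) (Y s) \<and> \<sigma> * X s \<ge> 0 \<and> \<bar>W s - W tau0\<bar> \<le> \<delta> / 4"
    using ann Xge Wclose by (simp add: W0_def)
  show ?thesis
    using t1 time op clo stop c\<theta> uniq unfolding W0_def by (intro exI[of _ tau1]) blast
qed

end

definition vf :: "real \<Rightarrow> nat \<Rightarrow> (nat \<Rightarrow> nat \<Rightarrow> real) \<Rightarrow> (nat \<Rightarrow> nat \<Rightarrow> real) \<Rightarrow> real \<Rightarrow> real \<times> real \<Rightarrow> real \<times> real" where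
  "vf e n a b eps p = (fx e n a eps (fst p) (snd p), fy n b eps (fst p) (snd p))"

lemma vf_continuous: "continuous_on S g \<Longrightarrow> continuous_on S (\<lambda>s. vf e n a b eps (g s))"
  unfolding vf_def fx_def fy_def pev_def by (intro continuous_intros) auto

context half_flow
begin

text \<open>Solve the angle equation along \<open>psi\<close> first, by inverting the time as a function of the angle, and map the result to the plane.\<close>

lemma solution_exists:
  fixes tau0 w :: real
  assumes w: "A - 2 * \<delta> < w" "w < B + 2 * \<delta>" and t0c: "t0 = 0 \<or> t0 = pi"
  shows "\<exists>gam T. T > tau0 \<and> continuous_on {tau0..T} gam \<and> gam tau0 = (0, yc e w t0) \<and>
     gam T = (0, yc e (psi w (t0 + pi)) (t0 + pi)) \<and>
     (\<forall>s\<in>{tau0<..<T}. (gam has_vector_derivative vf e n a b eps (gam s)) (at s)) \<and>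
     (\<forall>s\<in>{tau0..T}. \<exists>t\<in>{t0..t0 + pi}. \<exists>v>sqrt e. gam s = (xc e v t, yc e v t))"
proof -
  note pp = psi_props[OF w]
  have tr: "0 \<le> t \<and> t \<le> 2 * pi" if "t \<in> {t0..t0 + pi}" for t using that t0 by auto
  have sb: "m \<le> speed e n a b eps (psi w t) t" if "t \<in> {t0..t0 + pi}" for t
    using real_bounds(1)[OF eps] tr[OF that] pp(4)[OF that] by blast
  have we: "psi w t > sqrt e" if "t \<in> {t0..t0 + pi}" for t using pp(4)[OF that] A \<delta> by linarith
  have sqrte: "sqrt e > 0" using e by simp
  have cs: "continuous_on {t0..t0 + pi} (\<lambda>t. speed e n a b eps (psi w t) t)"
  proof -
    have "continuous_on ((\<lambda>t. (of_real (psi w t), t)) ` {t0..t0 + pi}) (\<lambda>x. speed e n a b eps (fst x :: complex) (snd x))"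
      unfolding speed_def by (intro continuous_intros coords_continuous e) (use we in auto)
    moreover have "continuous_on {t0..t0 + pi} (\<lambda>t. (complex_of_real (psi w t), t))"
      by (intro continuous_intros pp(2))
    ultimately have "continuous_on {t0..t0 + pi} (\<lambda>t. speed e n a b eps (fst (complex_of_real (psi w t), t)) (snd (complex_of_real (psi w t), t)))"
      by (rule continuous_on_compose2) auto
    hence "continuous_on {t0..t0 + pi} (\<lambda>t. speed e n a b eps (of_real (psi w t) :: complex) t)"
      by (simp only: fst_conv snd_conv)
    hence "continuous_on {t0..t0 + pi} (\<lambda>t. Re (of_real (speed e n a b eps (psi w t) t)))"
      unfolding of_real_slope by (rule continuous_on_Re)
    thus ?thesis by simp
  qed
  define sp where "sp t = speed e n a b eps (psi w t) t" for t
  have sp0: "sp t > 0" if "t \<in> {t0..t0 + pi}" for t using sb[OF that] pos by (simp add: sp_def)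
  have ci: "continuous_on {t0..t0 + pi} (\<lambda>t. 1 / sp t)"
    using cs sp0 unfolding sp_def by (intro continuous_intros) (auto simp: less_imp_neq[symmetric])
  define S where "S t = tau0 + integral {t0..t} (\<lambda>r. 1 / sp r)" for t
  have dS: "(S has_real_derivative 1 / sp t) (at t within {t0..t0 + pi})" if "t \<in> {t0..t0 + pi}" for t
    unfolding has_real_derivative_iff_has_vector_derivative S_def[abs_def]
    using integral_has_vector_derivative[OF ci that] by (auto intro!: derivative_eq_intros)
  have dSi: "(S has_real_derivative 1 / sp t) (at t)" if "t \<in> {t0<..<t0 + pi}" for t
    using dS[of t] that at_within_interior[of t "{t0..t0+pi}"] by auto
  have cS: "continuous_on {t0..t0 + pi} S" using dS by (rule DERIV_continuous_on)
  have mono: "S r < S t" if "t0 \<le> r" "r < t" "t \<le> t0 + pi" for r t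
  proof -
    have "\<exists>l z. r < z \<and> z < t \<and> DERIV S z :> l \<and> S t - S r = (t - r) * l"
    proof (rule MVT[OF that(2)])
      show "continuous_on {r..t} S" by (rule continuous_on_subset[OF cS]) (use that in auto)
      show "S differentiable (at x)" if "r < x" "x < t" for x
        using dSi[of x] that \<open>t0 \<le> r\<close> \<open>t \<le> t0 + pi\<close> by (auto simp: real_differentiable_def)
    qed
    then obtain l z where z: "r < z" "z < t" "DERIV S z :> l" "S t - S r = (t - r) * l" by blast
    have zi: "z \<in> {t0<..<t0+pi}" using z that by auto
    have "l = 1 / sp z" using dSi[OF zi] z(3) DERIV_unique by blast
    hence "l > 0" using sp0[of z] zi by auto
    thus ?thesis using z(4) that by (metis diff_gt_0_iff_gt mult_pos_pos)
  qed
  have inj: "inj_on S {t0..t0 + pi}"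
    using mono by (intro linorder_inj_onI) (force simp: )+
  define T where "T = S (t0 + pi)"
  have S0: "S t0 = tau0" by (simp add: S_def)
  have T: "T > tau0" using mono[of t0 "t0 + pi"] by (simp add: T_def S0)
  have img: "S ` {t0..t0 + pi} = {tau0..T}"
  proof
    show "S ` {t0..t0 + pi} \<subseteq> {tau0..T}"
    proof clarify
      fix t assume "t \<in> {t0..t0 + pi}"
      thus "S t \<in> {tau0..T}" using mono[of t0 t] mono[of t "t0 + pi"] S0 T_def
        by (cases "t = t0"; cases "t = t0 + pi") auto
    qed
    show "{tau0..T} \<subseteq> S ` {t0..t0 + pi}"
    proof
      fix y assume "y \<in> {tau0..T}"
      hence "\<exists>x. t0 \<le> x \<and> x \<le> t0 + pi \<and> S x = y"
        using cS S0 by (intro IVT') (auto simp: T_def)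
      thus "y \<in> S ` {t0..t0 + pi}" by auto
    qed
  qed
  define g where "g = the_inv_into {t0..t0 + pi} S"
  have gS: "g (S t) = t" if "t \<in> {t0..t0 + pi}" for t
    unfolding g_def by (rule the_inv_into_f_f[OF inj that])
  have Sg: "S (g s) = s" "g s \<in> {t0..t0 + pi}" if "s \<in> {tau0..T}" for s
    using that f_the_inv_into_f[OF inj] the_inv_into_into[OF inj _ order_refl] unfolding img[symmetric] g_def by auto
  have cg: "continuous_on {tau0..T} g"
    unfolding img[symmetric] by (rule continuous_on_inv[OF cS]) (use gS in auto)
  have gint: "g s \<in> {t0<..<t0 + pi}" if "s \<in> {tau0<..<T}" for s
  proof -
    have "g s \<noteq> t0" "g s \<noteq> t0 + pi" using Sg(1)[of s] S0 T_def that by auto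
    thus ?thesis using Sg(2)[of s] that by auto
  qed
  have dg: "(g has_real_derivative sp (g s)) (at s)" if s: "s \<in> {tau0<..<T}" for s
  proof -
    have "isCont g s" using cg s by (simp add: continuous_on_interior)
    moreover have "sp (g s) > 0" using sp0 Sg(2) s by auto
    ultimately have "DERIV g s :> inverse (1 / sp (g s))"
      using dSi[OF gint[OF s]] s Sg(1)
      by (intro DERIV_inverse_function[where f = S and a = tau0 and b = T]) auto
    thus ?thesis by simp
  qed
  define gam where "gam s = (xc e (psi w (g s)) (g s) :: real, yc e (psi w (g s)) (g s) :: real)" for s
  have cp: "continuous_on {tau0..T} (\<lambda>s. psi w (g s))"
    by (rule continuous_on_compose2[OF pp(2) cg]) (use Sg in auto)
  have pg: "psi w (g s) > sqrt e" if "s \<in> {tau0..T}" for s using we Sg(2)[OF that] by blast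
  have pg0: "psi w (g s) > 0" if "s \<in> {tau0..T}" for s using pg[OF that] sqrte by linarith
  have cgam: "continuous_on {tau0..T} gam"
    unfolding gam_def by (intro continuous_intros coords_continuous_real cp cg pg0)
  have dgam: "(gam has_vector_derivative vf e n a b eps (gam s)) (at s)" if s: "s \<in> {tau0<..<T}" for s
  proof -
    have sc: "s \<in> {tau0..T}" using s by auto
    have "(psi w has_real_derivative eps * slope e n a b eps (psi w (g s)) (g s)) (at (g s))"
      using pp(5)[of "g s"] gint[OF s] at_within_interior[of "g s" "{t0..t0+pi}"] by auto
    from DERIV_chain2[OF this dg[OF s]]
    have dp: "((\<lambda>s. psi w (g s)) has_real_derivative eps * slope e n a b eps (psi w (g s)) (g s) * sp (g s)) (at s)" .
    have "eps * slope e n a b eps (psi w (g s)) (g s) * sp (g s) = eps * zeta e n a b (psi w (g s)) (g s)"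
      using sp0[OF Sg(2)[OF sc]] by (simp add: slope_def sp_def)
    with dp have dp: "((\<lambda>s. psi w (g s)) has_real_derivative eps * zeta e n a b (psi w (g s)) (g s)) (at s)" by simp
    note cd = coords_derivative[OF pg0[OF sc] dp dg[OF s], of e]
    have "xw e (psi w (g s)) (g s) * (eps * zeta e n a b (psi w (g s)) (g s)) + xt e (psi w (g s)) (g s) * sp (g s) = fst (vf e n a b eps (gam s))"
      "yw e (psi w (g s)) (g s) * (eps * zeta e n a b (psi w (g s)) (g s)) + yt e (psi w (g s)) (g s) * sp (g s) = snd (vf e n a b eps (gam s))"
      using field_coords[OF e pg[OF sc], of "g s" "eps * zeta e n a b (psi w (g s)) (g s)" "sp (g s)" eps n a b]
      by (simp_all add: sp_def vf_def fx_def fy_def gam_def)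
    with cd have "((\<lambda>s. xc e (psi w (g s)) (g s)) has_vector_derivative fst (vf e n a b eps (gam s))) (at s)"
      "((\<lambda>s. yc e (psi w (g s)) (g s)) has_vector_derivative snd (vf e n a b eps (gam s))) (at s)"
      by (simp_all add: has_real_derivative_iff_has_vector_derivative)
    from has_vector_derivative_Pair[OF this] show ?thesis by (simp add: gam_def[abs_def])
  qed
  have g0: "g tau0 = t0" "g T = t0 + pi" using gS[of t0] gS[of "t0 + pi"] S0 T_def by auto
  have x0: "xc e v t0 = (0 :: real)" "xc e v (t0 + pi) = (0 :: real)" for v using t0c by (auto simp: xc_def)
  have g1: "gam tau0 = (0, yc e w t0)" "gam T = (0, yc e (psi w (t0 + pi)) (t0 + pi))"
    using pp(1) x0 by (simp_all add: gam_def g0)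
  have "\<forall>s\<in>{tau0..T}. \<exists>t\<in>{t0..t0 + pi}. \<exists>v>sqrt e. gam s = (xc e v t, yc e v t)"
    using Sg(2) pg gam_def by blast
  thus ?thesis using T cgam g1 dgam by (intro exI[of _ gam] exI[of _ T]) blast
qed

end

section \<open>Solutions of the differential inclusion\<close>

text \<open>The Filippov field of two polynomial fields that are separated by the line \<open>x = 0\<close>.\<close>

definition filF :: "real \<Rightarrow> nat \<Rightarrow> (nat \<Rightarrow> nat \<Rightarrow> real) \<Rightarrow> (nat \<Rightarrow> nat \<Rightarrow> real) \<Rightarrow> (nat \<Rightarrow> nat \<Rightarrow> real) \<Rightarrow> (nat \<Rightarrow> nat \<Rightarrow> real)
    \<Rightarrow> real \<Rightarrow> real \<times> real \<Rightarrow> (real \<times> real) set" where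
  "filF e n a1 b1 a2 b2 eps p =
     (if fst p > 0 then {vf e n a1 b1 eps p} else if fst p < 0 then {vf e n a2 b2 eps p}
      else convex hull {vf e n a1 b1 eps p, vf e n a2 b2 eps p})"

lemma inclusion_solution_subset:
  "inclusion_solution F gam I \<Longrightarrow> J \<subseteq> I \<Longrightarrow> inclusion_solution F gam J"
  unfolding inclusion_solution_def by (meson subsetD)

lemma inclusion_solution_cong:
  assumes "inclusion_solution F gam I" "\<And>t. t \<in> I \<Longrightarrow> gam t = gam' t"
  shows "inclusion_solution F gam' I"
  using assms unfolding inclusion_solution_def by (metis (no_types, lifting))

lemma inclusion_solution_glue:
  fixes F :: "real \<times> real \<Rightarrow> (real \<times> real) set"
  assumes 1: "inclusion_solution F gam {a..b}" and 2: "inclusion_solution F gam {b..c}" and abc: "a \<le> b" "b \<le> c"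
  shows "inclusion_solution F gam {a..c}"
proof -
  obtain v1 where v1: "\<And>t. t \<in> {a..b} \<Longrightarrow> v1 t \<in> F (gam t)"
    "\<And>s t. s \<in> {a..b} \<Longrightarrow> t \<in> {a..b} \<Longrightarrow> s \<le> t \<Longrightarrow> (v1 has_integral (gam t - gam s)) {s..t}"
    using 1 unfolding inclusion_solution_def by blast
  obtain v2 where v2: "\<And>t. t \<in> {b..c} \<Longrightarrow> v2 t \<in> F (gam t)"
    "\<And>s t. s \<in> {b..c} \<Longrightarrow> t \<in> {b..c} \<Longrightarrow> s \<le> t \<Longrightarrow> (v2 has_integral (gam t - gam s)) {s..t}"
    using 2 unfolding inclusion_solution_def by blast
  define v where "v t = (if t \<le> b then v1 t else v2 t)" for t
  have i1: "(v has_integral (gam t - gam s)) {s..t}" if "s \<in> {a..b}" "t \<in> {a..b}" "s \<le> t" for s t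
    by (rule has_integral_eq[OF _ v1(2)[OF that]]) (use that in \<open>auto simp: v_def\<close>)
  have i2: "(v has_integral (gam t - gam s)) {s..t}" if "s \<in> {b..c}" "t \<in> {b..c}" "s \<le> t" for s t
    by (rule has_integral_spike_finite[of "{b}", OF _ _ v2(2)[OF that]]) (use that in \<open>auto simp: v_def\<close>)
  have "(v has_integral (gam t - gam s)) {s..t}" if st: "s \<in> {a..c}" "t \<in> {a..c}" "s \<le> t" for s t
  proof (cases "t \<le> b")
    case True
    thus ?thesis using i1 st by auto
  next
    case False
    show ?thesis
    proof (cases "s \<ge> b")
      case True
      thus ?thesis using i2 st by auto
    next
      case f2: False
      have "(v has_integral ((gam b - gam s) + (gam t - gam b))) {s..t}"
      proof (rule has_integral_combine)
        show "s \<le> b" "b \<le> t" using False f2 by auto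
        show "(v has_integral (gam b - gam s)) {s..b}" by (rule i1) (use f2 st abc in auto)
        show "(v has_integral (gam t - gam b)) {b..t}" by (rule i2) (use False st abc in auto)
      qed
      thus ?thesis by simp
    qed
  qed
  moreover have "v t \<in> F (gam t)" if "t \<in> {a..c}" for t
    using v1(1)[of t] v2(1)[of t] that by (auto simp: v_def)
  ultimately show ?thesis unfolding inclusion_solution_def by blast
qed

lemma inclusion_solution_ode:
  fixes gam V :: "real \<Rightarrow> real \<times> real"
  assumes "continuous_on {a..b} gam" "\<And>s. s \<in> {a<..<b} \<Longrightarrow> (gam has_vector_derivative V s) (at s)"
    "\<And>s. s \<in> {a..b} \<Longrightarrow> V s \<in> F (gam s)"
  shows "inclusion_solution F gam {a..b}"
  unfolding inclusion_solution_def
proof (intro exI[of _ V] conjI ballI impI)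
  fix s t assume st: "s \<in> {a..b}" "t \<in> {a..b}" "s \<le> t"
  show "(V has_integral (gam t - gam s)) {s..t}"
    by (rule fundamental_theorem_of_calculus_interior[OF st(3)])
       (use assms(1,2) st in \<open>auto intro: continuous_on_subset\<close>)
qed (use assms in auto)

lemma inclusion_solution_continuous:
  fixes F :: "real \<times> real \<Rightarrow> (real \<times> real) set"
  assumes "inclusion_solution F gam {a..b}"
  shows "continuous_on {a..b} gam"
proof (cases "a \<le> b")
  case True
  obtain v where v: "\<And>s t. s \<in> {a..b} \<Longrightarrow> t \<in> {a..b} \<Longrightarrow> s \<le> t \<Longrightarrow> (v has_integral (gam t - gam s)) {s..t}"
    using assms unfolding inclusion_solution_def by blast
  have "v integrable_on {a..b}" using v[of a b] True by (auto simp: integrable_on_def)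
  hence "continuous_on {a..b} (\<lambda>t. gam a + integral {a..t} v)"
    by (intro continuous_intros indefinite_integral_continuous_1)
  thus ?thesis
  proof (rule continuous_on_eq)
    fix t assume "t \<in> {a..b}"
    hence "(v has_integral (gam t - gam a)) {a..t}" using v[of a t] True by auto
    thus "gam a + integral {a..t} v = gam t" by (simp add: integral_unique)
  qed
qed auto

text \<open>Off the switching line the inclusion has one value, which is continuous, so that the integral form can be differentiated.\<close>

lemma inclusion_solution_derivative:
  fixes F :: "real \<times> real \<Rightarrow> (real \<times> real) set"
  assumes sol: "inclusion_solution F gam {a..b}" and s: "a < s" "s < b"
    and U: "open U" "gam s \<in> U" and F: "\<And>p. p \<in> U \<Longrightarrow> F p = {G p}" and G: "continuous_on U G"
  shows "(gam has_vector_derivative G (gam s)) (at s)"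
proof -
  have c: "continuous_on {a..b} gam" by (rule inclusion_solution_continuous[OF sol])
  obtain v where v: "\<And>t. t \<in> {a..b} \<Longrightarrow> v t \<in> F (gam t)"
    "\<And>s t. s \<in> {a..b} \<Longrightarrow> t \<in> {a..b} \<Longrightarrow> s \<le> t \<Longrightarrow> (v has_integral (gam t - gam s)) {s..t}"
    using sol unfolding inclusion_solution_def by blast
  obtain r where r: "r > 0" "ball (gam s) r \<subseteq> U" using U open_contains_ball by blast
  obtain d where d: "d > 0" "\<And>q. q \<in> {a..b} \<Longrightarrow> dist q s < d \<Longrightarrow> dist (gam q) (gam s) < r"
    using c r(1) s unfolding continuous_on_iff by (metis atLeastAtMost_iff less_imp_le)
  define d' where "d' = min (d / 2) (min (s - a) (b - s))"
  have d': "d' > 0" "d' < d" "a \<le> s - d'" "s + d' \<le> b" using d s by (auto simp: d'_def)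
  let ?I = "{s - d'..s + d'}"
  have inU: "gam q \<in> U" if "q \<in> ?I" for q
    using d(2)[of q] that d' r(2) by (force simp: dist_real_def dist_commute)
  have vG: "v q = G (gam q)" if "q \<in> ?I" for q
    using v(1)[of q] F[OF inU[OF that]] that d' by auto
  have cG: "continuous_on ?I (\<lambda>q. G (gam q))"
    by (rule continuous_on_compose2[OF G]) (use c inU d' in \<open>auto intro: continuous_on_subset\<close>)
  have "((\<lambda>u. gam (s - d') + integral {s - d'..u} (\<lambda>q. G (gam q))) has_vector_derivative G (gam s)) (at s within ?I)"
    using integral_has_vector_derivative[OF cG, of s] d' by (auto intro!: derivative_eq_intros)
  hence "(gam has_vector_derivative G (gam s)) (at s within ?I)"
  proof (rule has_vector_derivative_transform[rotated 2])
    fix u assume u: "u \<in> ?I"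
    have "((\<lambda>q. G (gam q)) has_integral (gam u - gam (s - d'))) {s - d'..u}"
      by (rule has_integral_eq[OF _ v(2)[of "s - d'" u]]) (use vG u d' in auto)
    thus "gam u = gam (s - d') + integral {s - d'..u} (\<lambda>q. G (gam q))" by (simp add: integral_unique)
  qed (use d' in auto)
  moreover have "at s within ?I = at s" using d' by (intro at_within_interior) auto
  ultimately show ?thesis by simp
qed

text \<open>Where both fields cross the line in the same direction, all selections of the inclusion have horizontal component of that sign, by
convexity and continuity; so a solution must enter the half-plane.\<close>

lemma inclusion_solution_enters:
  fixes F :: "real \<times> real \<Rightarrow> (real \<times> real) set"
  assumes sol: "inclusion_solution F gam {a..b}" and ab: "a < b"
    and F: "\<And>p. F p \<subseteq> convex hull {G1 p, G2 p}" and G: "continuous_on UNIV G1" "continuous_on UNIV G2"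
    and x0: "fst (gam a) = 0" and pos: "\<sigma> * fst (G1 (gam a)) > 0" "\<sigma> * fst (G2 (gam a)) > 0"
  shows "\<exists>s>a. \<forall>r. a < r \<and> r < s \<longrightarrow> \<sigma> * fst (gam r) > 0"
proof -
  have c: "continuous_on {a..b} gam" by (rule inclusion_solution_continuous[OF sol])
  obtain v where v: "\<And>t. t \<in> {a..b} \<Longrightarrow> v t \<in> F (gam t)"
    "\<And>s t. s \<in> {a..b} \<Longrightarrow> t \<in> {a..b} \<Longrightarrow> s \<le> t \<Longrightarrow> (v has_integral (gam t - gam s)) {s..t}"
    using sol unfolding inclusion_solution_def by blast
  define k where "k = min (\<sigma> * fst (G1 (gam a))) (\<sigma> * fst (G2 (gam a))) / 2"
  have k: "k > 0" "k < \<sigma> * fst (G1 (gam a))" "k < \<sigma> * fst (G2 (gam a))" using pos by (auto simp: k_def)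
  let ?U = "{p. k < \<sigma> * fst (G1 p)} \<inter> {p. k < \<sigma> * fst (G2 p)}"
  have "open ?U" using G by (intro open_Int open_Collect_less continuous_intros)
  moreover have "gam a \<in> ?U" using k by auto
  ultimately obtain r where r: "r > 0" "ball (gam a) r \<subseteq> ?U" using open_contains_ball by blast
  obtain d where d: "d > 0" "\<And>q. q \<in> {a..b} \<Longrightarrow> dist q a < d \<Longrightarrow> dist (gam q) (gam a) < r"
    using c r(1) ab unfolding continuous_on_iff by (metis atLeastAtMost_iff less_imp_le order_refl)
  have inU: "gam q \<in> ?U" if "q \<in> {a..b}" "q < a + d" for q
  proof -
    have "gam q \<in> ball (gam a) r" using d(2)[of q] that by (simp add: dist_real_def dist_commute)
    thus ?thesis using r(2) by blast
  qed
  have vk: "k \<le> \<sigma> * fst (v q)" if "q \<in> {a..b}" "q < a + d" for q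
  proof -
    have "{p. k \<le> \<sigma> * fst p} = {p :: real \<times> real. inner (\<sigma>, 0) p \<ge> k}"
      by (auto simp: inner_prod_def)
    hence conv: "convex {p :: real \<times> real. k \<le> \<sigma> * fst p}" by (simp only: convex_halfspace_ge)
    have "convex hull {G1 (gam q), G2 (gam q)} \<subseteq> {p. k \<le> \<sigma> * fst p}"
      by (rule hull_minimal[where S = convex, OF _ conv]) (use inU[OF that] in auto)
    thus ?thesis using v(1)[OF that(1)] F by blast
  qed
  have "\<sigma> * fst (gam r) > 0" if r: "a < r" "r < min b (a + d)" for r
  proof -
    have "(v has_integral (gam r - gam a)) {a..r}" using v(2)[of a r] r by auto
    from has_integral_mult_right[OF has_integral_linear[OF this bounded_linear_fst], of \<sigma>]
    have vi: "((\<lambda>q. \<sigma> * fst (v q)) has_integral \<sigma> * fst (gam r)) {a..r}"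
      by (simp add: o_def x0)
    have ki: "((\<lambda>q. k) has_integral (r - a) * k) {a..r}"
      using has_integral_const_real[of k a r] r by simp
    have "(r - a) * k \<le> \<sigma> * fst (gam r)"
      by (rule has_integral_le[OF ki vi]) (use vk r in auto)
    moreover have "(r - a) * k > 0" using r k by simp
    ultimately show ?thesis by linarith
  qed
  thus ?thesis using ab d(1) by (intro exI[of _ "min b (a + d)"]) auto
qed

section \<open>The return map\<close>

text \<open>The right half-plane is passed in the angle range \<open>{0..pi}\<close> with the first field, the left one in \<open>{pi..2 * pi}\<close> with the second.\<close>

locale full_turn =
  R: half_flow n a1 b1 e A B \<delta> eps1 m1 M1 eps 0 + L: half_flow n a2 b2 e A B \<delta> eps2 m2 M2 eps pi
  for n :: nat and a1 b1 a2 b2 :: "nat \<Rightarrow> nat \<Rightarrow> real" and e A B \<delta> eps1 m1 M1 eps2 m2 M2 eps :: real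
begin

abbreviation "F \<equiv> filF e n a1 b1 a2 b2 eps"

definition ret :: "real \<Rightarrow> real" where
  "ret w = L.psi (R.psi w pi) (2 * pi)"

definition Tmax :: real where
  "Tmax = pi / m1 + pi / m2 + 1"

lemma speeds_pos:
  assumes "A - 3 * \<delta> < w" "w < B + 3 * \<delta>" "0 \<le> t" "t \<le> 2 * pi"
  shows "speed e n a1 b1 eps w t > 0" "speed e n a2 b2 eps w t > 0"
  using R.real_bounds(1)[OF R.eps assms(3,4,1,2)] L.real_bounds(1)[OF L.eps assms(3,4,1,2)] R.pos L.pos by linarith+

lemma fx_axis:
  assumes "w > sqrt e" "sin t = 0"
  shows "fx e n a eps (xc e w t) (yc e w t) = xt e w t * speed e n a b eps w t"
  using field_coords[OF R.e assms(1), of t "eps * zeta e n a b w t" "speed e n a b eps w t" eps n a b] assms(2)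
  by (simp add: fx_def xw_def)

text \<open>On the axis the field is transversal to the switching line and crosses it in the clockwise direction.\<close>

lemma fx_axis_sign:
  assumes w: "A - 3 * \<delta> < w" "w < B + 3 * \<delta>" and \<sigma>: "\<sigma> = 1 \<or> \<sigma> = -1" and t: "t = (if \<sigma> = 1 then 0 else pi)"
  shows "\<sigma> * fst (vf e n a1 b1 eps (xc e w t, yc e w t)) > 0" "\<sigma> * fst (vf e n a2 b2 eps (xc e w t, yc e w t)) > 0"
proof -
  have we: "w > sqrt e" using w R.A R.\<delta> by linarith
  have w0: "w > 0" using we real_sqrt_gt_zero[OF R.e] by linarith
  have w2: "w\<^sup>2 > e" using we w0 R.e by (metis real_less_rsqrt real_sqrt_less_iff real_sqrt_abs abs_of_pos)
  have x: "\<sigma> * xt e w t > 0" using \<sigma> w0 w2 by (auto simp: t xt_def)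
  have s: "sin t = 0" "0 \<le> t" "t \<le> 2 * pi" using t by auto
  show "\<sigma> * fst (vf e n a1 b1 eps (xc e w t, yc e w t)) > 0" "\<sigma> * fst (vf e n a2 b2 eps (xc e w t, yc e w t)) > 0"
    using fx_axis[OF we s(1), of a1 b1] fx_axis[OF we s(1), of a2 b2] x speeds_pos[OF w s(2,3)]
    by (simp_all add: vf_def flip: mult.assoc)
qed

lemma sol_facts:
  assumes sol: "inclusion_solution F gam {tau0..T}" and \<sigma>: "\<sigma> = 1 \<or> \<sigma> = -1" and T: "tau0 < T"
    and ann: "annulus e (fst (gam tau0)) (snd (gam tau0))"
    and W: "A - \<delta> < ww e (fst (gam tau0)) (snd (gam tau0))" "ww e (fst (gam tau0)) (snd (gam tau0)) < B + \<delta>"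
    and start: "\<sigma> * fst (gam tau0) > 0 \<or> fst (gam tau0) = 0 \<and> ang e \<sigma> (fst (gam tau0)) (snd (gam tau0)) = (if \<sigma> = 1 then 0 else pi)"
  shows "continuous_on {tau0..T} (\<lambda>s. fst (gam s))" "continuous_on {tau0..T} (\<lambda>s. snd (gam s))"
    and "\<And>s. tau0 < s \<Longrightarrow> s < T \<Longrightarrow> \<sigma> * fst (gam s) > 0 \<Longrightarrow>
       ((\<lambda>s. fst (gam s)) has_real_derivative fx e n (if \<sigma> = 1 then a1 else a2) eps (fst (gam s)) (snd (gam s))) (at s)"
    and "\<And>s. tau0 < s \<Longrightarrow> s < T \<Longrightarrow> \<sigma> * fst (gam s) > 0 \<Longrightarrow>
       ((\<lambda>s. snd (gam s)) has_real_derivative fy n (if \<sigma> = 1 then b1 else b2) eps (fst (gam s)) (snd (gam s))) (at s)"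
    and "\<exists>s>tau0. \<forall>r. tau0 < r \<and> r < s \<longrightarrow> \<sigma> * fst (gam r) > 0"
proof -
  have c: "continuous_on {tau0..T} gam" by (rule inclusion_solution_continuous[OF sol])
  show c1: "continuous_on {tau0..T} (\<lambda>s. fst (gam s))" and "continuous_on {tau0..T} (\<lambda>s. snd (gam s))"
    using continuous_on_fst[OF c] continuous_on_snd[OF c] by auto
  define G where "G = vf e n (if \<sigma> = 1 then a1 else a2) (if \<sigma> = 1 then b1 else b2) eps"
  have der: "(gam has_vector_derivative G (gam s)) (at s)" if s: "tau0 < s" "s < T" "\<sigma> * fst (gam s) > 0" for s
  proof (rule inclusion_solution_derivative[OF sol s(1,2)])
    show "open {p :: real \<times> real. \<sigma> * fst p > 0}" by (intro open_Collect_less continuous_intros)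
    show "gam s \<in> {p. \<sigma> * fst p > 0}" using s by simp
    show "F p = {G p}" if "p \<in> {p. \<sigma> * fst p > 0}" for p
      using that \<sigma> by (auto simp: filF_def G_def)
    show "continuous_on {p. \<sigma> * fst p > 0} G" unfolding G_def by (rule vf_continuous[OF continuous_on_id])
  qed
  show "((\<lambda>s. fst (gam s)) has_real_derivative fx e n (if \<sigma> = 1 then a1 else a2) eps (fst (gam s)) (snd (gam s))) (at s)"
    if "tau0 < s" "s < T" "\<sigma> * fst (gam s) > 0" for s
    using bounded_linear.has_vector_derivative[OF bounded_linear_fst der[OF that]]
    by (simp add: has_real_derivative_iff_has_vector_derivative G_def vf_def)
  show "((\<lambda>s. snd (gam s)) has_real_derivative fy n (if \<sigma> = 1 then b1 else b2) eps (fst (gam s)) (snd (gam s))) (at s)"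
    if "tau0 < s" "s < T" "\<sigma> * fst (gam s) > 0" for s
    using bounded_linear.has_vector_derivative[OF bounded_linear_snd der[OF that]]
    by (simp add: has_real_derivative_iff_has_vector_derivative G_def vf_def)
  show "\<exists>s>tau0. \<forall>r. tau0 < r \<and> r < s \<longrightarrow> \<sigma> * fst (gam r) > 0"
  proof (cases "\<sigma> * fst (gam tau0) > 0")
    case True
    have "continuous_on {tau0..T} (\<lambda>s. \<sigma> * fst (gam s))" by (rule continuous_on_mult_left[OF c1])
    then obtain d where d: "d > 0" "\<And>r. r \<in> {tau0..T} \<Longrightarrow> dist r tau0 < d \<Longrightarrow> dist (\<sigma> * fst (gam r)) (\<sigma> * fst (gam tau0)) < \<sigma> * fst (gam tau0)"
      using True T unfolding continuous_on_iff by (metis atLeastAtMost_iff less_imp_le order_refl)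
    have "\<sigma> * fst (gam r) > 0" if "tau0 < r \<and> r < min T (tau0 + d)" for r
      using d(2)[of r] that by (auto simp: dist_real_def)
    thus ?thesis using T d(1) by (intro exI[of _ "min T (tau0 + d)"]) auto
  next
    case False
    hence x0: "fst (gam tau0) = 0" and an: "ang e \<sigma> (fst (gam tau0)) (snd (gam tau0)) = (if \<sigma> = 1 then 0 else pi)"
      using start by auto
    define w where "w = ww e (fst (gam tau0)) (snd (gam tau0))"
    have g: "gam tau0 = (xc e w (if \<sigma> = 1 then 0 else pi), yc e w (if \<sigma> = 1 then 0 else pi))"
      using ang_props(1,2)[OF R.e ann \<sigma>] x0 an by (simp add: w_def prod_eq_iff)
    have "A - 3 * \<delta> < w" "w < B + 3 * \<delta>" using W R.\<delta> unfolding w_def by linarith+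
    note sg = fx_axis_sign[OF this \<sigma> refl, folded g]
    show ?thesis
    proof (rule inclusion_solution_enters[OF sol T])
      show "F p \<subseteq> convex hull {vf e n a1 b1 eps p, vf e n a2 b2 eps p}" for p
        by (auto simp: filF_def intro: hull_inc)
      show "continuous_on UNIV (vf e n a1 b1 eps)" "continuous_on UNIV (vf e n a2 b2 eps)"
        by (rule vf_continuous[OF continuous_on_id])+
      show "\<sigma> * fst (vf e n a1 b1 eps (gam tau0)) > 0" "\<sigma> * fst (vf e n a2 b2 eps (gam tau0)) > 0"
        by (fact sg)+
    qed (use x0 in auto)
  qed
qed

lemma half_turn_right:
  assumes sol: "inclusion_solution F gam {tau0..T}" and T: "tau0 < T"
    and ann: "annulus e (fst (gam tau0)) (snd (gam tau0))"
    and W: "A - \<delta> < ww e (fst (gam tau0)) (snd (gam tau0))" "ww e (fst (gam tau0)) (snd (gam tau0)) < B + \<delta>"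
    and start: "fst (gam tau0) > 0 \<or> fst (gam tau0) = 0 \<and> ang e 1 (fst (gam tau0)) (snd (gam tau0)) = 0"
  defines "W \<equiv> \<lambda>s. ww e (fst (gam s)) (snd (gam s))" and "\<theta> \<equiv> \<lambda>s. ang e 1 (fst (gam s)) (snd (gam s))"
  shows "\<exists>tau1. tau0 < tau1 \<and> tau1 \<le> T \<and> tau1 - tau0 \<le> pi / m1 \<and> (\<forall>s. tau0 < s \<and> s < tau1 \<longrightarrow> fst (gam s) > 0) \<and>
    (\<forall>s\<in>{tau0..tau1}. annulus e (fst (gam s)) (snd (gam s)) \<and> fst (gam s) \<ge> 0 \<and> \<bar>W s - W tau0\<bar> \<le> \<delta> / 4) \<and>
    (fst (gam tau1) \<noteq> 0 \<and> tau1 = T \<or> fst (gam tau1) = 0 \<and> \<theta> tau1 = pi) \<and> continuous_on {tau0..tau1} \<theta> \<and>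
    (\<theta> tau0 = 0 \<longrightarrow> (\<forall>s\<in>{tau0..tau1}. W s = R.psi (W tau0) (\<theta> s)))"
proof -
  note sf = sol_facts[OF sol _ T ann W, of 1, simplified, OF start]
  show ?thesis
    using R.half_turn[of 1 tau0 T "\<lambda>s. fst (gam s)" "\<lambda>s. snd (gam s)", simplified, OF T sf(1-4) ann W sf(5)]
    unfolding W_def \<theta>_def by simp
qed

lemma half_turn_left:
  assumes sol: "inclusion_solution F gam {tau0..T}" and T: "tau0 < T"
    and ann: "annulus e (fst (gam tau0)) (snd (gam tau0))"
    and W: "A - \<delta> < ww e (fst (gam tau0)) (snd (gam tau0))" "ww e (fst (gam tau0)) (snd (gam tau0)) < B + \<delta>"
    and start: "fst (gam tau0) < 0 \<or> fst (gam tau0) = 0 \<and> ang e (-1) (fst (gam tau0)) (snd (gam tau0)) = pi"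
  defines "W \<equiv> \<lambda>s. ww e (fst (gam s)) (snd (gam s))" and "\<theta> \<equiv> \<lambda>s. ang e (-1) (fst (gam s)) (snd (gam s))"
  shows "\<exists>tau1. tau0 < tau1 \<and> tau1 \<le> T \<and> tau1 - tau0 \<le> pi / m2 \<and> (\<forall>s. tau0 < s \<and> s < tau1 \<longrightarrow> fst (gam s) < 0) \<and>
    (\<forall>s\<in>{tau0..tau1}. annulus e (fst (gam s)) (snd (gam s)) \<and> fst (gam s) \<le> 0 \<and> \<bar>W s - W tau0\<bar> \<le> \<delta> / 4) \<and>
    (fst (gam tau1) \<noteq> 0 \<and> tau1 = T \<or> fst (gam tau1) = 0 \<and> \<theta> tau1 = 2 * pi) \<and> continuous_on {tau0..tau1} \<theta> \<and>
    (\<theta> tau0 = pi \<longrightarrow> (\<forall>s\<in>{tau0..tau1}. W s = L.psi (W tau0) (\<theta> s)))"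
proof -
  note sf = sol_facts[OF sol _ T ann W, of "-1", simplified, OF start]
  show ?thesis
    using L.half_turn[of "-1" tau0 T "\<lambda>s. fst (gam s)" "\<lambda>s. snd (gam s)", simplified, OF T sf(1-4) ann W sf(5)]
    unfolding W_def \<theta>_def by simp
qed

lemma axis_top:
  assumes "w > sqrt e"
  shows "annulus e 0 (w\<^sup>2 + e)" "ww e 0 (w\<^sup>2 + e) = w" "ang e 1 0 (w\<^sup>2 + e) = 0" "ang e (-1) 0 (w\<^sup>2 + e) = 2 * pi"
    "yc e w 0 = w\<^sup>2 + e" "yc e w (2 * pi) = w\<^sup>2 + e" "w\<^sup>2 + e > 2 * e" "xc e w 0 = (0::real)" "xc e w (2 * pi) = (0::real)"
proof -
  have w0: "w > 0" using assms real_sqrt_gt_zero[OF R.e] by linarith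
  have w2: "w\<^sup>2 > e" using assms w0 R.e by (metis real_less_rsqrt real_sqrt_less_iff real_sqrt_abs abs_of_pos)
  show x: "xc e w 0 = (0::real)" "xc e w (2 * pi) = (0::real)" by (simp_all add: xc_def)
  show y: "yc e w 0 = w\<^sup>2 + e" "yc e w (2 * pi) = w\<^sup>2 + e" using w0 by (simp_all add: yc_def)
  show ann: "annulus e 0 (w\<^sup>2 + e)" and ww: "ww e 0 (w\<^sup>2 + e) = w" using ww_coords[OF R.e assms, of 0] x y by auto
  have "cc e 0 (w\<^sup>2 + e) = ((w\<^sup>2 + e) - (w\<^sup>2 + e)\<^sup>2 / (2 * w\<^sup>2)) / ((w\<^sup>2 + e) * (w\<^sup>2 - e) / (2 * w\<^sup>2))"
    by (simp add: cc_def ww)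
  also have "(w\<^sup>2 + e) - (w\<^sup>2 + e)\<^sup>2 / (2 * w\<^sup>2) = (w\<^sup>2 + e) * (w\<^sup>2 - e) / (2 * w\<^sup>2)"
  proof -
    have "(k + e) - (k + e)\<^sup>2 / (2 * k) = (k + e) * (k - e) / (2 * k)" if "k > 0" for k :: real
      using that by (simp add: field_simps power2_eq_square)
    thus ?thesis using w0 by simp
  qed
  finally have "cc e 0 (w\<^sup>2 + e) = 1" using w0 w2 R.e by simp
  thus "ang e 1 0 (w\<^sup>2 + e) = 0" "ang e (-1) 0 (w\<^sup>2 + e) = 2 * pi" by (simp_all add: ang_def)
  show "w\<^sup>2 + e > 2 * e" using w2 by simp
qed

lemma axis_angle:
  assumes ann: "annulus e 0 y"
  shows "(ang e 1 0 y = 0 \<and> ang e (-1) 0 y = 2 * pi \<and> y = (ww e 0 y)\<^sup>2 + e \<and> y > 2 * e) \<or>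
         (ang e 1 0 y = pi \<and> ang e (-1) 0 y = pi \<and> y < 2 * e)"
proof -
  note ac = annulus_circle[OF R.e ann]
  have we: "ww e 0 y > sqrt e" using ww_props(1)[OF R.e ann] .
  have w0: "ww e 0 y > 0" using we real_sqrt_gt_zero[OF R.e] by linarith
  have w2: "(ww e 0 y)\<^sup>2 > e" using we w0 R.e by (metis real_less_rsqrt real_sqrt_less_iff real_sqrt_abs abs_of_pos)
  have "1 - (cc e 0 y)\<^sup>2 = 0" using ac(1) w0 w2 by auto
  hence "cc e 0 y = 1 \<or> cc e 0 y = -1" by (simp add: power2_eq_1_iff)
  thus ?thesis
  proof
    assume c: "cc e 0 y = 1"
    have "y = (ww e 0 y)\<^sup>2 + e" using ac(3) w0 by (simp add: c)
    thus ?thesis using c w2 by (auto simp: ang_def)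
  next
    assume c: "cc e 0 y = -1"
    have "y = ((ww e 0 y)\<^sup>2 + e) * (2 * e) / (2 * (ww e 0 y)\<^sup>2)" using ac(3) by (simp add: c)
    also have "\<dots> < 2 * e"
    proof -
      have "e * ((ww e 0 y)\<^sup>2 + e) < e * (2 * (ww e 0 y)\<^sup>2)" using w2 R.e by (intro mult_strict_left_mono) auto
      thus ?thesis using w0 by (simp add: divide_less_eq mult.commute)
    qed
    finally show ?thesis using c by (auto simp: ang_def)
  qed
qed

end

lemma image_by_angle:
  fixes \<theta> :: "real \<Rightarrow> real"
  assumes "continuous_on {a..b} \<theta>" "a \<le> b" "\<theta> a = c" "\<theta> b = d"
    "\<And>s. s \<in> {a..b} \<Longrightarrow> c \<le> \<theta> s \<and> \<theta> s \<le> d \<and> gam s = h (\<theta> s)"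
  shows "gam ` {a..b} = h ` {c..d}"
proof
  show "gam ` {a..b} \<subseteq> h ` {c..d}" using assms(5) by auto
  show "h ` {c..d} \<subseteq> gam ` {a..b}"
  proof clarify
    fix t assume "t \<in> {c..d}"
    then obtain s where "a \<le> s" "s \<le> b" "\<theta> s = t"
      using IVT'[of \<theta> a t b] assms(1-4) by auto
    thus "h t \<in> gam ` {a..b}" using assms(5)[of s] by force
  qed
qed

context full_turn
begin

text \<open>One turn of the perturbed system that starts at \<open>(0, w\<^sup>2 + e)\<close>, as a point set.\<close>

definition orb :: "real \<Rightarrow> (real \<times> real) set" where
  "orb w = (\<lambda>t. (xc e (R.psi w t) t, yc e (R.psi w t) t)) ` {0..pi} \<union>
           (\<lambda>t. (xc e (L.psi (R.psi w pi) t) t, yc e (L.psi (R.psi w pi) t) t)) ` {pi..2 * pi}"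

lemma in_cross: "p \<in> cross_section (2 * e) \<longleftrightarrow> fst p = 0 \<and> snd p > 2 * e"
  by (cases p) (simp add: cross_section_def)

lemma psi_close:
  assumes "A - 2 * \<delta> < w" "w < B + 2 * \<delta>"
  shows "t \<in> {0..pi} \<Longrightarrow> \<bar>R.psi w t - w\<bar> \<le> \<delta> / 4" "t \<in> {pi..2*pi} \<Longrightarrow> \<bar>L.psi w t - w\<bar> \<le> \<delta> / 4"
proof -
  have "M1 * pi * \<bar>eps\<bar> \<le> M1 * pi * eps1" "M2 * pi * \<bar>eps\<bar> \<le> M2 * pi * eps2"
    using R.eps L.eps R.pos L.pos by (intro mult_left_mono; simp)+
  hence b: "M1 * pi * \<bar>eps\<bar> \<le> \<delta> / 4" "M2 * pi * \<bar>eps\<bar> \<le> \<delta> / 4"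
    using R.smallness(1) L.smallness(1) by (simp_all add: mult_ac)
  show "\<bar>R.psi w t - w\<bar> \<le> \<delta> / 4" if "t \<in> {0..pi}"
    using R.psi_props(3)[OF assms, of t] that b(1) by auto
  show "\<bar>L.psi w t - w\<bar> \<le> \<delta> / 4" if "t \<in> {pi..2*pi}"
    using L.psi_props(3)[OF assms, of t] that b(2) by auto
qed

lemma ret_close:
  assumes "A - \<delta> < w" "w < B + \<delta>"
  shows "\<bar>ret w - w\<bar> \<le> \<delta> / 2"
proof -
  have 1: "\<bar>R.psi w pi - w\<bar> \<le> \<delta> / 4" using psi_close(1)[of w pi] assms R.\<delta> by auto
  hence "A - 2 * \<delta> < R.psi w pi" "R.psi w pi < B + 2 * \<delta>" using assms R.\<delta> by linarith+
  from psi_close(2)[OF this, of "2 * pi"] have "\<bar>ret w - R.psi w pi\<bar> \<le> \<delta> / 4" by (simp add: ret_def)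
  thus ?thesis using 1 by linarith
qed

lemma ret_mono:
  assumes w: "A - \<delta> / 2 < w" "w < w'" "w' < B + \<delta> / 2"
  shows "ret w < ret w'"
proof -
  have "\<bar>R.psi w pi - w\<bar> \<le> \<delta> / 4" "\<bar>R.psi w' pi - w'\<bar> \<le> \<delta> / 4"
    using psi_close(1)[of w pi] psi_close(1)[of w' pi] w R.\<delta> by auto
  hence "A - \<delta> < R.psi w pi" "R.psi w' pi < B + \<delta>" using w R.\<delta> by linarith+
  moreover have "R.psi w pi < R.psi w' pi" using R.psi_mono[of w w'] w R.\<delta> by simp
  ultimately have "L.psi (R.psi w pi) (pi + pi) < L.psi (R.psi w' pi) (pi + pi)" by (intro L.psi_mono)
  thus ?thesis by (simp only: ret_def mult_2)
qed

text \<open>Either the solution ends before it returns, or it has passed both half-planes and met the section again exactly at the value of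
\<open>ret\<close>.\<close>

lemma turn:
  assumes sol: "inclusion_solution F gam {tau0..T}" and T: "tau0 < T"
    and w: "A - \<delta> / 2 < w" "w < B + \<delta> / 2" and g0: "gam tau0 = (0, w\<^sup>2 + e)"
  shows "(T - tau0 < Tmax \<and> (\<forall>tau. tau0 < tau \<and> tau \<le> T \<longrightarrow> gam tau \<notin> cross_section (2 * e))) \<or>
    (\<exists>tau2. tau0 < tau2 \<and> tau2 \<le> T \<and> tau2 - tau0 \<le> Tmax \<and> gam tau2 = (0, (ret w)\<^sup>2 + e) \<and>
       (\<forall>tau. tau0 < tau \<and> tau < tau2 \<longrightarrow> gam tau \<notin> cross_section (2 * e)) \<and> gam ` {tau0..tau2} = orb w)"
proof -
  have d: "\<delta> > 0" using R.\<delta> .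
  have we: "w > sqrt e" using w R.A d by linarith
  note at = axis_top[OF we]
  have pos: "pi / m1 > 0" "pi / m2 > 0" using R.pos L.pos by auto
  define W where "W s = ww e (fst (gam s)) (snd (gam s))" for s
  define \<theta>1 where "\<theta>1 s = ang e 1 (fst (gam s)) (snd (gam s))" for s
  define \<theta>2 where "\<theta>2 s = ang e (-1) (fst (gam s)) (snd (gam s))" for s
  have W0: "W tau0 = w" and th0: "\<theta>1 tau0 = 0" using at by (simp_all add: W_def \<theta>1_def g0)
  have "\<exists>tau1. tau0 < tau1 \<and> tau1 \<le> T \<and> tau1 - tau0 \<le> pi / m1 \<and> (\<forall>s. tau0 < s \<and> s < tau1 \<longrightarrow> fst (gam s) > 0) \<and>
    (\<forall>s\<in>{tau0..tau1}. annulus e (fst (gam s)) (snd (gam s)) \<and> fst (gam s) \<ge> 0 \<and> \<bar>W s - W tau0\<bar> \<le> \<delta> / 4) \<and>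
    (fst (gam tau1) \<noteq> 0 \<and> tau1 = T \<or> fst (gam tau1) = 0 \<and> \<theta>1 tau1 = pi) \<and> continuous_on {tau0..tau1} \<theta>1 \<and>
    (\<theta>1 tau0 = 0 \<longrightarrow> (\<forall>s\<in>{tau0..tau1}. W s = R.psi (W tau0) (\<theta>1 s)))"
    unfolding W_def \<theta>1_def by (rule half_turn_right[OF sol T]) (use at w d in \<open>auto simp: g0\<close>)
  then obtain tau1 where t1: "tau0 < tau1" "tau1 \<le> T" "tau1 - tau0 \<le> pi / m1"
    and p1: "\<And>s. tau0 < s \<Longrightarrow> s < tau1 \<Longrightarrow> fst (gam s) > 0"
    and q1: "\<And>s. s \<in> {tau0..tau1} \<Longrightarrow> annulus e (fst (gam s)) (snd (gam s)) \<and> fst (gam s) \<ge> 0 \<and> \<bar>W s - w\<bar> \<le> \<delta> / 4"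
    and e1: "fst (gam tau1) \<noteq> 0 \<and> tau1 = T \<or> fst (gam tau1) = 0 \<and> \<theta>1 tau1 = pi"
    and c1: "continuous_on {tau0..tau1} \<theta>1" and u1: "\<And>s. s \<in> {tau0..tau1} \<Longrightarrow> W s = R.psi w (\<theta>1 s)"
    unfolding W0 using th0 by blast
  show ?thesis
  proof (cases "fst (gam tau1) = 0")
    case False
    hence "tau1 = T" using e1 by blast
    hence "gam tau \<notin> cross_section (2 * e)" if "tau0 < tau" "tau \<le> T" for tau
      using p1[of tau] False that by (cases "tau = T") (auto simp: in_cross)
    thus ?thesis using t1 \<open>tau1 = T\<close> pos by (auto simp: Tmax_def)
  next
    case x1: True
    hence th1: "\<theta>1 tau1 = pi" using e1 by blast
    have e1': "tau1 \<in> {tau0..tau1}" using t1 by auto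
    have ann1: "annulus e 0 (snd (gam tau1))" using q1[OF e1'] x1 by simp
    have th1': "ang e (-1) (fst (gam tau1)) (snd (gam tau1)) = pi" and y1: "snd (gam tau1) < 2 * e"
      using axis_angle[OF ann1] th1 x1 by (auto simp: \<theta>1_def)
    have W1: "W tau1 = R.psi w pi" using u1[OF e1'] th1 by simp
    have W1r: "A - \<delta> < W tau1" "W tau1 < B + \<delta>" using q1[OF e1'] w d by linarith+
    have img1: "gam ` {tau0..tau1} = (\<lambda>t. (xc e (R.psi w t) t, yc e (R.psi w t) t)) ` {0..pi}"
    proof (rule image_by_angle[OF c1 less_imp_le[OF t1(1)] th0 th1])
      fix s assume s: "s \<in> {tau0..tau1}"
      note ap = ang_props[OF R.e, of "fst (gam s)" "snd (gam s)" 1]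
      show "0 \<le> \<theta>1 s \<and> \<theta>1 s \<le> pi \<and> gam s = (xc e (R.psi w (\<theta>1 s)) (\<theta>1 s), yc e (R.psi w (\<theta>1 s)) (\<theta>1 s))"
        using ap q1[OF s] u1[OF s] by (simp add: \<theta>1_def W_def prod_eq_iff)
    qed
    have nc1: "gam tau \<notin> cross_section (2 * e)" if "tau0 < tau" "tau \<le> tau1" for tau
      using p1[of tau] that y1 by (cases "tau = tau1") (auto simp: in_cross)
    show ?thesis
    proof (cases "tau1 = T")
      case True
      thus ?thesis using nc1 t1 pos by (auto simp: Tmax_def)
    next
      case False
      hence T1: "tau1 < T" using t1 by auto
      have sol1: "inclusion_solution F gam {tau1..T}" by (rule inclusion_solution_subset[OF sol]) (use t1 in auto)
      have "\<exists>tau2. tau1 < tau2 \<and> tau2 \<le> T \<and> tau2 - tau1 \<le> pi / m2 \<and> (\<forall>s. tau1 < s \<and> s < tau2 \<longrightarrow> fst (gam s) < 0) \<and>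
        (\<forall>s\<in>{tau1..tau2}. annulus e (fst (gam s)) (snd (gam s)) \<and> fst (gam s) \<le> 0 \<and> \<bar>W s - W tau1\<bar> \<le> \<delta> / 4) \<and>
        (fst (gam tau2) \<noteq> 0 \<and> tau2 = T \<or> fst (gam tau2) = 0 \<and> \<theta>2 tau2 = 2 * pi) \<and> continuous_on {tau1..tau2} \<theta>2 \<and>
        (\<theta>2 tau1 = pi \<longrightarrow> (\<forall>s\<in>{tau1..tau2}. W s = L.psi (W tau1) (\<theta>2 s)))"
        unfolding W_def \<theta>2_def
        by (rule half_turn_left[OF sol1 T1]) (use q1[OF e1'] W1r x1 th1' in \<open>auto simp: W_def\<close>)
      then obtain tau2 where t2: "tau1 < tau2" "tau2 \<le> T" "tau2 - tau1 \<le> pi / m2"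
        and p2: "\<And>s. tau1 < s \<Longrightarrow> s < tau2 \<Longrightarrow> fst (gam s) < 0"
        and q2: "\<And>s. s \<in> {tau1..tau2} \<Longrightarrow> annulus e (fst (gam s)) (snd (gam s)) \<and> fst (gam s) \<le> 0"
        and e2: "fst (gam tau2) \<noteq> 0 \<and> tau2 = T \<or> fst (gam tau2) = 0 \<and> \<theta>2 tau2 = 2 * pi"
        and c2: "continuous_on {tau1..tau2} \<theta>2" and u2: "\<And>s. s \<in> {tau1..tau2} \<Longrightarrow> W s = L.psi (R.psi w pi) (\<theta>2 s)"
        using th1' unfolding W1 \<theta>2_def[symmetric] by blast
      have nc2: "gam tau \<notin> cross_section (2 * e)" if "tau0 < tau" "tau < tau2" for tau
        using nc1[of tau] p2[of tau] that by (cases "tau \<le> tau1") (auto simp: in_cross)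
      have tt: "tau2 - tau0 < Tmax" using t1 t2 pos by (simp add: Tmax_def)
      show ?thesis
      proof (cases "fst (gam tau2) = 0")
        case False
        hence "tau2 = T" using e2 by blast
        hence "gam tau \<notin> cross_section (2 * e)" if "tau0 < tau" "tau \<le> T" for tau
          using nc2[of tau] False that by (cases "tau = T") (auto simp: in_cross)
        thus ?thesis using tt \<open>tau2 = T\<close> by auto
      next
        case x2: True
        hence th2: "\<theta>2 tau2 = 2 * pi" using e2 by blast
        have e2': "tau2 \<in> {tau1..tau2}" using t2 by auto
        have ann2: "annulus e 0 (snd (gam tau2))" using q2[OF e2'] x2 by simp
        have y2: "snd (gam tau2) = (ww e 0 (snd (gam tau2)))\<^sup>2 + e"
          using axis_angle[OF ann2] th2 x2 by (auto simp: \<theta>2_def)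
        have "ww e 0 (snd (gam tau2)) = ret w" using u2[OF e2'] th2 x2 by (simp add: W_def ret_def)
        hence g2: "gam tau2 = (0, (ret w)\<^sup>2 + e)" using y2 x2 by (simp add: prod_eq_iff)
        have img2: "gam ` {tau1..tau2} = (\<lambda>t. (xc e (L.psi (R.psi w pi) t) t, yc e (L.psi (R.psi w pi) t) t)) ` {pi..2*pi}"
        proof (rule image_by_angle[OF c2 less_imp_le[OF t2(1)] _ th2])
          show "\<theta>2 tau1 = pi" using th1' by (simp add: \<theta>2_def)
          fix s assume s: "s \<in> {tau1..tau2}"
          note ap = ang_props[OF R.e, of "fst (gam s)" "snd (gam s)" "-1"]
          show "pi \<le> \<theta>2 s \<and> \<theta>2 s \<le> 2 * pi \<and> gam s = (xc e (L.psi (R.psi w pi) (\<theta>2 s)) (\<theta>2 s), yc e (L.psi (R.psi w pi) (\<theta>2 s)) (\<theta>2 s))"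
            using ap q2[OF s] u2[OF s] by (simp add: \<theta>2_def W_def prod_eq_iff)
        qed
        have "{tau0..tau2} = {tau0..tau1} \<union> {tau1..tau2}" using t1 t2 by auto
        hence "gam ` {tau0..tau2} = orb w" unfolding orb_def img1[symmetric] img2[symmetric] by auto
        thus ?thesis using t1 t2 tt g2 nc2 by (intro disjI2 exI[of _ tau2]) auto
      qed
    qed
  qed
qed

text \<open>From a point of the annulus band that need not lie on the section, a solution still reaches the section at a position close by, so that it
cannot leave the controlled range unnoticed.\<close>

lemma follow:
  assumes sol: "inclusion_solution F gam {tau0..tau0 + Tmax}"
    and ann: "annulus e (fst (gam tau0)) (snd (gam tau0))" and mu: "ww e (fst (gam tau0)) (snd (gam tau0)) = \<mu>"
    and \<mu>: "A - \<delta> / 2 < \<mu>" "\<mu> < B + \<delta> / 2"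
  shows "\<exists>tau2 u. tau0 < tau2 \<and> gam tau2 = (0, u\<^sup>2 + e) \<and> u > sqrt e \<and> \<bar>u - \<mu>\<bar> \<le> \<delta> / 2 \<and>
    (\<forall>s\<in>{tau0..tau2}. \<bar>ww e (fst (gam s)) (snd (gam s)) - \<mu>\<bar> \<le> \<delta> / 2)"
proof -
  have d: "\<delta> > 0" using R.\<delta> .
  have pos: "pi / m1 > 0" "pi / m2 > 0" using R.pos L.pos by auto
  define T where "T = tau0 + Tmax"
  have T0: "tau0 < T" using pos by (simp add: T_def Tmax_def)
  have left: "\<exists>tau2 u. tau1 < tau2 \<and> gam tau2 = (0, u\<^sup>2 + e) \<and> u > sqrt e \<and> \<bar>u - ww e (fst (gam tau1)) (snd (gam tau1))\<bar> \<le> \<delta> / 4 \<and>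
    (\<forall>s\<in>{tau1..tau2}. \<bar>ww e (fst (gam s)) (snd (gam s)) - ww e (fst (gam tau1)) (snd (gam tau1))\<bar> \<le> \<delta> / 4)"
    if t1: "tau0 \<le> tau1" "tau1 - tau0 \<le> pi / m1" and ann1: "annulus e (fst (gam tau1)) (snd (gam tau1))"
      and W1: "A - \<delta> < ww e (fst (gam tau1)) (snd (gam tau1))" "ww e (fst (gam tau1)) (snd (gam tau1)) < B + \<delta>"
      and st: "fst (gam tau1) < 0 \<or> fst (gam tau1) = 0 \<and> ang e (-1) (fst (gam tau1)) (snd (gam tau1)) = pi" for tau1
  proof -
    have T1: "tau1 < T" using t1 pos by (simp add: T_def Tmax_def)
    have sol1: "inclusion_solution F gam {tau1..T}" unfolding T_def by (rule inclusion_solution_subset[OF sol]) (use t1 in auto)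
    from half_turn_left[OF sol1 T1 ann1 W1 st] obtain tau2 where t2: "tau1 < tau2" "tau2 \<le> T" "tau2 - tau1 \<le> pi / m2"
      and q2: "\<And>s. s \<in> {tau1..tau2} \<Longrightarrow> annulus e (fst (gam s)) (snd (gam s)) \<and> \<bar>ww e (fst (gam s)) (snd (gam s)) - ww e (fst (gam tau1)) (snd (gam tau1))\<bar> \<le> \<delta> / 4"
      and e2: "fst (gam tau2) \<noteq> 0 \<and> tau2 = T \<or> fst (gam tau2) = 0 \<and> ang e (-1) (fst (gam tau2)) (snd (gam tau2)) = 2 * pi"
      by blast
    have "tau2 \<noteq> T" using t1 t2 pos by (auto simp: T_def Tmax_def)
    hence x2: "fst (gam tau2) = 0" "ang e (-1) (fst (gam tau2)) (snd (gam tau2)) = 2 * pi" using e2 by auto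
    have e2': "tau2 \<in> {tau1..tau2}" using t2 by auto
    have ann2: "annulus e 0 (snd (gam tau2))" using q2[OF e2'] x2 by simp
    define u where "u = ww e 0 (snd (gam tau2))"
    have "snd (gam tau2) = u\<^sup>2 + e" using axis_angle[OF ann2] x2 by (auto simp: u_def)
    hence "gam tau2 = (0, u\<^sup>2 + e)" using x2 by (simp add: prod_eq_iff)
    moreover have "u > sqrt e" using ww_props(1)[OF R.e ann2] by (simp add: u_def)
    ultimately show ?thesis using t2(1) q2 q2[OF e2'] x2(1) by (intro exI[of _ tau2] exI[of _ u]) (auto simp: u_def)
  qed
  have W0: "A - \<delta> < ww e (fst (gam tau0)) (snd (gam tau0))" "ww e (fst (gam tau0)) (snd (gam tau0)) < B + \<delta>"
    using \<mu> mu d by auto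
  show ?thesis
  proof (cases "fst (gam tau0) < 0 \<or> fst (gam tau0) = 0 \<and> ang e (-1) (fst (gam tau0)) (snd (gam tau0)) = pi")
    case True
    then obtain tau2 u where *: "tau0 < tau2" "gam tau2 = (0, u\<^sup>2 + e)" "u > sqrt e" "\<bar>u - \<mu>\<bar> \<le> \<delta> / 4"
      "\<And>s. s \<in> {tau0..tau2} \<Longrightarrow> \<bar>ww e (fst (gam s)) (snd (gam s)) - \<mu>\<bar> \<le> \<delta> / 4"
      using left[of tau0] W0 ann pos unfolding mu by auto
    have "\<bar>ww e (fst (gam s)) (snd (gam s)) - \<mu>\<bar> \<le> \<delta> / 2" if "s \<in> {tau0..tau2}" for s using *(5)[OF that] d by linarith
    thus ?thesis using * d by (intro exI[of _ tau2] exI[of _ u]) auto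
  next
    case False
    hence st: "fst (gam tau0) > 0 \<or> fst (gam tau0) = 0 \<and> ang e 1 (fst (gam tau0)) (snd (gam tau0)) = 0"
      using axis_angle[of "snd (gam tau0)"] ann by (cases "fst (gam tau0) = 0") auto
    have sol0: "inclusion_solution F gam {tau0..T}" using sol by (simp add: T_def)
    from half_turn_right[OF sol0 T0 ann W0 st] obtain tau1 where t1: "tau0 < tau1" "tau1 \<le> T" "tau1 - tau0 \<le> pi / m1"
      and q1: "\<And>s. s \<in> {tau0..tau1} \<Longrightarrow> annulus e (fst (gam s)) (snd (gam s)) \<and> \<bar>ww e (fst (gam s)) (snd (gam s)) - \<mu>\<bar> \<le> \<delta> / 4"
      and e1: "fst (gam tau1) \<noteq> 0 \<and> tau1 = T \<or> fst (gam tau1) = 0 \<and> ang e 1 (fst (gam tau1)) (snd (gam tau1)) = pi"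
      unfolding mu by blast
    have "tau1 \<noteq> T" using t1 pos by (auto simp: T_def Tmax_def)
    hence x1: "fst (gam tau1) = 0" "ang e 1 (fst (gam tau1)) (snd (gam tau1)) = pi" using e1 by auto
    have e1': "tau1 \<in> {tau0..tau1}" using t1 by auto
    have ann1: "annulus e 0 (snd (gam tau1))" using q1[OF e1'] x1 by simp
    have th: "ang e (-1) (fst (gam tau1)) (snd (gam tau1)) = pi" using axis_angle[OF ann1] x1 by auto
    have W1: "A - \<delta> < ww e (fst (gam tau1)) (snd (gam tau1))" "ww e (fst (gam tau1)) (snd (gam tau1)) < B + \<delta>"
      using q1[OF e1'] \<mu> d by linarith+
    define W1 where "W1 = ww e (fst (gam tau1)) (snd (gam tau1))"
    obtain tau2 u where *: "tau1 < tau2" "gam tau2 = (0, u\<^sup>2 + e)" "u > sqrt e" "\<bar>u - W1\<bar> \<le> \<delta> / 4"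
      "\<And>s. s \<in> {tau1..tau2} \<Longrightarrow> \<bar>ww e (fst (gam s)) (snd (gam s)) - W1\<bar> \<le> \<delta> / 4"
      using left[of tau1] t1 q1[OF e1'] W1 x1 th unfolding W1_def by auto
    have c: "\<bar>W1 - \<mu>\<bar> \<le> \<delta> / 4" using q1[OF e1'] by (simp add: W1_def)
    have "\<bar>ww e (fst (gam s)) (snd (gam s)) - \<mu>\<bar> \<le> \<delta> / 2" if "s \<in> {tau0..tau2}" for s
    proof (cases "s \<le> tau1")
      case True
      thus ?thesis using q1[of s] that d by auto
    next
      case False
      hence "s \<in> {tau1..tau2}" using that by auto
      from *(5)[OF this] c show ?thesis by linarith
    qed
    moreover have "\<bar>u - \<mu>\<bar> \<le> \<delta> / 2" using *(4) c by linarith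
    ultimately show ?thesis using * t1 by (intro exI[of _ tau2] exI[of _ u]) auto
  qed
qed

text \<open>Glue the explicit solutions of the two half-planes.\<close>

lemma turn_exists:
  assumes w: "A - \<delta> / 2 < w" "w < B + \<delta> / 2"
  shows "\<exists>gam T. T > 0 \<and> inclusion_solution F gam {0..T} \<and> gam 0 = (0, w\<^sup>2 + e) \<and> gam T \<in> cross_section (2 * e)"
proof -
  have d: "\<delta> > 0" using R.\<delta> .
  define w1 where "w1 = R.psi w pi"
  have "\<bar>w1 - w\<bar> \<le> \<delta> / 4" using psi_close(1)[of w pi] w d by (auto simp: w1_def)
  hence w1: "A - 2 * \<delta> < w1" "w1 < B + 2 * \<delta>" "A - \<delta> < w1" "w1 < B + \<delta>" using w d by linarith+
  have we: "w > sqrt e" using w R.A d by linarith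
  have se: "sqrt e > 0" using R.e by simp
  have x_sign: "xc e v t \<ge> 0" if "v > sqrt e" "t \<in> {0..pi}" for v t :: real
  proof -
    have "v > 0" using that se by linarith
    moreover have "v\<^sup>2 > e" using that calculation R.e by (metis real_less_rsqrt real_sqrt_less_iff real_sqrt_abs abs_of_pos)
    ultimately show ?thesis using that sin_ge_zero[of t] by (auto simp: xc_def)
  qed
  have x_sign2: "xc e v t \<le> 0" if "v > sqrt e" "t \<in> {pi..2 * pi}" for v t :: real
  proof -
    have "v > 0" using that se by linarith
    moreover have "v\<^sup>2 > e" using that calculation R.e by (metis real_less_rsqrt real_sqrt_less_iff real_sqrt_abs abs_of_pos)
    moreover have "sin t \<le> 0" using that sin_ge_zero[of "t - pi"] by (simp add: sin_diff)
    ultimately show ?thesis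
      unfolding xc_def by (intro mult_nonneg_nonpos divide_nonneg_nonneg) auto
  qed
  obtain gam1 T1 where g1: "T1 > 0" "continuous_on {0..T1} gam1" "gam1 0 = (0, yc e w 0)" "gam1 T1 = (0, yc e w1 pi)"
    "\<And>s. s \<in> {0<..<T1} \<Longrightarrow> (gam1 has_vector_derivative vf e n a1 b1 eps (gam1 s)) (at s)"
    "\<And>s. s \<in> {0..T1} \<Longrightarrow> \<exists>t\<in>{0..pi}. \<exists>v>sqrt e. gam1 s = (xc e v t, yc e v t)"
    using R.solution_exists[of w 0] w d unfolding w1_def by auto
  obtain gam2 T2 where g2: "T2 > T1" "continuous_on {T1..T2} gam2" "gam2 T1 = (0, yc e w1 pi)" "gam2 T2 = (0, yc e (L.psi w1 (2*pi)) (2*pi))"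
    "\<And>s. s \<in> {T1<..<T2} \<Longrightarrow> (gam2 has_vector_derivative vf e n a2 b2 eps (gam2 s)) (at s)"
    "\<And>s. s \<in> {T1..T2} \<Longrightarrow> \<exists>t\<in>{pi..2*pi}. \<exists>v>sqrt e. gam2 s = (xc e v t, yc e v t)"
    using L.solution_exists[OF w1(1,2), of T1] unfolding mult_2[symmetric] by auto
  define gam where "gam s = (if s \<le> T1 then gam1 s else gam2 s)" for s
  have s1: "inclusion_solution F gam1 {0..T1}"
  proof (rule inclusion_solution_ode[where V = "\<lambda>s. vf e n a1 b1 eps (gam1 s)"])
    fix s assume s: "s \<in> {0..T1}"
    have "fst (gam1 s) \<ge> 0" using g1(6)[OF s] x_sign by auto
    thus "vf e n a1 b1 eps (gam1 s) \<in> F (gam1 s)" by (auto simp: filF_def intro: hull_inc)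
  qed (use g1 in auto)
  have s2: "inclusion_solution F gam2 {T1..T2}"
  proof (rule inclusion_solution_ode[where V = "\<lambda>s. vf e n a2 b2 eps (gam2 s)"])
    fix s assume s: "s \<in> {T1..T2}"
    have "fst (gam2 s) \<le> 0" using g2(6)[OF s] x_sign2 by auto
    thus "vf e n a2 b2 eps (gam2 s) \<in> F (gam2 s)" by (auto simp: filF_def intro: hull_inc)
  qed (use g2 in auto)
  have "inclusion_solution F gam {0..T2}"
  proof (rule inclusion_solution_glue)
    show "inclusion_solution F gam {0..T1}" by (rule inclusion_solution_cong[OF s1]) (auto simp: gam_def)
    show "inclusion_solution F gam {T1..T2}" by (rule inclusion_solution_cong[OF s2]) (use g1 g2 in \<open>auto simp: gam_def\<close>)
  qed (use g1 g2 in auto)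
  moreover have "gam 0 = (0, w\<^sup>2 + e)" using g1 axis_top(5)[OF we] by (simp add: gam_def)
  moreover have "gam T2 \<in> cross_section (2 * e)"
  proof -
    have "\<bar>L.psi w1 (2*pi) - w1\<bar> \<le> \<delta> / 4" using psi_close(2)[OF w1(1,2), of "2*pi"] by auto
    hence "L.psi w1 (2*pi) > sqrt e" using w1 R.A d by linarith
    from axis_top(6,7)[OF this] show ?thesis using g2 by (simp add: gam_def in_cross)
  qed
  ultimately show ?thesis using g1(1) g2(1) by (intro exI[of _ gam] exI[of _ T2]) auto
qed

text \<open>Existence by \<open>turn_exists\<close>, uniqueness by \<open>turn\<close>.\<close>

lemma first_return_iff:
  assumes w: "A - \<delta> / 2 < w" "w < B + \<delta> / 2"
  shows "first_return (2 * e) F (w\<^sup>2 + e) y' \<longleftrightarrow> y' = (ret w)\<^sup>2 + e"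
proof -
  have d: "\<delta> > 0" using R.\<delta> .
  have we: "w > sqrt e" using w R.A d by linarith
  have "\<bar>ret w - w\<bar> \<le> \<delta> / 2" using ret_close[of w] w d by auto
  hence re: "ret w > sqrt e" using w R.A d by linarith
  have cs: "(0, w\<^sup>2 + e) \<in> cross_section (2 * e)" "(0, (ret w)\<^sup>2 + e) \<in> cross_section (2 * e)"
    using axis_top(7)[OF we] axis_top(7)[OF re] by (auto simp: in_cross)
  show ?thesis
  proof
    assume "first_return (2 * e) F (w\<^sup>2 + e) y'"
    then obtain gam T where g: "T > 0" "inclusion_solution F gam {0..T}" "gam 0 = (0, w\<^sup>2 + e)" "gam T = (0, y')"
      "(0, y') \<in> cross_section (2 * e)" "\<And>t. 0 < t \<Longrightarrow> t < T \<Longrightarrow> gam t \<notin> cross_section (2 * e)"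
      unfolding first_return_def by blast
    from turn[OF g(2,1) w g(3)] obtain tau2 where "0 < tau2" "tau2 \<le> T" "gam tau2 = (0, (ret w)\<^sup>2 + e)"
      using g(1,4,5) by auto
    moreover from this have "tau2 = T" using g(6)[of tau2] cs(2) by fastforce
    ultimately show "y' = (ret w)\<^sup>2 + e" using g(4) by simp
  next
    assume y': "y' = (ret w)\<^sup>2 + e"
    obtain gam T where g: "T > 0" "inclusion_solution F gam {0..T}" "gam 0 = (0, w\<^sup>2 + e)" "gam T \<in> cross_section (2 * e)"
      using turn_exists[OF w] by blast
    from turn[OF g(2,1) w g(3)] obtain tau2 where t: "0 < tau2" "tau2 \<le> T" "gam tau2 = (0, (ret w)\<^sup>2 + e)"
      "\<forall>tau. 0 < tau \<and> tau < tau2 \<longrightarrow> gam tau \<notin> cross_section (2 * e)"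
      using g(1,4) by auto
    have "inclusion_solution F gam {0..tau2}" by (rule inclusion_solution_subset[OF g(2)]) (use t in auto)
    thus "first_return (2 * e) F (w\<^sup>2 + e) y'"
      unfolding first_return_def y' using t g(3) cs by blast
  qed
qed

lemma displacement_eq:
  assumes w: "A - \<delta> / 2 < w" "w < B + \<delta> / 2"
  shows "displacement (2 * e) F (w\<^sup>2 + e) = (ret w)\<^sup>2 - w\<^sup>2"
  using first_return_iff[OF w] by (simp add: displacement_def)

end

section \<open>Periodic orbits are single turns\<close>

text \<open>The first integral, cut off so that it is continuous on the whole plane; on the annulus nothing is cut off. It is only used to
find points of prescribed level on a path by the intermediate value theorem.\<close>

definition level :: "real \<Rightarrow> real \<times> real \<Rightarrow> real" where
  "level e p = min 0 (((fst p)\<^sup>2 - snd p + e) / (max (snd p) (e / 2))\<^sup>2)"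

text \<open>The value of the first integral on the orbit through \<open>(0, w\<^sup>2 + e)\<close>; it increases from \<open>-1 / (4 * e)\<close> at \<open>w = sqrt e\<close>
towards \<open>0\<close>.\<close>

definition hw :: "real \<Rightarrow> real \<Rightarrow> real" where
  "hw e u = - (u\<^sup>2 / (u\<^sup>2 + e)\<^sup>2)"

lemma level_continuous: "e > 0 \<Longrightarrow> continuous_on S (level e)"
  unfolding level_def by (intro continuous_intros) (auto simp: max_def)

lemma hw_strict_mono:
  assumes e: "e > 0" and uv: "sqrt e \<le> u" "u < v"
  shows "hw e u < hw e v"
proof -
  have se: "sqrt e > 0" using e by simp
  have u0: "u > 0" and v0: "v > 0" using uv se by linarith+
  have u2: "u\<^sup>2 \<ge> e" using uv e u0 by (metis real_sqrt_le_iff real_sqrt_abs abs_of_pos)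
  have "e = sqrt e * sqrt e" using e by simp
  also have "\<dots> \<le> sqrt e * u" using uv se by (intro mult_left_mono) auto
  also have "\<dots> < v * u" using uv u0 by (intro mult_strict_right_mono) auto
  finally have ev: "e < u * v" by (simp add: mult.commute)
  have "v * (u\<^sup>2 + e) - u * (v\<^sup>2 + e) = (u - v) * (u * v - e)" by algebra
  also have "\<dots> < 0" using uv ev by (intro mult_neg_pos) auto
  finally have "v * (u\<^sup>2 + e) < u * (v\<^sup>2 + e)" by simp
  moreover have "u\<^sup>2 + e > 0" "v\<^sup>2 + e > 0" using e by (simp_all add: add_nonneg_pos)
  ultimately have "v / (v\<^sup>2 + e) < u / (u\<^sup>2 + e)" by (simp add: field_simps)
  hence "(v / (v\<^sup>2 + e))\<^sup>2 < (u / (u\<^sup>2 + e))\<^sup>2"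
    using v0 e by (intro power_strict_mono) auto
  thus ?thesis by (simp add: hw_def power_divide)
qed

lemma level_section:
  assumes e: "e > 0"
  shows "level e (0, u\<^sup>2 + e) = hw e u"
proof -
  have "e / 2 \<le> u\<^sup>2 + e" using e zero_le_power2[of u] by linarith
  hence "max (u\<^sup>2 + e) (e / 2) = u\<^sup>2 + e" by (rule max_absorb1)
  moreover have "- (u\<^sup>2) / (u\<^sup>2 + e)\<^sup>2 \<le> 0" by (intro divide_nonpos_nonneg) auto
  ultimately have "min 0 (- (u\<^sup>2) / (u\<^sup>2 + e)\<^sup>2) = - (u\<^sup>2) / (u\<^sup>2 + e)\<^sup>2"
    "max (u\<^sup>2 + e) (e / 2) = u\<^sup>2 + e" by (simp_all only: min_absorb2)
  thus ?thesis by (simp add: level_def hw_def)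
qed

lemma level_annulus:
  assumes e: "e > 0" and \<mu>: "\<mu> > sqrt e" and l: "level e p = hw e \<mu>"
  shows "annulus e (fst p) (snd p)" "ww e (fst p) (snd p) = \<mu>"
proof -
  have \<mu>0: "\<mu> > 0" using \<mu> real_sqrt_gt_zero[OF e] by linarith
  have "\<mu>\<^sup>2 / (\<mu>\<^sup>2 + e)\<^sup>2 > 0" using \<mu>0 e by (intro divide_pos_pos zero_less_power) (auto simp: add_pos_pos)
  hence neg: "hw e \<mu> < 0" by (simp add: hw_def)
  define k where "k = max (snd p) (e / 2)"
  have k: "k > 0" using e by (simp add: k_def)
  have eq: "((fst p)\<^sup>2 - snd p + e) / k\<^sup>2 = hw e \<mu>"
    using l neg by (auto simp: level_def k_def min_def split: if_splits)
  hence "(fst p)\<^sup>2 - snd p + e < 0" using neg k by (metis divide_less_0_iff zero_less_power not_less_iff_gr_or_eq)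
  hence lt: "(fst p)\<^sup>2 < snd p - e" by simp
  moreover have "(fst p)\<^sup>2 \<ge> 0" by simp
  ultimately have y: "snd p > e" by linarith
  hence kk: "k = snd p" using e by (simp add: k_def max_def)
  hence H: "HH e (fst p) (snd p) = hw e \<mu>" using eq by (simp add: HH_def)
  have "\<not> (fst p = 0 \<and> snd p = 2 * e)"
  proof
    assume c: "fst p = 0 \<and> snd p = 2 * e"
    have "p = (0, (sqrt e)\<^sup>2 + e)" using c e by (simp add: prod_eq_iff)
    hence "level e p = hw e (sqrt e)" using level_section[OF e] by metis
    thus False using l hw_strict_mono[OF e order_refl \<mu>] by simp
  qed
  thus ann: "annulus e (fst p) (snd p)" using y e lt by (simp add: annulus_def)
  have "HH e (xc e \<mu> 0) (yc e \<mu> 0) = hw e \<mu>" using HH_coords(2)[OF e \<mu>0] by (simp add: hw_def)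
  hence "ww e (fst p) (snd p) = ww e (xc e \<mu> 0) (yc e \<mu> 0)" using H by (simp add: ww_def)
  thus "ww e (fst p) (snd p) = \<mu>" using ww_coords(2)[OF e \<mu>, of 0] by simp
qed

lemma last_visit:
  fixes gam :: "real \<Rightarrow> real \<times> real"
  assumes c: "continuous_on {a..b} gam" and S: "closed S" and a: "a \<le> b" "gam a \<in> S"
  shows "\<exists>s\<in>{a..b}. gam s \<in> S \<and> (\<forall>r\<in>{a..b}. gam r \<in> S \<longrightarrow> r \<le> s)"
proof -
  let ?B = "{a..b} \<inter> gam -` S"
  have "closed ?B" using continuous_closed_preimage[OF c _ S] by simp
  hence "compact ?B" by (metis compact_Int_closed compact_Icc Int_assoc Int_absorb)
  moreover have "?B \<noteq> {}" using a by auto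
  ultimately obtain s where "s \<in> ?B" "\<forall>t\<in>?B. t \<le> s" using compact_attains_sup[of ?B] by blast
  thus ?thesis by (intro bexI[of _ s]) auto
qed

context full_turn
begin

text \<open>Take the last time before \<open>tau'\<close> at which the solution meets the section in \<open>S\<close>. If the position there is in the controlled
range, the next return is again in \<open>S\<close>, unless it comes after \<open>tau'\<close>, and then the section is not met in between. If the position is outside the range, then on the
way to \<open>v\<close> the level passes through some intermediate \<open>\<mu>\<close>, and following the solution from there it next meets the section
within \<open>\<delta> / 2\<close> of \<open>\<mu>\<close>, hence in \<open>S\<close>. Both contradict the choice of the time.\<close>

lemma trap:
  fixes S :: "real set"
  assumes sol: "inclusion_solution F gam UNIV" and S: "closed S" "S \<subseteq> {sqrt e..}"
    and inv: "\<And>u. u \<in> S \<Longrightarrow> A - \<delta> / 2 < u \<Longrightarrow> u < B + \<delta> / 2 \<Longrightarrow> ret u \<in> S"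
    and out: "\<And>u. u \<in> S \<Longrightarrow> \<not> (A - \<delta> / 2 < u \<and> u < B + \<delta> / 2) \<Longrightarrow>
       \<exists>\<mu>. A - \<delta> / 2 < \<mu> \<and> \<mu> < B + \<delta> / 2 \<and> (u < \<mu> \<and> \<mu> < v \<or> v < \<mu> \<and> \<mu> < u) \<and> {\<mu> - \<delta> / 2..\<mu> + \<delta> / 2} \<subseteq> S"
    and u1: "u1 \<in> S" "gam tau1 = (0, u1\<^sup>2 + e)" and v: "v > sqrt e" "v \<notin> S" and t: "tau1 \<le> tau'"
  shows "gam tau' \<noteq> (0, v\<^sup>2 + e)"
proof
  assume g': "gam tau' = (0, v\<^sup>2 + e)"
  have e: "e > 0" using R.e .
  have se: "sqrt e > 0" using e by simp
  have subsol: "inclusion_solution F gam I" for I by (rule inclusion_solution_subset[OF sol]) auto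
  have c: "continuous_on {a..b} gam" for a b by (rule inclusion_solution_continuous[OF subsol])
  define Q where "Q = {p :: real \<times> real. fst p = 0 \<and> snd p \<ge> 2 * e \<and> sqrt (snd p - e) \<in> S}"
  have "Q = {p. fst p = 0} \<inter> {p. snd p \<ge> 2 * e} \<inter> ((\<lambda>p. sqrt (snd p - e)) -` S)" by (auto simp: Q_def)
  also have "closed \<dots>"
    by (intro closed_Int closed_Collect_eq closed_Collect_le continuous_intros closed_vimage S(1))
  finally have cQ: "closed Q" .
  have Qi: "(0, u\<^sup>2 + e) \<in> Q" if "u \<in> S" for u
  proof -
    have "u \<ge> sqrt e" using S(2) that by auto
    hence "u > 0" using se by linarith
    moreover have "u\<^sup>2 \<ge> e" using \<open>u \<ge> sqrt e\<close> \<open>u > 0\<close> e by (metis real_sqrt_le_iff real_sqrt_abs abs_of_pos)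
    ultimately show ?thesis using that by (simp add: Q_def)
  qed
  have Qe: "\<exists>u\<in>S. p = (0, u\<^sup>2 + e)" if "p \<in> Q" for p
    using that e by (intro bexI[of _ "sqrt (snd p - e)"]) (auto simp: Q_def prod_eq_iff)
  obtain s where s: "s \<in> {tau1..tau'}" "gam s \<in> Q" "\<And>r. r \<in> {tau1..tau'} \<Longrightarrow> gam r \<in> Q \<Longrightarrow> r \<le> s"
    using last_visit[OF c cQ t] Qi[OF u1(1)] u1(2) by auto
  obtain u where u: "u \<in> S" "gam s = (0, u\<^sup>2 + e)" using Qe[OF s(2)] by blast
  have u0: "u > 0" using S(2) u(1) se by (meson atLeast_iff less_le_trans subsetD)
  have v0: "v > 0" using v se by linarith
  have "s \<noteq> tau'"
  proof
    assume "s = tau'"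
    hence "u\<^sup>2 = v\<^sup>2" using u(2) g' by simp
    hence "u = v" using u0 v0 by (simp add: power2_eq_iff)
    thus False using u(1) v(2) by simp
  qed
  hence s': "s < tau'" using s(1) by auto
  have vc: "gam tau' \<in> cross_section (2 * e)" using axis_top(7)[OF v(1)] by (simp add: g' in_cross)
  show False
  proof (cases "A - \<delta> / 2 < u \<and> u < B + \<delta> / 2")
    case True
    from turn[OF subsol s' _ _ u(2)] True obtain tau2 where t2: "s < tau2" "tau2 \<le> tau'" "gam tau2 = (0, (ret u)\<^sup>2 + e)"
      using s' vc by blast
    have "gam tau2 \<in> Q" using Qi[OF inv] u(1) True t2(3) by simp
    hence "tau2 \<le> s" using s(3)[of tau2] t2 s(1) by auto
    thus False using t2 by simp
  next
    case False
    obtain \<mu> where m: "A - \<delta> / 2 < \<mu>" "\<mu> < B + \<delta> / 2" "u < \<mu> \<and> \<mu> < v \<or> v < \<mu> \<and> \<mu> < u" "{\<mu> - \<delta> / 2..\<mu> + \<delta> / 2} \<subseteq> S"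
      using out[OF u(1) False] by blast
    have \<mu>e: "\<mu> > sqrt e" using m(1) R.A R.\<delta> by linarith
    have ue: "u \<ge> sqrt e" using S(2) u(1) by auto
    have cl: "continuous_on {s..tau'} (\<lambda>r. level e (gam r))"
      by (rule continuous_on_compose2[OF level_continuous[OF e] c]) auto
    have ls: "level e (gam s) = hw e u" "level e (gam tau') = hw e v" by (simp_all add: u(2) g' level_section[OF e])
    have "\<exists>r. s \<le> r \<and> r \<le> tau' \<and> level e (gam r) = hw e \<mu>"
    proof (cases "u < \<mu>")
      case True
      hence "\<mu> < v" using m(3) by auto
      hence "level e (gam s) \<le> hw e \<mu>" "hw e \<mu> \<le> level e (gam tau')"
        using hw_strict_mono[OF e ue True] hw_strict_mono[OF e less_imp_le[OF \<mu>e] \<open>\<mu> < v\<close>] ls by auto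
      from IVT'[OF this less_imp_le[OF s'] cl] show ?thesis by auto
    next
      case False
      hence vu: "v < \<mu>" "\<mu> < u" using m(3) by auto
      hence "level e (gam tau') \<le> hw e \<mu>" "hw e \<mu> \<le> level e (gam s)"
        using hw_strict_mono[OF e less_imp_le[OF \<mu>e] vu(2)] hw_strict_mono[OF e less_imp_le[OF v(1)] vu(1)] ls by auto
      from IVT2'[OF this less_imp_le[OF s'] cl] show ?thesis by auto
    qed
    then obtain r where r: "s \<le> r" "r \<le> tau'" "level e (gam r) = hw e \<mu>" by blast
    note la = level_annulus[OF e \<mu>e r(3)]
    obtain tau2 u2 where t2: "r < tau2" "gam tau2 = (0, u2\<^sup>2 + e)" "u2 > sqrt e" "\<bar>u2 - \<mu>\<bar> \<le> \<delta> / 2"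
      "\<And>q. q \<in> {r..tau2} \<Longrightarrow> \<bar>ww e (fst (gam q)) (snd (gam q)) - \<mu>\<bar> \<le> \<delta> / 2"
      using follow[OF subsol la(1,2) m(1,2)] by blast
    show False
    proof (cases "tau2 \<le> tau'")
      case True
      have "u2 \<in> {\<mu> - \<delta> / 2..\<mu> + \<delta> / 2}" using t2(4) unfolding atLeastAtMost_iff by linarith
      hence "gam tau2 \<in> Q" using m(4) Qi t2(2) by auto
      hence "tau2 \<le> s" using s(3)[of tau2] True t2(1) r s(1) by auto
      thus False using t2(1) r by simp
    next
      case False
      hence "\<bar>ww e (fst (gam tau')) (snd (gam tau')) - \<mu>\<bar> \<le> \<delta> / 2" using t2(5)[of tau'] r by auto
      hence "\<bar>v - \<mu>\<bar> \<le> \<delta> / 2" using axis_top(2)[OF v(1)] by (simp add: g')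
      hence "v \<in> {\<mu> - \<delta> / 2..\<mu> + \<delta> / 2}" unfolding atLeastAtMost_iff by linarith
      thus False using m(4) v(2) by auto
    qed
  qed
qed

text \<open>During the turn the section is met only at the two ends, which coincide.\<close>

lemma orb_section:
  assumes w: "A - \<delta> / 2 < w" "w < B + \<delta> / 2" and rw: "ret w = w"
  shows "orb w \<inter> cross_section (2 * e) = {(0, w\<^sup>2 + e)}"
proof -
  have d: "\<delta> > 0" using R.\<delta> .
  have we: "w > sqrt e" using w R.A d by linarith
  have r0: "R.psi w 0 = w" using R.psi_props(1)[of w] w d by auto
  have clR: "R.psi w t > sqrt e" if "t \<in> {0..pi}" for t
  proof -
    have "\<bar>R.psi w t - w\<bar> \<le> \<delta> / 4" using psi_close(1)[of w t] w d that by auto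
    thus ?thesis using w R.A d by linarith
  qed
  have w1: "\<bar>R.psi w pi - w\<bar> \<le> \<delta> / 4" using psi_close(1)[of w pi] w d by auto
  hence w1r: "A - 2 * \<delta> < R.psi w pi" "R.psi w pi < B + 2 * \<delta>" using w d by linarith+
  have clL: "L.psi (R.psi w pi) t > sqrt e" if "t \<in> {pi..2 * pi}" for t
  proof -
    have "\<bar>L.psi (R.psi w pi) t - R.psi w pi\<bar> \<le> \<delta> / 4" by (rule psi_close(2)[OF w1r that])
    thus ?thesis using w1 w R.A d by linarith
  qed
  have x0: "sin t = 0" if "xc e v t = 0" "v > sqrt e" for v t :: real
  proof -
    have "v > 0" using that real_sqrt_gt_zero[OF R.e] by linarith
    moreover have "v\<^sup>2 > e" using that calculation R.e by (metis real_less_rsqrt real_sqrt_less_iff real_sqrt_abs abs_of_pos)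
    ultimately show ?thesis using that(1) by (auto simp: xc_def)
  qed
  have ypi: "yc e v pi \<le> 2 * e" if "v > sqrt e" for v :: real
  proof -
    have "v > 0" using that real_sqrt_gt_zero[OF R.e] by linarith
    moreover have "v\<^sup>2 > e" using that calculation R.e by (metis real_less_rsqrt real_sqrt_less_iff real_sqrt_abs abs_of_pos)
    moreover have "e * (v\<^sup>2 + e) \<le> e * (2 * v\<^sup>2)" using calculation R.e by (intro mult_left_mono) auto
    ultimately show ?thesis by (simp add: yc_def divide_le_eq mult.commute)
  qed
  show ?thesis
  proof
    show "{(0, w\<^sup>2 + e)} \<subseteq> orb w \<inter> cross_section (2 * e)"
    proof -
      have "(0, w\<^sup>2 + e) = (xc e (R.psi w 0) 0, yc e (R.psi w 0) 0)" using axis_top[OF we] r0 by simp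
      hence "(0, w\<^sup>2 + e) \<in> orb w" unfolding orb_def by fastforce
      thus ?thesis using axis_top(7)[OF we] by (simp add: in_cross)
    qed
    show "orb w \<inter> cross_section (2 * e) \<subseteq> {(0, w\<^sup>2 + e)}"
    proof
      fix p assume p: "p \<in> orb w \<inter> cross_section (2 * e)"
      hence px: "fst p = 0" "snd p > 2 * e" by (auto simp: in_cross)
      from p consider t where "t \<in> {0..pi}" "p = (xc e (R.psi w t) t, yc e (R.psi w t) t)"
        | t where "t \<in> {pi..2*pi}" "p = (xc e (L.psi (R.psi w pi) t) t, yc e (L.psi (R.psi w pi) t) t)"
        unfolding orb_def by blast
      thus "p \<in> {(0, w\<^sup>2 + e)}"
      proof cases
        case (1 t)
        have "sin t = 0" using x0[OF _ clR[OF 1(1)]] px 1(2) by simp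
        hence "t = 0 \<or> t = pi" using 1(1) sin_gt_zero[of t] by (cases "t = 0"; cases "t = pi") auto
        moreover have "t \<noteq> pi" using ypi[OF clR[OF 1(1)]] px 1(2) by auto
        ultimately show ?thesis using 1(2) axis_top[OF we] r0 by simp
      next
        case (2 t)
        have "sin t = 0" using x0[OF _ clL[OF 2(1)]] px 2(2) by simp
        hence "t = pi \<or> t = 2 * pi" using 2(1) sin_lt_zero[of t] by (cases "t = pi"; cases "t = 2 * pi") auto
        moreover have "t \<noteq> pi" using ypi[OF clL[OF 2(1)]] px 2(2) by auto
        ultimately have "t = 2 * pi" by blast
        hence "p = (xc e (ret w) (2 * pi), yc e (ret w) (2 * pi))" using 2(2) by (simp add: ret_def)
        thus ?thesis using axis_top[OF we] rw by simp
      qed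
    qed
  qed
qed

text \<open>If \<open>ret w > w\<close>, monotonicity traps the orbit in the closed set of positions at least \<open>ret w\<close>, so that it never comes back to
\<open>w\<close>; similarly if \<open>ret w < w\<close>.\<close>

lemma periodic_orbit_through:
  assumes per: "periodic_orbit F C" and w: "A + \<delta> < w" "w < B - \<delta>" and wC: "(0, w\<^sup>2 + e) \<in> C"
  shows "ret w = w" "C = orb w"
proof -
  have d: "\<delta> > 0" using R.\<delta> .
  have e: "e > 0" using R.e .
  have w': "A - \<delta> / 2 < w" "w < B + \<delta> / 2" using w d by linarith+
  have we: "w > sqrt e" using w R.A d by linarith
  obtain gam T where T: "T > 0" and sol: "inclusion_solution F gam UNIV" and p: "\<And>t. gam (t + T) = gam t" and C: "C = range gam"
    using per unfolding periodic_orbit_def by blast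
  have pk: "gam (t + real k * T) = gam t" for t k
  proof (induction k)
    case (Suc k)
    have "gam (t + real (Suc k) * T) = gam ((t + real k * T) + T)" by (simp add: algebra_simps)
    thus ?case using p Suc by simp
  qed simp
  have big: "\<exists>k. c \<le> t + real k * T" for c t
  proof -
    obtain k where "(c - t) / T < real k" using reals_Archimedean2 by blast
    hence "c - t < real k * T" using T by (simp add: divide_less_eq)
    thus ?thesis by (intro exI[of _ k]) simp
  qed
  have subsol: "inclusion_solution F gam I" for I by (rule inclusion_solution_subset[OF sol]) auto
  have c: "continuous_on {a..b} gam" for a b by (rule inclusion_solution_continuous[OF subsol])
  have "pi / m1 > 0" "pi / m2 > 0" using R.pos L.pos by auto
  hence Tm: "Tmax > 0" by (simp add: Tmax_def)
  have step: "\<exists>tau2. s < tau2 \<and> gam tau2 = (0, (ret w)\<^sup>2 + e) \<and> gam ` {s..tau2} = orb w" if "gam s = (0, w\<^sup>2 + e)" for s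
    using turn[OF subsol _ w' that, of "s + Tmax"] Tm by auto
  obtain tau0 where g0: "gam tau0 = (0, w\<^sup>2 + e)" using wC C by (metis rangeE)
  obtain tau1 where t1: "tau0 < tau1" "gam tau1 = (0, (ret w)\<^sup>2 + e)" "gam ` {tau0..tau1} = orb w" using step[OF g0] by blast
  have rc: "\<bar>ret w - w\<bar> \<le> \<delta> / 2" using ret_close[of w] w d by auto
  obtain k where k: "tau1 \<le> tau0 + real k * T" using big by blast
  have gk: "gam (tau0 + real k * T) = (0, w\<^sup>2 + e)" using pk g0 by simp
  have rr: "A - \<delta> / 2 < ret w" "ret w < B + \<delta> / 2" using rc w d by linarith+
  show rw: "ret w = w"
  proof (rule ccontr)
    assume "ret w \<noteq> w"
    then consider "ret w > w" | "ret w < w" by linarith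
    thus False
    proof cases
      case 1
      have "gam (tau0 + real k * T) \<noteq> (0, w\<^sup>2 + e)"
      proof (rule trap[OF sol, where S = "{ret w..}"])
        show "{ret w..} \<subseteq> {sqrt e..}" using 1 we by auto
        show "ret u \<in> {ret w..}" if "u \<in> {ret w..}" "A - \<delta> / 2 < u" "u < B + \<delta> / 2" for u
        proof -
          have "w < u" using that(1) 1 by simp
          from ret_mono[OF w'(1) this that(3)] show ?thesis by simp
        qed
        show "\<exists>\<mu>. A - \<delta> / 2 < \<mu> \<and> \<mu> < B + \<delta> / 2 \<and> (u < \<mu> \<and> \<mu> < w \<or> w < \<mu> \<and> \<mu> < u) \<and> {\<mu> - \<delta> / 2..\<mu> + \<delta> / 2} \<subseteq> {ret w..}"
          if "u \<in> {ret w..}" "\<not> (A - \<delta> / 2 < u \<and> u < B + \<delta> / 2)" for u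
        proof (intro exI[of _ "B + \<delta> / 4"] conjI)
          have "u \<ge> B + \<delta> / 2" using that rr by auto
          thus "u < B + \<delta> / 4 \<and> B + \<delta> / 4 < w \<or> w < B + \<delta> / 4 \<and> B + \<delta> / 4 < u" using w d by auto
          have "ret w \<le> B + \<delta> / 4 - \<delta> / 2" using rc w d by linarith
          thus "{B + \<delta> / 4 - \<delta> / 2..B + \<delta> / 4 + \<delta> / 2} \<subseteq> {ret w..}" by auto
          show "A - \<delta> / 2 < B + \<delta> / 4" "B + \<delta> / 4 < B + \<delta> / 2" using w d by linarith+
        qed
        show "w > sqrt e" "w \<notin> {ret w..}" using we 1 by auto
      qed (use t1 k in auto)
      thus False using gk by simp
    next
      case 2
      have "gam (tau0 + real k * T) \<noteq> (0, w\<^sup>2 + e)"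
      proof (rule trap[OF sol, where S = "{sqrt e..ret w}"])
        show "ret u \<in> {sqrt e..ret w}" if "u \<in> {sqrt e..ret w}" "A - \<delta> / 2 < u" "u < B + \<delta> / 2" for u
        proof -
          have "u < w" using that(1) 2 by simp
          from ret_mono[OF that(2) this w'(2)] have "ret u < ret w" .
          moreover have "\<bar>ret u - u\<bar> \<le> \<delta> / 2" using ret_close[of u] that d by auto
          hence "ret u > sqrt e" using that(2) R.A d by linarith
          ultimately show ?thesis by simp
        qed
        show "\<exists>\<mu>. A - \<delta> / 2 < \<mu> \<and> \<mu> < B + \<delta> / 2 \<and> (u < \<mu> \<and> \<mu> < w \<or> w < \<mu> \<and> \<mu> < u) \<and> {\<mu> - \<delta> / 2..\<mu> + \<delta> / 2} \<subseteq> {sqrt e..ret w}"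
          if "u \<in> {sqrt e..ret w}" "\<not> (A - \<delta> / 2 < u \<and> u < B + \<delta> / 2)" for u
        proof (intro exI[of _ "A - \<delta> / 4"] conjI)
          have "u \<le> A - \<delta> / 2" using that rr by auto
          thus "u < A - \<delta> / 4 \<and> A - \<delta> / 4 < w \<or> w < A - \<delta> / 4 \<and> A - \<delta> / 4 < u" using w d by auto
          have "A - \<delta> / 4 + \<delta> / 2 \<le> ret w" "sqrt e \<le> A - \<delta> / 4 - \<delta> / 2" using rc w d R.A by linarith+
          thus "{A - \<delta> / 4 - \<delta> / 2..A - \<delta> / 4 + \<delta> / 2} \<subseteq> {sqrt e..ret w}" by auto
          show "A - \<delta> / 2 < A - \<delta> / 4" "A - \<delta> / 4 < B + \<delta> / 2" using w d by linarith+
        qed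
        show "ret w \<in> {sqrt e..ret w}" using rr R.A d by auto
        show "w > sqrt e" "w \<notin> {sqrt e..ret w}" using we 2 by auto
      qed (use t1 k in auto)
      thus False using gk by simp
    qed
  qed
  show "C = orb w"
  proof
    show "orb w \<subseteq> C" unfolding C t1(3)[symmetric] by auto
    show "C \<subseteq> orb w"
    proof
      fix p assume "p \<in> C"
      then obtain t where t: "p = gam t" using C by auto
      obtain j where j: "tau0 \<le> t + real j * T" using big by blast
      define b where "b = t + real j * T"
      have gb: "gam b = p" unfolding b_def pk t ..
      have "gam tau0 \<in> {(0, w\<^sup>2 + e)}" using g0 by simp
      from last_visit[OF c closed_singleton _ this, of b] j
      obtain s where s: "s \<in> {tau0..b}" "gam s = (0, w\<^sup>2 + e)" "\<And>r. r \<in> {tau0..b} \<Longrightarrow> gam r = (0, w\<^sup>2 + e) \<Longrightarrow> r \<le> s"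
        unfolding b_def by auto
      obtain tau2 where t2: "s < tau2" "gam tau2 = (0, w\<^sup>2 + e)" "gam ` {s..tau2} = orb w" using step[OF s(2)] rw by auto
      have "tau2 > b" using s(1) s(3)[of tau2] t2 by force
      hence "b \<in> {s..tau2}" using s(1) by auto
      thus "p \<in> orb w" using gb t2(3) by blast
    qed
  qed
qed

end

section \<open>Zeros of the explicit Melnikov function\<close>

definition sq :: "real \<Rightarrow> real poly" where "sq e = [:1, 4 * e:]"
definition Qf :: "real \<Rightarrow> real \<Rightarrow> real" where "Qf e h = sqrt (1 + 4 * e * h)"
definition Lf :: "real \<Rightarrow> real \<Rightarrow> real" where "Lf e h = ln ((1 + Qf e h) / (1 - Qf e h))"

lemma Qf_range:
  assumes "e > 0" "- 1 / (4 * e) < h" "h < 0"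
  shows "Qf e h > 0" "Qf e h < 1" "(Qf e h)\<^sup>2 = poly (sq e) h"
proof -
  have "1 + 4 * e * h > 0" using assms by (simp add: field_simps)
  thus "Qf e h > 0" "(Qf e h)\<^sup>2 = poly (sq e) h" by (simp_all add: Qf_def sq_def mult_ac)
  show "Qf e h < 1" using assms by (simp add: Qf_def mult_pos_neg)
qed

text \<open>The functions \<open>P(h) / (sqrt (-h) h ^ N)\<close> with polynomial \<open>P\<close> of bounded degree are mapped to functions of the same form.\<close>

lemma deriv_sqrt_part:
  assumes "h < 0"
  shows "((\<lambda>h. poly P h / (sqrt (- h) * h ^ N)) has_real_derivative
     poly (pCons 0 (pderiv P) - smult (real N + 1 / 2) P) h / (sqrt (- h) * h ^ Suc N)) (at h)"
proof -
  have s: "sqrt (- h) > 0" "sqrt (- h) * sqrt (- h) = - h" using assms by auto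
  have g: "((\<lambda>h. 1 / (sqrt (- h) * h ^ N)) has_real_derivative
      - (real N + 1 / 2) * (1 / (sqrt (- h) * h ^ Suc N))) (at h)" for N
  proof (induction N)
    case 0
    have "((\<lambda>h. 1 / sqrt (- h)) has_real_derivative - ((inverse (sqrt (- h)) / 2) * (- 1)) / (sqrt (- h) * sqrt (- h))) (at h)"
      using assms by (auto intro!: derivative_eq_intros)
    also have "- ((inverse (sqrt (- h)) / 2) * (- 1)) / (sqrt (- h) * sqrt (- h)) = - (real 0 + 1 / 2) * (1 / (sqrt (- h) * h ^ Suc 0))"
      unfolding s(2) using s(1) assms by (simp add: field_simps)
    finally show ?case by simp
  next
    case (Suc N)
    have "((\<lambda>h. (1 / (sqrt (- h) * h ^ N)) * (1 / h)) has_real_derivative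
        - (real N + 1 / 2) * (1 / (sqrt (- h) * h ^ Suc N)) * (1 / h) + (- (1 / h\<^sup>2)) * (1 / (sqrt (- h) * h ^ N))) (at h)"
      by (rule DERIV_mult[OF Suc]) (use assms in \<open>auto intro!: derivative_eq_intros simp: power2_eq_square\<close>)
    also have "(\<lambda>h. (1 / (sqrt (- h) * h ^ N)) * (1 / h)) = (\<lambda>h. 1 / (sqrt (- h) * h ^ Suc N))"
      by (simp add: mult_ac)
    also have "- (real N + 1 / 2) * (1 / (sqrt (- h) * h ^ Suc N)) * (1 / h) + (- (1 / h\<^sup>2)) * (1 / (sqrt (- h) * h ^ N))
        = - (real (Suc N) + 1 / 2) * (1 / (sqrt (- h) * h ^ Suc (Suc N)))"
      using assms s(1) by (simp add: field_simps power2_eq_square)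
    finally show ?case .
  qed
  have "((\<lambda>h. poly P h * (1 / (sqrt (- h) * h ^ N))) has_real_derivative
     poly (pderiv P) h * (1 / (sqrt (- h) * h ^ N)) + - (real N + 1 / 2) * (1 / (sqrt (- h) * h ^ Suc N)) * poly P h) (at h)"
    by (rule DERIV_mult[OF poly_DERIV g])
  also have "poly (pderiv P) h * (1 / (sqrt (- h) * h ^ N)) + - (real N + 1 / 2) * (1 / (sqrt (- h) * h ^ Suc N)) * poly P h
     = poly (pCons 0 (pderiv P) - smult (real N + 1 / 2) P) h / (sqrt (- h) * h ^ Suc N)"
    using assms s(1) by (simp add: field_simps)
  finally show ?thesis by simp
qed

lemma Qf_deriv:
  assumes "e > 0" "- 1 / (4 * e) < h" "h < 0"
  shows "(Qf e has_real_derivative 2 * e / Qf e h) (at h)"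
proof -
  have p: "1 + 4 * e * h > 0" using assms by (simp add: field_simps)
  have "((\<lambda>h. sqrt (1 + 4 * e * h)) has_real_derivative (inverse (sqrt (1 + 4 * e * h)) / 2) * (4 * e)) (at h)"
    using p by (auto intro!: derivative_eq_intros)
  thus ?thesis by (simp add: Qf_def[abs_def] field_simps)
qed

lemma poly_over_power_deriv:
  fixes h :: real
  assumes "h \<noteq> 0"
  shows "((\<lambda>h. poly B h / h ^ N) has_real_derivative poly (pCons 0 (pderiv B) - smult (real N) B) h / h ^ Suc N) (at h)"
proof (cases N)
  case 0
  thus ?thesis using assms poly_DERIV[of B h] by simp
next
  case (Suc k)
  have "((\<lambda>h. poly B h / h ^ N) has_real_derivative (poly (pderiv B) h * h ^ N - poly B h * (real N * h ^ (N - 1))) / (h ^ N * h ^ N)) (at h)"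
    by (rule DERIV_divide[OF poly_DERIV]) (use assms in \<open>auto intro!: derivative_eq_intros\<close>)
  also have "(poly (pderiv B) h * h ^ N - poly B h * (real N * h ^ (N - 1))) / (h ^ N * h ^ N)
      = poly (pCons 0 (pderiv B) - smult (real N) B) h / h ^ Suc N"
    using assms by (simp add: Suc field_simps)
  finally show ?thesis .
qed

text \<open>Differentiating \<open>sqrt (1 + 4 e h) B(h) / h ^ N\<close> puts the root into the denominator; the numerator gains one degree each time.\<close>

lemma deriv_root_part:
  assumes "e > 0" "- 1 / (4 * e) < h" "h < 0"
  shows "((\<lambda>h. Qf e h * poly B h / h ^ N) has_real_derivative
      poly (sq e * (pCons 0 (pderiv B) - smult (real N) B) + smult (2 * e) (pCons 0 B)) h / (Qf e h * h ^ Suc N)) (at h)"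
    and "((\<lambda>h. poly B h / (Qf e h * h ^ N)) has_real_derivative
      poly (sq e * (pCons 0 (pderiv B) - smult (real N) B) - smult (2 * e) (pCons 0 B)) h / (Qf e h ^ 3 * h ^ Suc N)) (at h)"
proof -
  note q = Qf_range[OF assms]
  have q2: "poly (sq e) h = Qf e h * Qf e h" using q(3) by (simp add: power2_eq_square)
  have nz: "h \<noteq> 0" "Qf e h \<noteq> 0" using assms q by auto
  note d = poly_over_power_deriv[OF nz(1), of B N] and dq = Qf_deriv[OF assms]
  have "((\<lambda>h. Qf e h * (poly B h / h ^ N)) has_real_derivative
     2 * e / Qf e h * (poly B h / h ^ N) + poly (pCons 0 (pderiv B) - smult (real N) B) h / h ^ Suc N * Qf e h) (at h)"
    by (rule DERIV_mult[OF dq d])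
  also have "2 * e / Qf e h * (poly B h / h ^ N) + poly (pCons 0 (pderiv B) - smult (real N) B) h / h ^ Suc N * Qf e h
     = poly (sq e * (pCons 0 (pderiv B) - smult (real N) B) + smult (2 * e) (pCons 0 B)) h / (Qf e h * h ^ Suc N)"
    unfolding poly_add poly_mult q2 using nz by (simp add: field_simps)
  finally show "((\<lambda>h. Qf e h * poly B h / h ^ N) has_real_derivative
      poly (sq e * (pCons 0 (pderiv B) - smult (real N) B) + smult (2 * e) (pCons 0 B)) h / (Qf e h * h ^ Suc N)) (at h)"
    by simp
  have "((\<lambda>h. (poly B h / h ^ N) / Qf e h) has_real_derivative
     (poly (pCons 0 (pderiv B) - smult (real N) B) h / h ^ Suc N * Qf e h - (poly B h / h ^ N) * (2 * e / Qf e h)) / (Qf e h * Qf e h)) (at h)"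
    by (rule DERIV_divide[OF d dq nz(2)])
  also have "(poly (pCons 0 (pderiv B) - smult (real N) B) h / h ^ Suc N * Qf e h - (poly B h / h ^ N) * (2 * e / Qf e h)) / (Qf e h * Qf e h)
     = poly (sq e * (pCons 0 (pderiv B) - smult (real N) B) - smult (2 * e) (pCons 0 B)) h / (Qf e h ^ 3 * h ^ Suc N)"
    unfolding poly_diff[of "sq e * _"] poly_mult q2 using nz by (simp add: field_simps power3_eq_cube)
  also have "(\<lambda>h. (poly B h / h ^ N) / Qf e h) = (\<lambda>h. poly B h / (Qf e h * h ^ N))" by (simp add: mult.commute)
  finally show "((\<lambda>h. poly B h / (Qf e h * h ^ N)) has_real_derivative
      poly (sq e * (pCons 0 (pderiv B) - smult (real N) B) - smult (2 * e) (pCons 0 B)) h / (Qf e h ^ 3 * h ^ Suc N)) (at h)" .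
qed

lemma Lf_deriv:
  assumes "e > 0" "- 1 / (4 * e) < h" "h < 0"
  shows "(Lf e has_real_derivative - (1 / (h * Qf e h))) (at h)"
proof -
  note q = Qf_range[OF assms]
  have h: "1 - Qf e h * Qf e h = - (4 * e * h)" using q(3) by (simp add: sq_def power2_eq_square)
  have "((\<lambda>h. (1 + Qf e h) / (1 - Qf e h)) has_real_derivative
     (2 * e / Qf e h * (1 - Qf e h) - (1 + Qf e h) * (- (2 * e / Qf e h))) / ((1 - Qf e h) * (1 - Qf e h))) (at h)"
    using q by (auto intro!: derivative_eq_intros Qf_deriv[OF assms])
  from DERIV_chain2[OF DERIV_ln this] q
  have "(Lf e has_real_derivative inverse ((1 + Qf e h) / (1 - Qf e h)) *
     ((2 * e / Qf e h * (1 - Qf e h) - (1 + Qf e h) * (- (2 * e / Qf e h))) / ((1 - Qf e h) * (1 - Qf e h)))) (at h)"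
    unfolding Lf_def[abs_def] by simp
  also have "inverse ((1 + Qf e h) / (1 - Qf e h)) *
     ((2 * e / Qf e h * (1 - Qf e h) - (1 + Qf e h) * (- (2 * e / Qf e h))) / ((1 - Qf e h) * (1 - Qf e h)))
     = 4 * e / (Qf e h * (1 - Qf e h * Qf e h))"
  proof -
    have "inverse ((1 + q) / (1 - q)) * ((2 * e / q * (1 - q) - (1 + q) * (- (2 * e / q))) / ((1 - q) * (1 - q)))
       = 4 * e / (q * (1 - q * q))" if "0 < q" "q < 1" for q :: real
    proof -
      have "2 * e / q * (1 - q) - (1 + q) * (- (2 * e / q)) = 4 * e / q" using that by (simp add: field_simps)
      moreover have "1 - q * q = (1 + q) * (1 - q)" by (simp add: algebra_simps)
      ultimately show ?thesis using that by simp
    qed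
    thus ?thesis using q by blast
  qed
  also have "\<dots> = - (1 / (h * Qf e h))" unfolding h using assms q(1) by (simp add: field_simps)
  finally show ?thesis .
qed

text \<open>The Euler operator \<open>h d/dh\<close> does not raise the degree.\<close>

lemma degree_euler_le: "degree (pCons 0 (pderiv P) - smult (c :: real) P) \<le> degree P"
proof (cases "pderiv P = 0")
  case True
  thus ?thesis by (simp add: degree_smult_le)
next
  case False
  hence "degree (pCons 0 (pderiv P)) \<le> degree P"
    using degree_pCons_le[of 0 "pderiv P"] degree_pderiv[of P] pderiv_eq_0_iff[of P] by linarith
  thus ?thesis by (intro degree_diff_le degree_smult_le)
qed

lemma degree_sq_mult_le: "degree (sq e * P) \<le> Suc (degree P)"
  using degree_mult_le[of "sq e" P] degree_pCons_le[of 1 "[:4 * e:]"] by (simp add: sq_def)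

lemma degree_root_step_le:
  "degree (sq e * (pCons 0 (pderiv B) - smult c B) + smult d (pCons 0 B)) \<le> Suc (degree B)"
  "degree (sq e * (pCons 0 (pderiv B) - smult c B) - smult d (pCons 0 B)) \<le> Suc (degree B)"
proof -
  have "degree (sq e * (pCons 0 (pderiv B) - smult c B)) \<le> Suc (degree B)"
    using degree_sq_mult_le[of e "pCons 0 (pderiv B) - smult c B"] degree_euler_le[of B c] by linarith
  moreover have "degree (smult d (pCons 0 B)) \<le> Suc (degree B)"
    by (meson degree_smult_le degree_pCons_le order_trans)
  ultimately show "degree (sq e * (pCons 0 (pderiv B) - smult c B) + smult d (pCons 0 B)) \<le> Suc (degree B)"
    "degree (sq e * (pCons 0 (pderiv B) - smult c B) - smult d (pCons 0 B)) \<le> Suc (degree B)"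
    by (simp_all only: degree_add_le degree_diff_le)
qed

lemma poly_eq_0_on_pos:
  fixes p :: "real poly"
  assumes "\<And>h. h > 0 \<Longrightarrow> poly p h = 0"
  shows "p = 0"
proof (rule ccontr)
  assume "p \<noteq> 0"
  hence "finite {h. poly p h = 0}" by (rule poly_roots_finite)
  moreover have "{0<..} \<subseteq> {h. poly p h = 0}" using assms by auto
  ultimately have "finite {0::real<..}" by (rule finite_subset[rotated])
  thus False using infinite_Ioi by blast
qed

lemma zeros_le_affine:
  assumes ra: "real_analytic_on f I" "open I" "is_interval I"
    and d2: "\<And>x. x \<in> I \<Longrightarrow> deriv (deriv f) x = 0" and nz: "x0 \<in> I" "f x0 \<noteq> 0"
  shows "zeros_le f I 1"
proof -
  note d = real_analytic_on_deriv[OF ra(1,2)]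
  note dd = real_analytic_on_deriv[OF d(1) ra(2)]
  have cv: "convex I" using ra(3) by (simp add: is_interval_convex)
  have "(deriv f has_real_derivative 0) (at x within I)" if "x \<in> I" for x
    using dd(2)[OF that] d2[OF that] by (simp add: has_field_derivative_at_within)
  hence "\<exists>c. \<forall>x\<in>I. deriv f x = c" by (rule has_field_derivative_zero_constant[OF cv])
  hence const: "deriv f x = deriv f x0" if "x \<in> I" for x using that nz(1) by metis
  show ?thesis
  proof (cases "deriv f x0 = 0")
    case False
    hence "zeros_le (deriv f) I 0" by (intro zeros_le_nonzero) (use const in auto)
    from zeros_le_deriv[OF ra this] show ?thesis by simp
  next
    case True
    have "(f has_real_derivative 0) (at x within I)" if "x \<in> I" for x
      using d(2)[OF that] const[OF that] True by (simp add: has_field_derivative_at_within)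
    hence "\<exists>c. \<forall>x\<in>I. f x = c" by (rule has_field_derivative_zero_constant[OF cv])
    hence "f x = f x0" if "x \<in> I" for x using that nz(1) by metis
    hence "f x \<noteq> 0" if "x \<in> I" for x using that nz(2) by metis
    thus ?thesis by (rule zeros_le_nonzero)
  qed
qed

text \<open>The second derivative is \<open>(P2 / sqrt (-h) + D / Q ^ 3) / h ^ (N + 2)\<close> with polynomials \<open>P2\<close>, \<open>D\<close> of degree at most \<open>N + 2\<close> and
\<open>N + 3\<close>, where \<open>Q = sqrt (1 + 4 e h)\<close>. Multiplied by its conjugate it becomes a polynomial of degree at most \<open>2 N + 7\<close> up to factors without zeros, and two
applications of Rolle's theorem add \<open>2\<close>. When the polynomial vanishes identically the function is affine, because the two radicals
are independent. Without \<open>P\<close> and the logarithm, and with \<open>N = 0\<close>, only \<open>D\<close>, of degree at most \<open>3\<close>, has to be counted.\<close>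

lemma zeros_le_explicit:
  fixes e :: real and P B :: "real poly" and N :: nat
  defines "I \<equiv> {- 1 / (4 * e) <..< 0}"
  assumes e: "e > 0"
    and f: "\<And>h. h \<in> I \<Longrightarrow> f h = poly P h / (sqrt (- h) * h ^ N) + (a0 + a1 * h) + Qf e h * poly B h / h ^ N + (\<alpha> + \<beta> * h) * Lf e h"
    and nz: "\<exists>h\<in>I. f h \<noteq> 0"
    and deg: "degree P \<le> N + 2" "degree B \<le> N + 1"
  shows "real_analytic_on f I" and "zeros_le f I (2 * N + 9)"
    and "P = 0 \<Longrightarrow> \<alpha> = 0 \<Longrightarrow> \<beta> = 0 \<Longrightarrow> N = 0 \<Longrightarrow> zeros_le f I 5"
proof -
  have I: "open I" "is_interval I" by (auto simp: I_def is_interval_oo)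
  have Ih: "- 1 / (4 * e) < h" "h < 0" "h \<noteq> 0" if "h \<in> I" for h using that by (auto simp: I_def)
  have q: "Qf e h > 0" "Qf e h < 1" "(Qf e h)\<^sup>2 = poly (sq e) h" if "h \<in> I" for h
    using Qf_range[OF e Ih(1,2)[OF that]] by auto
  have raS: "real_analytic_on (\<lambda>h. sqrt (- h)) I"
  proof -
    have "real_analytic_on (\<lambda>h. sqrt (0 - h)) I"
      by (intro real_analytic_intros) (use Ih in auto)
    thus ?thesis by simp
  qed
  have raQ: "real_analytic_on (Qf e) I"
    unfolding Qf_def[abs_def] by (intro real_analytic_intros) (use q(1) in \<open>auto simp: Qf_def\<close>)
  have raL: "real_analytic_on (Lf e) I"
    unfolding Lf_def[abs_def]
  proof (intro real_analytic_ln real_analytic_divide real_analytic_add real_analytic_diff real_analytic_const raQ)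
    fix h assume h: "h \<in> I"
    show "1 - Qf e h \<noteq> 0" using q(2)[OF h] by simp
    show "(1 + Qf e h) / (1 - Qf e h) > 0" using q(1,2)[OF h] by (intro divide_pos_pos) auto
  qed
  define f1 where "f1 h = poly P h / (sqrt (- h) * h ^ N) + (a0 + a1 * h) + Qf e h * poly B h / h ^ N + (\<alpha> + \<beta> * h) * Lf e h" for h
  have raf1: "real_analytic_on f1 I"
    unfolding f1_def[abs_def]
    by (intro real_analytic_mult real_analytic_power real_analytic_add real_analytic_divide real_analytic_poly
        real_analytic_ident real_analytic_const raS raQ raL) (use Ih in auto)
  show raf: "real_analytic_on f I" by (rule real_analytic_on_cong[OF raf1]) (use f in \<open>simp add: f1_def\<close>)
  define P1 where "P1 = pCons 0 (pderiv P) - smult (real N + 1 / 2) P"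
  define P2 where "P2 = pCons 0 (pderiv P1) - smult (real (Suc N) + 1 / 2) P1"
  define B1 where "B1 = sq e * (pCons 0 (pderiv B) - smult (real N) B) + smult (2 * e) (pCons 0 B)"
  define B2 where "B2 = sq e * (pCons 0 (pderiv B1) - smult (real (Suc N)) B1) - smult (2 * e) (pCons 0 B1)"
  \<comment> \<open>The logarithm contributes \<open>C / (h Q)\<close> to the first derivative and \<open>C2 / (h\<^sup>2 Q ^ 3)\<close> to the second.\<close>
  define C where "C = [:- \<alpha>, - \<beta>:]"
  define C1 where "C1 = sq e * (pCons 0 (pderiv C) - smult (real 1) C) - smult (2 * e) (pCons 0 C)"
  define C2 where "C2 = [:0, - \<beta>:] * sq e + C1"
  have f1': "(f1 has_real_derivative poly P1 h / (sqrt (- h) * h ^ Suc N) + a1 + poly B1 h / (Qf e h * h ^ Suc N) + (\<beta> * Lf e h + poly C h / (Qf e h * h ^ 1))) (at h)"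
    if h: "h \<in> I" for h
  proof -
    note L = Lf_deriv[OF e Ih(1,2)[OF h]]
    have "((\<lambda>h. (\<alpha> + \<beta> * h) * Lf e h) has_real_derivative \<beta> * Lf e h + - (1 / (h * Qf e h)) * (\<alpha> + \<beta> * h)) (at h)"
      by (rule DERIV_mult[OF _ L]) (auto intro!: derivative_eq_intros)
    also have "- (1 / (h * Qf e h)) * (\<alpha> + \<beta> * h) = poly C h / (Qf e h * h ^ 1)"
      using Ih(3)[OF h] q(1)[OF h] by (simp add: C_def field_simps)
    finally have "((\<lambda>h. (\<alpha> + \<beta> * h) * Lf e h) has_real_derivative \<beta> * Lf e h + poly C h / (Qf e h * h ^ 1)) (at h)" .
    moreover have "((\<lambda>h. a0 + a1 * h) has_real_derivative a1) (at h)" by (auto intro!: derivative_eq_intros)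
    ultimately show ?thesis unfolding f1_def[abs_def]
      using deriv_sqrt_part[OF Ih(2)[OF h], of P N] deriv_root_part(1)[OF e Ih(1,2)[OF h], of B N]
      unfolding P1_def B1_def by (intro DERIV_add)
  qed
  define g1 where "g1 h = poly P1 h / (sqrt (- h) * h ^ Suc N) + a1 + poly B1 h / (Qf e h * h ^ Suc N) + (\<beta> * Lf e h + poly C h / (Qf e h * h ^ 1))" for h
  have g1': "(g1 has_real_derivative poly P2 h / (sqrt (- h) * h ^ Suc (Suc N)) + 0 + poly B2 h / (Qf e h ^ 3 * h ^ Suc (Suc N)) + poly C2 h / (Qf e h ^ 3 * h ^ 2)) (at h)"
    if h: "h \<in> I" for h
  proof -
    have "((\<lambda>h. \<beta> * Lf e h) has_real_derivative \<beta> * (- (1 / (h * Qf e h)))) (at h)"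
      by (rule DERIV_cmult[OF Lf_deriv[OF e Ih(1,2)[OF h]]])
    from DERIV_add[OF this deriv_root_part(2)[OF e Ih(1,2)[OF h], of C 1]]
    have "((\<lambda>h. \<beta> * Lf e h + poly C h / (Qf e h * h ^ 1)) has_real_derivative \<beta> * (- (1 / (h * Qf e h))) +
       poly (sq e * (pCons 0 (pderiv C) - smult (real 1) C) - smult (2 * e) (pCons 0 C)) h / (Qf e h ^ 3 * h ^ Suc 1)) (at h)" .
    moreover have "\<beta> * (- (1 / (h * Qf e h))) = poly ([:0, - \<beta>:] * sq e) h / (Qf e h ^ 3 * h ^ Suc 1)"
      unfolding poly_mult q(3)[OF h, symmetric] using Ih(3)[OF h] q(1)[OF h] by (simp add: field_simps power3_eq_cube power2_eq_square)
    ultimately have "((\<lambda>h. \<beta> * Lf e h + poly C h / (Qf e h * h ^ 1)) has_real_derivative poly C2 h / (Qf e h ^ 3 * h ^ 2)) (at h)"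
      unfolding C1_def[symmetric] by (simp only: C2_def poly_add add_divide_distrib numeral_2_eq_2 One_nat_def)
    thus ?thesis unfolding g1_def[abs_def]
      using deriv_sqrt_part[OF Ih(2)[OF h], of P1 "Suc N"] deriv_root_part(2)[OF e Ih(1,2)[OF h], of B1 "Suc N"]
      unfolding P2_def B2_def by (intro DERIV_add DERIV_const)
  qed
  have ff: "deriv f h = g1 h" if h: "h \<in> I" for h
  proof -
    have "(f has_real_derivative g1 h) (at h)"
      unfolding g1_def by (rule has_field_derivative_transform_within_open[OF f1'[OF h] I(1) h]) (use f in \<open>simp add: f1_def\<close>)
    thus ?thesis by (rule DERIV_imp_deriv)
  qed
  define D where "D = B2 + C2 * monom 1 N"
  have f2: "deriv (deriv f) h = (poly P2 h / sqrt (- h) + poly D h / Qf e h ^ 3) / h ^ Suc (Suc N)" if h: "h \<in> I" for h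
  proof -
    have "(deriv f has_real_derivative poly P2 h / (sqrt (- h) * h ^ Suc (Suc N)) + 0 + poly B2 h / (Qf e h ^ 3 * h ^ Suc (Suc N)) + poly C2 h / (Qf e h ^ 3 * h ^ 2)) (at h)"
      by (rule has_field_derivative_transform_within_open[OF g1'[OF h] I(1) h]) (use ff in simp)
    hence "deriv (deriv f) h = poly P2 h / (sqrt (- h) * h ^ Suc (Suc N)) + 0 + poly B2 h / (Qf e h ^ 3 * h ^ Suc (Suc N)) + poly C2 h / (Qf e h ^ 3 * h ^ 2)"
      by (rule DERIV_imp_deriv)
    moreover have "poly C2 h / (Qf e h ^ 3 * h ^ 2) = poly (C2 * monom 1 N) h / (Qf e h ^ 3 * h ^ Suc (Suc N))"
      using Ih(3)[OF h] by (simp add: poly_monom power2_eq_square)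
    ultimately show ?thesis by (simp add: D_def add_divide_distrib)
  qed
  have degs: "degree P2 \<le> N + 2" "degree B2 \<le> degree B + 2" "degree D \<le> N + 3"
  proof -
    show "degree P2 \<le> N + 2" unfolding P2_def P1_def using degree_euler_le deg(1) by (meson order_trans)
    have "degree B1 \<le> Suc (degree B)" "degree B2 \<le> Suc (degree B1)"
      unfolding B1_def B2_def by (rule degree_root_step_le)+
    thus b: "degree B2 \<le> degree B + 2" by linarith
    have "degree C \<le> 1" by (simp add: C_def)
    hence "degree C1 \<le> 2"
      unfolding C1_def using degree_root_step_le(2)[of e C "real 1" "2 * e"] by linarith
    moreover have "degree ([:0, - \<beta>:] * sq e) \<le> 2"
      using degree_mult_le[of "[:0, - \<beta>:]" "sq e"] degree_pCons_le[of 1 "[:4 * e:]"] degree_pCons_le[of 0 "[:- \<beta>:]"] by (simp add: sq_def)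
    ultimately have "degree C2 \<le> 2" unfolding C2_def by (simp only: degree_add_le)
    hence "degree (C2 * monom 1 N) \<le> N + 2" using degree_mult_le[of C2 "monom 1 N"] degree_monom_le[of "1::real" N] by linarith
    thus "degree D \<le> N + 3" unfolding D_def using b deg(2) by (intro degree_add_le) linarith+
  qed
  note ra1 = real_analytic_on_deriv(1)[OF raf I(1)]
  note ra2 = real_analytic_on_deriv(1)[OF ra1 I(1)]
  have lift: "zeros_le f I (k + 2)" if "zeros_le (deriv (deriv f)) I k" for k
    using zeros_le_deriv[OF raf I zeros_le_deriv[OF ra1 I that]] by simp
  have affine: "zeros_le f I 1" if "P2 = 0" "D = 0"
  proof -
    obtain x0 where x0: "x0 \<in> I" "f x0 \<noteq> 0" using nz by blast
    show ?thesis by (rule zeros_le_affine[OF raf I _ x0]) (use f2 that in simp)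
  qed
  define R where "R = P2 * P2 * sq e ^ 3 + [:0, 1:] * D * D"
  show "zeros_le f I (2 * N + 9)"
  proof (cases "R = 0")
    case True
    have "P2 = 0 \<and> D = 0"
    proof -
      have *: "poly P2 h = 0 \<and> poly D h = 0" if h: "h > 0" for h
      proof -
        have "poly P2 h * poly P2 h * (1 + 4 * e * h) ^ 3 + h * (poly D h * poly D h) = 0"
          using arg_cong[OF True, of "\<lambda>p. poly p h"] by (simp add: R_def sq_def mult_ac)
        moreover have "poly P2 h * poly P2 h * (1 + 4 * e * h) ^ 3 \<ge> 0" "h * (poly D h * poly D h) \<ge> 0"
          using h e by simp_all
        ultimately have "poly P2 h * poly P2 h * (1 + 4 * e * h) ^ 3 = 0" "h * (poly D h * poly D h) = 0" by linarith+
        moreover have "1 + 4 * e * h > 0" using h e by (simp add: add_pos_pos)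
        ultimately show ?thesis using h by auto
      qed
      thus ?thesis using poly_eq_0_on_pos[of P2] poly_eq_0_on_pos[of D] by blast
    qed
    thus ?thesis using affine zeros_le_mono[of f I 1 "2 * N + 9"] by simp
  next
    case False
    define G where "G h = (sqrt (- h) * Qf e h ^ 3 * h ^ Suc (Suc N)) * (poly P2 h * Qf e h ^ 3 - sqrt (- h) * poly D h)" for h
    have raG: "real_analytic_on G I"
      unfolding G_def[abs_def]
    by (intro real_analytic_mult real_analytic_power real_analytic_diff real_analytic_poly real_analytic_ident raS raQ)
    have "zeros_le (\<lambda>h. deriv (deriv f) h * G h) I (2 * N + 7)"
    proof (rule zeros_le_cong[OF zeros_le_mono[OF zeros_le_poly[OF False I]] I(1)])
      have "degree (P2 * P2 * sq e ^ 3) \<le> (N + 2) + (N + 2) + 3"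
      proof -
        have "degree (sq e) \<le> 1" using degree_pCons_le[of 1 "[:4 * e:]"] by (simp add: sq_def)
        hence "degree (sq e ^ 3) \<le> 3" using degree_power_le[of "sq e" 3] by linarith
        thus ?thesis using degree_mult_le[of "P2 * P2" "sq e ^ 3"] degree_mult_le[of P2 P2] degs(1) by linarith
      qed
      moreover have "degree ([:0, 1:] * D * D) \<le> 1 + (N + 3) + (N + 3)"
        using degree_mult_le[of "[:0, 1:] * D" D] degree_mult_le[of "[:0, 1:]" D] degs(3) by simp
      ultimately show "degree R \<le> 2 * N + 7" unfolding R_def by (intro degree_add_le) linarith+
      fix h assume h: "h \<in> I"
      define s x where "s = sqrt (- h)" and "x = Qf e h"
      have s: "s > 0" "s * s = - h" using Ih[OF h] by (simp_all add: s_def)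
      have x: "x > 0" "poly (sq e) h = x * x" using q[OF h] by (simp_all add: x_def power2_eq_square)
      have "deriv (deriv f) h * G h = (poly P2 h / s + poly D h / x ^ 3) / h ^ Suc (Suc N) * ((s * x ^ 3 * h ^ Suc (Suc N)) * (poly P2 h * x ^ 3 - s * poly D h))"
        by (simp only: f2[OF h] G_def s_def x_def)
      also have "\<dots> = (poly P2 h * x ^ 3 + s * poly D h) * (poly P2 h * x ^ 3 - s * poly D h)"
        using s(1) x(1) Ih(3)[OF h] by (simp add: field_simps)
      also have "\<dots> = poly P2 h * poly P2 h * (x * x) ^ 3 - (s * s) * poly D h * poly D h" by algebra
      also have "\<dots> = poly R h" unfolding s(2) R_def poly_add poly_mult poly_power x(2) by simp
      finally show "poly R h = deriv (deriv f) h * G h" by simp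
    qed
    from lift[OF zeros_le_mult[OF ra2 raG I(1) this]] show ?thesis by (rule zeros_le_mono) simp
  qed
  show "zeros_le f I 5" if z: "P = 0" "\<alpha> = 0" "\<beta> = 0" "N = 0"
  proof (cases "D = 0")
    case True
    have "P2 = 0" using z by (simp add: P2_def P1_def)
    thus ?thesis using affine[OF _ True] zeros_le_mono[of f I 1 5] by simp
  next
    case False
    have "C2 = 0" using z by (simp add: C2_def C1_def C_def)
    hence "degree D \<le> 3" using degs(2) deg(2) z by (simp add: D_def)
    have "zeros_le (\<lambda>h. deriv (deriv f) h * (Qf e h ^ 3 * h ^ 2)) I 3"
    proof (rule zeros_le_cong[OF zeros_le_mono[OF zeros_le_poly[OF False I] \<open>degree D \<le> 3\<close>] I(1)])
      fix h assume h: "h \<in> I"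
      have "P2 = 0" using z by (simp add: P2_def P1_def)
      thus "poly D h = deriv (deriv f) h * (Qf e h ^ 3 * h ^ 2)"
        using f2[OF h] q(1)[OF h] Ih(3)[OF h] z(4) by (simp add: power2_eq_square)
    qed
    moreover have "real_analytic_on (\<lambda>h. Qf e h ^ 3 * h ^ 2) I" by (intro real_analytic_intros raQ)
    ultimately have "zeros_le (deriv (deriv f)) I 3" using zeros_le_mult[OF ra2 _ I(1)] by blast
    from lift[OF this] show ?thesis by simp
  qed
qed

section \<open>Integrals of monomials along half an orbit\<close>

text \<open>Minus the line integral of \<open>x ^ i y ^ k dy\<close> along the right half of an unperturbed orbit; negative exponents \<open>k\<close> come from the
integrating factor \<open>y ^ -3\<close>.\<close>

definition KK :: "real \<Rightarrow> nat \<Rightarrow> int \<Rightarrow> real \<Rightarrow> real" where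
  "KK e i k w = integral {0..pi} (\<lambda>t. xc e w t ^ i * yc e w t powi k * - yt e w t)"

lemma integral_by_antiderivative:
  fixes f F :: "real \<Rightarrow> real"
  assumes "a \<le> b" "\<And>t. (F has_real_derivative f t) (at t)"
  shows "integral {a..b} f = F b - F a"
  by (rule integral_unique, rule fundamental_theorem_of_calculus[OF assms(1)])
     (use assms(2) in \<open>auto simp flip: has_real_derivative_iff_has_vector_derivative intro: has_field_derivative_at_within\<close>)

lemma coord_t_derivs:
  fixes w :: real
  assumes "w > 0"
  shows "(xc e w has_real_derivative xt e w t) (at t)" "(yc e w has_real_derivative yt e w t) (at t)"
  using coords_derivative[of "\<lambda>_. w" t 0 UNIV "\<lambda>t. t" 1 e] assms by simp_all

lemma coord_continuous_t:
  fixes w :: real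
  assumes "w > 0"
  shows "continuous_on S (xc e w)" "continuous_on S (yc e w)" "continuous_on S (xt e w)" "continuous_on S (yt e w)"
  using assms unfolding xc_def yc_def xt_def yt_def by (auto intro!: continuous_intros)

lemma real_gt_sqrt:
  assumes "e > 0" "w > sqrt e"
  shows "(w::real) > 0" "w\<^sup>2 > e" "w\<^sup>2 + e > 0"
proof -
  show w: "w > 0" using assms real_sqrt_gt_zero[OF assms(1)] by linarith
  show "w\<^sup>2 > e" using assms w by (metis real_less_rsqrt real_sqrt_less_iff real_sqrt_abs abs_of_pos)
  show "w\<^sup>2 + e > 0" using assms by (simp add: add_nonneg_pos)
qed

context
  fixes e w :: real
  assumes e: "e > 0" and w: "w > sqrt e"
begin

lemma w_pos: "w > 0" using real_gt_sqrt[OF e w] by simp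
lemma y_pos: "yc e w t > 0" using yc_pos[OF e w_pos] .

definition hh :: real where "hh = - (w\<^sup>2 / (w\<^sup>2 + e)\<^sup>2)"

lemma x_squared: "(xc e w t)\<^sup>2 = hh * (yc e w t)\<^sup>2 + yc e w t - e"
  using HH_coords(1)[OF e w_pos] by (simp add: hh_def)

lemma x_xt: "2 * xc e w t * xt e w t = (2 * hh * yc e w t + 1) * yt e w t"
proof -
  note d = coord_t_derivs[OF w_pos, of e t]
  have "((\<lambda>t. (xc e w t)\<^sup>2) has_real_derivative 2 * xc e w t * xt e w t) (at t)"
    using d by (auto intro!: derivative_eq_intros)
  moreover have "((\<lambda>t. hh * (yc e w t)\<^sup>2 + yc e w t - e) has_real_derivative (2 * hh * yc e w t + 1) * yt e w t) (at t)"
    using d by (auto intro!: derivative_eq_intros simp: algebra_simps)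
  ultimately show ?thesis unfolding x_squared using DERIV_unique by blast
qed

lemma KK_integrable: "(\<lambda>t. xc e w t ^ i * yc e w t powi k * - yt e w t) integrable_on {0..pi}"
  using y_pos w_pos
  by (intro integrable_continuous_real continuous_intros coord_continuous_t) (auto simp: less_imp_neq[symmetric])

text \<open>On the orbit \<open>x\<^sup>2 = h y\<^sup>2 + y - e\<close>.\<close>

lemma KK_rec: "KK e (i + 2) k w = hh * KK e i (k + 2) w + KK e i (k + 1) w - e * KK e i k w"
proof -
  define J where "J k t = xc e w t ^ i * yc e w t powi k * - yt e w t" for k t
  have int: "J k integrable_on {0..pi}" for k unfolding J_def by (rule KK_integrable)
  have "xc e w t ^ (i + 2) * yc e w t powi k * - yt e w t = (hh * J (k + 2) t + J (k + 1) t) - e * J k t" for t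
  proof -
    have "yc e w t \<noteq> 0" using y_pos[of t] by simp
    hence "yc e w t powi (k + 2) = yc e w t powi k * (yc e w t)\<^sup>2" "yc e w t powi (k + 1) = yc e w t powi k * yc e w t"
      by (simp_all add: power_int_add)
    moreover have "xc e w t ^ (i + 2) = xc e w t ^ i * (hh * (yc e w t)\<^sup>2 + yc e w t - e)"
      unfolding power_add x_squared ..
    ultimately show ?thesis by (simp only: J_def) (simp add: algebra_simps)
  qed
  hence "KK e (i + 2) k w = integral {0..pi} (\<lambda>t. (hh * J (k + 2) t + J (k + 1) t) - e * J k t)"
    unfolding KK_def by presburger
  also have "\<dots> = integral {0..pi} (\<lambda>t. hh * J (k + 2) t + J (k + 1) t) - integral {0..pi} (\<lambda>t. e * J k t)"
    by (intro Henstock_Kurzweil_Integration.integral_diff integrable_add integrable_on_mult_right int)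
  also have "integral {0..pi} (\<lambda>t. hh * J (k + 2) t + J (k + 1) t) = integral {0..pi} (\<lambda>t. hh * J (k + 2) t) + integral {0..pi} (J (k + 1))"
    by (intro Henstock_Kurzweil_Integration.integral_add integrable_on_mult_right int)
  finally show ?thesis unfolding KK_def J_def by simp
qed

text \<open>Integrals in \<open>dx\<close> are reduced to integrals in \<open>dy\<close>; the boundary terms vanish because \<open>x = 0\<close> at both ends.\<close>

lemma KK_by_parts:
  "integral {0..pi} (\<lambda>t. xc e w t ^ i * yc e w t powi k * xt e w t) = real_of_int k / real (i + 1) * KK e (i + 1) (k - 1) w"
proof -
  have int: "(\<lambda>t. xc e w t ^ i * yc e w t powi k * xt e w t) integrable_on {0..pi}"
    using y_pos w_pos
    by (intro integrable_continuous_real continuous_intros coord_continuous_t) (auto simp: less_imp_neq[symmetric])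
  have der: "((\<lambda>t. xc e w t ^ (i + 1) * yc e w t powi k) has_real_derivative
      real (i + 1) * (xc e w t ^ i * yc e w t powi k * xt e w t) - of_int k * (xc e w t ^ (i + 1) * yc e w t powi (k - 1) * - yt e w t)) (at t)" for t
  proof -
    have y: "0 \<le> k \<or> yc e w t \<noteq> 0" using y_pos[of t] by simp
    note d = coord_t_derivs[OF w_pos, of e t]
    show ?thesis
      by (rule DERIV_cong[OF DERIV_mult[OF DERIV_power[OF d(1), of "i + 1"] DERIV_power_int[OF d(2) y]]])
         (simp add: algebra_simps)
  qed
  have "integral {0..pi} (\<lambda>t. real (i + 1) * (xc e w t ^ i * yc e w t powi k * xt e w t) - of_int k * (xc e w t ^ (i + 1) * yc e w t powi (k - 1) * - yt e w t)) = 0"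
    by (subst integral_by_antiderivative[OF _ der]) (auto simp: xc_def)
  also have "integral {0..pi} (\<lambda>t. real (i + 1) * (xc e w t ^ i * yc e w t powi k * xt e w t) - of_int k * (xc e w t ^ (i + 1) * yc e w t powi (k - 1) * - yt e w t))
     = real (i + 1) * integral {0..pi} (\<lambda>t. xc e w t ^ i * yc e w t powi k * xt e w t) - of_int k * KK e (i + 1) (k - 1) w"
    unfolding KK_def
    by (subst Henstock_Kurzweil_Integration.integral_diff[OF integrable_on_mult_right[OF int] integrable_on_mult_right[OF KK_integrable]]) simp
  finally show ?thesis by (simp add: field_simps)
qed

text \<open>Integrate the derivative of \<open>- x ^ 3 y ^ p\<close>, which vanishes at both ends, and use the equation of the orbit.\<close>

lemma KK_odd_rec:
  "(real_of_int p + 3) * hh * KK e 1 (p + 1) w + (real_of_int p + 3 / 2) * KK e 1 p w - real_of_int p * e * KK e 1 (p - 1) w = 0"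
proof -
  define J where "J k t = xc e w t ^ 1 * yc e w t powi k * - yt e w t" for k t
  have int: "J k integrable_on {0..pi}" for k unfolding J_def by (rule KK_integrable)
  have KJ: "KK e 1 k w = integral {0..pi} (J k)" for k unfolding KK_def J_def by simp
  have der: "((\<lambda>t. - (xc e w t ^ 3 * yc e w t powi p)) has_real_derivative
      ((of_int p + 3) * hh) * J (p + 1) t + (of_int p + 3 / 2) * J p t - (of_int p * e) * J (p - 1) t) (at t)" for t
  proof -
    have y: "yc e w t \<noteq> 0" using y_pos[of t] by simp
    have "((\<lambda>t. - (xc e w t ^ 3 * yc e w t powi p)) has_real_derivative
       - (3 * (xc e w t)\<^sup>2 * xt e w t * yc e w t powi p + of_int p * yc e w t powi (p - 1) * yt e w t * xc e w t ^ 3)) (at t)"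
      using coord_t_derivs[OF w_pos, of e t] y
      by (auto intro!: derivative_eq_intros simp: algebra_simps power2_eq_square)
    also have "yc e w t powi p = yc e w t powi (p - 1) * yc e w t" using power_int_add_1[of "yc e w t" "p - 1"] y by simp
    also have "xc e w t ^ 3 = xc e w t * (xc e w t)\<^sup>2" by (simp add: power2_eq_square power3_eq_cube)
    also have "3 * (xc e w t)\<^sup>2 * xt e w t = 3 / 2 * xc e w t * ((2 * hh * yc e w t + 1) * yt e w t)"
      unfolding x_xt[symmetric] by (simp add: power2_eq_square)
    also have "- (3 / 2 * xc e w t * ((2 * hh * yc e w t + 1) * yt e w t) * (yc e w t powi (p - 1) * yc e w t)
         + of_int p * yc e w t powi (p - 1) * yt e w t * (xc e w t * (xc e w t)\<^sup>2))
       = ((of_int p + 3) * hh) * J (p + 1) t + (of_int p + 3 / 2) * J p t - (of_int p * e) * J (p - 1) t"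
    proof -
      have "yc e w t powi (p + 1) = yc e w t powi ((p - 1) + 2)" by (rule arg_cong[where f = "\<lambda>k. yc e w t powi k"]) simp
      also have "\<dots> = yc e w t powi (p - 1) * yc e w t powi 2" by (rule power_int_add) (use y in simp)
      finally have "yc e w t powi (p + 1) = yc e w t powi (p - 1) * (yc e w t)\<^sup>2" by simp
      moreover have "yc e w t powi p = yc e w t powi (p - 1) * yc e w t"
        using y power_int_add_1[of "yc e w t" "p - 1"] by simp
      ultimately show ?thesis unfolding J_def x_squared by (simp only:) (simp add: algebra_simps power2_eq_square)
    qed
    finally show ?thesis .
  qed
  have "integral {0..pi} (\<lambda>t. ((of_int p + 3) * hh) * J (p + 1) t + (of_int p + 3 / 2) * J p t - (of_int p * e) * J (p - 1) t) = 0"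
    by (subst integral_by_antiderivative[OF _ der]) (auto simp: xc_def)
  also have "integral {0..pi} (\<lambda>t. ((of_int p + 3) * hh) * J (p + 1) t + (of_int p + 3 / 2) * J p t - (of_int p * e) * J (p - 1) t)
     = ((of_int p + 3) * hh) * integral {0..pi} (J (p + 1)) + (of_int p + 3 / 2) * integral {0..pi} (J p) - (of_int p * e) * integral {0..pi} (J (p - 1))"
    by (subst Henstock_Kurzweil_Integration.integral_diff, intro integrable_add integrable_on_mult_right int, intro integrable_on_mult_right int,
        subst Henstock_Kurzweil_Integration.integral_add, intro integrable_on_mult_right int, intro integrable_on_mult_right int, simp)
  finally show ?thesis unfolding KJ .
qed

lemma y_ends: "yc e w 0 = w\<^sup>2 + e" "yc e w pi = e * (w\<^sup>2 + e) / w\<^sup>2"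
  using w_pos by (simp_all add: yc_def)

lemma KK_even_base:
  assumes "k \<noteq> - 1"
  shows "KK e 0 k w = ((w\<^sup>2 + e) powi (k + 1) - (e * (w\<^sup>2 + e) / w\<^sup>2) powi (k + 1)) / (real_of_int k + 1)"
proof -
  have k: "real_of_int k + 1 \<noteq> 0" using assms by (metis of_int_1 of_int_add of_int_eq_0_iff add_eq_0_iff2)
  have der: "((\<lambda>t. - (yc e w t powi (k + 1)) / (real_of_int k + 1)) has_real_derivative xc e w t ^ 0 * yc e w t powi k * - yt e w t) (at t)" for t
  proof -
    have "yc e w t \<noteq> 0" using y_pos[of t] by simp
    hence "((\<lambda>t. - (yc e w t powi (k + 1)) / (real_of_int k + 1)) has_real_derivative
       - (real_of_int (k + 1) * yc e w t powi (k + 1 - 1) * yt e w t) / (real_of_int k + 1)) (at t)"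
      using coord_t_derivs(2)[OF w_pos, of e t] by (intro DERIV_cdivide DERIV_minus DERIV_power_int) auto
    also have "- (real_of_int (k + 1) * yc e w t powi (k + 1 - 1) * yt e w t) / (real_of_int k + 1) = xc e w t ^ 0 * yc e w t powi k * - yt e w t"
      using k by simp
    finally show ?thesis .
  qed
  show ?thesis unfolding KK_def
    by (subst integral_by_antiderivative[OF _ der]) (simp_all add: y_ends diff_divide_distrib)
qed

lemma KK_even_log: "KK e 0 (-1) w = ln (w\<^sup>2 / e)"
proof -
  have der: "((\<lambda>t. - ln (yc e w t)) has_real_derivative xc e w t ^ 0 * yc e w t powi (-1) * - yt e w t) (at t)" for t
  proof -
    have "((\<lambda>t. - ln (yc e w t)) has_real_derivative - (1 / yc e w t * yt e w t)) (at t)"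
      using DERIV_minus[OF DERIV_chain2[OF DERIV_ln_divide[OF y_pos] coord_t_derivs(2)[OF w_pos]]] .
    thus ?thesis by (simp add: power_int_minus field_simps)
  qed
  have "KK e 0 (-1) w = ln (w\<^sup>2 + e) - ln (e * (w\<^sup>2 + e) / w\<^sup>2)"
    unfolding KK_def by (subst integral_by_antiderivative[OF _ der]) (simp_all add: y_ends)
  also have "\<dots> = ln (w\<^sup>2 / e)"
    using real_gt_sqrt[OF e w] e by (simp add: ln_div ln_mult)
  finally show ?thesis .
qed

lemma KK_odd_0: "KK e 1 0 w = pi / 8 * ((w\<^sup>2 + e) * (w\<^sup>2 - e)\<^sup>2 / w ^ 3)"
proof -
  define c where "c = (w\<^sup>2 + e) * (w\<^sup>2 - e)\<^sup>2 / (4 * w ^ 3)"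
  have der: "((\<lambda>t. c * ((t - sin t * cos t) / 2)) has_real_derivative xc e w t ^ 1 * yc e w t powi 0 * - yt e w t) (at t)" for t
  proof -
    have "((\<lambda>t. c * ((t - sin t * cos t) / 2)) has_real_derivative c * ((1 - (cos t * cos t + - sin t * sin t)) / 2)) (at t)"
      by (auto intro!: derivative_eq_intros)
    also have "(1 - (cos t * cos t + - sin t * sin t)) / 2 = (sin t)\<^sup>2"
      using sin_cos_squared_add[of t] by (simp add: power2_eq_square)
    also have "c * (sin t)\<^sup>2 = xc e w t ^ 1 * yc e w t powi 0 * - yt e w t"
      using w_pos by (simp add: c_def xc_def yt_def power2_eq_square power3_eq_cube field_simps)
    finally show ?thesis .
  qed
  show ?thesis unfolding KK_def
    by (subst integral_by_antiderivative[OF _ der]) (simp_all add: c_def)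
qed

text \<open>The Poisson kernel has mean value \<open>1\<close>. The antiderivative \<open>t - 2 arctan (\<kappa> sin t / (1 + \<kappa> cos t))\<close> is smooth on the whole line, unlike
the one obtained by the half-angle substitution.\<close>

lemma integral_poisson:
  assumes "\<bar>\<kappa>\<bar> < (1::real)"
  shows "integral {0..pi} (\<lambda>t. (1 - \<kappa>\<^sup>2) / (1 + \<kappa>\<^sup>2 + 2 * \<kappa> * cos t)) = pi"
proof -
  have p: "1 + \<kappa> * cos t > 0" for t
  proof -
    have "\<bar>\<kappa> * cos t\<bar> \<le> \<bar>\<kappa>\<bar> * 1" unfolding abs_mult by (intro mult_left_mono) auto
    thus ?thesis using assms by linarith
  qed
  have der: "((\<lambda>t. t - 2 * arctan (\<kappa> * sin t / (1 + \<kappa> * cos t))) has_real_derivative (1 - \<kappa>\<^sup>2) / (1 + \<kappa>\<^sup>2 + 2 * \<kappa> * cos t)) (at t)" for t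
  proof -
    define S C where "S = sin t" and "C = cos t"
    have SC: "S\<^sup>2 = 1 - C\<^sup>2" by (simp add: S_def C_def sin_squared_eq)
    have n: "1 + \<kappa> * C \<noteq> 0" using p[of t] by (simp add: C_def)
    have "((\<lambda>t. t - 2 * arctan (\<kappa> * sin t / (1 + \<kappa> * cos t))) has_real_derivative
       1 - 2 * (inverse (1 + (\<kappa> * S / (1 + \<kappa> * C))\<^sup>2) * ((\<kappa> * C * (1 + \<kappa> * C) - \<kappa> * S * (\<kappa> * - S)) / ((1 + \<kappa> * C) * (1 + \<kappa> * C))))) (at t)"
      using n unfolding S_def C_def by (auto intro!: derivative_eq_intros)
    also have "1 + (\<kappa> * S / (1 + \<kappa> * C))\<^sup>2 = (1 + \<kappa>\<^sup>2 + 2 * \<kappa> * C) / (1 + \<kappa> * C)\<^sup>2"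
    proof -
      have "(1 + \<kappa> * C)\<^sup>2 + (\<kappa> * S)\<^sup>2 = 1 + \<kappa>\<^sup>2 + 2 * \<kappa> * C" unfolding power_mult_distrib SC by (simp add: power2_eq_square algebra_simps)
      thus ?thesis using n by (simp add: power_divide add_divide_distrib[symmetric] divide_simps)
    qed
    also have "\<kappa> * C * (1 + \<kappa> * C) - \<kappa> * S * (\<kappa> * - S) = \<kappa> * (C + \<kappa>)" using SC by algebra
    also have "1 - 2 * (inverse ((1 + \<kappa>\<^sup>2 + 2 * \<kappa> * C) / (1 + \<kappa> * C)\<^sup>2) * (\<kappa> * (C + \<kappa>) / ((1 + \<kappa> * C) * (1 + \<kappa> * C))))
       = (1 - \<kappa>\<^sup>2) / (1 + \<kappa>\<^sup>2 + 2 * \<kappa> * C)"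
    proof -
      have "(1 + \<kappa> * C)\<^sup>2 + (\<kappa> * S)\<^sup>2 = 1 + \<kappa>\<^sup>2 + 2 * \<kappa> * C" unfolding power_mult_distrib SC by (simp add: power2_eq_square algebra_simps)
      moreover have "(1 + \<kappa> * C)\<^sup>2 > 0" using n by simp
      ultimately have "1 + \<kappa>\<^sup>2 + 2 * \<kappa> * C > 0" using zero_le_power2[of "\<kappa> * S"] by linarith
      moreover have "1 - 2 * (inverse (D / (1 + \<kappa> * C)\<^sup>2) * (N / ((1 + \<kappa> * C) * (1 + \<kappa> * C)))) = (D - 2 * N) / D" if "D > 0" for D N
        using n that by (simp add: power2_eq_square diff_divide_distrib)
      moreover have "1 + \<kappa>\<^sup>2 + 2 * \<kappa> * C - 2 * (\<kappa> * (C + \<kappa>)) = 1 - \<kappa>\<^sup>2" by (simp add: power2_eq_square algebra_simps)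
      ultimately show ?thesis by presburger
    qed
    finally show ?thesis by (simp add: C_def)
  qed
  show ?thesis by (subst integral_by_antiderivative[OF _ der]) simp_all
qed

text \<open>The integrand is a trigonometric polynomial minus a constant multiple of the Poisson kernel with parameter
\<open>\<kappa> = (w - sqrt e) / (w + sqrt e)\<close>.\<close>

lemma KK_odd_m1: "KK e 1 (-1) w = pi * (w\<^sup>2 + e) / (2 * w) - pi * sqrt e"
proof -
  define z d where "z = w\<^sup>2 + e" and "d = w\<^sup>2 - e"
  note rg = real_gt_sqrt[OF e w]
  have se: "sqrt e > 0" "sqrt e * sqrt e = e" using e by auto
  define \<kappa> where "\<kappa> = (w - sqrt e) / (w + sqrt e)"
  have ws: "w + sqrt e > 0" using rg se by linarith
  have k: "\<bar>\<kappa>\<bar> < 1" using w se ws by (simp add: \<kappa>_def abs_less_iff field_simps)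
  have zd: "z + d * cos t > 0" for t
  proof -
    have "yc e w t * (2 * w\<^sup>2) = z * (z + d * cos t)" using rg by (simp add: yc_def z_def d_def)
    hence "z * (z + d * cos t) > 0" using y_pos[of t] rg by (metis mult_pos_pos zero_less_numeral zero_less_power)
    thus ?thesis using rg by (simp add: z_def zero_less_mult_iff)
  qed
  have P: "(1 - \<kappa>\<^sup>2) / (1 + \<kappa>\<^sup>2 + 2 * \<kappa> * cos t) = 2 * sqrt e * w / (z + d * cos t)" for t
  proof -
    have 1: "1 - \<kappa>\<^sup>2 = 4 * w * sqrt e / (w + sqrt e)\<^sup>2"
    proof -
      have "(w + sqrt e)\<^sup>2 - (w - sqrt e)\<^sup>2 = 4 * w * sqrt e" by (simp add: power2_eq_square algebra_simps)
      moreover have "1 - \<kappa>\<^sup>2 = ((w + sqrt e)\<^sup>2 - (w - sqrt e)\<^sup>2) / (w + sqrt e)\<^sup>2"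
      proof -
        have "\<kappa>\<^sup>2 = (w - sqrt e)\<^sup>2 / (w + sqrt e)\<^sup>2" by (simp add: \<kappa>_def power_divide)
        thus ?thesis using ws by (simp add: diff_divide_distrib)
      qed
      ultimately show ?thesis by simp
    qed
    have 2: "1 + \<kappa>\<^sup>2 + 2 * \<kappa> * cos t = 2 * (z + d * cos t) / (w + sqrt e)\<^sup>2"
    proof -
      have "(w + sqrt e)\<^sup>2 + (w - sqrt e)\<^sup>2 = 2 * z" using se(2) by (simp add: z_def power2_eq_square algebra_simps)
      moreover have "(w - sqrt e) * (w + sqrt e) = d" using se(2) by (simp add: d_def power2_eq_square algebra_simps)
      hence \<kappa>: "\<kappa> = d / (w + sqrt e)\<^sup>2" using ws unfolding \<kappa>_def by (metis less_irrefl mult_divide_mult_cancel_right power2_eq_square)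
      moreover have "\<kappa>\<^sup>2 = (w - sqrt e)\<^sup>2 / (w + sqrt e)\<^sup>2" by (simp add: \<kappa>_def power_divide)
      moreover have "1 = (w + sqrt e)\<^sup>2 / (w + sqrt e)\<^sup>2" using ws by simp
      moreover have "2 * \<kappa> * cos t = 2 * d * cos t / (w + sqrt e)\<^sup>2" using \<kappa> by simp
      ultimately have "1 + \<kappa>\<^sup>2 + 2 * \<kappa> * cos t = ((w + sqrt e)\<^sup>2 + (w - sqrt e)\<^sup>2 + 2 * d * cos t) / (w + sqrt e)\<^sup>2"
        unfolding add_divide_distrib by presburger
      also have "\<dots> = 2 * (z + d * cos t) / (w + sqrt e)\<^sup>2"
        by (simp add: \<open>(w + sqrt e)\<^sup>2 + (w - sqrt e)\<^sup>2 = 2 * z\<close>)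
      finally show ?thesis .
    qed
    show ?thesis unfolding 1 2 using ws zd[of t] by (simp add: field_simps)
  qed
  have Pc: "continuous_on {0..pi} (\<lambda>t. 2 * sqrt e * w / (z + d * cos t))"
    using zd by (intro continuous_intros) (auto simp: less_imp_neq[symmetric])
  have Pi: "integral {0..pi} (\<lambda>t. 2 * sqrt e * w / (z + d * cos t)) = pi"
    using integral_poisson[OF k] unfolding P .
  have der1: "((\<lambda>t. 1 / (2 * w) * (z * t - d * sin t)) has_real_derivative 1 / (2 * w) * (z - d * cos t)) (at t)" for t
  proof -
    have "((\<lambda>t. z * t - d * sin t) has_real_derivative z - d * cos t) (at t)" by (auto intro!: derivative_eq_intros)
    thus ?thesis by (rule DERIV_cmult)
  qed
  have i1: "integral {0..pi} (\<lambda>t. 1 / (2 * w) * (z - d * cos t)) = 1 / (2 * w) * (z * pi)"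
    by (subst integral_by_antiderivative[OF _ der1]) simp_all
  have "xc e w t ^ 1 * yc e w t powi (-1) * - yt e w t = 1 / (2 * w) * (z - d * cos t) - sqrt e * (2 * sqrt e * w / (z + d * cos t))" for t
  proof -
    have nz: "w \<noteq> 0" "z \<noteq> 0" "z + d * cos t \<noteq> 0" using rg zd[of t] by (auto simp: z_def)
    have "xc e w t ^ 1 * yc e w t powi (-1) * - yt e w t
       = (d / (2 * w) * sin t) * inverse (z * (z + d * cos t) / (2 * w\<^sup>2)) * (z * d / (2 * w\<^sup>2) * sin t)"
      by (simp add: xc_def yc_def yt_def z_def d_def power_int_minus)
    also have "\<dots> = d\<^sup>2 * (sin t)\<^sup>2 / (2 * w * (z + d * cos t))"
    proof -
      have "(d / (2 * w) * s) * inverse (z * Z / (2 * w\<^sup>2)) * (z * d / (2 * w\<^sup>2) * s) = d\<^sup>2 * s\<^sup>2 / (2 * w * Z)"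
        if "Z \<noteq> 0" for Z s
        using nz(1,2) that by (simp add: field_simps power2_eq_square)
      thus ?thesis using nz(3) by blast
    qed
    also have "d\<^sup>2 * (sin t)\<^sup>2 = (z - d * cos t) * (z + d * cos t) - 4 * e * w\<^sup>2"
      unfolding sin_squared_eq z_def d_def by algebra
    also have "((z - d * cos t) * (z + d * cos t) - 4 * e * w\<^sup>2) / (2 * w * (z + d * cos t))
       = 1 / (2 * w) * (z - d * cos t) - 2 * e * w / (z + d * cos t)"
    proof -
      have "(Y * Z - 4 * e * w\<^sup>2) / (2 * w * Z) = 1 / (2 * w) * Y - 2 * e * w / Z" if "Z \<noteq> 0" for Y Z
        using nz(1) that by (simp add: field_simps power2_eq_square)
      thus ?thesis using nz(3) by blast
    qed
    also have "2 * e * w / (z + d * cos t) = sqrt e * (2 * sqrt e * w / (z + d * cos t))"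
      using se(2) by (simp add: mult.assoc[symmetric])
    finally show ?thesis .
  qed
  hence "KK e 1 (-1) w = integral {0..pi} (\<lambda>t. 1 / (2 * w) * (z - d * cos t) - sqrt e * (2 * sqrt e * w / (z + d * cos t)))"
    unfolding KK_def by presburger
  also have "\<dots> = 1 / (2 * w) * (z * pi) - sqrt e * pi"
  proof -
    have A: "(\<lambda>t. 1 / (2 * w) * (z - d * cos t)) integrable_on {0..pi}"
      by (intro integrable_continuous_real continuous_intros)
    have B: "(\<lambda>t. sqrt e * (2 * sqrt e * w / (z + d * cos t))) integrable_on {0..pi}"
      by (intro integrable_on_mult_right integrable_continuous_real Pc)
    have C: "integral {0..pi} (\<lambda>t. sqrt e * (2 * sqrt e * w / (z + d * cos t))) = sqrt e * pi"
      by (subst integral_mult_right) (simp only: Pi)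
    show ?thesis unfolding Henstock_Kurzweil_Integration.integral_diff[OF A B] i1 C ..
  qed
  finally show ?thesis by (simp add: z_def mult_ac)
qed

end

section \<open>The linear span of the half-orbit integrals\<close>

text \<open>Laurent polynomials in \<open>h < 0\<close> with exponents in \<open>{a..b}\<close>; the interval may be empty.\<close>

definition lsp :: "int \<Rightarrow> int \<Rightarrow> (real \<Rightarrow> real) \<Rightarrow> bool" where
  "lsp a b f \<longleftrightarrow> (\<exists>c. \<forall>h<0. f h = (\<Sum>j = a..b. c j * h powi j))"

lemma lsp_zero: "lsp a b (\<lambda>_. 0)"
  unfolding lsp_def by (rule exI[of _ "\<lambda>_. 0"]) simp

lemma lsp_add:
  assumes "lsp a b f" "lsp a b g"
  shows "lsp a b (\<lambda>h. f h + g h)"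
proof -
  obtain c d where "\<forall>h<0. f h = (\<Sum>j = a..b. c j * h powi j)" "\<forall>h<0. g h = (\<Sum>j = a..b. d j * h powi j)"
    using assms unfolding lsp_def by blast
  thus ?thesis unfolding lsp_def
    by (intro exI[of _ "\<lambda>j. c j + d j"]) (simp add: sum.distrib algebra_simps)
qed

lemma lsp_cmult:
  assumes "lsp a b f"
  shows "lsp a b (\<lambda>h. r * f h)"
proof -
  obtain c where "\<forall>h<0. f h = (\<Sum>j = a..b. c j * h powi j)" using assms unfolding lsp_def by blast
  thus ?thesis unfolding lsp_def by (intro exI[of _ "\<lambda>j. r * c j"]) (simp add: sum_distrib_left mult_ac)
qed

lemma lsp_mono:
  assumes "lsp a b f" "a' \<le> a" "b \<le> b'"
  shows "lsp a' b' f"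
proof -
  obtain c where c: "\<forall>h<0. f h = (\<Sum>j = a..b. c j * h powi j)" using assms unfolding lsp_def by blast
  have "(\<Sum>j = a..b. c j * h powi j) = (\<Sum>j = a'..b'. (if j \<in> {a..b} then c j else 0) * h powi j)" for h :: real
    by (rule sum.mono_neutral_cong_left) (use assms(2,3) in auto)
  with c show ?thesis unfolding lsp_def by (intro exI[of _ "\<lambda>j. if j \<in> {a..b} then c j else 0"]) presburger
qed

lemma lsp_shift:
  assumes "lsp a b f" and d: "a' = a + d" "b' = b + d" and g: "\<And>h. h < 0 \<Longrightarrow> g h = h powi d * f h"
  shows "lsp a' b' g"
proof -
  obtain c where c: "\<forall>h<0. f h = (\<Sum>j = a..b. c j * h powi j)" using assms unfolding lsp_def by blast
  have "g h = (\<Sum>j = a'..b'. c (j - d) * h powi j)" if "h < 0" for h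
  proof -
    have "g h = (\<Sum>j = a..b. c j * h powi (j + d))"
      using c that g[OF that] by (simp add: sum_distrib_left power_int_add mult_ac)
    also have "\<dots> = (\<Sum>j = a'..b'. c (j - d) * h powi j)"
      by (rule sum.reindex_bij_witness[where i = "\<lambda>j. j - d" and j = "\<lambda>j. j + d"]) (use d in auto)
    finally show ?thesis .
  qed
  thus ?thesis unfolding lsp_def by (intro exI[of _ "\<lambda>j. c (j - d)"]) blast
qed

lemma lsp_const:
  assumes "a \<le> 0" "0 \<le> b"
  shows "lsp a b (\<lambda>_. r)"
proof -
  have "lsp 0 0 (\<lambda>_. r)" unfolding lsp_def by (intro exI[of _ "\<lambda>_. r"]) simp
  thus ?thesis by (rule lsp_mono) (use assms in auto)
qed

lemma lsp_linear:
  assumes "a \<le> 0" "1 \<le> b"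
  shows "lsp a b (\<lambda>h. r + s * h)"
proof -
  have "lsp (0 + 1) (0 + 1) (\<lambda>h. s * h)"
    by (rule lsp_shift[OF lsp_const[of 0 0 s], where d = 1]) auto
  hence "lsp a b (\<lambda>h. s * h)" by (rule lsp_mono) (use assms in auto)
  thus ?thesis by (intro lsp_add lsp_const) (use assms in auto)
qed

lemma lsp_poly:
  assumes "lsp (- int N) (int m - int N) f"
  shows "\<exists>p. degree p \<le> m \<and> (\<forall>h<0. f h = poly p h / h ^ N)"
proof -
  obtain c where c: "\<forall>h<0. f h = (\<Sum>j = - int N..int m - int N. c j * h powi j)" using assms unfolding lsp_def by blast
  define p where "p = (\<Sum>k\<le>m. monom (c (int k - int N)) k)"
  have "degree p \<le> m" unfolding p_def
    by (intro degree_sum_le) (auto intro: order_trans[OF degree_monom_le])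
  moreover have "f h = poly p h / h ^ N" if "h < 0" for h
  proof -
    have "poly p h / h ^ N = (\<Sum>k\<le>m. c (int k - int N) * (h ^ k / h ^ N))"
      by (simp add: p_def poly_sum poly_monom sum_divide_distrib)
    also have "\<dots> = (\<Sum>k\<le>m. c (int k - int N) * h powi (int k - int N))"
      using that by (simp add: power_int_diff)
    also have "\<dots> = (\<Sum>j = - int N..int m - int N. c j * h powi j)"
      by (rule sum.reindex_bij_witness[where i = "\<lambda>j. nat (j + int N)" and j = "\<lambda>k. int k - int N"]) auto
    finally show ?thesis using c that by simp
  qed
  ultimately show ?thesis by blast
qed

text \<open>The form \<open>\<alpha> B + \<beta> C\<close> with \<open>B\<close> a Laurent polynomial in the level \<open>h\<close> and \<open>C\<close> a polynomial in it. The integrals of even and odd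
powers of \<open>x\<close> are of this form with different \<open>\<alpha>\<close> and \<open>\<beta>\<close>.\<close>

definition cls :: "real \<Rightarrow> (real \<Rightarrow> real) \<Rightarrow> (real \<Rightarrow> real) \<Rightarrow> int \<Rightarrow> int \<Rightarrow> int \<Rightarrow> (real \<Rightarrow> real) \<Rightarrow> bool" where
  "cls e \<alpha> \<beta> a b c f \<longleftrightarrow> (\<exists>B C. lsp a b B \<and> lsp 0 c C \<and>
     (\<forall>w>sqrt e. f w = \<alpha> w * B (hw e w) + \<beta> w * C (hw e w)))"

lemma clsI:
  assumes "lsp a b B" "lsp 0 c C" "\<And>w. w > sqrt e \<Longrightarrow> f w = \<alpha> w * B (hw e w) + \<beta> w * C (hw e w)"
  shows "cls e \<alpha> \<beta> a b c f"
  unfolding cls_def using assms by blast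

lemma cls_cong:
  assumes "cls e \<alpha> \<beta> a b c f" "\<And>w. w > sqrt e \<Longrightarrow> g w = f w"
  shows "cls e \<alpha> \<beta> a b c g"
  using assms unfolding cls_def by simp

lemma cls_mono:
  assumes "cls e \<alpha> \<beta> a b c f" "a' \<le> a" "b \<le> b'" "c \<le> c'"
  shows "cls e \<alpha> \<beta> a' b' c' f"
  using assms lsp_mono[of a b _ a' b'] lsp_mono[of 0 c _ 0 c'] unfolding cls_def by (metis order_refl)

lemma cls_mono_zero:
  assumes "cls e \<alpha> \<beta> a b (-1) f" "a' \<le> a" "b \<le> b'"
  shows "cls e \<alpha> \<beta> a' b' c' f"
proof -
  have "lsp 0 c' C" if "lsp 0 (-1) C" for C
    using that lsp_zero[of 0 c'] unfolding lsp_def by simp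
  thus ?thesis using assms lsp_mono[of a b _ a' b'] unfolding cls_def by metis
qed

lemma cls_zero: "cls e \<alpha> \<beta> a b c (\<lambda>_. 0)"
  by (rule clsI[OF lsp_zero lsp_zero]) simp

lemma cls_add:
  assumes "cls e \<alpha> \<beta> a b c f" "cls e \<alpha> \<beta> a b c g"
  shows "cls e \<alpha> \<beta> a b c (\<lambda>w. f w + g w)"
proof -
  obtain B C B' C' where "lsp a b B" "lsp 0 c C" "lsp a b B'" "lsp 0 c C'"
    and eq: "\<And>w. w > sqrt e \<Longrightarrow> f w = \<alpha> w * B (hw e w) + \<beta> w * C (hw e w)"
      "\<And>w. w > sqrt e \<Longrightarrow> g w = \<alpha> w * B' (hw e w) + \<beta> w * C' (hw e w)"
    using assms unfolding cls_def by metis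
  thus ?thesis by (intro clsI[OF lsp_add[of a b B B'] lsp_add[of 0 c C C']]) (auto simp: eq algebra_simps)
qed

lemma cls_cmult:
  assumes "cls e \<alpha> \<beta> a b c f"
  shows "cls e \<alpha> \<beta> a b c (\<lambda>w. r * f w)"
proof -
  obtain B C where "lsp a b B" "lsp 0 c C"
    and eq: "\<And>w. w > sqrt e \<Longrightarrow> f w = \<alpha> w * B (hw e w) + \<beta> w * C (hw e w)"
    using assms unfolding cls_def by metis
  thus ?thesis by (intro clsI[OF lsp_cmult[of a b B r] lsp_cmult[of 0 c C r]]) (auto simp: eq algebra_simps)
qed

lemma hw_neg:
  assumes "e > 0" "w > sqrt e"
  shows "hw e w < 0"
  using real_gt_sqrt[OF assms] by (simp add: hw_def)

lemma cls_times_h: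
  assumes "e > 0" "cls e \<alpha> \<beta> a b c f"
  shows "cls e \<alpha> \<beta> (a + 1) (b + 1) (c + 1) (\<lambda>w. hw e w * f w)"
proof -
  obtain B C where BC: "lsp a b B" "lsp 0 c C"
    and eq: "\<And>w. w > sqrt e \<Longrightarrow> f w = \<alpha> w * B (hw e w) + \<beta> w * C (hw e w)"
    using assms unfolding cls_def by metis
  have "lsp (0 + 1) (c + 1) (\<lambda>h. h * C h)" by (rule lsp_shift[OF BC(2), where d = 1]) simp_all
  hence "lsp 0 (c + 1) (\<lambda>h. h * C h)" by (rule lsp_mono) simp_all
  moreover have "lsp (a + 1) (b + 1) (\<lambda>h. h * B h)" by (rule lsp_shift[OF BC(1), where d = 1]) simp_all
  ultimately show ?thesis by (intro clsI) (auto simp: eq algebra_simps)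
qed

lemma KK_rec':
  assumes "e > 0" "w > sqrt e"
  shows "KK e (i + 2) k w = hw e w * KK e i (k + 2) w + KK e i (k + 1) w + (- e) * KK e i k w"
  using KK_rec[OF assms, of i k] by (simp add: hw_def hh_def[OF assms])

text \<open>The bounds \<open>(b - k) div 2\<close> and \<open>(- k - 1) div 2\<close> grow by one when \<open>k\<close> decreases by two, exactly as much as the factor \<open>h\<close> in
\<open>KK_rec\<close> requires.\<close>

lemma KK_class_step:
  assumes e: "e > 0" and K: "\<And>k. k \<ge> - 4 \<Longrightarrow> int i + k \<le> N - 1 \<Longrightarrow> cls e \<alpha> \<beta> (- N) ((b - k) div 2) ((- k - 1) div 2) (KK e i k)"
    and k: "k \<ge> - 4" "int (i + 2) + k \<le> N - 1"
  shows "cls e \<alpha> \<beta> (- N) ((b - k) div 2) ((- k - 1) div 2) (KK e (i + 2) k)"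
proof (rule cls_cong)
  have "cls e \<alpha> \<beta> (- N + 1) ((b - (k + 2)) div 2 + 1) ((- (k + 2) - 1) div 2 + 1) (\<lambda>w. hw e w * KK e i (k + 2) w)"
    by (rule cls_times_h[OF e K]) (use k in auto)
  hence "cls e \<alpha> \<beta> (- N) ((b - k) div 2) ((- k - 1) div 2) (\<lambda>w. hw e w * KK e i (k + 2) w)"
    by (rule cls_mono) linarith+
  moreover have "cls e \<alpha> \<beta> (- N) ((b - k) div 2) ((- k - 1) div 2) (KK e i (k + 1))"
    by (rule cls_mono[OF K]) (use k in auto)
  moreover have "cls e \<alpha> \<beta> (- N) ((b - k) div 2) ((- k - 1) div 2) (KK e i k)"
    by (rule K) (use k in auto)
  ultimately show "cls e \<alpha> \<beta> (- N) ((b - k) div 2) ((- k - 1) div 2) (\<lambda>w. hw e w * KK e i (k + 2) w + KK e i (k + 1) w + (- e) * KK e i k w)"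
    by (intro cls_add cls_cmult)
  show "KK e (i + 2) k w = hw e w * KK e i (k + 2) w + KK e i (k + 1) w + (- e) * KK e i k w" if "w > sqrt e" for w
    by (rule KK_rec'[OF e that])
qed

lemma KK_class_induct:
  assumes e: "e > 0" and r: "r < 2"
    and K: "\<And>k. k \<ge> - 4 \<Longrightarrow> int r + k \<le> N - 1 \<Longrightarrow> cls e \<alpha> \<beta> (- N) ((b - k) div 2) ((- k - 1) div 2) (KK e r k)"
    and k: "k \<ge> - 4" "int (r + 2 * m) + k \<le> N - 1"
  shows "cls e \<alpha> \<beta> (- N) ((b - k) div 2) ((- k - 1) div 2) (KK e (r + 2 * m) k)"
  using k
proof (induction m arbitrary: k)
  case 0
  thus ?case using K by simp
next
  case (Suc m)
  have "r + 2 * Suc m = (r + 2 * m) + 2" by simp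
  thus ?case using KK_class_step[OF e Suc.IH] Suc.prems by metis
qed

text \<open>In terms of \<open>h = hw e w\<close>, the functions \<open>qw, lw, rw\<close> are \<open>sqrt (1 + 4 e h)\<close>, the logarithm \<open>Lf e h\<close> and \<open>1 / sqrt (-h)\<close>.\<close>

definition qw :: "real \<Rightarrow> real \<Rightarrow> real" where "qw e w = (w\<^sup>2 - e) / (w\<^sup>2 + e)"
definition lw :: "real \<Rightarrow> real \<Rightarrow> real" where "lw e w = ln (w\<^sup>2 / e)"
definition rw :: "real \<Rightarrow> real \<Rightarrow> real" where "rw e w = (w\<^sup>2 + e) / w"

text \<open>The two heights \<open>X\<close>, \<open>Y\<close> at which the orbit meets the axis are the roots of a quadratic polynomial: \<open>X + Y = - 1 / h\<close> and
\<open>X Y = - e / h\<close>. This gives a linear recursion for \<open>X ^ m - Y ^ m\<close>.\<close>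

lemma power_difference_class:
  assumes e: "e > 0"
  shows "\<exists>B. lsp (- int m) ((- 1 - int m) div 2) B \<and>
     (\<forall>w>sqrt e. (w\<^sup>2 + e) ^ m - (e * (w\<^sup>2 + e) / w\<^sup>2) ^ m = qw e w * B (hw e w))"
proof (induction m rule: induct_nat_012)
  case 0
  show ?case by (rule exI[of _ "\<lambda>_. 0"]) (simp add: lsp_zero)
next
  case 1
  have "lsp (- 1) (- 1) (\<lambda>h. - 1 / h)"
    by (rule lsp_shift[OF lsp_const[of 0 0 "- 1"], where d = "- 1"]) (auto simp: power_int_minus field_simps)
  moreover have "(w\<^sup>2 + e) - (e * (w\<^sup>2 + e) / w\<^sup>2) = qw e w * (- 1 / hw e w)" if "w > sqrt e" for w
  proof -
    define u z where "u = w\<^sup>2" and "z = w\<^sup>2 + e"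
    have u: "u > 0" "z > 0" "u = z - e" using real_gt_sqrt[OF e that] by (simp_all add: u_def z_def)
    have "z - e * z / u = z * (u - e) / u" using u(1) by (simp add: field_simps)
    also have "\<dots> = (u - e) / z * (z\<^sup>2 / u)" using u(1,2) by (simp add: power2_eq_square)
    also have "z\<^sup>2 / u = - 1 / hw e w" using u(1,2) by (simp add: hw_def u_def z_def)
    finally show ?thesis by (simp only: qw_def u_def z_def)
  qed
  ultimately show ?case by (intro exI[of _ "\<lambda>h. - 1 / h"]) simp
next
  case (ge2 m)
  obtain B where B: "lsp (- int m) ((- 1 - int m) div 2) B"
    and Be: "\<And>w. w > sqrt e \<Longrightarrow> (w\<^sup>2 + e) ^ m - (e * (w\<^sup>2 + e) / w\<^sup>2) ^ m = qw e w * B (hw e w)" using ge2(1) by auto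
  obtain B' where B': "lsp (- int (Suc m)) ((- 1 - int (Suc m)) div 2) B'"
    and Be': "\<And>w. w > sqrt e \<Longrightarrow> (w\<^sup>2 + e) ^ Suc m - (e * (w\<^sup>2 + e) / w\<^sup>2) ^ Suc m = qw e w * B' (hw e w)" using ge2(2) by blast
  have "lsp (- int (Suc m) + (- 1)) ((- 1 - int (Suc m)) div 2 + (- 1)) (\<lambda>h. B' h / h)"
    by (rule lsp_shift[OF B', where d = "- 1"]) (auto simp: power_int_minus field_simps)
  hence 1: "lsp (- int (Suc (Suc m))) ((- 1 - int (Suc (Suc m))) div 2) (\<lambda>h. B' h / h)"
    by (rule lsp_mono) linarith+
  have "lsp (- int m + (- 1)) ((- 1 - int m) div 2 + (- 1)) (\<lambda>h. B h / h)"
    by (rule lsp_shift[OF B, where d = "- 1"]) (auto simp: power_int_minus field_simps)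
  hence 2: "lsp (- int (Suc (Suc m))) ((- 1 - int (Suc (Suc m))) div 2) (\<lambda>h. B h / h)"
    by (rule lsp_mono) linarith+
  show ?case
  proof (intro exI conjI allI impI)
    show "lsp (- int (Suc (Suc m))) ((- 1 - int (Suc (Suc m))) div 2) (\<lambda>h. (- 1) * (B' h / h) + e * (B h / h))"
      by (intro lsp_add lsp_cmult 1 2)
    fix w :: real assume w: "w > sqrt e"
    define X Y h where "X = w\<^sup>2 + e" and "Y = e * (w\<^sup>2 + e) / w\<^sup>2" and "h = hw e w"
    have h: "h \<noteq> 0" using hw_neg[OF e w] by (simp add: h_def)
    have s: "X + Y = - 1 / h" "X * Y = - e / h"
      using real_gt_sqrt[OF e w] by (simp_all add: X_def Y_def h_def hw_def field_simps power2_eq_square)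
    have "X ^ Suc (Suc m) - Y ^ Suc (Suc m) = (X + Y) * (X ^ Suc m - Y ^ Suc m) - (X * Y) * (X ^ m - Y ^ m)"
      by (simp add: algebra_simps)
    also have "\<dots> = (- 1 / h) * (qw e w * B' h) - (- e / h) * (qw e w * B h)"
      unfolding s using Be[OF w] Be'[OF w] by (simp only: X_def Y_def h_def)
    also have "\<dots> = qw e w * ((- 1) * (B' h / h) + e * (B h / h))"
      using h by (simp add: field_simps)
    finally show "(w\<^sup>2 + e) ^ Suc (Suc m) - (e * (w\<^sup>2 + e) / w\<^sup>2) ^ Suc (Suc m) = qw e w * ((- 1) * (B' (hw e w) / hw e w) + e * (B (hw e w) / hw e w))"
      by (simp only: X_def Y_def h_def)
  qed
qed

lemma KK_even_neg:
  assumes e: "e > 0" and w: "w > sqrt e"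
  shows "KK e 0 (-2) w = qw e w * (1 / e)"
    and "KK e 0 (-3) w = qw e w * (1 / (2 * e\<^sup>2))"
    and "KK e 0 (-4) w = qw e w * (1 / (3 * e ^ 3) + 1 / (3 * e\<^sup>2) * hw e w)"
proof -
  define z where "z = w\<^sup>2 + e"
  note rg = real_gt_sqrt[OF e w]
  have z: "z > 0" "w > 0" using rg by (auto simp: z_def)
  define d where "d = w\<^sup>2 - e"
  have k: "KK e 0 (- int m - 1) w = ((w\<^sup>2 / (e * z)) ^ m - (1 / z) ^ m) / real m" if "m > 0" for m
  proof -
    have "KK e 0 (- int m - 1) w = (z powi (- int m) - (e * z / w\<^sup>2) powi (- int m)) / (- real m)"
      by (subst KK_even_base[OF e w]) (use that in \<open>simp_all add: z_def\<close>)
    thus ?thesis using that by (simp add: power_int_minus power_divide field_simps)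
  qed
  have d2: "w\<^sup>2 = z - e" by (simp add: z_def)
  have q: "qw e w = (z - 2 * e) / z" by (simp add: qw_def z_def)
  have hz: "hw e w = - ((z - e) / z\<^sup>2)" by (simp add: hw_def z_def)
  show "KK e 0 (-2) w = qw e w * (1 / e)"
  proof -
    have "KK e 0 (-2) w = w\<^sup>2 / (e * z) - 1 / z" using k[of 1] by simp
    show ?thesis unfolding \<open>KK e 0 (-2) w = _\<close> d2 q using e z(1) by (simp add: field_simps)
  qed
  show "KK e 0 (-3) w = qw e w * (1 / (2 * e\<^sup>2))"
  proof -
    have "KK e 0 (-3) w = ((w\<^sup>2 / (e * z))\<^sup>2 - (1 / z)\<^sup>2) / 2" using k[of 2] by simp
    show ?thesis unfolding \<open>KK e 0 (-3) w = _\<close> d2 q using e z(1) by (simp add: field_simps power2_eq_square)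
  qed
  show "KK e 0 (-4) w = qw e w * (1 / (3 * e ^ 3) + 1 / (3 * e\<^sup>2) * hw e w)"
  proof -
    have "KK e 0 (-4) w = ((w\<^sup>2 / (e * z)) ^ 3 - (1 / z) ^ 3) / 3" using k[of 3] by simp
    show ?thesis unfolding \<open>KK e 0 (-4) w = _\<close> d2 q hz using e z(1) by (simp add: field_simps power2_eq_square power3_eq_cube)
  qed
qed

lemma KK_even_class:
  assumes e: "e > 0" and k: "k \<ge> - 4" "k \<le> N - 1" and N: "N \<ge> 0"
  shows "cls e (qw e) (lw e) (- N) ((- 2 - k) div 2) ((- k - 1) div 2) (KK e 0 k)"
proof -
  consider "k \<ge> 0" | "k = - 1" | "k = - 2" | "k = - 3" | "k = - 4" using k by linarith
  thus ?thesis
  proof cases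
    case 1
    define m where "m = nat k + 1"
    obtain B where B: "lsp (- int m) ((- 1 - int m) div 2) B"
      "\<And>w. w > sqrt e \<Longrightarrow> (w\<^sup>2 + e) ^ m - (e * (w\<^sup>2 + e) / w\<^sup>2) ^ m = qw e w * B (hw e w)"
      using power_difference_class[OF e] by blast
    have m: "k + 1 = int m" "real_of_int k + 1 = real m" using 1 by (simp_all add: m_def)
    show ?thesis
    proof (rule clsI[OF _ lsp_zero])
      show "lsp (- N) ((- 2 - k) div 2) (\<lambda>h. 1 / real m * B h)"
        by (intro lsp_cmult lsp_mono[OF B(1)]) (use m k in linarith)+
      fix w assume w: "w > sqrt e"
      show "KK e 0 k w = qw e w * (1 / real m * B (hw e w)) + lw e w * 0"
        using KK_even_base[OF e w, of k] 1 B(2)[OF w] by (simp add: m)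
    qed
  next
    case 2
    show ?thesis
      by (rule clsI[OF lsp_zero lsp_const[of 0 _ 1]]) (use 2 KK_even_log[OF e] in \<open>auto simp: lw_def\<close>)
  next
    case 3
    show ?thesis
      by (rule clsI[OF lsp_const[of _ _ "1 / e"] lsp_zero]) (use 3 N KK_even_neg[OF e] in auto)
  next
    case 4
    show ?thesis
      by (rule clsI[OF lsp_const[of _ _ "1 / (2 * e\<^sup>2)"] lsp_zero]) (use 4 N KK_even_neg[OF e] in auto)
  next
    case 5
    show ?thesis
      by (rule clsI[OF lsp_linear[of _ _ "1 / (3 * e ^ 3)" "1 / (3 * e\<^sup>2)"] lsp_zero]) (use 5 N KK_even_neg[OF e] in auto)
  qed
qed

lemma KK_odd_rec':
  assumes "e > 0" "w > sqrt e"
  shows "(real_of_int p + 3) * hw e w * KK e 1 (p + 1) w + (real_of_int p + 3 / 2) * KK e 1 p w - real_of_int p * e * KK e 1 (p - 1) w = 0"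
  using KK_odd_rec[OF assms, of p] by (simp add: hw_def hh_def[OF assms])

text \<open>From \<open>KK e 1 0\<close> and \<open>KK e 1 (-1)\<close> downwards by \<open>KK_odd_rec\<close>.\<close>

lemma KK_odd_neg:
  assumes e: "e > 0" and w: "w > sqrt e"
  shows "KK e 1 0 w = rw e w * (- (pi / 8) * (1 / hw e w) + - (pi / 2) * e)"
    and "KK e 1 (-1) w = rw e w * (pi / 2) + - pi * sqrt e"
    and "KK e 1 (-2) w = rw e w * (0 + pi * hw e w) + pi / (2 * sqrt e)"
    and "KK e 1 (-3) w = pi / (8 * e * sqrt e) + pi * sqrt e / (2 * e) * hw e w"
    and "KK e 1 (-4) w = pi / (16 * e\<^sup>2 * sqrt e) + pi * sqrt e / (4 * e\<^sup>2) * hw e w"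
proof -
  note rg = real_gt_sqrt[OF e w]
  have se: "sqrt e > 0" "sqrt e * sqrt e = e" using e by auto
  define h J0 J1 J2 J3 J4 r where "h = hw e w" and "J0 = KK e 1 0 w" and "J1 = KK e 1 (-1) w" and "J2 = KK e 1 (-2) w" and "J3 = KK e 1 (-3) w" and "J4 = KK e 1 (-4) w" and "r = rw e w"
  have h: "h \<noteq> 0" using hw_neg[OF e w] by (simp add: h_def)
  have j0: "J0 = r * (- (pi / 8) * (1 / h) + - (pi / 2) * e)"
  proof -
    define z where "z = w\<^sup>2 + e"
    have z: "z > 0" "w\<^sup>2 - e = z - 2 * e" "w\<^sup>2 = z - e" using rg by (auto simp: z_def)
    have "- (1 / 8) * (1 / h) - 1 / 2 * e = (w\<^sup>2 - e)\<^sup>2 / (8 * w\<^sup>2)"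
      using rg unfolding h_def hw_def z_def[symmetric] by (simp add: field_simps) (simp add: z_def power2_eq_square algebra_simps)
    moreover have "J0 = pi * r * ((w\<^sup>2 - e)\<^sup>2 / (8 * w\<^sup>2))"
      using rg unfolding J0_def KK_odd_0[OF e w] r_def rw_def by (simp add: power2_eq_square power3_eq_cube)
    ultimately have "J0 = pi * r * (- (1 / 8) * (1 / h) - 1 / 2 * e)" by presburger
    thus ?thesis by (simp add: algebra_simps)
  qed
  thus "KK e 1 0 w = rw e w * (- (pi / 8) * (1 / hw e w) + - (pi / 2) * e)" by (simp only: J0_def r_def h_def)
  have j1: "J1 = r * (pi / 2) + - pi * sqrt e"
    unfolding J1_def KK_odd_m1[OF e w] r_def rw_def by (simp add: mult.commute)
  thus "KK e 1 (-1) w = rw e w * (pi / 2) + - pi * sqrt e" by (simp only: J1_def r_def)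
  have r1: "2 * h * J0 + 1 / 2 * J1 + e * J2 = 0"
    using KK_odd_rec'[OF e w, of "-1"] by (simp add: J0_def J1_def J2_def h_def)
  have r2: "h * J1 - 1 / 2 * J2 + 2 * e * J3 = 0"
    using KK_odd_rec'[OF e w, of "-2"] by (simp add: J3_def J1_def J2_def h_def)
  have r3: "- (3 / 2) * J3 + 3 * e * J4 = 0"
    using KK_odd_rec'[OF e w, of "-3"] by (simp add: J3_def J4_def)
  have "2 * h * J0 = - (pi / 4) * r - pi * e * h * r" unfolding j0 using h by (simp add: field_simps)
  hence "e * J2 = e * (pi * h * r) + pi * sqrt e / 2" using r1 j1 by (simp add: algebra_simps)
  also have "\<dots> = e * (pi * h * r + pi / (2 * sqrt e))"
    using se(1) by (subst (2) se(2)[symmetric]) (simp add: distrib_left se(2) field_simps)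
  finally have j2: "J2 = pi * h * r + pi / (2 * sqrt e)" using e by simp
  thus "KK e 1 (-2) w = rw e w * (0 + pi * hw e w) + pi / (2 * sqrt e)" by (simp add: J2_def r_def h_def)
  have "2 * e * J3 = pi / (4 * sqrt e) + pi * sqrt e * h" using r2 unfolding j1 j2 by (simp add: algebra_simps)
  hence j3: "J3 = pi / (8 * e * sqrt e) + pi * sqrt e / (2 * e) * h" using e se(1) by (simp add: field_simps)
  thus "KK e 1 (-3) w = pi / (8 * e * sqrt e) + pi * sqrt e / (2 * e) * hw e w" by (simp only: J3_def h_def)
  have "J4 = J3 / (2 * e)" using r3 e by (simp add: field_simps)
  hence "J4 = pi / (16 * e\<^sup>2 * sqrt e) + pi * sqrt e / (4 * e\<^sup>2) * h"
    unfolding j3 by (simp add: add_divide_distrib power2_eq_square mult_ac)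
  thus "KK e 1 (-4) w = pi / (16 * e\<^sup>2 * sqrt e) + pi * sqrt e / (4 * e\<^sup>2) * hw e w" by (simp only: J4_def h_def)
qed

text \<open>From \<open>KK e 1 0\<close> upwards by \<open>KK_odd_rec\<close>; each step divides by \<open>h\<close>. The recursion for \<open>p = 0\<close> does not contain \<open>KK e 1 (-1)\<close>.\<close>

lemma KK_odd_nonneg_class:
  assumes e: "e > 0"
  shows "cls e (rw e) (\<lambda>_. 1) (- int p - 1) ((- int p) div 2) (-1) (KK e 1 (int p))"
proof (induction p rule: less_induct)
  case (less p)
  have base: "cls e (rw e) (\<lambda>_. 1) (-1) 0 (-1) (KK e 1 0)"
  proof (rule clsI[OF _ lsp_zero])
    have "lsp (-1) (-1) (\<lambda>h. 1 / h)"
      by (rule lsp_shift[OF lsp_const[of 0 0 1], where d = "- 1"]) (auto simp: power_int_minus field_simps)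
    hence "lsp (-1) 0 (\<lambda>h. 1 / h)" by (rule lsp_mono) auto
    thus "lsp (-1) 0 (\<lambda>h. - (pi / 8) * (1 / h) + - (pi / 2) * e)"
      by (intro lsp_add lsp_cmult lsp_const) auto
  qed (use KK_odd_neg(1)[OF e] in simp)
  have div_h: "cls e (rw e) (\<lambda>_. 1) (a - 1) (b - 1) (-1) (\<lambda>w. f w / hw e w)"
    if f: "cls e (rw e) (\<lambda>_. 1) a b (-1) f" for a b f
  proof -
    obtain B C where BC: "lsp a b B" "lsp 0 (-1) C" "\<And>w. w > sqrt e \<Longrightarrow> f w = rw e w * B (hw e w) + 1 * C (hw e w)"
      using f unfolding cls_def by blast
    have C: "C h = 0" if "h < 0" for h using BC(2) that unfolding lsp_def by auto
    have "lsp (a - 1) (b - 1) (\<lambda>h. B h / h)"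
      by (rule lsp_shift[OF BC(1), where d = "- 1"]) (auto simp: power_int_minus field_simps)
    thus ?thesis by (rule clsI[OF _ lsp_zero]) (use BC(3) C hw_neg[OF e] in auto)
  qed
  consider "p = 0" | "p = 1" | q where "p = q + 2" by (metis One_nat_def add_2_eq_Suc' nat.exhaust)
  thus ?case
  proof cases
    case 1 thus ?thesis using base by simp
  next
    case 2
    have "cls e (rw e) (\<lambda>_. 1) (- int p - 1) ((- int p) div 2) (-1) (\<lambda>w. (- 1 / 2) * (KK e 1 0 w / hw e w))"
      by (intro cls_cmult cls_mono[OF div_h[OF base]]) (use 2 in auto)
    thus ?thesis
    proof (rule cls_cong)
      fix w assume w: "w > sqrt e"
      show "KK e 1 (int p) w = (- 1 / 2) * (KK e 1 0 w / hw e w)"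
        using KK_odd_rec'[OF e w, of 0] hw_neg[OF e w] 2 by (simp add: field_simps)
    qed
  next
    case 3
    define c where "c = real q + 4"
    have c: "c > 0" by (simp add: c_def)
    have A: "cls e (rw e) (\<lambda>_. 1) (- int (q + 1) - 1) ((- int (q + 1)) div 2) (-1) (KK e 1 (int (q + 1)))"
      "cls e (rw e) (\<lambda>_. 1) (- int q - 1) ((- int q) div 2) (-1) (KK e 1 (int q))"
      by (rule less, simp add: 3)+
    have "cls e (rw e) (\<lambda>_. 1) (- int p - 1) ((- int p) div 2) (-1)
       (\<lambda>w. (- (real q + 5 / 2) / c) * (KK e 1 (int (q + 1)) w / hw e w) + ((real q + 1) * e / c) * (KK e 1 (int q) w / hw e w))"
      by (intro cls_add cls_cmult cls_mono[OF div_h[OF A(1)]] cls_mono[OF div_h[OF A(2)]]) (use 3 in linarith)+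
    thus ?thesis
    proof (rule cls_cong)
      fix w assume w: "w > sqrt e"
      define h J0 J1 J2 where "h = hw e w" and "J0 = KK e 1 (int q) w" and "J1 = KK e 1 (int (q + 1)) w" and "J2 = KK e 1 (int p) w"
      have h: "h \<noteq> 0" using hw_neg[OF e w] by (simp add: h_def)
      have A: "int (q + 1) + 1 = int p" "int (q + 1) - 1 = int q" "real_of_int (int (q + 1)) + 3 = c"
        "real_of_int (int (q + 1)) + 3 / 2 = real q + 5 / 2" "real_of_int (int (q + 1)) = real q + 1"
        using 3 by (simp_all add: c_def)
      have "c * h * J2 + (real q + 5 / 2) * J1 - (real q + 1) * e * J0 = 0"
        using KK_odd_rec'[OF e w, of "int (q + 1)"] unfolding h_def J0_def J1_def J2_def A(1,2) A(3)[symmetric] A(4)[symmetric] A(5)[symmetric] .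
      hence "c * h * J2 = (real q + 1) * e * J0 - (real q + 5 / 2) * J1" by linarith
      hence "J2 = ((real q + 1) * e * J0 - (real q + 5 / 2) * J1) / (c * h)" using c h by (simp add: field_simps)
      also have "\<dots> = (- (real q + 5 / 2) / c) * (J1 / h) + ((real q + 1) * e / c) * (J0 / h)"
      proof -
        have "(A * X - B * Y) / (c * h) = (- B / c) * (Y / h) + (A / c) * (X / h)" for A B X Y :: real
          by (simp add: diff_divide_distrib)
        from this[of "(real q + 1) * e" J0 "real q + 5 / 2" J1] show ?thesis .
      qed
      finally show "KK e 1 (int p) w = (- (real q + 5 / 2) / c) * (KK e 1 (int (q + 1)) w / hw e w) + ((real q + 1) * e / c) * (KK e 1 (int q) w / hw e w)"
        unfolding h_def J0_def J1_def J2_def .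
    qed
  qed
qed

lemma KK_odd_class:
  assumes e: "e > 0" and k: "k \<ge> - 4" "1 + k \<le> N - 1" and N: "N \<ge> 0"
  shows "cls e (rw e) (\<lambda>_. 1) (- N) ((0 - k) div 2) ((- k - 1) div 2) (KK e 1 k)"
proof -
  consider "k \<ge> 0" | "k = - 1" | "k = - 2" | "k = - 3" | "k = - 4" using k by linarith
  thus ?thesis
  proof cases
    case 1
    then obtain p where p: "k = int p" using nonneg_int_cases by blast
    show ?thesis unfolding p by (rule cls_mono_zero[OF KK_odd_nonneg_class[OF e]]) (use k p in linarith)+
  next
    case 2
    show ?thesis
      by (rule clsI[OF lsp_const[of _ _ "pi / 2"] lsp_const[of 0 _ "- pi * sqrt e"]]) (use 2 N KK_odd_neg[OF e] in auto)
  next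
    case 3
    show ?thesis
      by (rule clsI[OF lsp_linear[of _ _ 0 pi] lsp_const[of 0 _ "pi / (2 * sqrt e)"]]) (use 3 N KK_odd_neg[OF e] in auto)
  next
    case 4
    show ?thesis
      by (rule clsI[OF lsp_zero lsp_linear[of 0 _ "pi / (8 * e * sqrt e)" "pi * sqrt e / (2 * e)"]]) (use 4 N KK_odd_neg[OF e] in auto)
  next
    case 5
    show ?thesis
      by (rule clsI[OF lsp_zero lsp_linear[of 0 _ "pi / (16 * e\<^sup>2 * sqrt e)" "pi * sqrt e / (4 * e\<^sup>2)"]]) (use 5 N KK_odd_neg[OF e] in auto)
  qed
qed

definition mix :: "real \<Rightarrow> int \<Rightarrow> int \<Rightarrow> int \<Rightarrow> int \<Rightarrow> int \<Rightarrow> (real \<Rightarrow> real) \<Rightarrow> bool" where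
  "mix e a b c b' c' f \<longleftrightarrow> (\<exists>g g'. cls e (qw e) (lw e) a b c g \<and> cls e (rw e) (\<lambda>_. 1) a b' c' g' \<and>
     (\<forall>w>sqrt e. f w = g w + g' w))"

lemma mix_even: "cls e (qw e) (lw e) a b c f \<Longrightarrow> mix e a b c b' c' f"
  unfolding mix_def using cls_zero by (metis add.right_neutral)

lemma mix_odd: "cls e (rw e) (\<lambda>_. 1) a b' c' f \<Longrightarrow> mix e a b c b' c' f"
  unfolding mix_def using cls_zero by (metis add.left_neutral)

lemma mix_add:
  assumes "mix e a b c b' c' f" "mix e a b c b' c' g"
  shows "mix e a b c b' c' (\<lambda>w. f w + g w)"
proof -
  obtain u u' v v' where "cls e (qw e) (lw e) a b c u" "cls e (rw e) (\<lambda>_. 1) a b' c' u'" "cls e (qw e) (lw e) a b c v" "cls e (rw e) (\<lambda>_. 1) a b' c' v'"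
    and eq: "\<And>w. w > sqrt e \<Longrightarrow> f w = u w + u' w" "\<And>w. w > sqrt e \<Longrightarrow> g w = v w + v' w"
    using assms unfolding mix_def by metis
  thus ?thesis unfolding mix_def
    by (intro exI[of _ "\<lambda>w. u w + v w"] exI[of _ "\<lambda>w. u' w + v' w"]) (auto intro: cls_add simp: eq)
qed

lemma mix_cmult:
  assumes "mix e a b c b' c' f"
  shows "mix e a b c b' c' (\<lambda>w. r * f w)"
proof -
  obtain u u' where "cls e (qw e) (lw e) a b c u" "cls e (rw e) (\<lambda>_. 1) a b' c' u'"
    and eq: "\<And>w. w > sqrt e \<Longrightarrow> f w = u w + u' w"
    using assms unfolding mix_def by metis
  thus ?thesis unfolding mix_def
    by (intro exI[of _ "\<lambda>w. r * u w"] exI[of _ "\<lambda>w. r * u' w"]) (auto intro: cls_cmult simp: eq algebra_simps)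
qed

lemma mix_sum:
  assumes "finite S" "\<And>s. s \<in> S \<Longrightarrow> mix e a b c b' c' (f s)"
  shows "mix e a b c b' c' (\<lambda>w. \<Sum>s\<in>S. f s w)"
  using assms
proof (induction S rule: finite_induct)
  case empty
  show ?case using mix_even[OF cls_zero] by simp
next
  case (insert s S)
  have "mix e a b c b' c' (\<lambda>w. f s w + (\<Sum>s\<in>S. f s w))"
    by (intro mix_add insert.IH insert.prems) auto
  thus ?case using insert.hyps by simp
qed

text \<open>The condition \<open>i + k \<le> N - 1\<close> holds with \<open>N = n - 2\<close> for all integrals that occur in a Melnikov function of degree \<open>n\<close>.\<close>

lemma KK_mix:
  assumes e: "e > 0" and k: "k \<ge> - 4" "int i + k \<le> N - 1" and N: "N \<ge> 0"
  shows "mix e (- N) 1 1 2 1 (KK e i k)"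
proof (cases "even i")
  case True
  then obtain m where m: "i = 0 + 2 * m" by auto
  have "cls e (qw e) (lw e) (- N) ((- 2 - k) div 2) ((- k - 1) div 2) (KK e i k)"
    unfolding m by (rule KK_class_induct[OF e, of 0 N]) (use k m N KK_even_class[OF e] in auto)
  hence "cls e (qw e) (lw e) (- N) 1 1 (KK e i k)" by (rule cls_mono) (use k in linarith)+
  thus ?thesis by (rule mix_even)
next
  case False
  then obtain m where m: "i = 1 + 2 * m" by (metis oddE add.commute)
  have "cls e (rw e) (\<lambda>_. 1) (- N) ((0 - k) div 2) ((- k - 1) div 2) (KK e i k)"
    unfolding m by (rule KK_class_induct[OF e, of 1 N]) (use k m N KK_odd_class[OF e] in auto)
  hence "cls e (rw e) (\<lambda>_. 1) (- N) 2 1 (KK e i k)" by (rule cls_mono) (use k in linarith)+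
  thus ?thesis by (rule mix_odd)
qed

text \<open>The integrals that occur for \<open>n = 1\<close>. In them the logarithm and the radical \<open>1 / sqrt (-h)\<close> are absent.\<close>

lemma KK_mix_low:
  assumes e: "e > 0" and ik: "(i, k) \<in> {(0, -3), (0, -2), (1, -3), (1, -4), (2, -4)}"
  shows "mix e 0 1 (-1) (-1) 1 (KK e i k)"
proof -
  have 2: "cls e (qw e) (lw e) 0 0 (-1) (KK e 0 (-2))"
    by (rule clsI[OF lsp_const[of _ _ "1 / e"] lsp_zero]) (use KK_even_neg[OF e] in auto)
  have 3: "cls e (qw e) (lw e) 0 0 (-1) (KK e 0 (-3))"
    by (rule clsI[OF lsp_const[of _ _ "1 / (2 * e\<^sup>2)"] lsp_zero]) (use KK_even_neg[OF e] in auto)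
  have 4: "cls e (qw e) (lw e) 0 1 (-1) (KK e 0 (-4))"
    by (rule clsI[OF lsp_linear[of _ _ "1 / (3 * e ^ 3)" "1 / (3 * e\<^sup>2)"] lsp_zero]) (use KK_even_neg[OF e] in auto)
  have o3: "cls e (rw e) (\<lambda>_. 1) 0 (-1) 1 (KK e 1 (-3))"
    by (rule clsI[OF lsp_zero lsp_linear[of 0 _ "pi / (8 * e * sqrt e)" "pi * sqrt e / (2 * e)"]]) (use KK_odd_neg[OF e] in auto)
  have o4: "cls e (rw e) (\<lambda>_. 1) 0 (-1) 1 (KK e 1 (-4))"
    by (rule clsI[OF lsp_zero lsp_linear[of 0 _ "pi / (16 * e\<^sup>2 * sqrt e)" "pi * sqrt e / (4 * e\<^sup>2)"]]) (use KK_odd_neg[OF e] in auto)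
  have h2: "cls e (qw e) (lw e) 0 1 (-1) (\<lambda>w. hw e w * KK e 0 (-2) w)"
  proof (rule clsI[OF lsp_linear[of _ _ 0 "1 / e"] lsp_zero])
    fix w assume "w > sqrt e"
    thus "hw e w * KK e 0 (-2) w = qw e w * (0 + 1 / e * hw e w) + lw e w * 0" using KK_even_neg(1)[OF e] by simp
  qed simp_all
  have "cls e (qw e) (lw e) 0 1 (-1) (KK e 2 (-4))"
  proof (rule cls_cong)
    show "cls e (qw e) (lw e) 0 1 (-1) (\<lambda>w. hw e w * KK e 0 (-2) w + KK e 0 (-3) w + (- e) * KK e 0 (-4) w)"
      by (intro cls_add cls_cmult h2 4 cls_mono[OF 3]) auto
    show "KK e 2 (-4) w = hw e w * KK e 0 (-2) w + KK e 0 (-3) w + (- e) * KK e 0 (-4) w" if "w > sqrt e" for w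
      using KK_rec'[OF e that, of 0 "-4"] by (simp add: numeral_2_eq_2)
  qed
  moreover have "cls e (qw e) (lw e) 0 1 (-1) (KK e 0 (-2))" by (rule cls_mono[OF 2]) auto
  moreover have "cls e (qw e) (lw e) 0 1 (-1) (KK e 0 (-3))" by (rule cls_mono[OF 3]) auto
  ultimately show ?thesis using ik mix_even mix_odd[OF o3] mix_odd[OF o4] by auto
qed

lemma mix_explicit:
  assumes e: "e > 0" and N: "mix e (- int N) (int m - int N) c b' 1 f" "c \<le> 1" "b' \<le> int m' - int N"
  shows "\<exists>P B a0 a1 \<alpha> \<beta>. degree B \<le> m \<and> degree P \<le> m' \<and> (b' < - int N \<longrightarrow> P = 0) \<and> (c = - 1 \<longrightarrow> \<alpha> = 0 \<and> \<beta> = 0) \<and>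
     (\<forall>w>sqrt e. f w = poly P (hw e w) / (sqrt (- hw e w) * hw e w ^ N) + (a0 + a1 * hw e w)
        + Qf e (hw e w) * poly B (hw e w) / hw e w ^ N + (\<alpha> + \<beta> * hw e w) * Lf e (hw e w))"
proof -
  obtain B C B' C' where BC: "lsp (- int N) (int m - int N) B" "lsp 0 c C" "lsp (- int N) b' B'" "lsp 0 1 C'"
    and f: "\<And>w. w > sqrt e \<Longrightarrow> f w = (qw e w * B (hw e w) + lw e w * C (hw e w)) + (rw e w * B' (hw e w) + 1 * C' (hw e w))"
    using N(1) unfolding mix_def cls_def by metis
  obtain p where p: "degree p \<le> m" "\<And>h. h < 0 \<Longrightarrow> B h = poly p h / h ^ N" using lsp_poly[OF BC(1)] by blast
  have "\<exists>p'. degree p' \<le> m' \<and> (b' < - int N \<longrightarrow> p' = 0) \<and> (\<forall>h<0. B' h = poly p' h / h ^ N)"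
  proof (cases "b' < - int N")
    case True
    hence "\<forall>h<0. B' h = poly 0 h / h ^ N" using BC(3) unfolding lsp_def by simp
    thus ?thesis by (intro exI[of _ 0]) simp
  next
    case False
    thus ?thesis using lsp_poly[OF lsp_mono[OF BC(3) order_refl N(3)]] by blast
  qed
  then obtain p' where p': "degree p' \<le> m'" "\<And>h. h < 0 \<Longrightarrow> B' h = poly p' h / h ^ N" "b' < - int N \<longrightarrow> p' = 0" by blast
  have lin: "\<exists>r s. \<forall>h<0. G h = r + s * h" if G: "lsp 0 1 G" for G
  proof -
    have "{0..1::int} = {0, 1}" by auto
    moreover obtain d where "\<forall>h<0. G h = (\<Sum>j = 0..1. d j * h powi j)" using G unfolding lsp_def by blast
    ultimately have "\<forall>h<0. G h = d 0 + d 1 * h" by simp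
    thus ?thesis by blast
  qed
  obtain a0 a1 where a: "\<And>h. h < 0 \<Longrightarrow> C' h = a0 + a1 * h" using lin[OF BC(4)] by blast
  have "\<exists>\<alpha> \<beta>. (c = - 1 \<longrightarrow> \<alpha> = 0 \<and> \<beta> = 0) \<and> (\<forall>h<0. C h = \<alpha> + \<beta> * h)"
  proof (cases "c = - 1")
    case True
    hence "\<forall>h<0. C h = 0 + 0 * h" using BC(2) unfolding lsp_def by simp
    thus ?thesis by blast
  next
    case False
    thus ?thesis using lin[OF lsp_mono[OF BC(2) order_refl N(2)]] by blast
  qed
  then obtain \<alpha> \<beta> where ab: "c = - 1 \<longrightarrow> \<alpha> = 0 \<and> \<beta> = 0" "\<And>h. h < 0 \<Longrightarrow> C h = \<alpha> + \<beta> * h" by blast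
  have "f w = poly p' (hw e w) / (sqrt (- hw e w) * hw e w ^ N) + (a0 + a1 * hw e w)
        + Qf e (hw e w) * poly p (hw e w) / hw e w ^ N + (\<alpha> + \<beta> * hw e w) * Lf e (hw e w)" if w: "w > sqrt e" for w
  proof -
    note rg = real_gt_sqrt[OF e w]
    have h: "hw e w < 0" by (rule hw_neg[OF e w])
    have s: "sqrt (- hw e w) = w / (w\<^sup>2 + e)" using rg by (simp add: hw_def real_sqrt_divide)
    have r: "rw e w = 1 / sqrt (- hw e w)" unfolding s using rg by (simp add: rw_def)
    have "1 + 4 * e * hw e w = (qw e w)\<^sup>2"
    proof -
      define z where "z = w\<^sup>2 + e"
      have "z \<noteq> 0" "w\<^sup>2 = z - e" using rg by (auto simp: z_def)
      hence "1 + 4 * e * (- ((z - e) / z\<^sup>2)) = ((z - e - e) / z)\<^sup>2" by (simp add: field_simps power2_eq_square)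
      thus ?thesis unfolding z_def hw_def qw_def by simp
    qed
    moreover have qp: "qw e w > 0" using rg by (simp add: qw_def)
    ultimately have q: "Qf e (hw e w) = qw e w" by (simp add: Qf_def)
    have "1 + qw e w = 2 * w\<^sup>2 / (w\<^sup>2 + e)" "1 - qw e w = 2 * e / (w\<^sup>2 + e)" using rg by (simp_all add: qw_def field_simps)
    hence l: "Lf e (hw e w) = lw e w" using rg e by (simp add: Lf_def q lw_def)
    show ?thesis unfolding f[OF w] q l r p(2)[OF h] p'(2)[OF h] a[OF h] ab(2)[OF h]
      by (simp add: algebra_simps)
  qed
  thus ?thesis using p(1) p'(1,3) ab(1) by blast
qed

section \<open>The explicit form of the Melnikov function\<close>

text \<open>The integrand of the Melnikov function, for the parametrization by \<open>t\<close>.\<close>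

definition GG :: "real \<Rightarrow> nat \<Rightarrow> (nat \<Rightarrow> nat \<Rightarrow> real) \<Rightarrow> (nat \<Rightarrow> nat \<Rightarrow> real) \<Rightarrow> real \<Rightarrow> real \<Rightarrow> real" where
  "GG e n a b w t = (pev n b (xc e w t) (yc e w t) * xt e w t - pev n a (xc e w t) (yc e w t) * yt e w t) / yc e w t ^ 3"

text \<open>The reciprocal of the derivative of \<open>hw e\<close>, see \<open>hw_real_analytic\<close>.\<close>

definition fac :: "real \<Rightarrow> real \<Rightarrow> real" where
  "fac e w = (w\<^sup>2 + e) ^ 3 / (2 * w * (w\<^sup>2 - e))"

lemma slope_unperturbed:
  fixes w :: real
  assumes e: "e > 0" and w: "w > sqrt e"
  shows "slope e n a b 0 w t = fac e w * GG e n a b w t"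
proof -
  note rg = real_gt_sqrt[OF e w]
  define Y u d z where "Y = yc e w t" and "u = pev n b (xc e w t) (yc e w t) * xt e w t - pev n a (xc e w t) (yc e w t) * yt e w t"
    and "d = w\<^sup>2 - e" and "z = w\<^sup>2 + e"
  have nz: "Y \<noteq> 0" "d \<noteq> 0" "z \<noteq> 0" "w \<noteq> 0" using yc_pos[OF e rg(1), of t] rg by (auto simp: Y_def d_def z_def)
  have "slope e n a b 0 w t = (- u / - (Y\<^sup>2 * d / z\<^sup>2)) / (2 * (w / z) * Y)"
    by (simp add: slope_def zeta_def speed_def omega_def jac_def u_def Y_def d_def z_def)
  also have "\<dots> = z ^ 3 / (2 * w * d) * (u / Y ^ 3)"
    using nz by (simp add: field_simps power2_eq_square power3_eq_cube)
  finally show ?thesis by (simp only: fac_def GG_def u_def Y_def d_def z_def)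
qed

lemma GG_continuous:
  assumes "e > 0" "w > sqrt e"
  shows "continuous_on S (GG e n a b w)"
  using yc_pos[OF assms(1) real_gt_sqrt(1)[OF assms]]
  unfolding GG_def pev_def
  by (intro continuous_intros coord_continuous_t real_gt_sqrt(1)[OF assms]) (auto simp: less_imp_neq[symmetric])

lemma orbit_param_coords:
  assumes e: "e > 0" and w: "w > sqrt e"
  shows "orbit_param (2 * e) (hw e w) t = (xc e w t, yc e w t)"
proof -
  define z where "z = w\<^sup>2 + e"
  note rg = real_gt_sqrt[OF e w]
  have z: "z > 0" using rg by (simp add: z_def)
  have h: "hw e w = - (w\<^sup>2 / z\<^sup>2)" by (simp add: hw_def z_def)
  have "- 1 / (4 * hw e w) - 2 * e / 2 = z\<^sup>2 / (4 * w\<^sup>2) - e" unfolding h by simp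
  also have "\<dots> = (z\<^sup>2 - 4 * e * w\<^sup>2) / (2 * w)\<^sup>2" using rg by (simp add: diff_divide_distrib power_mult_distrib)
  also have "z\<^sup>2 - 4 * e * w\<^sup>2 = (w\<^sup>2 - e)\<^sup>2" unfolding z_def by algebra
  also have "(w\<^sup>2 - e)\<^sup>2 / (2 * w)\<^sup>2 = ((w\<^sup>2 - e) / (2 * w))\<^sup>2" by (rule power_divide[symmetric])
  finally have "sqrt (- 1 / (4 * hw e w) - 2 * e / 2) = \<bar>(w\<^sup>2 - e) / (2 * w)\<bar>"
    by (simp only: real_sqrt_abs)
  hence r: "sqrt (- 1 / (4 * hw e w) - 2 * e / 2) = (w\<^sup>2 - e) / (2 * w)" using rg by simp
  have s: "sqrt (- hw e w) = w / z" unfolding h using rg z by (simp add: real_sqrt_divide)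
  have b: "- 1 / (2 * hw e w) = z\<^sup>2 / (2 * w\<^sup>2)" unfolding h by simp
  have "z\<^sup>2 / (2 * w\<^sup>2) + (w\<^sup>2 - e) / (2 * w) / (w / z) * cos t = z * (z + (w\<^sup>2 - e) * cos t) / (2 * w\<^sup>2)"
    using rg by (simp add: add_divide_distrib distrib_left power2_eq_square mult_ac)
  thus ?thesis unfolding orbit_param_def Let_def r s b by (simp add: xc_def yc_def z_def)
qed

lemma integral_Collect_open:
  fixes f :: "real \<Rightarrow> real"
  assumes "continuous_on {a..b} f" "open U"
  shows "f integrable_on ({a..b} \<inter> U)"
proof -
  have "set_integrable lebesgue {a..b} f" by (rule absolutely_integrable_continuous_real[OF assms(1)])
  hence "set_integrable lebesgue ({a..b} \<inter> U) f"
    by (rule set_integrable_subset) (use assms(2) in auto)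
  thus ?thesis using absolutely_integrable_on_def by blast
qed

text \<open>Equality of the fields in the upper and lower quadrants merges the four integrals into two; the domains agree up to the finitely many
parameters at which the orbit meets the lines that separate the quadrants.\<close>

lemma melnikov_halves:
  assumes e: "e > 0" and w: "w > sqrt e"
    and f1: "\<And>x y. f 1 (x, y) = pev n a1 x y" and g1: "\<And>x y. g 1 (x, y) = pev n b1 x y"
    and f3: "\<And>x y. f 3 (x, y) = pev n a2 x y" and g3: "\<And>x y. g 3 (x, y) = pev n b2 x y"
    and eq: "f 1 = f 2" "g 1 = g 2" "f 3 = f 4" "g 3 = g 4"
  shows "melnikov (2 * e) f g (hw e w) = integral {0..pi} (GG e n a1 b1 w) + integral {pi..2 * pi} (GG e n a2 b2 w)"
proof -
  note rg = real_gt_sqrt[OF e w]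
  define D where "D k = {t \<in> {0..2 * pi}. orbit_param (2 * e) (hw e w) t \<in> quadrant (2 * e) k}" for k
  have vd: "vector_derivative (orbit_param (2 * e) (hw e w)) (at t) = (xt e w t, yt e w t)" for t
  proof (rule vector_derivative_at)
    have "orbit_param (2 * e) (hw e w) = (\<lambda>t. (xc e w t, yc e w t))" using orbit_param_coords[OF e w] by blast
    thus "(orbit_param (2 * e) (hw e w) has_vector_derivative (xt e w t, yt e w t)) (at t)"
      using coord_t_derivs[OF rg(1), of e t]
      by (auto intro!: has_vector_derivative_Pair simp flip: has_real_derivative_iff_has_vector_derivative)
  qed
  have li: "line_integral (\<lambda>p. g k p / snd p ^ 3) (\<lambda>p. - f k p / snd p ^ 3) (orbit_param (2 * e) (hw e w)) S
     = integral S (GG e n a b w)"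
    if "\<And>x y. f k (x, y) = pev n a x y" "\<And>x y. g k (x, y) = pev n b x y" for k a b S
    unfolding line_integral_def vd orbit_param_coords[OF e w] GG_def
    by (simp add: that diff_divide_distrib)
  have s0: "2 * pi \<ge> 0" by simp
  have xs: "xc e w t > 0 \<longleftrightarrow> sin t > 0" "xc e w t < 0 \<longleftrightarrow> sin t < 0" for t
  proof -
    define r where "r = (w\<^sup>2 - e) / (2 * w)"
    have "r > 0" using rg by (simp add: r_def)
    moreover have "xc e w t = r * sin t" by (simp add: xc_def r_def)
    ultimately show "xc e w t > 0 \<longleftrightarrow> sin t > 0" "xc e w t < 0 \<longleftrightarrow> sin t < 0"
      by (simp_all add: zero_less_mult_iff mult_less_0_iff)
  qed
  have sl: "sin t \<le> 0" if "pi \<le> t" "t \<le> 2 * pi" for t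
    using that sin_le_zero[of t] by (cases "t = 2 * pi") auto
  have sg: "sin t \<ge> 0" if "0 \<le> t" "t \<le> pi" for t
    using that by (rule sin_ge_zero)
  have D: "D 1 = {0..2 * pi} \<inter> {t. sin t > 0 \<and> yc e w t > 2 * e}" "D 2 = {0..2 * pi} \<inter> {t. sin t > 0 \<and> yc e w t < 2 * e}"
    "D 3 = {0..2 * pi} \<inter> {t. sin t < 0 \<and> yc e w t < 2 * e}" "D 4 = {0..2 * pi} \<inter> {t. sin t < 0 \<and> yc e w t > 2 * e}"
    unfolding D_def orbit_param_coords[OF e w] by (auto simp: quadrant_def xs)
  have op: "open {t. sin t > 0 \<and> yc e w t > 2 * e}" "open {t. sin t > 0 \<and> yc e w t < 2 * e}"
    "open {t. sin t < 0 \<and> yc e w t < 2 * e}" "open {t. sin t < 0 \<and> yc e w t > 2 * e}"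
    unfolding Collect_conj_eq
    by (intro open_Int open_Collect_less continuous_intros coord_continuous_t rg)+
  define c where "c = (4 * e * w\<^sup>2 / (w\<^sup>2 + e) - (w\<^sup>2 + e)) / (w\<^sup>2 - e)"
  have ye: "cos t = c" if "yc e w t = 2 * e" for t
  proof -
    have "(w\<^sup>2 + e) * (w\<^sup>2 + e + (w\<^sup>2 - e) * cos t) = 4 * e * w\<^sup>2"
      using that rg by (simp add: yc_def field_simps)
    hence "w\<^sup>2 + e + (w\<^sup>2 - e) * cos t = 4 * e * w\<^sup>2 / (w\<^sup>2 + e)"
      using rg by (metis less_irrefl nonzero_mult_div_cancel_left)
    hence "(w\<^sup>2 - e) * cos t = 4 * e * w\<^sup>2 / (w\<^sup>2 + e) - (w\<^sup>2 + e)" by linarith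
    thus ?thesis unfolding c_def using rg by (metis less_irrefl nonzero_mult_div_cancel_left right_minus_eq)
  qed
  \<comment> \<open>The parameters at which the orbit meets a line that separates quadrants; there \<open>cos t = c\<close> at height \<open>2 * e\<close>.\<close>
  define Z where "Z = {0, pi, 2 * pi, arccos c, 2 * pi - arccos c}"
  have Z: "t \<in> Z" if t: "0 \<le> t" "t \<le> 2 * pi" and z: "sin t = 0 \<or> yc e w t = 2 * e" for t
  proof (cases "t \<le> pi")
    case True
    show ?thesis
    proof (cases "sin t = 0")
      case s: True
      hence "\<not> (0 < t \<and> t < pi)" using sin_gt_zero[of t] by auto
      thus ?thesis using t(1) True by (auto simp: Z_def)
    next
      case False
      hence "cos t = c" using z ye by blast
      hence "t = arccos c" using arccos_cos[OF t(1) True] by simp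
      thus ?thesis by (simp add: Z_def)
    qed
  next
    case False
    show ?thesis
    proof (cases "sin t = 0")
      case s: True
      hence "\<not> (pi < t \<and> t < 2 * pi)" using sin_lt_zero[of t] by auto
      thus ?thesis using t(2) False by (auto simp: Z_def)
    next
      case s: False
      hence "cos (2 * pi - t) = c" using z ye by (simp add: cos_diff)
      hence "2 * pi - t = arccos c" using arccos_cos[of "2 * pi - t"] t False by simp
      thus ?thesis by (simp add: Z_def)
    qed
  qed
  have nZ: "negligible Z" by (auto simp: Z_def intro: negligible_finite)
  have int: "GG e n a b w integrable_on D k" if "k \<in> {1,2,3,4}" for a b k
    using that D op integral_Collect_open[OF GG_continuous[OF e w]] by auto
  have R: "integral (D 1) (GG e n a1 b1 w) + integral (D 2) (GG e n a1 b1 w) = integral {0..pi} (GG e n a1 b1 w)"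
  proof -
    have "integral (D 1) (GG e n a1 b1 w) + integral (D 2) (GG e n a1 b1 w) = integral (D 1 \<union> D 2) (GG e n a1 b1 w)"
    proof (rule Henstock_Kurzweil_Integration.integral_Un[symmetric])
      have "D 1 \<inter> D 2 = {}" unfolding D by auto
      thus "negligible (D 1 \<inter> D 2)" by simp
    qed (use int in auto)
    also have "\<dots> = integral {0..pi} (GG e n a1 b1 w)"
    proof (rule integral_spike_set)
      have "t \<in> {0..pi}" if "t \<in> D 1 \<union> D 2" for t
      proof -
        have "0 \<le> t" "t \<le> 2 * pi" "sin t > 0" using that unfolding D by auto
        thus ?thesis using sl[of t] by (cases "t \<le> pi") auto
      qed
      hence "{x \<in> D 1 \<union> D 2 - {0..pi}. GG e n a1 b1 w x \<noteq> 0} = {}" by blast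
      thus "negligible {x \<in> D 1 \<union> D 2 - {0..pi}. GG e n a1 b1 w x \<noteq> 0}" by (simp only: negligible_empty)
      have "{0..pi} - (D 1 \<union> D 2) \<subseteq> Z"
      proof
        fix t assume t: "t \<in> {0..pi} - (D 1 \<union> D 2)"
        hence "sin t \<ge> 0" using sg by auto
        moreover have "0 \<le> t" "t \<le> 2 * pi" using t by auto
        ultimately have "sin t = 0 \<or> yc e w t = 2 * e" using t unfolding D by (auto simp: not_less)
        thus "t \<in> Z" using t Z by auto
      qed
      hence "{x \<in> {0..pi} - (D 1 \<union> D 2). GG e n a1 b1 w x \<noteq> 0} \<subseteq> Z" by blast
      thus "negligible {x \<in> {0..pi} - (D 1 \<union> D 2). GG e n a1 b1 w x \<noteq> 0}" using nZ negligible_subset by blast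
    qed
    finally show ?thesis .
  qed
  have L: "integral (D 3) (GG e n a2 b2 w) + integral (D 4) (GG e n a2 b2 w) = integral {pi..2 * pi} (GG e n a2 b2 w)"
  proof -
    have "integral (D 3) (GG e n a2 b2 w) + integral (D 4) (GG e n a2 b2 w) = integral (D 3 \<union> D 4) (GG e n a2 b2 w)"
    proof (rule Henstock_Kurzweil_Integration.integral_Un[symmetric])
      have "D 3 \<inter> D 4 = {}" unfolding D by auto
      thus "negligible (D 3 \<inter> D 4)" by simp
    qed (use int in auto)
    also have "\<dots> = integral {pi..2 * pi} (GG e n a2 b2 w)"
    proof (rule integral_spike_set)
      have "t \<in> {pi..2 * pi}" if "t \<in> D 3 \<union> D 4" for t
      proof -
        have "0 \<le> t" "t \<le> 2 * pi" "sin t < 0" using that unfolding D by auto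
        thus ?thesis using sg[of t] by (cases "pi \<le> t") auto
      qed
      hence "{x \<in> D 3 \<union> D 4 - {pi..2 * pi}. GG e n a2 b2 w x \<noteq> 0} = {}" by blast
      thus "negligible {x \<in> D 3 \<union> D 4 - {pi..2 * pi}. GG e n a2 b2 w x \<noteq> 0}" by (simp only: negligible_empty)
      have "{pi..2 * pi} - (D 3 \<union> D 4) \<subseteq> Z"
      proof
        fix t assume t: "t \<in> {pi..2 * pi} - (D 3 \<union> D 4)"
        hence "sin t \<le> 0" using sl by auto
        moreover have t0: "0 \<le> t" using t pi_gt_zero unfolding Diff_iff atLeastAtMost_iff by linarith
        moreover have "t \<le> 2 * pi" using t by auto
        ultimately have "sin t = 0 \<or> yc e w t = 2 * e" using t unfolding D by (auto simp: not_less)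
        thus "t \<in> Z" using t Z t0 by auto
      qed
      hence "{x \<in> {pi..2 * pi} - (D 3 \<union> D 4). GG e n a2 b2 w x \<noteq> 0} \<subseteq> Z" by blast
      thus "negligible {x \<in> {pi..2 * pi} - (D 3 \<union> D 4). GG e n a2 b2 w x \<noteq> 0}" using nZ negligible_subset by blast
    qed
    finally show ?thesis .
  qed
  have f2: "f 2 (x, y) = pev n a1 x y" "g 2 (x, y) = pev n b1 x y" "f 4 (x, y) = pev n a2 x y" "g 4 (x, y) = pev n b2 x y" for x y
    using f1 g1 f3 g3 eq by auto
  have I4: "{1..4::nat} = {1, 2, 3, 4}" by auto
  have "melnikov (2 * e) f g (hw e w) = integral (D 1) (GG e n a1 b1 w) + (integral (D 2) (GG e n a1 b1 w) + (integral (D 3) (GG e n a2 b2 w) + integral (D 4) (GG e n a2 b2 w)))"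
    unfolding melnikov_def D_def[symmetric] I4
    by (simp del: One_nat_def divide_minus_left add: li[of 1, OF f1 g1] li[of 2, OF f2(1,2)] li[of 3, OF f3 g3] li[of 4, OF f2(3,4)])
  thus ?thesis using R L by simp
qed

lemma GG_half_expand:
  assumes e: "e > 0" and w: "w > sqrt e"
  shows "integral {0..pi} (GG e n a b w) = (\<Sum>i\<le>n. \<Sum>j\<le>n - i. a i j * KK e i (int j - 3) w
     + b i j * ((real j - 3) / real (i + 1)) * KK e (i + 1) (int j - 4) w)"
proof -
  note rg = real_gt_sqrt[OF e w]
  define u where "u i j t = xc e w t ^ i * yc e w t powi (int j - 3) * - yt e w t" for i j t
  define v where "v i j t = xc e w t ^ i * yc e w t powi (int j - 3) * xt e w t" for i j t
  have iu: "(u i j has_integral KK e i (int j - 3) w) {0..pi}" for i j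
    unfolding u_def[abs_def] KK_def by (rule integrable_integral[OF KK_integrable[OF e w]])
  have iv: "(v i j has_integral (real j - 3) / real (i + 1) * KK e (i + 1) (int j - 4) w) {0..pi}" for i j
  proof -
    have "v i j integrable_on {0..pi}" unfolding v_def[abs_def]
      using yc_pos[OF e rg(1)]
      by (intro integrable_continuous_real continuous_intros coord_continuous_t rg(1)) (auto simp: less_imp_neq[symmetric])
    hence "(v i j has_integral integral {0..pi} (v i j)) {0..pi}" by (rule integrable_integral)
    also have "integral {0..pi} (v i j) = (real j - 3) / real (i + 1) * KK e (i + 1) (int j - 4) w"
      unfolding v_def[abs_def] using KK_by_parts[OF e w, of i "int j - 3"] by simp
    finally show ?thesis .
  qed
  have "GG e n a b w t = (\<Sum>i\<le>n. \<Sum>j\<le>n - i. a i j * u i j t + b i j * v i j t)" for t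
  proof -
    have y: "yc e w t \<noteq> 0" using yc_pos[OF e rg(1), of t] by simp
    have y3: "yc e w t powi (int j - 3) = yc e w t ^ j / yc e w t ^ 3" for j
      using y by (simp add: power_int_diff)
    have "GG e n a b w t = (\<Sum>i\<le>n. \<Sum>j\<le>n - i. (of_real (b i j) * xc e w t ^ i * yc e w t ^ j * xt e w t
        - of_real (a i j) * xc e w t ^ i * yc e w t ^ j * yt e w t) / yc e w t ^ 3)"
      by (simp only: GG_def pev_def sum_distrib_right sum_divide_distrib sum_subtractf diff_divide_distrib)
    also have "\<dots> = (\<Sum>i\<le>n. \<Sum>j\<le>n - i. a i j * u i j t + b i j * v i j t)"
      unfolding u_def v_def y3 by (intro sum.cong refl) (simp add: diff_divide_distrib mult_ac)
    finally show ?thesis .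
  qed
  moreover have "((\<lambda>t. \<Sum>i\<le>n. \<Sum>j\<le>n - i. a i j * u i j t + b i j * v i j t) has_integral
     (\<Sum>i\<le>n. \<Sum>j\<le>n - i. a i j * KK e i (int j - 3) w + b i j * ((real j - 3) / real (i + 1) * KK e (i + 1) (int j - 4) w))) {0..pi}"
    by (intro has_integral_sum has_integral_add has_integral_mult_right iu iv) auto
  ultimately have "(GG e n a b w has_integral
     (\<Sum>i\<le>n. \<Sum>j\<le>n - i. a i j * KK e i (int j - 3) w + b i j * ((real j - 3) / real (i + 1) * KK e (i + 1) (int j - 4) w))) {0..pi}"
    by presburger
  hence "integral {0..pi} (GG e n a b w) = (\<Sum>i\<le>n. \<Sum>j\<le>n - i. a i j * KK e i (int j - 3) w + b i j * ((real j - 3) / real (i + 1) * KK e (i + 1) (int j - 4) w))"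
    by (rule integral_unique)
  thus ?thesis by (simp add: mult.assoc)
qed

text \<open>Reflect \<open>t\<close> to \<open>2 * pi - t\<close>, which changes the sign of \<open>x\<close>.\<close>

lemma GG_left_half:
  "integral {pi..2 * pi} (GG e n a b w) = integral {0..pi} (GG e n (\<lambda>i j. - ((- 1) ^ i * a i j)) (\<lambda>i j. (- 1) ^ i * b i j) w)"
proof -
  have "integral {0..pi} (GG e n (\<lambda>i j. - ((- 1) ^ i * a i j)) (\<lambda>i j. (- 1) ^ i * b i j) w) = integral {0..pi} (\<lambda>t. GG e n a b w (2 * pi - t))"
  proof (rule integral_cong)
    fix t
    have c: "xc e w (2 * pi - t) = - xc e w t" "yc e w (2 * pi - t) = yc e w t"
      "xt e w (2 * pi - t) = xt e w t" "yt e w (2 * pi - t) = - yt e w t"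
      by (simp_all add: xc_def yc_def xt_def yt_def sin_diff cos_diff)
    have p: "pev n a (- x) y = - pev n (\<lambda>i j. - ((- 1) ^ i * a i j)) x y" "pev n b (- x) y = pev n (\<lambda>i j. (- 1) ^ i * b i j) x y" for x y :: real
      unfolding pev_def by (simp_all add: sum_negf power_minus[of x] mult_ac)
    show "GG e n (\<lambda>i j. - ((- 1) ^ i * a i j)) (\<lambda>i j. (- 1) ^ i * b i j) w t = GG e n a b w (2 * pi - t)"
      unfolding GG_def c p by simp
  qed
  also have "\<dots> = integral {pi..2 * pi} (GG e n a b w)"
  proof -
    have "integral {0..pi} (\<lambda>t. GG e n a b w (2 * pi - t)) = integral {- pi..0} (\<lambda>t. GG e n a b w (2 * pi + t))"
      using Henstock_Kurzweil_Integration.integral_reflect_real[of 0 "- pi" "\<lambda>t. GG e n a b w (2 * pi + t)"] by simp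
    also have "\<dots> = integral {- pi + 2 * pi..0 + 2 * pi} (GG e n a b w)"
      using integral_shift_Icc_real[where a = "- pi" and b = 0 and c = "2 * pi" and f = "GG e n a b w"] by (simp only: o_def)
    finally show ?thesis by simp
  qed
  finally show ?thesis ..
qed

text \<open>Solve \<open>s (w\<^sup>2 + e) = w\<close> with \<open>s = sqrt (-h)\<close> for the larger root.\<close>

lemma hw_surj:
  assumes e: "e > 0" and h: "h \<in> {- 1 / (4 * e)<..<0}"
  shows "\<exists>w>sqrt e. hw e w = h"
proof -
  have h0: "h < 0" "1 + 4 * e * h > 0" using h e by (auto simp: field_simps)
  define s Q where "s = sqrt (- h)" and "Q = sqrt (1 + 4 * e * h)"
  have s: "s > 0" "s\<^sup>2 = - h" using h0 by (simp_all add: s_def)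
  have Q: "Q > 0" "Q\<^sup>2 = 1 - 4 * e * s\<^sup>2" using h0 s(2) by (simp_all add: Q_def)
  define w where "w = (1 + Q) / (2 * s)"
  have w0: "w > 0" using s Q by (simp add: w_def)
  have eq: "s * (w\<^sup>2 + e) = w"
  proof -
    have "4 * s * (s * (w\<^sup>2 + e)) = (2 * s * w)\<^sup>2 + 4 * e * s\<^sup>2" by (simp add: power2_eq_square algebra_simps)
    also have "2 * s * w = 1 + Q" using s by (simp add: w_def)
    also have "(1 + Q)\<^sup>2 + 4 * e * s\<^sup>2 = 2 * (1 + Q)" using Q(2) by (simp add: power2_eq_square algebra_simps)
    also have "\<dots> = 4 * s * w" using s by (simp add: w_def)
    finally show ?thesis using s by simp
  qed
  have "hw e w = h"
  proof -
    have "w\<^sup>2 / (w\<^sup>2 + e)\<^sup>2 = s\<^sup>2"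
    proof -
      have "w\<^sup>2 + e > 0" using e by (simp add: add_nonneg_pos)
      thus ?thesis by (subst (1) eq[symmetric]) (simp add: power_mult_distrib)
    qed
    thus ?thesis using s by (simp add: hw_def)
  qed
  moreover have "w > sqrt e"
  proof -
    have "sqrt e < 1 / (2 * s)"
    proof -
      have "4 * e * s\<^sup>2 < 1" using Q by (metis zero_less_power diff_gt_0_iff_gt)
      hence "(2 * s * sqrt e)\<^sup>2 < 1\<^sup>2" using e by (simp add: power_mult_distrib mult_ac)
      hence "2 * s * sqrt e < 1" by (rule power_less_imp_less_base) simp
      thus ?thesis using s by (simp add: field_simps)
    qed
    also have "\<dots> < w" using Q s by (simp add: w_def field_simps)
    finally show ?thesis .
  qed
  ultimately show ?thesis by blast
qed

lemma mix_cong: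
  assumes "mix e a b c b' c' f" "\<And>w. w > sqrt e \<Longrightarrow> g w = f w"
  shows "mix e a b c b' c' g"
  using assms unfolding mix_def by simp

lemma melnikov_zeros_le:
  assumes e: "e > 0" and n: "n \<ge> 1"
    and f1: "\<And>x y. f 1 (x, y) = pev n a1 x y" and g1: "\<And>x y. g 1 (x, y) = pev n b1 x y"
    and f3: "\<And>x y. f 3 (x, y) = pev n a2 x y" and g3: "\<And>x y. g 3 (x, y) = pev n b2 x y"
    and eq: "f 1 = f 2" "g 1 = g 2" "f 3 = f 4" "g 3 = g 4"
    and nz: "\<exists>h\<in>{- 1 / (4 * e)<..<0}. melnikov (2 * e) f g h \<noteq> 0"
  shows "real_analytic_on (melnikov (2 * e) f g) {- 1 / (4 * e)<..<0}"
    and "zeros_le (melnikov (2 * e) f g) {- 1 / (4 * e)<..<0} (9 * n - 4)"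
proof -
  define M where "M w = melnikov (2 * e) f g (hw e w)" for w
  let ?T = "\<lambda>a b i j w. a i j * KK e i (int j - 3) w + b i j * ((real j - 3) / real (i + 1)) * KK e (i + 1) (int j - 4) w"
  define a' b' where "a' i j = - ((- 1) ^ i * a2 i j)" and "b' i j = (- 1) ^ i * b2 i j" for i j
  have M: "M w = (\<Sum>i\<le>n. \<Sum>j\<le>n - i. ?T a1 b1 i j w) + (\<Sum>i\<le>n. \<Sum>j\<le>n - i. ?T a' b' i j w)" if "w > sqrt e" for w
    unfolding M_def melnikov_halves[OF e that f1 g1 f3 g3 eq] GG_left_half GG_half_expand[OF e that] a'_def b'_def ..
  have sum: "mix e a b c b'' c' M"
    if K: "\<And>i j. i + j \<le> n \<Longrightarrow> mix e a b c b'' c' (KK e i (int j - 3)) \<and> mix e a b c b'' c' (KK e (i + 1) (int j - 4))"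
    for a b c b'' c'
  proof -
    have T: "mix e a b c b'' c' (?T p q i j)" if "i + j \<le> n" for p q i j
      using mix_add[OF mix_cmult[OF conjunct1[OF K[OF that]], of "p i j"]
          mix_cmult[OF conjunct2[OF K[OF that]], of "q i j * ((real j - 3) / real (i + 1))"]] .
    have S: "mix e a b c b'' c' (\<lambda>w. \<Sum>i\<le>n. \<Sum>j\<le>n - i. ?T p q i j w)" for p q
      by (rule mix_sum, simp, rule mix_sum, simp, rule T, simp)
    show ?thesis
      by (rule mix_cong[OF mix_add[OF S[of a1 b1] S[of a' b']] M])
  qed
  let ?I = "{- 1 / (4 * e)<..<0}"
  have "real_analytic_on (melnikov (2 * e) f g) ?I \<and> zeros_le (melnikov (2 * e) f g) ?I (9 * n - 4)"
  proof (cases "n = 1")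
    case True
    have "mix e (- int 0) (int 1 - int 0) (- 1) (- 1) 1 M"
    proof -
      have "mix e 0 1 (- 1) (- 1) 1 M"
      proof (rule sum)
        fix i j :: nat assume "i + j \<le> n"
        hence "(i, j) \<in> {(0, 0), (0, 1), (1, 0)}" using True by auto
        thus "mix e 0 1 (- 1) (- 1) 1 (KK e i (int j - 3)) \<and> mix e 0 1 (- 1) (- 1) 1 (KK e (i + 1) (int j - 4))"
          using KK_mix_low[OF e] by (auto simp: numeral_2_eq_2)
      qed
      thus ?thesis by simp
    qed
    from mix_explicit[OF e this, of 0, simplified] have "\<exists>B. degree B \<le> 1 \<and> (\<exists>a0 a1. \<forall>w>sqrt e. M w = a0 + a1 * hw e w + Qf e (hw e w) * poly B (hw e w))"
      by simp
    then obtain B a0 a1' where "degree B \<le> 1" "\<forall>w>sqrt e. M w = a0 + a1' * hw e w + Qf e (hw e w) * poly B (hw e w)"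
      by blast
    hence B: "degree B \<le> 1"
      "\<And>w. w > sqrt e \<Longrightarrow> M w = poly 0 (hw e w) / (sqrt (- hw e w) * hw e w ^ 0) + (a0 + a1' * hw e w)
        + Qf e (hw e w) * poly B (hw e w) / hw e w ^ 0 + (0 + 0 * hw e w) * Lf e (hw e w)"
      by simp_all
    have form: "melnikov (2 * e) f g h = poly 0 h / (sqrt (- h) * h ^ 0) + (a0 + a1' * h)
        + Qf e h * poly B h / h ^ 0 + (0 + 0 * h) * Lf e h" if "h \<in> ?I" for h
      using hw_surj[OF e that] B(2) unfolding M_def by metis
    show ?thesis
      using zeros_le_explicit(1)[OF e form nz] zeros_le_explicit(3)[OF e form nz] B(1) True by simp
  next
    case False
    define N where "N = n - 2"
    have N: "n = N + 2" using False n by (simp add: N_def)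
    have "mix e (- int N) (int (N + 1) - int N) 1 (int (N + 2) - int N) 1 M"
    proof -
      have "mix e (- int N) 1 1 2 1 M"
        by (rule sum, intro conjI KK_mix[OF e]) (use N in auto)
      thus ?thesis by simp
    qed
    then obtain P B a0 a1' \<alpha> \<beta> where B: "degree B \<le> N + 1" "degree P \<le> N + 2"
      "\<And>w. w > sqrt e \<Longrightarrow> M w = poly P (hw e w) / (sqrt (- hw e w) * hw e w ^ N) + (a0 + a1' * hw e w)
        + Qf e (hw e w) * poly B (hw e w) / hw e w ^ N + (\<alpha> + \<beta> * hw e w) * Lf e (hw e w)"
      using mix_explicit[OF e, of N "N + 1" 1 "int (N + 2) - int N" M "N + 2"] by auto
    have form: "melnikov (2 * e) f g h = poly P h / (sqrt (- h) * h ^ N) + (a0 + a1' * h)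
        + Qf e h * poly B h / h ^ N + (\<alpha> + \<beta> * h) * Lf e h" if "h \<in> ?I" for h
      using hw_surj[OF e that] B(3) unfolding M_def by metis
    have "zeros_le (melnikov (2 * e) f g) ?I (2 * N + 9)" "real_analytic_on (melnikov (2 * e) f g) ?I"
      using zeros_le_explicit(1,2)[OF e form nz B(2,1)] by auto
    moreover have "2 * N + 9 \<le> 9 * n - 4" using N by simp
    ultimately show ?thesis using zeros_le_mono by blast
  qed
  thus "real_analytic_on (melnikov (2 * e) f g) ?I" "zeros_le (melnikov (2 * e) f g) ?I (9 * n - 4)" by blast+
qed

section \<open>Limit cycles and zeros of the displacement\<close>

text \<open>What the count of limit cycles needs to know about one value of \<open>eps\<close>: the complex return map \<open>R\<close> with its first order term \<open>V\<close>, its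
restriction \<open>r\<close> to real points, and the turns \<open>Ob w\<close> as candidates for periodic orbits.\<close>

definition turn_data ::
  "real \<Rightarrow> (real \<times> real \<Rightarrow> (real \<times> real) set) \<Rightarrow> real \<Rightarrow> real \<Rightarrow> real \<Rightarrow> real \<Rightarrow> (complex \<Rightarrow> complex) \<Rightarrow> real
    \<Rightarrow> (complex \<Rightarrow> complex) \<Rightarrow> (real \<Rightarrow> real) \<Rightarrow> (real \<Rightarrow> (real \<times> real) set) \<Rightarrow> bool" where
  "turn_data e F A B \<delta> c V eps R r Ob \<longleftrightarrow>
     R holomorphic_on cbx A B \<delta> \<and>
     (\<forall>w. A - \<delta> < w \<and> w < B + \<delta> \<longrightarrow> R (of_real w) = of_real (r w)) \<and>
     (\<forall>w\<in>cbx A B \<delta>. cmod (R w - w - of_real eps * V w) \<le> c * \<bar>eps\<bar>\<^sup>2) \<and>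
     (\<forall>w. A - \<delta> < w \<and> w < B + \<delta> \<longrightarrow> \<bar>r w - w\<bar> \<le> \<delta> / 2) \<and>
     (\<forall>w. A - \<delta> / 2 < w \<and> w < B + \<delta> / 2 \<longrightarrow> displacement (2 * e) F (w\<^sup>2 + e) = (r w)\<^sup>2 - w\<^sup>2) \<and>
     (\<forall>C w. periodic_orbit F C \<and> A + \<delta> < w \<and> w < B - \<delta> \<and> (0, w\<^sup>2 + e) \<in> C \<longrightarrow>
        r w = w \<and> C = Ob w \<and> C \<inter> cross_section (2 * e) = {(0, w\<^sup>2 + e)})"

context full_turn
begin

text \<open>The error terms of the two half turns add up, together with the change of the second average caused by the first half
turn.\<close>

lemma turn_data_holds:
  "turn_data e F A B \<delta> ((M1 / \<delta> * (M1 * pi) + M1) * pi + (M2 / \<delta> * (M2 * pi) + M2) * pi + M2 / \<delta> * pi * (M1 * pi))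
     (\<lambda>w. R.avg 0 w + L.avg pi w) eps (\<lambda>w. L.flow (R.flow w pi) (2 * pi)) ret orb"
  unfolding turn_data_def
proof (intro conjI allI impI ballI)
  let ?\<Omega> = "cbx A B \<delta>"
  have sub: "?\<Omega> \<subseteq> cbx A B (2 * \<delta>)" using R.\<delta> by (intro cbx_mono) simp
  have two: "pi + pi = 2 * pi" by simp
  have cl: "cmod (R.flow w pi - w) \<le> M1 * pi * \<bar>eps\<bar>" if "w \<in> ?\<Omega>" for w
    using R.flow_close[of w pi] that sub by auto
  have small: "M1 * pi * \<bar>eps\<bar> \<le> \<delta>"
  proof -
    have "M1 * pi * \<bar>eps\<bar> \<le> M1 * pi * eps1" using R.eps R.pos by (intro mult_left_mono) auto
    also have "\<dots> \<le> \<delta> / 4" using R.smallness(1) by (simp add: mult_ac)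
    finally show ?thesis using R.\<delta> by simp
  qed
  have in2: "R.flow w pi \<in> cbx A B (2 * \<delta>)" if "w \<in> ?\<Omega>" for w
  proof -
    have "R.flow w pi \<in> cball w \<delta>" using cl[OF that] small by (simp add: dist_norm norm_minus_commute)
    thus ?thesis using cbx_margin[OF that, of \<delta> "2 * \<delta>"] by auto
  qed
  show "(\<lambda>w. L.flow (R.flow w pi) (2 * pi)) holomorphic_on ?\<Omega>"
  proof (rule holomorphic_on_compose_gen[of "\<lambda>w. R.flow w pi" ?\<Omega> "\<lambda>w. L.flow w (2 * pi)" "cbx A B (2 * \<delta>)", unfolded o_def])
    show "(\<lambda>w. R.flow w pi) holomorphic_on ?\<Omega>"
      by (rule holomorphic_on_subset[OF R.flow_holomorphic sub]) simp
    show "(\<lambda>w. L.flow w (2 * pi)) holomorphic_on cbx A B (2 * \<delta>)"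
      by (rule L.flow_holomorphic) simp
  qed (use in2 in auto)
  fix w :: real
  show "L.flow (R.flow (of_real w) pi) (2 * pi) = of_real (ret w)" if w: "A - \<delta> < w \<and> w < B + \<delta>"
  proof -
    have w2: "A - 2 * \<delta> < w" "w < B + 2 * \<delta>" using w R.\<delta> by linarith+
    have 1: "R.flow (of_real w) pi = of_real (R.psi w pi)" by (rule R.flow_of_real[OF w2]) simp
    have "\<bar>R.psi w pi - w\<bar> \<le> \<delta> / 4" by (rule psi_close(1)[OF w2]) simp
    hence b: "R.psi w pi - w \<le> \<delta> / 4" "- (R.psi w pi - w) \<le> \<delta> / 4" by (rule abs_le_D1, rule abs_le_D2)
    have w1: "A - 2 * \<delta> < R.psi w pi" "R.psi w pi < B + 2 * \<delta>" using b w R.\<delta> by (simp_all add: field_simps)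
    show ?thesis unfolding 1 ret_def by (rule L.flow_of_real[OF w1]) simp
  qed
  show "\<bar>ret w - w\<bar> \<le> \<delta> / 2" if "A - \<delta> < w \<and> w < B + \<delta>" using ret_close that by blast
  show "displacement (2 * e) F (w\<^sup>2 + e) = (ret w)\<^sup>2 - w\<^sup>2" if "A - \<delta> / 2 < w \<and> w < B + \<delta> / 2"
    using displacement_eq that by blast
  fix C
  assume per: "periodic_orbit F C \<and> A + \<delta> < w \<and> w < B - \<delta> \<and> (0, w\<^sup>2 + e) \<in> C"
  note po = periodic_orbit_through[OF conjunct1[OF per] conjunct1[OF conjunct2[OF per]] conjunct1[OF conjunct2[OF conjunct2[OF per]]]
      conjunct2[OF conjunct2[OF conjunct2[OF per]]]]
  show "ret w = w" "C = orb w" by (fact po)+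
  have "A - \<delta> / 2 < w" "w < B + \<delta> / 2" using per R.\<delta> by simp_all
  from orb_section[OF this po(1)] show "C \<inter> cross_section (2 * e) = {(0, w\<^sup>2 + e)}" unfolding po(2) .
next
  fix w assume w: "w \<in> cbx A B \<delta>"
  have sub: "cbx A B \<delta> \<subseteq> cbx A B (2 * \<delta>)" "cbx A B (2 * \<delta>) \<subseteq> cbx A B (3 * \<delta>)" using R.\<delta> by (intro cbx_mono, simp)+
  have small: "M1 * pi * \<bar>eps\<bar> \<le> \<delta>"
  proof -
    have "M1 * pi * \<bar>eps\<bar> \<le> M1 * pi * eps1" using R.eps R.pos by (intro mult_left_mono) auto
    also have "\<dots> \<le> \<delta> / 4" using R.smallness(1) by (simp add: mult_ac)
    finally show ?thesis using R.\<delta> by simp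
  qed
  define w1 where "w1 = R.flow w pi"
  have w2: "w \<in> cbx A B (2 * \<delta>)" using w sub by blast
  have cl: "cmod (w1 - w) \<le> M1 * pi * \<bar>eps\<bar>" unfolding w1_def using R.flow_close[OF w2, of pi] by simp
  have "w1 \<in> cball w \<delta>" using cl small by (simp add: dist_norm norm_minus_commute)
  hence w12: "w1 \<in> cbx A B (2 * \<delta>)" using cbx_margin[OF w, of \<delta> "2 * \<delta>"] by auto
  have 1: "cmod (w1 - w - of_real eps * R.avg 0 w) \<le> (M1 / \<delta> * (M1 * pi) + M1) * pi * \<bar>eps\<bar>\<^sup>2"
    using R.flow_first_order[OF w2] by (simp add: w1_def)
  have "pi + pi = 2 * pi" by simp
  hence 2: "cmod (L.flow w1 (2 * pi) - w1 - of_real eps * L.avg pi w1) \<le> (M2 / \<delta> * (M2 * pi) + M2) * pi * \<bar>eps\<bar>\<^sup>2"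
    using L.flow_first_order[OF w12] by metis
  have "cmod (L.avg pi w1 - L.avg pi w) \<le> M2 / \<delta> * pi * cmod (w1 - w)"
    by (rule L.avg_lipschitz) (use w12 w2 sub in auto)
  also have "\<dots> \<le> M2 / \<delta> * pi * (M1 * pi * \<bar>eps\<bar>)"
    using L.pos L.\<delta> by (intro mult_left_mono cl) auto
  finally have "\<bar>eps\<bar> * cmod (L.avg pi w1 - L.avg pi w) \<le> \<bar>eps\<bar> * (M2 / \<delta> * pi * (M1 * pi * \<bar>eps\<bar>))"
    by (intro mult_left_mono) auto
  hence 3: "cmod (of_real eps * (L.avg pi w1 - L.avg pi w)) \<le> M2 / \<delta> * pi * (M1 * pi) * \<bar>eps\<bar>\<^sup>2"
    by (simp add: norm_mult power2_eq_square mult_ac)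
  have split: "L.flow w1 (2 * pi) - w - of_real eps * (R.avg 0 w + L.avg pi w)
     = (w1 - w - of_real eps * R.avg 0 w) + (L.flow w1 (2 * pi) - w1 - of_real eps * L.avg pi w1) + of_real eps * (L.avg pi w1 - L.avg pi w)"
    by (simp add: algebra_simps)
  have "cmod (L.flow w1 (2 * pi) - w - of_real eps * (R.avg 0 w + L.avg pi w))
     \<le> (M1 / \<delta> * (M1 * pi) + M1) * pi * \<bar>eps\<bar>\<^sup>2 + (M2 / \<delta> * (M2 * pi) + M2) * pi * \<bar>eps\<bar>\<^sup>2 + M2 / \<delta> * pi * (M1 * pi) * \<bar>eps\<bar>\<^sup>2"
    unfolding split by (intro norm_triangle_le add_mono 1 2 3)
  thus "cmod (L.flow (R.flow w pi) (2 * pi) - w - of_real eps * (R.avg 0 w + L.avg pi w))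
     \<le> ((M1 / \<delta> * (M1 * pi) + M1) * pi + (M2 / \<delta> * (M2 * pi) + M2) * pi + M2 / \<delta> * pi * (M1 * pi)) * \<bar>eps\<bar>\<^sup>2"
    unfolding w1_def distrib_right .
qed

end

lemma turn_data_exists:
  assumes e: "e > 0" and A: "sqrt e < A - 4 * \<delta>" and AB: "A \<le> B" and \<delta>: "\<delta> > 0"
  shows "\<exists>c V eps0. eps0 > 0 \<and> V holomorphic_on cbx A B \<delta> \<and>
    (\<forall>w. A - \<delta> < w \<and> w < B + \<delta> \<longrightarrow> V (of_real w) =
       of_real (fac e w * (integral {0..pi} (GG e n a1 b1 w) + integral {pi..2 * pi} (GG e n a2 b2 w)))) \<and>
    (\<forall>eps. \<bar>eps\<bar> \<le> eps0 \<longrightarrow> (\<exists>R r Ob. turn_data e (filF e n a1 b1 a2 b2 eps) A B \<delta> c V eps R r Ob))"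
proof -
  obtain eps1 m1 M1 where H1: "half_field n a1 b1 e A B \<delta> eps1 m1 M1" using half_field_exists[OF assms] by blast
  obtain eps2 m2 M2 where H2: "half_field n a2 b2 e A B \<delta> eps2 m2 M2" using half_field_exists[OF assms] by blast
  interpret R: half_field n a1 b1 e A B \<delta> eps1 m1 M1 by (fact H1)
  interpret L: half_field n a2 b2 e A B \<delta> eps2 m2 M2 by (fact H2)
  show ?thesis
  proof (intro exI conjI allI impI)
    show "min eps1 eps2 > 0" using R.pos L.pos by simp
    have sub: "cbx A B \<delta> \<subseteq> cbx A B (4 * \<delta>)" using \<delta> by (intro cbx_mono) simp
    show "(\<lambda>w. R.avg 0 w + L.avg pi w) holomorphic_on cbx A B \<delta>"
      by (intro holomorphic_on_add holomorphic_on_subset[OF R.avg_holomorphic sub] holomorphic_on_subset[OF L.avg_holomorphic sub]) auto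
    fix w :: real assume w: "A - \<delta> < w \<and> w < B + \<delta>"
    hence we: "w > sqrt e" using A \<delta> by linarith
    have c: "(of_real w :: complex) \<in> cbx A B (4 * \<delta>)" using w \<delta> by (auto simp: cbx_iff)
    have "R.avg 0 (of_real w) + L.avg pi (of_real w) =
      of_real (integral {0..0 + pi} (\<lambda>t. slope e n a1 b1 0 w t) + integral {pi..pi + pi} (\<lambda>t. slope e n a2 b2 0 w t))"
      using R.avg_real[OF _ _ c, of 0] L.avg_real[OF _ _ c, of pi] by simp
    also have "integral {0..0 + pi} (\<lambda>t. slope e n a1 b1 0 w t) = fac e w * integral {0..pi} (GG e n a1 b1 w)"
      unfolding slope_unperturbed[OF e we] by simp
    also have "integral {pi..pi + pi} (\<lambda>t. slope e n a2 b2 0 w t) = fac e w * integral {pi..2 * pi} (GG e n a2 b2 w)"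
    proof -
      have "pi + pi = 2 * pi" by simp
      thus ?thesis by (simp only: slope_unperturbed[OF e we] integral_mult_right)
    qed
    finally show "R.avg 0 (of_real w) + L.avg pi (of_real w) =
       of_real (fac e w * (integral {0..pi} (GG e n a1 b1 w) + integral {pi..2 * pi} (GG e n a2 b2 w)))"
      by (simp add: distrib_left)
  next
    fix eps :: real assume "\<bar>eps\<bar> \<le> min eps1 eps2"
    then interpret T: full_turn n a1 b1 a2 b2 e A B \<delta> eps1 m1 M1 eps2 m2 M2 eps
      by unfold_locales auto
    show "turn_data e (filF e n a1 b1 a2 b2 eps) A B \<delta>
      ((M1 / \<delta> * (M1 * pi) + M1) * pi + (M2 / \<delta> * (M2 * pi) + M2) * pi + M2 / \<delta> * pi * (M1 * pi))
      (\<lambda>w. R.avg 0 w + L.avg pi w) eps (\<lambda>w. T.L.flow (T.R.flow w pi) (2 * pi)) T.ret T.orb"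
      by (rule T.turn_data_holds)
  qed
qed

lemma closure_quadrant:
  "closure (quadrant \<eta> 1) = {p. fst p \<ge> 0 \<and> snd p \<ge> \<eta>}" "closure (quadrant \<eta> 2) = {p. fst p \<ge> 0 \<and> snd p \<le> \<eta>}"
  "closure (quadrant \<eta> 3) = {p. fst p \<le> 0 \<and> snd p \<le> \<eta>}" "closure (quadrant \<eta> 4) = {p. fst p \<le> 0 \<and> snd p \<ge> \<eta>}"
proof -
  have "quadrant \<eta> 1 = {0<..} \<times> {\<eta><..}" "quadrant \<eta> 2 = {0<..} \<times> {..<\<eta>}" "quadrant \<eta> 3 = {..<0} \<times> {..<\<eta>}" "quadrant \<eta> 4 = {..<0} \<times> {\<eta><..}"
    by (auto simp: quadrant_def)
  thus "closure (quadrant \<eta> 1) = {p. fst p \<ge> 0 \<and> snd p \<ge> \<eta>}" "closure (quadrant \<eta> 2) = {p. fst p \<ge> 0 \<and> snd p \<le> \<eta>}"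
    "closure (quadrant \<eta> 3) = {p. fst p \<le> 0 \<and> snd p \<le> \<eta>}" "closure (quadrant \<eta> 4) = {p. fst p \<le> 0 \<and> snd p \<ge> \<eta>}"
    by (auto simp: closure_Times)
qed

lemma filippov_two_zones:
  assumes f1: "\<And>x y. f 1 (x, y) = pev n a1 x y" and g1: "\<And>x y. g 1 (x, y) = pev n b1 x y"
    and f3: "\<And>x y. f 3 (x, y) = pev n a2 x y" and g3: "\<And>x y. g 3 (x, y) = pev n b2 x y"
    and eq: "f 1 = f 2" "g 1 = g 2" "f 3 = f 4" "g 3 = g 4"
  shows "filippov_field (2 * e) f g eps = filF e n a1 b1 a2 b2 eps"
proof
  fix p :: "real \<times> real"
  have p1: "perturbed (2 * e) f g eps 1 p = vf e n a1 b1 eps p" "perturbed (2 * e) f g eps 3 p = vf e n a2 b2 eps p"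
    using f1[of "fst p" "snd p"] g1[of "fst p" "snd p"] f3[of "fst p" "snd p"] g3[of "fst p" "snd p"]
    by (simp_all add: perturbed_def unperturbed_def vf_def fx_def fy_def split_beta)
  have p2: "perturbed (2 * e) f g eps 2 p = vf e n a1 b1 eps p" "perturbed (2 * e) f g eps 4 p = vf e n a2 b2 eps p"
    using p1 eq unfolding perturbed_def by metis+
  have "{perturbed (2 * e) f g eps k p |k. k \<in> {1..4} \<and> p \<in> closure (quadrant (2 * e) k)}
     = (if fst p \<ge> 0 then {vf e n a1 b1 eps p} else {}) \<union> (if fst p \<le> 0 then {vf e n a2 b2 eps p} else {})"
  proof -
    have I4: "{1..4::nat} = {1, 2, 3, 4}" by auto
    have "{perturbed (2 * e) f g eps k p |k. k \<in> {1..4} \<and> p \<in> closure (quadrant (2 * e) k)}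
       = (if p \<in> closure (quadrant (2 * e) 1) then {perturbed (2 * e) f g eps 1 p} else {})
       \<union> (if p \<in> closure (quadrant (2 * e) 2) then {perturbed (2 * e) f g eps 2 p} else {})
       \<union> (if p \<in> closure (quadrant (2 * e) 3) then {perturbed (2 * e) f g eps 3 p} else {})
       \<union> (if p \<in> closure (quadrant (2 * e) 4) then {perturbed (2 * e) f g eps 4 p} else {})"
      unfolding I4 by (auto simp del: One_nat_def)
    thus ?thesis unfolding closure_quadrant p1 p2 by auto
  qed
  thus "filippov_field (2 * e) f g eps p = filF e n a1 b1 a2 b2 eps p"
    unfolding filippov_field_def filF_def by (auto simp: insert_commute)
qed

text \<open>The map \<open>hw e\<close> is an analytic change of coordinate between the section and the range of levels.\<close>

lemma hw_real_analytic:
  assumes e: "e > 0"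
  shows "real_analytic_on (hw e) {sqrt e<..}" "real_analytic_on (fac e) {sqrt e<..}"
    and "w > sqrt e \<Longrightarrow> deriv (hw e) w = 1 / fac e w" "w > sqrt e \<Longrightarrow> fac e w > 0" "w > sqrt e \<Longrightarrow> hw e w \<in> {- 1 / (4 * e)<..<0}"
proof -
  note rg = real_gt_sqrt[OF e]
  have "real_analytic_on (\<lambda>w. 0 - w\<^sup>2 / (w\<^sup>2 + e)\<^sup>2) {sqrt e<..}"
    by (intro real_analytic_diff real_analytic_const real_analytic_divide real_analytic_power real_analytic_add real_analytic_ident)
       (use rg(3) in force)
  thus "real_analytic_on (hw e) {sqrt e<..}" unfolding hw_def[abs_def] by simp
  show "real_analytic_on (fac e) {sqrt e<..}" unfolding fac_def[abs_def]
    by (intro real_analytic_diff real_analytic_const real_analytic_divide real_analytic_power real_analytic_add real_analytic_mult real_analytic_ident)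
       (use rg in force)
  assume w: "w > sqrt e"
  define z where "z = w\<^sup>2 + e"
  have z: "z \<noteq> 0" using rg(3)[OF w] by (simp add: z_def)
  have "(hw e has_real_derivative - ((2 * w * z\<^sup>2 - w\<^sup>2 * (2 * z * (2 * w))) / (z\<^sup>2 * z\<^sup>2))) (at w)"
    unfolding hw_def[abs_def] using z unfolding z_def by (auto intro!: derivative_eq_intros)
  moreover have "- ((2 * w * z\<^sup>2 - w\<^sup>2 * (2 * z * (2 * w))) / (z\<^sup>2 * z\<^sup>2)) = 2 * w * (2 * w\<^sup>2 - z) / z ^ 3"
    using z by (simp add: divide_simps) (simp add: power2_eq_square power3_eq_cube power4_eq_xxxx algebra_simps)
  moreover have "2 * w\<^sup>2 - z = w\<^sup>2 - e" by (simp add: z_def)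
  ultimately have "(hw e has_real_derivative 1 / fac e w) (at w)" by (simp add: fac_def z_def)
  thus "deriv (hw e) w = 1 / fac e w" by (rule DERIV_imp_deriv)
  show "fac e w > 0" using rg[OF w] by (simp add: fac_def)
  have "hw e (sqrt e) < hw e w" by (rule hw_strict_mono[OF e order_refl w])
  moreover have "hw e (sqrt e) = - 1 / (4 * e)" using e by (simp add: hw_def power2_eq_square)
  ultimately show "hw e w \<in> {- 1 / (4 * e)<..<0}" using hw_neg[OF e w] by simp
qed

text \<open>\<open>(ret w - w) / eps\<close> converges uniformly to \<open>fac e w * M (hw e w)\<close>, which has the zeros of \<open>M\<close> in the coordinate
\<open>w\<close>.\<close>

lemma return_zeros_le:
  assumes e: "e > 0" and A: "sqrt e < A - 4 * \<delta>" and AB: "A \<le> B" and \<delta>: "\<delta> > 0"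
    and Mra: "real_analytic_on M {- 1 / (4 * e)<..<0}" and Mz: "zeros_le M {- 1 / (4 * e)<..<0} N"
    and M: "\<And>w. w > sqrt e \<Longrightarrow> M (hw e w) = integral {0..pi} (GG e n a1 b1 w) + integral {pi..2 * pi} (GG e n a2 b2 w)"
  shows "\<exists>eps0>0. \<forall>eps. 0 < \<bar>eps\<bar> \<and> \<bar>eps\<bar> < eps0 \<longrightarrow>
    (\<exists>c V R r Ob. turn_data e (filF e n a1 b1 a2 b2 eps) A B \<delta> c V eps R r Ob \<and> zeros_le (\<lambda>w. (r w - w) / eps) {A..B} N)"
proof -
  let ?F = "filF e n a1 b1 a2 b2"
  obtain c V eps0 where pos: "eps0 > 0" and V: "V holomorphic_on cbx A B \<delta>"
    and Vr: "\<And>w. A - \<delta> < w \<Longrightarrow> w < B + \<delta> \<Longrightarrow> V (of_real w) =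
       of_real (fac e w * (integral {0..pi} (GG e n a1 b1 w) + integral {pi..2 * pi} (GG e n a2 b2 w)))"
    and T: "\<And>eps. \<bar>eps\<bar> \<le> eps0 \<Longrightarrow> \<exists>R r Ob. turn_data e (?F eps) A B \<delta> c V eps R r Ob"
    using turn_data_exists[OF e A AB \<delta>, of n a1 b1 a2 b2] by blast
  have "\<exists>X. \<forall>eps. \<bar>eps\<bar> \<le> eps0 \<longrightarrow> turn_data e (?F eps) A B \<delta> c V eps (fst (X eps)) (fst (snd (X eps))) (snd (snd (X eps)))"
  proof (rule choice, intro allI)
    fix eps
    show "\<exists>X. \<bar>eps\<bar> \<le> eps0 \<longrightarrow> turn_data e (?F eps) A B \<delta> c V eps (fst X) (fst (snd X)) (snd (snd X))"
    proof (cases "\<bar>eps\<bar> \<le> eps0")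
      case True
      then obtain R r Ob where "turn_data e (?F eps) A B \<delta> c V eps R r Ob" using T by blast
      thus ?thesis by (intro exI[of _ "(R, r, Ob)"]) simp
    qed simp
  qed
  then obtain X where X: "\<And>eps. \<bar>eps\<bar> \<le> eps0 \<Longrightarrow> turn_data e (?F eps) A B \<delta> c V eps (fst (X eps)) (fst (snd (X eps))) (snd (snd (X eps)))" by blast
  define R r where "R eps = fst (X eps)" and "r eps = fst (snd (X eps))" for eps
  let ?I = "{A - \<delta> / 2<..<B + \<delta> / 2}"
  have ev: "\<forall>\<^sub>F eps in at 0. \<bar>eps\<bar> \<le> eps0 \<and> eps \<noteq> 0"
    unfolding eventually_at using pos by (intro exI[of _ eps0]) (auto simp: dist_real_def)
  have "\<forall>\<^sub>F eps in at 0. zeros_le (\<lambda>w. (r eps w - w) / eps) {A..B} N"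
  proof (rule eventually_zeros_le)
    show "open ?I" "compact {A..B}" "{A..B} \<subseteq> ?I" using \<delta> by auto
    show "open (cbx A B \<delta>)" by (rule cbx_open_convex)
    show "of_real ` ?I \<subseteq> cbx A B \<delta>" using \<delta> by (auto simp: cbx_iff)
    show "\<forall>\<^sub>F eps in at 0. (\<lambda>w. (R eps w - w) / of_real eps) holomorphic_on cbx A B \<delta>"
      using ev
    proof (rule eventually_mono)
      fix eps assume h: "\<bar>eps\<bar> \<le> eps0 \<and> eps \<noteq> 0"
      hence "R eps holomorphic_on cbx A B \<delta>" using X[of eps] unfolding turn_data_def R_def by blast
      thus "(\<lambda>w. (R eps w - w) / of_real eps) holomorphic_on cbx A B \<delta>"
        using h by (intro holomorphic_intros) auto
    qed
    show "V holomorphic_on cbx A B \<delta>" by (rule V)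
    show "uniform_limit (cbx A B \<delta>) (\<lambda>eps w. (R eps w - w) / of_real eps) V (at 0)"
    proof (rule uniform_limitI)
      fix d :: real assume d: "d > 0"
      define k where "k = \<bar>c\<bar> + 1"
      have k: "k > 0" "c \<le> k" by (auto simp: k_def)
      have "\<forall>\<^sub>F eps in at 0. \<bar>eps\<bar> < d / k"
        unfolding eventually_at using d k by (intro exI[of _ "d / k"]) (auto simp: dist_real_def)
      with ev show "\<forall>\<^sub>F eps in at 0. \<forall>w\<in>cbx A B \<delta>. dist ((R eps w - w) / of_real eps) (V w) < d"
      proof eventually_elim
        fix eps assume h: "\<bar>eps\<bar> \<le> eps0 \<and> eps \<noteq> 0" and h2: "\<bar>eps\<bar> < d / k"
        show "\<forall>w\<in>cbx A B \<delta>. dist ((R eps w - w) / of_real eps) (V w) < d"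
        proof
          fix w assume w: "w \<in> cbx A B \<delta>"
          have "cmod (R eps w - w - of_real eps * V w) \<le> c * \<bar>eps\<bar>\<^sup>2"
            using X[of eps] h w unfolding turn_data_def R_def by blast
          moreover have "(R eps w - w) / of_real eps - V w = (R eps w - w - of_real eps * V w) / of_real eps"
            using h by (simp add: diff_divide_distrib)
          ultimately have "cmod ((R eps w - w) / of_real eps - V w) \<le> c * \<bar>eps\<bar>\<^sup>2 / \<bar>eps\<bar>"
            by (simp add: norm_divide divide_right_mono)
          also have "\<dots> = c * \<bar>eps\<bar>" using h by (simp add: power2_eq_square del: power2_abs abs_mult_self_eq)
          also have "\<dots> \<le> k * \<bar>eps\<bar>" using k by (intro mult_right_mono) auto
          also have "\<dots> < d" using h2 k by (simp add: pos_less_divide_eq mult.commute)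
          finally show "dist ((R eps w - w) / of_real eps) (V w) < d" by (simp add: dist_norm)
        qed
      qed
    qed
    show "\<forall>\<^sub>F eps in at 0. \<forall>x\<in>?I. (R eps (of_real x) - of_real x) / of_real eps = of_real ((r eps x - x) / eps)"
      using ev
    proof (rule eventually_mono, intro ballI)
      fix eps x assume h: "\<bar>eps\<bar> \<le> eps0 \<and> eps \<noteq> 0" and x: "x \<in> ?I"
      have "A - \<delta> < x \<and> x < B + \<delta>" using x \<delta> by auto
      hence "R eps (of_real x) = of_real (r eps x)" using X[of eps] h unfolding turn_data_def R_def r_def by blast
      thus "(R eps (of_real x) - of_real x) / of_real eps = of_real ((r eps x - x) / eps)" by simp
    qed
    have we: "x > sqrt e" if "x \<in> ?I" for x using that A \<delta> by auto
    have I: "?I \<subseteq> {sqrt e<..}" using we by auto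
    show "V (of_real x) = of_real (fac e x * M (hw e x))" if x: "x \<in> ?I" for x
    proof -
      have "A - \<delta> < x" "x < B + \<delta>" using x \<delta> by auto
      thus ?thesis using Vr M[OF we[OF x]] by simp
    qed
    note ra = hw_real_analytic[OF e]
    have raM: "real_analytic_on (\<lambda>x. M (hw e x)) ?I"
      by (rule real_analytic_compose[OF Mra real_analytic_on_subset[OF ra(1) I]]) (use ra(5) we in auto)
    have zM: "zeros_le (\<lambda>x. M (hw e x)) ?I N"
    proof (rule zeros_le_compose[OF Mra _ real_analytic_on_subset[OF ra(1) I]])
      show "inj_on (hw e) ?I"
      proof (rule inj_onI)
        fix x y assume "x \<in> ?I" "y \<in> ?I" "hw e x = hw e y"
        thus "x = y" using hw_strict_mono[OF e, of x y] hw_strict_mono[OF e, of y x] we[of x] we[of y] by (metis less_irrefl less_imp_le linorder_neqE)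
      qed
      show "deriv (hw e) x \<noteq> 0" if "x \<in> ?I" for x using ra(3,4)[OF we[OF that]] by simp
    qed (use ra(5) we Mz in auto)
    have raf: "real_analytic_on (fac e) ?I" by (rule real_analytic_on_subset[OF ra(2) I])
    show "zeros_le (\<lambda>x. fac e x * M (hw e x)) ?I N"
    proof (rule zeros_le_mult)
      show "real_analytic_on (\<lambda>x. fac e x * M (hw e x)) ?I" by (rule real_analytic_mult[OF raf raM])
      show "real_analytic_on (\<lambda>x. 1 / fac e x) ?I"
        by (rule real_analytic_divide[OF real_analytic_const raf]) (use ra(4) we in force)
      show "zeros_le (\<lambda>x. fac e x * M (hw e x) * (1 / fac e x)) ?I N"
        by (rule zeros_le_cong[OF zM]) (use ra(4)[OF we] in \<open>auto simp: less_imp_neq[symmetric]\<close>)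
    qed simp
  qed
  then obtain d where d: "d > 0" "\<And>eps. eps \<noteq> 0 \<Longrightarrow> dist eps 0 < d \<Longrightarrow> zeros_le (\<lambda>w. (r eps w - w) / eps) {A..B} N"
    unfolding eventually_at by auto
  show ?thesis
  proof (rule exI[of _ "min d eps0"], intro conjI allI impI)
    show "min d eps0 > 0" using d pos by simp
    fix eps assume h: "0 < \<bar>eps\<bar> \<and> \<bar>eps\<bar> < min d eps0"
    hence "zeros_le (\<lambda>w. (r eps w - w) / eps) {A..B} N" "turn_data e (?F eps) A B \<delta> c V eps (fst (X eps)) (fst (snd (X eps))) (snd (snd (X eps)))"
      using d(2)[of eps] X[of eps] by (auto simp: dist_real_def)
    thus "\<exists>c V R r Ob. turn_data e (?F eps) A B \<delta> c V eps R r Ob \<and> zeros_le (\<lambda>w. (r w - w) / eps) {A..B} N"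
      unfolding r_def by blast
  qed
qed

text \<open>The displacement at \<open>y = w\<^sup>2 + e\<close> is \<open>(r w)\<^sup>2 - w\<^sup>2\<close>, which is \<open>r w - w\<close> times a factor without zeros.\<close>

lemma vanishes_displacement:
  assumes e: "e > 0" and A: "sqrt e < A - 4 * \<delta>" and \<delta>: "\<delta> > 0" and eps: "eps \<noteq> 0"
    and T: "turn_data e F A B \<delta> c V eps R r Ob" and w: "A \<le> w" "w \<le> B" and d: "vanishes m (displacement (2 * e) F) (w\<^sup>2 + e)"
  shows "vanishes m (\<lambda>w. (r w - w) / eps) w"
proof -
  let ?I = "{A - \<delta> / 2<..<B + \<delta> / 2}"
  let ?J = "{(A - \<delta> / 2)\<^sup>2 + e<..<(B + \<delta> / 2)\<^sup>2 + e}"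
  have se: "sqrt e > 0" using e by simp
  have A0: "A - \<delta> / 2 > 0" using A \<delta> se by linarith
  have wI: "w \<in> ?I" using w \<delta> by auto
  have pos: "x > 0" if "x \<in> ?I" for x using that A0 by auto
  have rI: "R (of_real x) = of_real (r x)" "\<bar>r x - x\<bar> \<le> \<delta> / 2" "displacement (2 * e) F (x\<^sup>2 + e) = (r x)\<^sup>2 - x\<^sup>2" if "x \<in> ?I" for x
  proof -
    have "A - \<delta> < x \<and> x < B + \<delta>" "A - \<delta> / 2 < x \<and> x < B + \<delta> / 2" using that \<delta> by auto
    thus "R (of_real x) = of_real (r x)" "\<bar>r x - x\<bar> \<le> \<delta> / 2" "displacement (2 * e) F (x\<^sup>2 + e) = (r x)\<^sup>2 - x\<^sup>2"
      using T unfolding turn_data_def by blast+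
  qed
  have ra: "real_analytic_on r ?I"
  proof (rule real_analytic_onI[of R])
    show "R (of_real x) = of_real (r x)" if "x \<in> ?I" for x by (rule rI(1)[OF that])
    have "R analytic_on cbx A B \<delta>" using T cbx_open_convex(1) unfolding turn_data_def by (metis analytic_on_open)
    thus "R analytic_on (of_real ` ?I)" by (rule analytic_on_subset) (use \<delta> in \<open>auto simp: cbx_iff\<close>)
  qed
  have sJ: "sqrt (y - e) \<in> ?I" "y - e > 0" if "y \<in> ?J" for y
  proof -
    have y: "(A - \<delta> / 2)\<^sup>2 < y - e" "y - e < (B + \<delta> / 2)\<^sup>2" using that by auto
    have B0: "B + \<delta> / 2 > 0" using wI pos[OF wI] by auto
    show "sqrt (y - e) \<in> ?I" using y A0 B0 by (auto intro: real_less_rsqrt real_less_lsqrt)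
    show "y - e > 0" using y(1) zero_le_power2[of "A - \<delta> / 2"] by linarith
  qed
  have wJ: "w\<^sup>2 + e \<in> ?J"
    using wI A0 pos[OF wI] by (auto intro!: power_strict_mono)
  have sw: "sqrt (w\<^sup>2 + e - e) = w" using pos[OF wI] by simp
  define G where "G x = (r x)\<^sup>2 - x\<^sup>2" for x
  have raG: "real_analytic_on G ?I"
    unfolding G_def[abs_def] by (intro real_analytic_diff real_analytic_power real_analytic_ident ra)
  have "vanishes m (\<lambda>y. G (sqrt (y - e))) (w\<^sup>2 + e)"
  proof (rule iffD1[OF vanishes_cong[OF _ wJ] d])
    show "displacement (2 * e) F y = G (sqrt (y - e))" if "y \<in> ?J" for y
      using rI(3)[OF sJ(1)[OF that]] sJ(2)[OF that] by (simp add: G_def)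
  qed simp
  hence "vanishes m G (sqrt (w\<^sup>2 + e - e))"
  proof (rule vanishes_compose[OF raG _ _ _ wJ, rotated -1])
    show "real_analytic_on (\<lambda>y. sqrt (y - e)) ?J"
      by (intro real_analytic_sqrt real_analytic_diff real_analytic_ident real_analytic_const) (use sJ in auto)
    show "deriv (\<lambda>y. sqrt (y - e)) y \<noteq> 0" if "y \<in> ?J" for y
    proof -
      have "((\<lambda>y. sqrt (y - e)) has_real_derivative inverse (sqrt (y - e)) / 2) (at y)"
        using sJ(2)[OF that] by (auto intro!: derivative_eq_intros)
      thus ?thesis using DERIV_imp_deriv sJ(2)[OF that] by fastforce
    qed
  qed (use sJ in auto)
  hence G: "vanishes m G w" unfolding sw .
  have raf: "real_analytic_on (\<lambda>x. (r x - x) / eps) ?I"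
    by (intro real_analytic_divide real_analytic_diff real_analytic_ident real_analytic_const ra) (use eps in auto)
  have ras: "real_analytic_on (\<lambda>x. eps * (r x + x)) ?I"
    by (intro real_analytic_mult real_analytic_add real_analytic_ident real_analytic_const ra)
  show ?thesis
  proof (rule vanishes_mult_cancel[OF raf ras _ wI])
    have "(r x - x) / eps * (eps * (r x + x)) = G x" for x
    proof -
      have "(r x - x) / eps * (eps * (r x + x)) = (r x - x) * (r x + x)" using eps by simp
      thus ?thesis by (simp add: G_def power2_eq_square algebra_simps)
    qed
    hence "(\<lambda>x. (r x - x) / eps * (eps * (r x + x))) = G" by blast
    thus "vanishes m (\<lambda>x. (r x - x) / eps * (eps * (r x + x))) w" using G by simp
    show "eps * (r x + x) \<noteq> 0" if x: "x \<in> ?I" for x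
    proof -
      have "- (r x - x) \<le> \<delta> / 2" using rI(2)[OF x] by (rule abs_le_D2)
      moreover have "A - \<delta> / 2 < x" using x by simp
      ultimately have "r x > 0" using A \<delta> se by linarith
      hence "r x + x > 0" using pos[OF x] by simp
      thus ?thesis using eps by simp
    qed
  qed simp
qed

lemma vanishes_zero_multiplicity:
  assumes "enat m \<le> zero_multiplicity d y"
  shows "vanishes m d y"
  unfolding vanishes_def
proof (intro allI impI)
  fix j assume j: "j < m"
  show "(deriv ^^ j) d y = 0"
  proof (rule ccontr)
    assume nz: "(deriv ^^ j) d y \<noteq> 0"
    hence "zero_multiplicity d y = enat (LEAST m. (deriv ^^ m) d y \<noteq> 0)" unfolding zero_multiplicity_def by auto
    moreover have "(LEAST m. (deriv ^^ m) d y \<noteq> 0) \<le> j" using nz by (rule Least_le)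
    ultimately show False using assms j by simp
  qed
qed

text \<open>An infinite set of zeros, or a zero of infinite order, would contain more than \<open>N\<close> zeros.\<close>

lemma sum_enat_le:
  assumes z: "zeros_le f {A..B} N" and S: "S \<subseteq> {A..B}"
    and pos: "\<And>w. w \<in> S \<Longrightarrow> vanishes 1 f w"
    and \<mu>: "\<And>w m. w \<in> S \<Longrightarrow> enat m \<le> \<mu> w \<Longrightarrow> vanishes m f w"
  shows "finite S" "(\<Sum>w\<in>S. \<mu> w) \<le> enat N"
proof -
  show fin: "finite S"
  proof (rule ccontr)
    assume "infinite S"
    then obtain U where U: "U \<subseteq> S" "finite U" "card U = Suc N" using infinite_arbitrarily_large by blast
    have "sum (\<lambda>_. 1) U \<le> N" by (rule zeros_leD[OF z U(2)]) (use U S pos in auto)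
    thus False using U by simp
  qed
  have finite_\<mu>: "\<exists>m. \<mu> w = enat m" if "w \<in> S" for w
  proof (rule ccontr)
    assume "\<nexists>m. \<mu> w = enat m"
    hence "\<mu> w = \<infinity>" by (cases "\<mu> w") auto
    hence "vanishes (Suc N) f w" using \<mu>[OF that, of "Suc N"] by simp
    hence "sum (\<lambda>_. Suc N) {w} \<le> N" by (intro zeros_leD[OF z]) (use that S in auto)
    thus False by simp
  qed
  define \<nu> where "\<nu> w = the_enat (\<mu> w)" for w
  have \<nu>: "\<mu> w = enat (\<nu> w)" if "w \<in> S" for w using finite_\<mu>[OF that] by (auto simp: \<nu>_def)
  have "(\<Sum>w\<in>S. \<mu> w) = (\<Sum>w\<in>S. enat (\<nu> w))" using \<nu> by (intro sum.cong) auto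
  also have "\<dots> = enat (\<Sum>w\<in>S. \<nu> w)" using fin by (induction S rule: finite_induct) (auto simp: zero_enat_def)
  also have "(\<Sum>w\<in>S. \<nu> w) \<le> N" by (rule zeros_leD[OF z fin S]) (use \<mu> \<nu> in auto)
  finally show "(\<Sum>w\<in>S. \<mu> w) \<le> enat N" by simp
qed

text \<open>A limit cycle is determined by its point \<open>(0, w\<^sup>2 + e)\<close> on the section, and \<open>w\<close> is a zero of \<open>r w - w\<close> of at least the order that
the displacement has.\<close>

lemma cycles_le:
  assumes e: "e > 0" and A: "sqrt e < A - 4 * \<delta>" and \<delta>: "\<delta> > 0" and eps: "eps \<noteq> 0"
    and T: "turn_data e F A B \<delta> c V eps R r Ob" and z: "zeros_le (\<lambda>w. (r w - w) / eps) {A..B} N"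
    and K: "\<And>w. w > sqrt e \<Longrightarrow> hw e w \<in> K \<Longrightarrow> A + \<delta> < w \<and> w < B - \<delta>"
  shows "finite (limit_cycles_near (2 * e) F K) \<and>
    (\<Sum>C\<in>limit_cycles_near (2 * e) F K. cycle_multiplicity (2 * e) F C) \<le> enat N"
proof -
  let ?LC = "limit_cycles_near (2 * e) F K"
  have ex: "\<exists>w. A + \<delta> < w \<and> w < B - \<delta> \<and> r w = w \<and> C = Ob w \<and> C \<inter> cross_section (2 * e) = {(0, w\<^sup>2 + e)}"
    if C: "C \<in> ?LC" for C
  proof -
    obtain p where p: "p \<in> C" "p \<in> cross_section (2 * e)" "first_integral (2 * e) p \<in> K" and per: "periodic_orbit F C"
      using C unfolding limit_cycles_near_def limit_cycle_def by blast
    obtain y where y: "p = (0, y)" "y > 2 * e" using p(2) unfolding cross_section_def by auto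
    define w where "w = sqrt (y - e)"
    have w2: "w\<^sup>2 = y - e" using y(2) e by (simp add: w_def)
    have we: "w > sqrt e" unfolding w_def using y(2) by simp
    have "first_integral (2 * e) p = hw e w"
      unfolding y(1) hw_def w2 first_integral_def by (simp add: minus_divide_left)
    hence b: "A + \<delta> < w \<and> w < B - \<delta>" using K[OF we] p(3) by simp
    have "(0, w\<^sup>2 + e) \<in> C" using p(1) y(1) w2 by simp
    moreover have "\<forall>C w. periodic_orbit F C \<and> A + \<delta> < w \<and> w < B - \<delta> \<and> (0, w\<^sup>2 + e) \<in> C \<longrightarrow>
        r w = w \<and> C = Ob w \<and> C \<inter> cross_section (2 * e) = {(0, w\<^sup>2 + e)}"
      using T unfolding turn_data_def by (elim conjE)
    ultimately have "r w = w \<and> C = Ob w \<and> C \<inter> cross_section (2 * e) = {(0, w\<^sup>2 + e)}"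
      using b per by simp
    thus ?thesis using b by blast
  qed
  then obtain W where W: "\<And>C. C \<in> ?LC \<Longrightarrow> A + \<delta> < W C \<and> W C < B - \<delta> \<and> r (W C) = W C \<and> C = Ob (W C) \<and> C \<inter> cross_section (2 * e) = {(0, (W C)\<^sup>2 + e)}"
    by metis
  have inj: "inj_on W ?LC" by (rule inj_onI) (metis W)
  define \<mu> where "\<mu> w = zero_multiplicity (displacement (2 * e) F) (w\<^sup>2 + e)" for w
  have mult: "cycle_multiplicity (2 * e) F C = \<mu> (W C)" if "C \<in> ?LC" for C
  proof -
    have "C \<inter> cross_section (2 * e) = {(0, (W C)\<^sup>2 + e)}" using W[OF that] by blast
    thus ?thesis unfolding cycle_multiplicity_def \<mu>_def by simp
  qed
  have S: "W ` ?LC \<subseteq> {A..B}" using W \<delta> by force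
  have v1: "vanishes 1 (\<lambda>w. (r w - w) / eps) w" if "w \<in> W ` ?LC" for w
    using that W by (auto simp: vanishes_Suc)
  have vm: "vanishes m (\<lambda>w. (r w - w) / eps) w" if "w \<in> W ` ?LC" "enat m \<le> \<mu> w" for w m
  proof -
    have "A \<le> w" "w \<le> B" using S that(1) by auto
    thus ?thesis using that(2) unfolding \<mu>_def
      by (intro vanishes_displacement[OF e A \<delta> eps T] vanishes_zero_multiplicity)
  qed
  have "finite (W ` ?LC)" "(\<Sum>w\<in>W ` ?LC. \<mu> w) \<le> enat N"
    by (rule sum_enat_le[OF z S v1 vm], assumption+)+
  moreover have "(\<Sum>C\<in>?LC. cycle_multiplicity (2 * e) F C) = (\<Sum>w\<in>W ` ?LC. \<mu> w)"
    by (simp add: sum.reindex[OF inj] mult)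
  ultimately show ?thesis using finite_image_iff[OF inj] by simp
qed

lemma compact_level_range:
  assumes e: "e > 0" and K: "compact K" "K \<subseteq> {- 1 / (4 * e)<..<0}"
  shows "\<exists>w1 w2. sqrt e < w1 \<and> w1 \<le> w2 \<and> (\<forall>w>sqrt e. hw e w \<in> K \<longrightarrow> w1 \<le> w \<and> w \<le> w2)"
proof (cases "K = {}")
  case True
  thus ?thesis by (intro exI[of _ "sqrt e + 1"]) auto
next
  case False
  obtain h1 h2 where h: "h1 \<in> K" "\<And>h. h \<in> K \<Longrightarrow> h1 \<le> h" "h2 \<in> K" "\<And>h. h \<in> K \<Longrightarrow> h \<le> h2"
    using compact_attains_inf[OF K(1) False] compact_attains_sup[OF K(1) False] by blast
  obtain w1 where w1: "w1 > sqrt e" "hw e w1 = h1" using hw_surj[OF e] h(1) K(2) by blast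
  obtain w2 where w2: "w2 > sqrt e" "hw e w2 = h2" using hw_surj[OF e] h(3) K(2) by blast
  have mono: "u \<le> v" if "u > sqrt e" "v > sqrt e" "hw e u \<le> hw e v" for u v
    using that hw_strict_mono[OF e, of v u] by (meson less_imp_le not_le)
  show ?thesis using w1 w2 h mono by (intro exI[of _ w1] exI[of _ w2]) auto
qed

lemma poly_degree_le_pev:
  assumes "poly_degree_le n p"
  obtains a where "\<And>x y. p (x, y) = pev n a x y"
  using assms unfolding poly_degree_le_def pev_def by auto

theorem theorem1p2:
  fixes \<eta> :: real and n :: nat
    and f g :: "nat \<Rightarrow> real \<times> real \<Rightarrow> real"
  assumes "\<eta> > 0" and "n \<ge> 1"
    and "\<And>k. k \<in> {1..4} \<Longrightarrow> poly_degree_le n (f k)"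
    and "\<And>k. k \<in> {1..4} \<Longrightarrow> poly_degree_le n (g k)"
    and "\<exists>h \<in> annulus_range \<eta>. melnikov \<eta> f g h \<noteq> 0"
    and "f 1 = f 2" and "g 1 = g 2" and "f 3 = f 4" and "g 3 = g 4"
  shows "at_most_limit_cycles_bifurcate \<eta> f g (9 * n - 4)"
proof -
  define e where "e = \<eta> / 2"
  have e: "e > 0" and eta: "\<eta> = 2 * e" using assms(1) by (simp_all add: e_def)
  have range: "annulus_range \<eta> = {- 1 / (4 * e)<..<0}" by (simp add: annulus_range_def eta)
  obtain a1 where f1: "\<And>x y. f 1 (x, y) = pev n a1 x y" using poly_degree_le_pev[OF assms(3)[of 1]] by auto
  obtain b1 where g1: "\<And>x y. g 1 (x, y) = pev n b1 x y" using poly_degree_le_pev[OF assms(4)[of 1]] by auto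
  obtain a2 where f3: "\<And>x y. f 3 (x, y) = pev n a2 x y" using poly_degree_le_pev[OF assms(3)[of 3]] by auto
  obtain b2 where g3: "\<And>x y. g 3 (x, y) = pev n b2 x y" using poly_degree_le_pev[OF assms(4)[of 3]] by auto
  note fg = f1 g1 f3 g3 assms(6-9)
  have nz: "\<exists>h\<in>{- 1 / (4 * e)<..<0}. melnikov (2 * e) f g h \<noteq> 0"
    using assms(5) unfolding range unfolding eta .
  note MZ = melnikov_zeros_le[OF e assms(2) fg nz]
  show ?thesis
    unfolding at_most_limit_cycles_bifurcate_def Let_def
  proof (intro allI impI)
    fix K assume K: "compact K \<and> K \<subseteq> annulus_range \<eta>"
    obtain w1 w2 where w: "sqrt e < w1" "w1 \<le> w2" "\<And>w. w > sqrt e \<Longrightarrow> hw e w \<in> K \<Longrightarrow> w1 \<le> w \<and> w \<le> w2"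
      using compact_level_range[OF e, of K] K unfolding range by blast
    \<comment> \<open>The interval \<open>{w1..w2}\<close> is enlarged by \<open>2 * \<delta>\<close>; eight margins fit between \<open>sqrt e\<close> and \<open>w1\<close>, and six are used.\<close>
    define \<delta> A B where "\<delta> = (w1 - sqrt e) / 8" and "A = w1 - 2 * \<delta>" and "B = w2 + 2 * \<delta>"
    have \<delta>: "\<delta> > 0" and A: "sqrt e < A - 4 * \<delta>" and AB: "A \<le> B"
      using w(1,2) by (auto simp: \<delta>_def A_def B_def field_simps)
    obtain eps0 where e0: "eps0 > 0" and T: "\<And>eps. 0 < \<bar>eps\<bar> \<Longrightarrow> \<bar>eps\<bar> < eps0 \<Longrightarrow>
      \<exists>c V R r Ob. turn_data e (filF e n a1 b1 a2 b2 eps) A B \<delta> c V eps R r Ob \<and> zeros_le (\<lambda>w. (r w - w) / eps) {A..B} (9 * n - 4)"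
      using return_zeros_le[OF e A AB \<delta> MZ melnikov_halves[OF e _ fg]] by blast
    have "finite (limit_cycles_near \<eta> (filippov_field \<eta> f g eps) K) \<and>
      (\<Sum>C\<in>limit_cycles_near \<eta> (filippov_field \<eta> f g eps) K. cycle_multiplicity \<eta> (filippov_field \<eta> f g eps) C) \<le> enat (9 * n - 4)"
      if h: "0 < \<bar>eps\<bar>" "\<bar>eps\<bar> < eps0" for eps
    proof -
      obtain c V R r Ob where D: "turn_data e (filF e n a1 b1 a2 b2 eps) A B \<delta> c V eps R r Ob"
        "zeros_le (\<lambda>w. (r w - w) / eps) {A..B} (9 * n - 4)" using T[OF h] by blast
      show ?thesis unfolding eta filippov_two_zones[OF fg]
      proof (rule cycles_le[OF e A \<delta> _ D])
        show "eps \<noteq> 0" using h(1) by simp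
        show "A + \<delta> < w \<and> w < B - \<delta>" if "w > sqrt e" "hw e w \<in> K" for w
          using w(3)[OF that] \<delta> by (auto simp: A_def B_def)
      qed
    qed
    thus "\<exists>eps\<^sub>0>0. \<forall>eps. 0 < \<bar>eps\<bar> \<and> \<bar>eps\<bar> < eps\<^sub>0 \<longrightarrow>
      finite (limit_cycles_near \<eta> (filippov_field \<eta> f g eps) K) \<and>
      (\<Sum>C\<in>limit_cycles_near \<eta> (filippov_field \<eta> f g eps) K. cycle_multiplicity \<eta> (filippov_field \<eta> f g eps) C) \<le> enat (9 * n - 4)"
      using e0 by blast
  qed
qed

end
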